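(* If $S \in \mathcal{T}$, then $\tilde{S} \in \mathcal{U}$. Furthermore, if $u_1, \dots, u_n \in \mathcal{U}$, then $$(T_{u_1} \cdots T_{u_n})^{\sim}(m) = \langle T_{u_1 \circ \phi_m} \cdots T_{u_n \circ \phi_m} 1, 1\rangle$$ for every $m \in \mathcal{M}$, where the left side denotes the value at $m$ of the continuous extension to $\mathcal{M}$ of the Berezin transform of $T_{u_1}\cdots T_{u_n}$.
   Context: $D$ is the open unit disk in $\mathbb{C}$ and $dA$ is area measure on $D$ normalized so that $D$ has measure $1$. The Bergman space $L^2_a$ is the Hilbert space of analytic functions on $D$ lying in $L^2(D,dA)$; $\langle\cdot,\cdot\rangle$ and $\|\cdot\|_2$ are taken in $L^2(D,dA)$. $\mathcal{B}(L^2_a)$ is the set of bounded operators on $L^2_a$. The reproducing kernel at $z\in D$ is $K_z(w)=(1-\bar z w)^{-2}$, and $k_z = K_z/\|K_z\|_2$, i.e. $k_z(w)=(1-|z|^2)/(1-\bar z w)^2$. For $S\in\mathcal{B}(L^2_a)$, the Berezin transform of $S$ is the function $\tilde S$ (also written $(S)^{\sim}$) on $D$ given by $\tilde S(z)=\langle Sk_z,k_z\rangle$. For $u\in L^\infty(D,dA)$, $T_u$ is the Toeplitz operator on $L^2_a$, $T_uf=P(uf)$, with $P$ the orthogonal projection of $L^2(D,dA)$ onto $L^2_a$. $H^\infty$ is the algebra of bounded analytic functions on $D$. $\mathcal{T}$ (the Toeplitz algebra) is the $C^*$-subalgebra of $\mathcal{B}(L^2_a)$ generated by $\{T_g: g\in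 H^\infty\}$. $\mathcal{U}$ is the $C^*$-subalgebra of $L^\infty(D,dA)$ generated by $H^\infty$. $\mathcal{M}$ is the maximal ideal space of $H^\infty$: the set of multiplicative linear maps of $H^\infty$ onto $\mathbb{C}$, with the weak-star topology (a compact Hausdorff space). $D$ is regarded as a subset of $\mathcal{M}$ via point evaluations; by Carleson's corona theorem $D$ is dense in $\mathcal{M}$. Via the Gelfand transform, $\mathcal{U}$ is identified with $C(\mathcal{M})$: each $u\in\mathcal{U}$ is (represented by) a continuous function on $D$ that extends uniquely to a continuous function on $\mathcal{M}$, also denoted $u$; conversely a continuous function on $D$ that extends continuously to $\mathcal{M}$ belongs to $\mathcal{U}$. For $z\in D$ let $\phi_z(w)=\frac{z-w}{1-\bar z w}$. For $m\in\mathcal{M}$, the Hoffman map $\phi_m\colon D\to\mathcal{M}$ is $\phi_m(w)=\lim_{z\to m}\phi_z(w)$ (limit in $\mathcal{M}$, along $z\in D$ converging to $m$ in $\mathcal{M}$; Hoffman showed that it exists and that $\phi_m$ is continuous). Thus for $u\in\mathcal{U}$, $u\circ\phi_m$ is a bounded continuous function on $D$. *)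

theory Defs
  imports "HOL-Complex_Analysis.Complex_Analysis"
begin

text \<open>
  Analytic functions on the disc are represented by functions \<open>complex \<Rightarrow> complex\<close> that vanish off
  the disc, so that equality in HOL is equality on the disc.  Elements of \<open>L\<^sup>2\<close> and \<open>L\<^sup>\<infinity>\<close> are
  represented by functions, not by classes modulo null sets.
\<close>

abbreviation disc :: "complex set" where
  "disc \<equiv> ball 0 1"

definition dA :: "complex measure" where
  "dA = restrict_space (uniform_measure lborel disc) disc"

definition ip :: "(complex \<Rightarrow> complex) \<Rightarrow> (complex \<Rightarrow> complex) \<Rightarrow> complex" where
  "ip f g = (\<integral>z. f z * cnj (g z) \<partial>dA)"

definition norm2 :: "(complex \<Rightarrow> complex) \<Rightarrow> real" where
  "norm2 f = sqrt (\<integral>z. (cmod (f z))\<^sup>2 \<partial>dA)"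

definition bergman :: "(complex \<Rightarrow> complex) set" where
  "bergman = {f. f holomorphic_on disc \<and> (\<forall>z. z \<notin> disc \<longrightarrow> f z = 0) \<and>
                 integrable dA (\<lambda>z. (cmod (f z))\<^sup>2)}"

definition bergman_kernel :: "complex \<Rightarrow> complex \<Rightarrow> complex" where
  "bergman_kernel z w = (if w \<in> disc then 1 / (1 - cnj z * w)\<^sup>2 else 0)"

definition normalized_kernel :: "complex \<Rightarrow> complex \<Rightarrow> complex" where
  "normalized_kernel z w = bergman_kernel z w / of_real (norm2 (bergman_kernel z))"

text \<open>The orthogonal projection of \<open>L\<^sup>2(D,dA)\<close> onto the Bergman space.\<close>

definition bergman_proj :: "(complex \<Rightarrow> complex) \<Rightarrow> complex \<Rightarrow> complex" where
  "bergman_proj f = (THE g. g \<in> bergman \<and> (\<forall>h\<in>bergman. ip (\<lambda>z. f z - g z) h = 0))"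

type_synonym bop = "(complex \<Rightarrow> complex) \<Rightarrow> (complex \<Rightarrow> complex)"

definition bounded_ops :: "bop set" where
  "bounded_ops = {S \<in> bergman \<rightarrow>\<^sub>E bergman.
     (\<forall>f\<in>bergman. \<forall>g\<in>bergman. S (\<lambda>z. f z + g z) = (\<lambda>z. S f z + S g z)) \<and>
     (\<forall>c. \<forall>f\<in>bergman. S (\<lambda>z. c * f z) = (\<lambda>z. c * S f z)) \<and>
     (\<exists>C. \<forall>f\<in>bergman. norm2 (S f) \<le> C * norm2 f)}"

definition berezin :: "bop \<Rightarrow> complex \<Rightarrow> complex" where
  "berezin S z = ip (S (normalized_kernel z)) (normalized_kernel z)"

definition toeplitz :: "(complex \<Rightarrow> complex) \<Rightarrow> bop" where
  "toeplitz u = (\<lambda>f\<in>bergman. bergman_proj (\<lambda>z. u z * f z))"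

definition toeplitz_prod :: "(complex \<Rightarrow> complex) list \<Rightarrow> bop" where
  "toeplitz_prod us = foldr (\<lambda>u S. compose bergman (toeplitz u) S) us (\<lambda>f\<in>bergman. f)"

definition Hinf :: "(complex \<Rightarrow> complex) set" where
  "Hinf = {h. h holomorphic_on disc \<and> (\<forall>z. z \<notin> disc \<longrightarrow> h z = 0) \<and> bounded (h ` disc)}"

text \<open>
  \<open>C\<^sup>*\<close>-subalgebras of \<open>\<B>(L\<^sup>2\<^sub>a)\<close>: the last two conjuncts say that the set is closed under adjoints
  and closed in the operator norm.
\<close>

definition op_cstar_subalgebra :: "bop set \<Rightarrow> bool" where
  "op_cstar_subalgebra A \<longleftrightarrow> A \<subseteq> bounded_ops \<and>
     (\<forall>S\<in>A. \<forall>R\<in>A. (\<lambda>f\<in>bergman. \<lambda>z. S f z + R f z) \<in> A) \<and>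
     (\<forall>c. \<forall>S\<in>A. (\<lambda>f\<in>bergman. \<lambda>z. c * S f z) \<in> A) \<and>
     (\<forall>S\<in>A. \<forall>R\<in>A. compose bergman S R \<in> A) \<and>
     (\<forall>S\<in>A. \<forall>R\<in>bounded_ops. (\<forall>f\<in>bergman. \<forall>g\<in>bergman. ip (S f) g = ip f (R g)) \<longrightarrow> R \<in> A) \<and>
     (\<forall>S\<in>bounded_ops. (\<forall>\<epsilon>>0. \<exists>R\<in>A. \<forall>f\<in>bergman. norm2 (\<lambda>z. S f z - R f z) \<le> \<epsilon> * norm2 f) \<longrightarrow> S \<in> A)"

definition toeplitz_algebra :: "bop set" where
  "toeplitz_algebra = \<Inter>{A. op_cstar_subalgebra A \<and> toeplitz ` Hinf \<subseteq> A}"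

definition Linf :: "(complex \<Rightarrow> complex) set" where
  "Linf = {u \<in> borel_measurable dA. \<exists>C. AE z in dA. cmod (u z) \<le> C}"

text \<open>
  Closedness in the essential supremum norm makes such a set invariant under changing its members
  on null sets.
\<close>

definition Linf_cstar_subalgebra :: "(complex \<Rightarrow> complex) set \<Rightarrow> bool" where
  "Linf_cstar_subalgebra A \<longleftrightarrow> A \<subseteq> Linf \<and>
     (\<forall>u\<in>A. \<forall>v\<in>A. (\<lambda>z. u z + v z) \<in> A) \<and>
     (\<forall>c. \<forall>u\<in>A. (\<lambda>z. c * u z) \<in> A) \<and>
     (\<forall>u\<in>A. \<forall>v\<in>A. (\<lambda>z. u z * v z) \<in> A) \<and>
     (\<forall>u\<in>A. (\<lambda>z. cnj (u z)) \<in> A) \<and>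
     (\<forall>u\<in>Linf. (\<forall>\<epsilon>>0. \<exists>v\<in>A. AE z in dA. cmod (u z - v z) \<le> \<epsilon>) \<longrightarrow> u \<in> A)"

definition algebra_U :: "(complex \<Rightarrow> complex) set" where
  "algebra_U = \<Inter>{A. Linf_cstar_subalgebra A \<and> Hinf \<subseteq> A}"

type_synonym functional = "(complex \<Rightarrow> complex) \<Rightarrow> complex"

definition mult_functionals :: "functional set" where
  "mult_functionals = {m \<in> extensional Hinf.
     (\<forall>f\<in>Hinf. \<forall>g\<in>Hinf. m (\<lambda>z. f z + g z) = m f + m g) \<and>
     (\<forall>c. \<forall>f\<in>Hinf. m (\<lambda>z. c * f z) = c * m f) \<and>
     (\<forall>f\<in>Hinf. \<forall>g\<in>Hinf. m (\<lambda>z. f z * g z) = m f * m g) \<and>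
     m ` Hinf = UNIV}"

text \<open>The weak-star topology is the topology of pointwise convergence on \<open>H\<^sup>\<infinity>\<close>.\<close>

definition max_ideal_space :: "functional topology" where
  "max_ideal_space = subtopology (product_topology (\<lambda>_. euclidean) Hinf) mult_functionals"

definition point_eval :: "complex \<Rightarrow> functional" where
  "point_eval z = (\<lambda>h\<in>Hinf. h z)"

text \<open>The filter of points of the disc tending to \<open>m\<close> in the maximal ideal space.\<close>

definition disc_to :: "functional \<Rightarrow> complex filter" where
  "disc_to m = inf (filtercomap point_eval (nhdsin max_ideal_space m)) (principal disc)"

definition disc_aut :: "complex \<Rightarrow> complex \<Rightarrow> complex" where
  "disc_aut z w = (z - w) / (1 - cnj z * w)"

definition hoffman_map :: "functional \<Rightarrow> complex \<Rightarrow> functional" where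
  "hoffman_map m w =
     (THE p. limitin max_ideal_space (\<lambda>z. point_eval (disc_aut z w)) p (disc_to m))"

text \<open>
  By Carleson's corona theorem the disc is dense in the maximal ideal space, so \<open>F\<close> is determined
  by \<open>u\<close>, and \<open>F m\<close> is the value of \<open>u\<close> at \<open>m\<close>.
\<close>

definition continuous_extension :: "(complex \<Rightarrow> complex) \<Rightarrow> (functional \<Rightarrow> complex) \<Rightarrow> bool" where
  "continuous_extension u F \<longleftrightarrow>
     continuous_map max_ideal_space euclidean F \<and> (\<forall>z\<in>disc. F (point_eval z) = u z)"

text \<open>
  The identification of \<open>\<U>\<close> with the continuous functions on the maximal ideal space: \<open>u\<close> agrees
  almost everywhere with the continuous function on the disc that \<open>F\<close> extends.
\<close>

definition gelfand_rep :: "(complex \<Rightarrow> complex) \<Rightarrow> (functional \<Rightarrow> complex) \<Rightarrow> bool" where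
  "gelfand_rep u F \<longleftrightarrow> (\<exists>v. (AE z in dA. u z = v z) \<and> continuous_extension v F)"

end

theory Submission
  imports Defs
begin

text \<open>
  With the unitary involution \<open>V z f = (f \<circ> \<phi>\<^sub>z) k\<^sub>z\<close> of the Bergman space one has
  \<open>V z k\<^sub>z = 1\<close> and \<open>V z T\<^sub>u V z = T\<close> with symbol \<open>u \<circ> \<phi>\<^sub>z\<close>.  Hence the Berezin transform of
  \<open>T\<^sub>u \<dots> T\<^sub>v\<close> at \<open>z\<close> is \<open>\<langle>S 1, 1\<rangle>\<close>, where \<open>S\<close> is the product with symbols \<open>u \<circ> \<phi>\<^sub>z, \<dots>, v \<circ> \<phi>\<^sub>z\<close>.  As \<open>z\<close> tends to \<open>m\<close>
  these symbols converge, boundedly and uniformly on compact subsets of the disc, to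
  \<open>u \<circ> \<phi>\<^sub>m\<close>, so the products converge strongly.  Operators for which such limits exist, together with
  their adjoints, generate a \<open>C\<^sup>*\<close>-algebra containing the Toeplitz algebra, and their Berezin transforms
  extend continuously to the maximal ideal space.

  Uniqueness of limits along the disc is Carleson's corona theorem, obtained from Wolff's estimate by
  duality: the estimate makes a Pick-type matrix at finitely many points positive
  semidefinite, and Leech's theorem turns this into a bounded solution.  Existence of the limit of
  \<open>f \<circ> \<phi>\<^sub>z\<close> at \<open>m\<close> rests on interpolation: either \<open>f \<circ> \<phi>\<^sub>z\<close> is nearly \<open>f z\<close> near \<open>m\<close>, or \<open>m\<close> is close to
  an interpolating sequence, on which \<open>z \<mapsto> f (\<phi>\<^sub>z w)\<close> agrees with a bounded analytic function.
\<close>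

section \<open>Area measure on the disc\<close>

text \<open>The obstacle at the Hoffman maps is that z \<mapsto> f(\<phi>_z(w)) is not analytic in
  z, so its convergence at a point of the maximal ideal space is not part of the topology of that
  space; interpolation replaces it locally by an analytic function. Boundary values of bounded
  functions are never taken. Estimates on the unit circle are made for functions analytic on a
  larger disc, or at finitely many points, with constants blind to the dilation and to the number of
  points; normal families then remove the restriction. Pointwise convergence of u \<circ> \<phi>_z
  becomes locally uniform because functions that extend continuously to the maximal ideal space are
  uniformly continuous for the pseudohyperbolic distance, which every \<phi>_z preserves. That
  follows from Schwarz-Pick and Stone-Weierstrass, and Stone-Weierstrass also puts such functions
  into \<open>algebra_U\<close>. The corona theorem enters as the properness of the filter
  \<open>disc_to m\<close>; with it, limits along the disc are unique and define continuous
  functions of m.\<close>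

lemma emeasure_disc: "emeasure lborel disc = ennreal pi"
  by (simp add: emeasure_ball unit_ball_vol_2)

lemma space_dA [simp]: "space dA = disc"
  by (simp add: dA_def space_restrict_space)

lemma sets_dA: "sets dA = sets (restrict_space borel disc)"
  by (simp add: dA_def sets_restrict_space)

lemma dA_eq: "dA = restrict_space (density lborel (\<lambda>x. indicator disc x / ennreal pi)) disc"
  unfolding dA_def uniform_measure_def emeasure_disc ..

lemma borel_measurable_dA_ennreal_iff:
  fixes f :: "complex \<Rightarrow> ennreal"
  shows "f \<in> borel_measurable dA \<longleftrightarrow> (\<lambda>x. f x * indicator disc x) \<in> borel_measurable borel"
  unfolding dA_def by (subst borel_measurable_restrict_space_iff_ennreal) auto

lemma borel_measurable_dA_I: "f \<in> borel_measurable borel \<Longrightarrow> f \<in> borel_measurable dA"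
  unfolding dA_def by (intro measurable_restrict_space1) simp

lemma continuous_on_borel_measurable_dA:
  fixes f :: "complex \<Rightarrow> 'b::topological_space"
  assumes "continuous_on disc f" shows "f \<in> borel_measurable dA"
  using borel_measurable_continuous_on_restrict[OF assms]
  by (subst measurable_cong_sets[OF sets_dA refl])

lemma nn_integral_dA:
  assumes "f \<in> borel_measurable dA"
  shows "(\<integral>\<^sup>+x. f x \<partial>dA) = (\<integral>\<^sup>+x. f x * indicator disc x \<partial>lborel) / ennreal pi"
proof -
  have m: "(\<lambda>x. f x * indicator disc x) \<in> borel_measurable borel"
    using assms by (simp add: borel_measurable_dA_ennreal_iff)
  have "(\<integral>\<^sup>+x. f x \<partial>dA) = (\<integral>\<^sup>+x. f x * indicator disc x \<partial>density lborel (\<lambda>x. indicator disc x / ennreal pi))"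
    unfolding dA_eq by (subst nn_integral_restrict_space) auto
  also have "\<dots> = (\<integral>\<^sup>+x. (f x * indicator disc x) / ennreal pi \<partial>lborel)"
    using m by (subst nn_integral_density) (auto intro!: nn_integral_cong simp: indicator_def divide_ennreal_def ac_simps)
  also have "\<dots> = (\<integral>\<^sup>+x. f x * indicator disc x \<partial>lborel) / ennreal pi"
    using m by (subst nn_integral_divide) auto
  finally show ?thesis .
qed

lemma emeasure_dA_space: "emeasure dA disc = 1"
proof -
  have "emeasure dA disc = (\<integral>\<^sup>+x. 1 \<partial>dA)" by (simp flip: space_dA)
  also have "\<dots> = 1"
    by (subst nn_integral_dA) (auto simp: emeasure_disc ennreal_divide_self)
  finally show ?thesis .
qed

lemma finite_measure_dA: "finite_measure dA"
  by standard (simp add: emeasure_dA_space)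

interpretation dA: finite_measure dA by (rule finite_measure_dA)

lemma measure_dA_disc: "measure dA disc = 1"
  by (simp add: measure_def emeasure_dA_space)

lemma integrable_dA_bounded:
  fixes f :: "complex \<Rightarrow> 'b::{banach,second_countable_topology}"
  assumes "f \<in> borel_measurable dA" "\<And>x. x \<in> disc \<Longrightarrow> norm (f x) \<le> B"
  shows "integrable dA f"
  by (rule dA.integrable_const_bound[of _ B]) (use assms in auto)

section \<open>Change of variables under holomorphic maps\<close>

text \<open>The Jacobian formula used below is stated for \<open>real^'n\<close>; \<open>c2\<close>
  and \<open>r2\<close> are the linear, measure preserving identification of the plane with
  \<open>real^2\<close>.\<close>

definition c2 :: "real^2 \<Rightarrow> complex" where "c2 v = Complex (v $ 1) (v $ 2)"
definition r2 :: "complex \<Rightarrow> real^2" where "r2 z = (\<chi> i. if i = 1 then Re z else Im z)"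

lemma c2_r2 [simp]: "c2 (r2 z) = z" by (simp add: c2_def r2_def)
lemma r2_c2 [simp]: "r2 (c2 v) = v"
  by (simp add: c2_def r2_def vec_eq_iff forall_2)

lemma bounded_linear_c2: "bounded_linear c2"
  by (intro linear_conv_bounded_linear[THEN iffD1] linearI) (auto simp: c2_def complex_eq_iff)
lemma bounded_linear_r2: "bounded_linear r2"
  by (intro linear_conv_bounded_linear[THEN iffD1] linearI) (auto simp: r2_def vec_eq_iff forall_2)

lemma measurable_c2 [measurable]: "c2 \<in> borel_measurable borel"
  by (intro borel_measurable_continuous_onI linear_continuous_on bounded_linear_c2)
lemma distr_c2: "distr lborel borel c2 = (lborel :: complex measure)"
proof (rule lborel_eqI[symmetric])
  fix l u :: complex
  assume le: "\<And>b. b \<in> Basis \<Longrightarrow> l \<bullet> b \<le> u \<bullet> b"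
  have 1: "Re l \<le> Re u" "Im l \<le> Im u" using le[of 1] le[of \<i>] by (auto simp: Basis_complex_def)
  have "c2 -` box l u = box (r2 l) (r2 u)"
    by (auto simp: c2_def r2_def in_box_complex_iff mem_box_cart forall_2)
  then have "emeasure (distr lborel borel c2) (box l u) = emeasure lborel (box (r2 l) (r2 u))"
    by (simp add: emeasure_distr)
  also have "\<dots> = ennreal (\<Prod>b\<in>Basis. (r2 u - r2 l) \<bullet> b)"
    by (rule emeasure_lborel_box) (use 1 in \<open>auto simp: Basis_vec_def r2_def inner_axis axis_eq_axis\<close>)
  also have "(\<Prod>b\<in>Basis. (r2 u - r2 l) \<bullet> b) = (Re u - Re l) * (Im u - Im l)"
    unfolding Basis_vec_def
    by (subst prod.UNION_disjoint) (auto simp: r2_def inner_axis axis_eq_axis UNIV_2)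
  also have "\<dots> = (\<Prod>b\<in>Basis. (u - l) \<bullet> b)"
    by (simp add: Basis_complex_def)
  finally show "emeasure (distr lborel borel c2) (box l u) = ennreal (\<Prod>b\<in>Basis. (u - l) \<bullet> b)" .
qed simp

lemma emeasure_r2_image:
  assumes "S \<in> sets borel"
  shows "emeasure lborel (r2 ` S) = emeasure lborel S" "r2 ` S \<in> sets borel"
proof -
  have eq: "r2 ` S = c2 -` S"
    by (auto simp: image_iff) (metis r2_c2)
  show "r2 ` S \<in> sets borel" unfolding eq
    using measurable_sets[OF measurable_c2 assms] by simp
  show "emeasure lborel (r2 ` S) = emeasure lborel S"
    unfolding eq using assms by (simp add: emeasure_distr flip: distr_c2)
qed

text \<open>Multiplication by a + bi is a real 2 by 2 matrix of determinant a^2 + b^2, so the real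
  Jacobian of a holomorphic map is the squared modulus of its derivative. The rest carries the real
  theorem through \<open>c2\<close> and \<open>r2\<close>.\<close>

lemma emeasure_holomorphic_image:
  assumes f: "f holomorphic_on T" "open T" "inj_on f T" and S: "S \<in> sets borel" "S \<subseteq> T"
    and fS: "f ` S \<in> sets borel" "bounded (f ` S)"
  shows "(\<integral>\<^sup>+x. ennreal ((cmod (deriv f x))^2) * indicator S x \<partial>lborel) = emeasure lborel (f ` S)"
proof -
  define S' where "S' = r2 ` S"
  define g where "g = r2 \<circ> f \<circ> c2"
  define g' where "g' x h = r2 (deriv f (c2 x) * c2 h)" for x h
  have S': "S' \<in> sets borel" unfolding S'_def by (rule emeasure_r2_image(2)[OF S(1)])
  have im: "g ` S' = r2 ` (f ` S)" by (simp add: g_def S'_def image_image)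
  have der: "(g has_derivative g' x) (at x within S')" if "x \<in> S'" for x
  proof -
    have x: "c2 x \<in> T" using that S(2) by (auto simp: S'_def)
    have "(f has_derivative (\<lambda>h. deriv f (c2 x) * h)) (at (c2 x))"
      using holomorphic_derivI[OF f(1,2) x] by (simp add: has_field_derivative_def)
    then have "((\<lambda>v. r2 (f (c2 v))) has_derivative (\<lambda>h. r2 (deriv f (c2 x) * c2 h))) (at x within S')"
      by (intro bounded_linear.has_derivative[OF bounded_linear_r2]
                has_derivative_compose[OF bounded_linear_imp_has_derivative[OF bounded_linear_c2]])
    then show ?thesis by (simp add: g_def g'_def[abs_def] o_def)
  qed
  have det: "\<bar>det (matrix (g' x))\<bar> = (cmod (deriv f (c2 x)))^2" for x
  proof -
    obtain a b where ab: "deriv f (c2 x) = Complex a b" by (cases "deriv f (c2 x)")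
    show ?thesis
      unfolding det_2 matrix_def g'_def ab
      by (simp add: r2_def c2_def axis_def cmod_def power2_eq_square)
  qed
  have inj: "inj_on g S'"
    using f(3) S(2) unfolding g_def S'_def inj_on_def by (auto, metis c2_r2 subsetD)
  have gS: "g ` S' \<in> lmeasurable" unfolding im
  proof (rule bounded_set_imp_lmeasurable)
    show "bounded (r2 ` f ` S)" by (rule bounded_linear_image[OF fS(2) bounded_linear_r2])
    show "r2 ` f ` S \<in> sets lebesgue" using emeasure_r2_image(2)[OF fS(1)] by simp
  qed
  have meas: "(\<lambda>x. (cmod (deriv f x))^2 * indicator S x) \<in> borel_measurable borel"
  proof -
    have "continuous_on T (deriv f)"
      by (intro holomorphic_on_imp_continuous_on holomorphic_deriv f)
    then have "(\<lambda>x. indicator T x *\<^sub>R deriv f x) \<in> borel_measurable borel"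
      using f(2) by (intro borel_measurable_continuous_on_indicator) auto
    then have "(\<lambda>x. (cmod (indicator T x *\<^sub>R deriv f x))^2 * indicator S x) \<in> borel_measurable borel"
      using S(1) by measurable
    moreover have "(\<lambda>x. (cmod (indicator T x *\<^sub>R deriv f x))^2 * indicator S x) = (\<lambda>x. (cmod (deriv f x))^2 * indicator S x)"
      using S(2) by (auto simp: indicator_def fun_eq_iff)
    ultimately show ?thesis by simp
  qed
  have hi: "((\<lambda>x. \<bar>det (matrix (g' x))\<bar>) has_integral measure lebesgue (g ` S')) S'"
    using has_measure_differentiable_image[OF _ der inj, of "measure lebesgue (g ` S')"] gS S' by auto
  have mem: "c2 x \<in> S \<longleftrightarrow> x \<in> S'" for x by (auto simp: S'_def image_iff) (metis r2_c2)
  have hi2: "((\<lambda>x. (cmod (deriv f (c2 x)))^2 * indicator S (c2 x)) has_integral measure lebesgue (g ` S')) UNIV"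
    using hi unfolding det has_integral_restrict_UNIV[of S', symmetric]
    by (rule back_subst[where P="\<lambda>h. (h has_integral _) _"]) (auto simp: indicator_def mem fun_eq_iff)
  have "(\<integral>\<^sup>+x. ennreal ((cmod (deriv f x))^2) * indicator S x \<partial>lborel)
      = (\<integral>\<^sup>+x. ennreal ((cmod (deriv f x))^2 * indicator S x) \<partial>distr lborel borel c2)"
    unfolding distr_c2 by (intro nn_integral_cong) (auto simp: indicator_def)
  also have "\<dots> = (\<integral>\<^sup>+x. ennreal ((cmod (deriv f (c2 x)))^2 * indicator S (c2 x)) \<partial>lborel)"
    using meas by (subst nn_integral_distr) auto
  also have "\<dots> = ennreal (measure lebesgue (g ` S'))"
    by (rule nn_integral_has_integral_lborel[OF _ _ hi2])
       (use measurable_compose[OF measurable_c2 meas] in \<open>auto simp: indicator_def\<close>)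
  also have "\<dots> = emeasure lborel (r2 ` f ` S)"
  proof -
    have "ennreal (measure lebesgue (g ` S')) = emeasure lebesgue (r2 ` f ` S)"
      using gS unfolding im by (rule emeasure_eq_measure2[symmetric])
    then show ?thesis using emeasure_r2_image(2)[OF fS(1)] by (simp add: emeasure_completion)
  qed
  also have "\<dots> = emeasure lborel (f ` S)" by (rule emeasure_r2_image[OF fS(1)])
  finally show ?thesis .
qed

text \<open>Serves two families of maps: rotations, for polar coordinates, and the disc
  automorphisms, for the unitarity of \<open>V z\<close>.\<close>

lemma distr_dA_biholomorphic:
  assumes f: "f holomorphic_on disc" "bij_betw f disc disc" "g holomorphic_on disc"
    and g: "\<And>x. x \<in> disc \<Longrightarrow> g (f x) = x"
  shows "distr (density dA (\<lambda>x. ennreal ((cmod (deriv f x))^2))) dA f = dA"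
proof (rule measure_eqI)
  have fm: "f \<in> measurable dA dA"
  proof -
    have "f \<in> measurable dA (restrict_space borel disc)"
      using f(1,2) by (intro measurable_restrict_space2 continuous_on_borel_measurable_dA holomorphic_on_imp_continuous_on)
         (auto simp: bij_betw_def)
    then show ?thesis by (subst measurable_cong_sets[OF refl sets_dA])
  qed
  have dm: "(\<lambda>x. ennreal ((cmod (deriv f x))^2)) \<in> borel_measurable dA"
    using f(1) by (intro measurable_compose[OF _ measurable_ennreal] continuous_on_borel_measurable_dA
        continuous_intros holomorphic_on_imp_continuous_on holomorphic_deriv) auto
  show "sets (distr (density dA (\<lambda>x. ennreal ((cmod (deriv f x))^2))) dA f) = sets dA" by simp
  fix A assume "A \<in> sets (distr (density dA (\<lambda>x. ennreal ((cmod (deriv f x))^2))) dA f)"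
  then have A: "A \<in> sets dA" by simp
  then have A': "A \<in> sets borel" "A \<subseteq> disc"
    unfolding sets_dA by (auto simp: sets_restrict_space_iff)
  define S where "S = f -` A \<inter> disc"
  have S: "S \<in> sets dA" using measurable_sets[OF fm A] by (simp add: S_def)
  then have S': "S \<in> sets borel" "S \<subseteq> disc"
    unfolding sets_dA by (auto simp: sets_restrict_space_iff)
  have fS: "f ` S = A"
  proof (intro subset_antisym subsetI)
    fix x assume x: "x \<in> A"
    then have "x \<in> f ` disc" using bij_betw_imp_surj_on[OF f(2)] A'(2) by (simp add: subset_iff)
    then obtain y where "y \<in> disc" "x = f y" by (rule imageE)
    then show "x \<in> f ` S" using x by (auto simp: S_def)
  qed (auto simp: S_def)
  have "emeasure (distr (density dA (\<lambda>x. ennreal ((cmod (deriv f x))^2))) dA f) A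
    = emeasure (density dA (\<lambda>x. ennreal ((cmod (deriv f x))^2))) S"
    using fm A by (subst emeasure_distr) (simp_all add: S_def)
  also have "\<dots> = (\<integral>\<^sup>+x. ennreal ((cmod (deriv f x))^2) * indicator S x \<partial>dA)"
    using dm S by (simp add: emeasure_density)
  also have "\<dots> = (\<integral>\<^sup>+x. ennreal ((cmod (deriv f x))^2) * indicator S x * indicator disc x \<partial>lborel) / pi"
    using dm S by (subst nn_integral_dA) auto
  also have "(\<integral>\<^sup>+x. ennreal ((cmod (deriv f x))^2) * indicator S x * indicator disc x \<partial>lborel)
     = (\<integral>\<^sup>+x. ennreal ((cmod (deriv f x))^2) * indicator S x \<partial>lborel)"
    using S'(2) by (intro nn_integral_cong) (auto simp: indicator_def)
  also have "\<dots> = emeasure lborel A"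
    unfolding fS[symmetric]
    by (rule emeasure_holomorphic_image[of _ disc])
       (use f S' A' fS in \<open>auto simp: bij_betw_def intro: bounded_subset[OF bounded_ball]\<close>)
  also have "emeasure lborel A = (\<integral>\<^sup>+x. indicator A x * indicator disc x \<partial>lborel)"
  proof -
    have "(\<lambda>x. indicator A x * indicator disc x :: ennreal) = indicator A"
      using A'(2) by (auto simp: indicator_def fun_eq_iff)
    then show ?thesis using A' by simp
  qed
  also have "\<dots> / pi = emeasure dA A"
    using A by (subst nn_integral_dA[symmetric]) auto
  finally show "emeasure (distr (density dA (\<lambda>x. ennreal ((cmod (deriv f x))^2))) dA f) A = emeasure dA A" .
qed

section \<open>Radial distribution, rotations and polar coordinates\<close>

lemma emeasure_dA_cball:
  assumes "0 \<le> r" "r < 1"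
  shows "emeasure dA (cball 0 r) = ennreal (r^2)"
proof -
  have sub: "cball 0 r \<subseteq> disc" using assms by auto
  have s: "cball 0 r \<in> sets dA" using sub by (auto simp: sets_dA sets_restrict_space_iff)
  have "emeasure dA (cball 0 r) = (\<integral>\<^sup>+x. indicator (cball 0 r) x \<partial>dA)" using s by simp
  also have "\<dots> = (\<integral>\<^sup>+x. indicator (cball 0 r) x * indicator disc x \<partial>lborel) / ennreal pi"
    using s by (subst nn_integral_dA) auto
  also have "(\<integral>\<^sup>+x. indicator (cball 0 r) x * indicator disc x \<partial>lborel) = (\<integral>\<^sup>+x. indicator (cball (0::complex) r) x \<partial>lborel)"
    using sub by (intro nn_integral_cong) (auto simp: indicator_def)
  also have "\<dots> = ennreal (pi * r^2)"
    using assms by (simp add: emeasure_cball unit_ball_vol_2)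
  also have "\<dots> / ennreal pi = ennreal (r^2)"
    by (subst divide_ennreal) auto
  finally show ?thesis .
qed

text \<open>Measures on the line are compared on the half-lines above x: the disc of radius x has
  normalized area x^2, and 1 - x^2 is the integral of 2t from x to 1.\<close>

lemma distr_dA_cmod:
  "distr dA borel cmod = density lborel (\<lambda>r. ennreal (2 * r) * indicator {0..1} r)"
proof (rule measure_eqI_lessThan)
  have cm: "cmod \<in> borel_measurable dA" by (intro borel_measurable_dA_I) auto
  show "sets (distr dA borel cmod) = sets borel" by simp
  show "sets (density lborel (\<lambda>r. ennreal (2 * r) * indicator {0..1} r)) = sets borel" by simp
  fix x :: real
  show "emeasure (distr dA borel cmod) {x<..} < \<infinity>"
    using cm by (subst emeasure_distr) (auto simp: dA.emeasure_eq_measure)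
  show "emeasure (distr dA borel cmod) {x<..} = emeasure (density lborel (\<lambda>r. ennreal (2 * r) * indicator {0..1} r)) {x<..}"
  proof -
    have l: "emeasure (distr dA borel cmod) {x<..} = emeasure dA ({z. x < cmod z} \<inter> disc)"
      using cm by (subst emeasure_distr) (auto intro: arg_cong[of _ _ "emeasure dA"])
    have r: "emeasure (density lborel (\<lambda>r. ennreal (2 * r) * indicator {0..1} r)) {x<..}
       = (\<integral>\<^sup>+t. ennreal (2 * t) * indicator {max 0 x..1} t \<partial>lborel)"
    proof -
      have "emeasure (density lborel (\<lambda>r. ennreal (2 * r) * indicator {0..1} r)) {x<..}
        = (\<integral>\<^sup>+t. ennreal (2 * t) * indicator {0..1} t * indicator {x<..} t \<partial>lborel)"
        by (subst emeasure_density) auto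
      also have "\<dots> = (\<integral>\<^sup>+t. ennreal (2 * t) * indicator {max 0 x..1} t \<partial>lborel)"
        proof (rule nn_integral_cong_AE, rule AE_mp[OF AE_lborel_singleton[of x]], rule AE_I2, rule impI)
          fix t :: real assume "t \<noteq> x"
          then have "0 \<le> t \<and> t \<le> 1 \<and> x < t \<longleftrightarrow> max 0 x \<le> t \<and> t \<le> 1" by linarith
          then show "ennreal (2 * t) * indicator {0..1} t * indicator {x<..} t = ennreal (2 * t) * indicator {max 0 x..1} t"
            using \<open>t \<noteq> x\<close> by (auto simp: indicator_def split: if_split)
        qed
      finally show ?thesis .
    qed
    show ?thesis
    proof (cases "x < 1")
      case False
      then have "{z. x < cmod z} \<inter> disc = {}" by auto
      moreover have "(\<integral>\<^sup>+t. ennreal (2 * t) * indicator {max 0 x..1} t \<partial>lborel) = (\<integral>\<^sup>+t. 0 \<partial>(lborel::real measure))"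
        proof (rule nn_integral_cong_AE, rule AE_mp[OF AE_lborel_singleton[of 1]], rule AE_I2, rule impI)
          fix t :: real assume "t \<noteq> 1"
          then have "\<not> (max 0 x \<le> t \<and> t \<le> 1)" using False by linarith
          then show "ennreal (2 * t) * indicator {max 0 x..1} t = 0"
            by (simp add: indicator_def split: if_split)
        qed
      ultimately show ?thesis using l r by simp
    next
      case True
      have "((\<lambda>t. t^2) has_real_derivative 2 * t) (at t within A)" for t :: real and A
        by (auto intro!: derivative_eq_intros)
      then have ri: "(\<integral>\<^sup>+t. ennreal (2 * t) * indicator {max 0 x..1} t \<partial>lborel) = ennreal (1^2 - (max 0 x)^2)"
        using True by (intro nn_integral_FTC_Icc) auto
      show ?thesis
      proof (cases "x < 0")
        case True
        then have "{z. x < cmod z} \<inter> disc = disc" by (auto intro: less_le_trans)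
        then show ?thesis using l r ri True by (simp add: emeasure_dA_space)
      next
        case False
        have "{z. x < cmod z} \<inter> disc = space dA - cball 0 x" by auto
        moreover have "cball 0 x \<in> sets dA" using True by (auto simp: sets_dA sets_restrict_space_iff)
        ultimately have "emeasure dA ({z. x < cmod z} \<inter> disc) = emeasure dA (space dA) - emeasure dA (cball 0 x)"
          using emeasure_compl[of "cball 0 x" dA] by (simp add: dA.emeasure_finite)
        also have "\<dots> = ennreal (1^2 - (max 0 x)^2)"
          using False True by (simp add: emeasure_dA_cball emeasure_dA_space ennreal_minus flip: ennreal_1)
        finally show ?thesis using l r ri by simp
      qed
    qed
  qed
qed

lemma distr_dA_rotation:
  assumes t: "cmod u = 1"
  shows "distr dA dA (\<lambda>z. u * z) = dA" "(\<lambda>z. u * z) \<in> measurable dA dA"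
proof -
  have u0: "u \<noteq> 0" using t by auto
  have bij: "bij_betw (\<lambda>z. u * z) disc disc"
    by (rule bij_betwI[of _ _ _ "\<lambda>z. z / u"]) (use t u0 in \<open>auto simp: norm_mult norm_divide\<close>)
  have d: "deriv (\<lambda>z. u * z) x = u" for x
    by (rule DERIV_imp_deriv) (auto intro!: derivative_eq_intros)
  have "distr (density dA (\<lambda>x. ennreal ((cmod (deriv (\<lambda>z. u * z) x))^2))) dA (\<lambda>z. u * z) = dA"
    by (rule distr_dA_biholomorphic[of _ "\<lambda>z. z / u"]) (use u0 bij in \<open>auto intro!: holomorphic_intros\<close>)
  then have eq: "distr dA dA (\<lambda>z. u * z) = dA"
    unfolding d t by (simp add: density_1)
  have m: "(\<lambda>z. u * z) \<in> measurable dA dA"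
  proof -
    have "(\<lambda>z. u * z) \<in> measurable dA (restrict_space borel disc)"
      using bij by (intro measurable_restrict_space2 borel_measurable_dA_I) (auto simp: bij_betw_def)
    then show ?thesis by (subst measurable_cong_sets[OF refl sets_dA])
  qed
  show "distr dA dA (\<lambda>z. u * z) = dA" "(\<lambda>z. u * z) \<in> measurable dA dA" by fact+
qed

lemma integral_dA_rotation:
  fixes g :: "complex \<Rightarrow> 'b::{banach,second_countable_topology}"
  assumes g: "g \<in> borel_measurable dA" and t: "cmod u = 1"
  shows "(\<integral>z. g (u * z) \<partial>dA) = (\<integral>z. g z \<partial>dA)"
proof -
  have "(\<integral>z. g z \<partial>dA) = (\<integral>z. g z \<partial>distr dA dA (\<lambda>z. u * z))" by (simp add: distr_dA_rotation[OF t])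
  also have "\<dots> = (\<integral>z. g (u * z) \<partial>dA)" using distr_dA_rotation(2)[OF t] g by (rule integral_distr)
  finally show ?thesis by simp
qed

lemma integrable_dA_rotation:
  fixes g :: "complex \<Rightarrow> 'b::{banach,second_countable_topology}"
  assumes g: "integrable dA g" and t: "cmod u = 1"
  shows "integrable dA (\<lambda>z. g (u * z))"
  using g distr_dA_rotation[OF t] by (metis integrable_distr)

definition circle_mean :: "(complex \<Rightarrow> 'b::real_normed_vector) \<Rightarrow> real \<Rightarrow> 'b" where
  "circle_mean g r = (1 / (2 * pi)) *\<^sub>R integral {0..2*pi} (\<lambda>t. g (of_real r * cis t))"

lemma continuous_on_circle:
  assumes "continuous_on (sphere 0 \<bar>r\<bar>) g"
  shows "continuous_on A (\<lambda>t. g (of_real r * cis t))"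
  by (rule continuous_on_compose2[OF assms]) (auto intro!: continuous_intros simp: norm_mult)

lemma integral_periodic_shift:
  fixes F :: "real \<Rightarrow> 'b::euclidean_space"
  assumes c: "continuous_on UNIV F" and p: "\<And>t. F (t + p) = F t" and s: "0 \<le> s" "s \<le> p"
  shows "integral {0..p} (\<lambda>t. F (t + s)) = integral {0..p} F"
proof -
  have i: "F integrable_on {a..b}" for a b
    by (intro integrable_continuous_real continuous_on_subset[OF c]) auto
  have "integral {0..p} (\<lambda>t. F (t + s)) = integral {s..p+s} F"
    using integral_shift[of 0 s p F] continuous_on_subset[OF c] by (simp add: o_def)
  also have "\<dots> = integral {s..p} F + integral {p..p+s} F"
    using s by (intro Henstock_Kurzweil_Integration.integral_combine[symmetric] i) auto
  also have "integral {p..p+s} F = integral {0..s} (\<lambda>t. F (t + p))"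
    using integral_shift[of 0 p s F] continuous_on_subset[OF c] by (simp add: add.commute o_def)
  also have "\<dots> = integral {0..s} F" by (simp add: p)
  also have "integral {s..p} F + integral {0..s} F = integral {0..p} F"
    using s by (subst add.commute, intro Henstock_Kurzweil_Integration.integral_combine i) auto
  finally show ?thesis .
qed

lemma circle_mean_rotate:
  fixes g :: "complex \<Rightarrow> 'b::euclidean_space"
  assumes "continuous_on (sphere 0 (cmod z)) g"
  shows "(1 / (2 * pi)) *\<^sub>R integral {0..2*pi} (\<lambda>t. g (cis t * z)) = circle_mean g (cmod z)"
proof -
  obtain s where s: "0 \<le> s" "s < 2 * pi" "z = of_real (cmod z) * cis s"
    using Arg2pi[of z] by (auto simp: is_Arg_def cis_conv_exp)
  have eq: "of_real (cmod z) * cis (t + s) = cis t * z" for t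
    by (subst (2) s(3)) (simp add: cis_mult ac_simps)
  have "integral {0..2*pi} (\<lambda>t. g (of_real (cmod z) * cis (t + s))) = integral {0..2*pi} (\<lambda>t. g (of_real (cmod z) * cis t))"
    by (rule integral_periodic_shift) (use s assms in \<open>auto intro!: continuous_on_circle simp flip: cis_mult\<close>)
  then show ?thesis unfolding eq circle_mean_def by simp
qed

text \<open>Rotations preserve \<open>dA\<close>, so the integrand may be averaged over all of them.
  By Fubini the inner average is a circle mean that depends on the modulus alone, and
  \<open>distr_dA_cmod\<close> gives the law of the modulus.\<close>

lemma polar_dA:
  fixes g :: "complex \<Rightarrow> complex"
  assumes cont: "continuous_on disc g" and int: "integrable dA g"
  shows "(\<integral>z. g z \<partial>dA) = (\<integral>r. indicator {0..<1} r *\<^sub>R ((2 * r) *\<^sub>R circle_mean g r) \<partial>lborel)"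
proof -
  interpret pair_sigma_finite lborel dA by (simp add: pair_sigma_finite_def sigma_finite_lborel dA.sigma_finite_measure_axioms)
  define h where "h = (\<lambda>(t, z). (indicator {0..2*pi} t / (2 * pi)) *\<^sub>R g (cis t * z))"
  have [measurable]: "g \<in> borel_measurable dA" using int by auto
  have [measurable]: "(\<lambda>(t, z). cis t * z) \<in> measurable (lborel \<Otimes>\<^sub>M dA) dA"
  proof -
    have "(\<lambda>z. z) \<in> borel_measurable dA" by (intro borel_measurable_dA_I) simp
    moreover have "cis \<in> borel_measurable lborel"
      by (simp, intro borel_measurable_continuous_onI continuous_intros)
    ultimately have "(\<lambda>(t, z). cis t * z) \<in> borel_measurable (lborel \<Otimes>\<^sub>M dA)"
      unfolding split_beta
      by (intro borel_measurable_times measurable_compose[OF measurable_fst] measurable_compose[OF measurable_snd])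
    then have "(\<lambda>(t, z). cis t * z) \<in> measurable (lborel \<Otimes>\<^sub>M dA) (restrict_space borel disc)"
      by (intro measurable_restrict_space2) (auto simp: space_pair_measure norm_mult)
    then show ?thesis by (subst measurable_cong_sets[OF refl sets_dA])
  qed
  have "(\<lambda>(t, z). g (cis t * z)) \<in> borel_measurable (lborel \<Otimes>\<^sub>M dA)"
    using measurable_compose[of "\<lambda>(t, z). cis t * z" "lborel \<Otimes>\<^sub>M dA" dA g] by (simp add: split_beta)
  then have hm: "h \<in> borel_measurable (lborel \<Otimes>\<^sub>M dA)" unfolding h_def split_beta by measurable
  have rot: "(\<integral>z. norm (g (cis t * z)) \<partial>dA) = (\<integral>z. norm (g z) \<partial>dA)"
            "(\<integral>z. g (cis t * z) \<partial>dA) = (\<integral>z. g z \<partial>dA)" for t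
    by (rule integral_dA_rotation; simp)+
  have hint: "integrable (lborel \<Otimes>\<^sub>M dA) h"
  proof (rule Fubini_integrable[OF hm])
    have eq: "(\<integral>z. norm (h (t, z)) \<partial>dA) = indicator {0..2*pi} t *\<^sub>R ((\<integral>z. norm (g z) \<partial>dA) / (2 * pi))" for t
      by (simp add: h_def rot indicator_def)
    show "integrable lborel (\<lambda>t. \<integral>z. norm (h (t, z)) \<partial>dA)"
      unfolding eq by (intro integrable_scaleR_left integrable_real_indicator) auto
    show "AE x in lborel. integrable dA (\<lambda>y. h (x, y))"
      unfolding h_def by (intro AE_I2) (auto intro!: integrable_dA_rotation int)
  qed
  have sph: "continuous_on (sphere 0 (cmod z)) g" if "z \<in> disc" for z
    by (rule continuous_on_subset[OF cont]) (use that in auto)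
  have inner: "(\<integral>t. h (t, z) \<partial>lborel) = circle_mean g (cmod z)" if "z \<in> disc" for z
  proof -
    have c: "continuous_on {0..2*pi} (\<lambda>t. g (cis t * z))"
      by (rule continuous_on_compose2[OF cont]) (use that in \<open>auto intro!: continuous_intros simp: norm_mult\<close>)
    have si: "set_integrable lborel {0..2*pi} (\<lambda>t. g (cis t * z))"
      unfolding set_integrable_def by (rule borel_integrable_compact[OF _ c]) simp
    have "(\<integral>t. h (t, z) \<partial>lborel) = (\<integral>t. (1 / (2 * pi)) *\<^sub>R (indicator {0..2*pi} t *\<^sub>R g (cis t * z)) \<partial>lborel)"
      by (simp add: h_def)
    also have "\<dots> = (1 / (2 * pi)) *\<^sub>R (LINT t:{0..2*pi}|lborel. g (cis t * z))"
      unfolding set_lebesgue_integral_def by (rule integral_scaleR_right)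
    also have "\<dots> = (1 / (2 * pi)) *\<^sub>R integral {0..2*pi} (\<lambda>t. g (cis t * z))"
      using set_borel_integral_eq_integral(2)[OF si] by simp
    also have "\<dots> = circle_mean g (cmod z)" by (rule circle_mean_rotate[OF sph[OF that]])
    finally show ?thesis .
  qed
  define m where "m r = indicator {0..<1} r *\<^sub>R circle_mean g r" for r
  have mm: "m \<in> borel_measurable borel"
  proof -
    have "continuous_on {0..<1} (\<lambda>r. integral (cbox 0 (2*pi)) (\<lambda>t. g (of_real r * cis t)))"
    proof (rule integral_continuous_on_param)
      show "continuous_on ({0..<1} \<times> cbox 0 (2*pi)) (\<lambda>(r, t). g (of_real r * cis t))"
        unfolding split_beta
        by (rule continuous_on_compose2[OF cont]) (auto intro!: continuous_intros simp: norm_mult)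
    qed
    then have "continuous_on {0..<1} (circle_mean g)"
      unfolding circle_mean_def by (intro continuous_intros) simp
    then show ?thesis unfolding m_def by (intro borel_measurable_continuous_on_indicator) auto
  qed
  have "(\<integral>z. g z \<partial>dA) = (\<integral>t. indicator {0..2*pi} t *\<^sub>R ((1 / (2*pi)) *\<^sub>R (\<integral>z. g z \<partial>dA)) \<partial>lborel)"
    by (simp add: scaleR_conv_of_real)
  also have "\<dots> = (\<integral>t. (\<integral>z. h (t, z) \<partial>dA) \<partial>lborel)"
    by (intro Bochner_Integration.integral_cong) (auto simp: h_def rot)
  also have "\<dots> = (\<integral>z. (\<integral>t. h (t, z) \<partial>lborel) \<partial>dA)"
    using Fubini_integral[of "\<lambda>t z. h (t, z)"] hint by simp
  also have "\<dots> = (\<integral>z. m (cmod z) \<partial>dA)"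
    by (intro Bochner_Integration.integral_cong) (auto simp: inner m_def)
  also have "\<dots> = (\<integral>r. m r \<partial>distr dA borel cmod)"
    using mm by (subst integral_distr) (auto intro!: borel_measurable_dA_I)
  also have "\<dots> = (\<integral>r. (2 * r * indicator {0..1} r) *\<^sub>R m r \<partial>lborel)"
  proof -
    have e: "(\<lambda>r. ennreal (2 * r) * indicator {0..1} r) = (\<lambda>r. ennreal (2 * r * indicator {0..1} r))"
      by (auto simp: indicator_def)
    show ?thesis unfolding distr_dA_cmod e
      using mm by (subst integral_density) (auto simp: indicator_def)
  qed
  also have "\<dots> = (\<integral>r. indicator {0..<1} r *\<^sub>R ((2 * r) *\<^sub>R circle_mean g r) \<partial>lborel)"
    by (intro Bochner_Integration.integral_cong) (auto simp: m_def indicator_def)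
  finally show ?thesis .
qed

section \<open>Wirtinger derivatives and Littlewood-Paley identities\<close>

text \<open>Green's theorem for the dbar derivative \<open>Q\<close>. The integral
  \<open>I r\<close> of X(z) z over the circle of radius r has derivative 2 \<pi> times 2r times the
  circle mean of \<open>Q\<close>, and it vanishes at r = 0; integrating over r yields the area
  integral in polar coordinates.\<close>

lemma circle_mean_integral_dA:
  fixes X :: "complex \<Rightarrow> complex"
  assumes der: "\<And>z. z \<in> cball 0 1 \<Longrightarrow> (X has_derivative (\<lambda>h. P z * h + Q z * cnj h)) (at z)"
    and cP: "continuous_on (cball 0 1) P" and cQ: "continuous_on (cball 0 1) Q"
  shows "(\<integral>z. Q z \<partial>dA) = circle_mean (\<lambda>z. X z * z) 1"
proof -
  define E where "E r t = X (of_real r * cis t) * (of_real r * cis t)" for r t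
  define D where "D r t = (P (of_real r * cis t) * cis t + Q (of_real r * cis t) * cnj (cis t)) * (of_real r * cis t)
       + X (of_real r * cis t) * cis t" for r t
  define D' where "D' r t = (P (of_real r * cis t) * cis t - Q (of_real r * cis t) * cnj (cis t)) * (of_real r * \<i>) * (of_real r * cis t)
       + X (of_real r * cis t) * (of_real r * (\<i> * cis t))" for r t
  define I where "I r = integral (cbox 0 (2*pi)) (E r)" for r
  have cX: "continuous_on (cball 0 1) X"
    by (rule has_derivative_continuous_on[OF has_derivative_at_withinI[OF der]])
  have in1: "of_real r * cis t \<in> cball 0 1" if "r \<in> {0..1}" for r t
    using that by (simp add: norm_mult)
  have cont2: "continuous_on ({0..1} \<times> S) (\<lambda>x. Y (of_real (fst x) * cis (snd x)))"
    if "continuous_on (cball 0 1) Y" for Y :: "complex \<Rightarrow> complex" and S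
    by (rule continuous_on_compose2[OF that]) (auto intro!: continuous_intros simp: norm_mult)
  have cont1: "continuous_on S (\<lambda>t. Y (of_real r * cis t))"
    if "continuous_on (cball 0 1) Y" "r \<in> {0..1}" for Y :: "complex \<Rightarrow> complex" and S r
    by (rule continuous_on_compose2[OF that(1)]) (use that(2) in \<open>auto intro!: continuous_intros simp: norm_mult\<close>)
  have Dr: "((\<lambda>r. E r t) has_vector_derivative D r t) (at r within {0..1})" if "r \<in> {0..1}" for r t
  proof -
    have 1: "((\<lambda>r. of_real r * cis t) has_derivative (\<lambda>h. of_real h * cis t)) (at r within {0..1})"
      by (auto intro!: derivative_eq_intros)
    have "((\<lambda>r. X (of_real r * cis t)) has_derivative
       (\<lambda>h. P (of_real r * cis t) * (of_real h * cis t) + Q (of_real r * cis t) * cnj (of_real h * cis t))) (at r within {0..1})"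
      by (rule has_derivative_compose[OF 1 der[OF in1[OF that]]])
    from has_derivative_mult[OF this 1] show ?thesis
      unfolding has_vector_derivative_def E_def D_def
      by (rule has_derivative_eq_rhs) (auto simp: fun_eq_iff scaleR_conv_of_real algebra_simps)
  qed
  have Dt: "(E r has_vector_derivative D' r t) (at t within S)" if "r \<in> {0..1}" for r t S
  proof -
    have 1: "((\<lambda>t. of_real r * cis t) has_derivative (\<lambda>h. of_real r * (of_real h * (\<i> * cis t)))) (at t within S)"
      by (auto intro!: derivative_eq_intros simp: scaleR_conv_of_real)
    have "((\<lambda>t. X (of_real r * cis t)) has_derivative
       (\<lambda>h. P (of_real r * cis t) * (of_real r * (of_real h * (\<i> * cis t))) + Q (of_real r * cis t) * cnj (of_real r * (of_real h * (\<i> * cis t))))) (at t within S)"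
      by (rule has_derivative_compose[OF 1 der[OF in1[OF that]]])
    from has_derivative_mult[OF this 1] show ?thesis
      unfolding has_vector_derivative_def E_def[abs_def] D'_def
      by (rule has_derivative_eq_rhs) (auto simp: fun_eq_iff scaleR_conv_of_real algebra_simps)
  qed
  have iD': "(D' r has_integral 0) {0..2*pi}" if "r \<in> {0..1}" for r
    using fundamental_theorem_of_calculus[of 0 "2*pi" "E r" "D' r"] Dt[OF that] by (simp add: E_def)
  have cE: "continuous_on S (E r)" if "r \<in> {0..1}" for r S
    unfolding E_def[abs_def] by (intro continuous_intros cont1[OF cX that])
  have cD: "continuous_on ({0..1} \<times> S) (\<lambda>(r, t). D r t)" for S
    unfolding D_def split_beta by (intro continuous_intros cont2 cP cQ cX)
  have dI: "(I has_vector_derivative integral (cbox 0 (2*pi)) (D r)) (at r within {0..1})" if "r \<in> {0..1}" for r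
    unfolding I_def
    by (rule leibniz_rule_vector_derivative[where fx=D])
       (use that Dr cE cD in \<open>auto intro!: integrable_continuous_real\<close>)
  have key: "integral (cbox 0 (2*pi)) (D r) = (2 * pi) *\<^sub>R ((2 * r) *\<^sub>R circle_mean Q r)" if "r \<in> {0<..<1}" for r
  proof -
    have r: "r \<in> {0..1}" "r \<noteq> 0" using that by auto
    \<comment> \<open>The radial derivative \<open>D\<close> and the angular derivative
      \<open>D'\<close> share their \<open>P\<close> and \<open>X\<close> parts after division by i
      r; only \<open>Q\<close> is left. The angular part integrates to zero by periodicity.\<close>
    have eq: "D r t = 2 * of_real r * Q (of_real r * cis t) + D' r t / (of_real r * \<i>)" for t
    proof -
      have c: "cnj (cis t) * cis t = 1" by (simp add: cis_cnj cis_mult)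
      have "D r t - D' r t / (of_real r * \<i>) = 2 * Q (of_real r * cis t) * of_real r * (cnj (cis t) * cis t)"
        unfolding D_def D'_def using r by (simp add: field_simps)
      then show ?thesis unfolding c by (simp add: algebra_simps)
    qed
    have "((\<lambda>t. D' r t / (of_real r * \<i>)) has_integral 0 / (of_real r * \<i>)) {0..2*pi}"
      by (intro has_integral_divide iD' r)
    moreover have "((\<lambda>t. 2 * of_real r * Q (of_real r * cis t)) has_integral
        2 * of_real r * integral {0..2*pi} (\<lambda>t. Q (of_real r * cis t))) {0..2*pi}"
      by (intro has_integral_mult_right integrable_integral integrable_continuous_real cont1[OF cQ r(1)])
    ultimately have "(D r has_integral 2 * of_real r * integral {0..2*pi} (\<lambda>t. Q (of_real r * cis t)) + 0 / (of_real r * \<i>)) {0..2*pi}"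
      unfolding eq[abs_def] by (rule has_integral_add[rotated])
    then show ?thesis by (simp add: integral_unique circle_mean_def scaleR_conv_of_real)
  qed
  have "((\<lambda>r. (2 * pi) *\<^sub>R ((2 * r) *\<^sub>R circle_mean Q r)) has_integral (I 1 - I 0)) {0..1}"
  proof (rule fundamental_theorem_of_calculus_interior)
    show "continuous_on {0..1} I"
      by (rule continuous_on_vector_derivative[OF dI])
    fix r :: real assume r: "r \<in> {0<..<1}"
    then have "(I has_vector_derivative integral (cbox 0 (2*pi)) (D r)) (at r within {0..1})" by (intro dI) auto
    then show "(I has_vector_derivative (2 * pi) *\<^sub>R ((2 * r) *\<^sub>R circle_mean Q r)) (at r)"
      using r key[OF r] at_within_Icc_at[of 0 r 1] by simp
  qed simp
  moreover have "I 0 = 0" by (simp add: I_def E_def[abs_def])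
  ultimately have 1: "((\<lambda>r. (2 * r) *\<^sub>R circle_mean Q r) has_integral (1 / (2*pi)) *\<^sub>R I 1) {0..1}"
    using has_integral_cmul[of "\<lambda>r. (2 * pi) *\<^sub>R ((2 * r) *\<^sub>R circle_mean Q r)" "I 1 - I 0" "{0..1}" "1 / (2*pi)"] by simp
  have cmc: "continuous_on {0..1} (\<lambda>r. (2 * r) *\<^sub>R circle_mean Q r)"
  proof -
    have "continuous_on {0..1} (\<lambda>r. integral (cbox 0 (2*pi)) (\<lambda>t. Q (of_real r * cis t)))"
      by (rule integral_continuous_on_param) (unfold split_beta, intro cont2 cQ)
    then show ?thesis unfolding circle_mean_def by (intro continuous_intros) simp
  qed
  obtain B where B: "\<And>z. z \<in> cball 0 1 \<Longrightarrow> norm (Q z) \<le> B"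
    using compact_imp_bounded[OF compact_continuous_image[OF cQ compact_cball]] unfolding bounded_iff by (metis image_eqI)
  have cQ': "continuous_on disc Q" by (rule continuous_on_subset[OF cQ]) auto
  have "(\<integral>z. Q z \<partial>dA) = (\<integral>r. indicator {0..<1} r *\<^sub>R ((2 * r) *\<^sub>R circle_mean Q r) \<partial>lborel)"
    by (rule polar_dA[OF cQ'], rule integrable_dA_bounded[of _ B])
       (use B in \<open>auto intro: continuous_on_borel_measurable_dA cQ'\<close>)
  also have "\<dots> = (LINT r:{0..1}|lborel. (2 * r) *\<^sub>R circle_mean Q r)"
    unfolding set_lebesgue_integral_def
  proof (rule integral_cong_AE)
    have m: "(\<lambda>r. indicator {0..1} r *\<^sub>R ((2 * r) *\<^sub>R circle_mean Q r)) \<in> borel_measurable borel"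
      by (intro borel_measurable_continuous_on_indicator cmc) auto
    show "(\<lambda>r. indicator {0..1} r *\<^sub>R ((2 * r) *\<^sub>R circle_mean Q r)) \<in> borel_measurable lborel"
      using m by simp
    have "(\<lambda>r. indicator {0..<1} r *\<^sub>R ((2 * r) *\<^sub>R circle_mean Q r))
       = (\<lambda>r. indicator {0..<1} r *\<^sub>R (indicator {0..1} r *\<^sub>R ((2 * r) *\<^sub>R circle_mean Q r)))"
      by (auto simp: indicator_def fun_eq_iff)
    then show "(\<lambda>r. indicator {0..<1} r *\<^sub>R ((2 * r) *\<^sub>R circle_mean Q r)) \<in> borel_measurable lborel"
      unfolding measurable_lborel2 by (rule ssubst) (rule borel_measurable_scaleR[OF _ m], simp)
    show "AE r in lborel. indicator {0..<1} r *\<^sub>R ((2 * r) *\<^sub>R circle_mean Q r) = indicator {0..1} r *\<^sub>R ((2 * r) *\<^sub>R circle_mean Q r)"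
      by (rule AE_mp[OF AE_lborel_singleton[of 1]], rule AE_I2) (auto simp: indicator_def)
  qed
  also have "\<dots> = integral {0..1} (\<lambda>r. (2 * r) *\<^sub>R circle_mean Q r)"
    by (rule set_borel_integral_eq_integral(2)) (unfold set_integrable_def, rule borel_integrable_compact, simp, rule cmc)
  also have "\<dots> = (1 / (2*pi)) *\<^sub>R I 1" using 1 by (rule integral_unique)
  also have "\<dots> = circle_mean (\<lambda>z. X z * z) 1" by (simp add: circle_mean_def I_def E_def[abs_def])
  finally show ?thesis .
qed

lemma integrable_dA_continuous_cball:
  fixes f :: "complex \<Rightarrow> 'b::{banach,second_countable_topology}"
  assumes "continuous_on (cball 0 1) f" shows "integrable dA f"
proof -
  obtain B where B: "\<And>z. z \<in> cball 0 1 \<Longrightarrow> norm (f z) \<le> B"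
    using compact_imp_bounded[OF compact_continuous_image[OF assms compact_cball]] unfolding bounded_iff by (metis image_eqI)
  show ?thesis
    by (rule integrable_dA_bounded[of _ B])
       (use B in \<open>auto intro!: continuous_on_borel_measurable_dA continuous_on_subset[OF assms]\<close>)
qed

section \<open>Wirtinger calculus and circle means\<close>

text \<open>The real derivative in complex form: \<open>p\<close> and \<open>q\<close> are the
  values at \<open>z\<close> of the derivatives of \<open>X\<close> with respect to z and to its
  conjugate.\<close>

definition wirtinger :: "(complex \<Rightarrow> complex) \<Rightarrow> complex \<Rightarrow> complex \<Rightarrow> complex \<Rightarrow> bool" where
  "wirtinger X p q z \<longleftrightarrow> (X has_derivative (\<lambda>h. p * h + q * cnj h)) (at z)"

lemma wirtinger_holomorphic:
  assumes "f holomorphic_on S" "open S" "z \<in> S"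
  shows "wirtinger f (deriv f z) 0 z"
  using holomorphic_derivI[OF assms] by (simp add: wirtinger_def has_field_derivative_def)

lemma wirtinger_ident: "wirtinger (\<lambda>z. z) 1 0 z"
  by (simp add: wirtinger_def)

lemma wirtinger_const: "wirtinger (\<lambda>z. c) 0 0 z"
  by (simp add: wirtinger_def)

lemma wirtinger_cnj:
  assumes "wirtinger X p q z" shows "wirtinger (\<lambda>z. cnj (X z)) (cnj q) (cnj p) z"
  using bounded_linear.has_derivative[OF bounded_linear_cnj assms[unfolded wirtinger_def]]
  by (simp add: wirtinger_def add.commute)

lemma wirtinger_diff:
  assumes "wirtinger X p q z" "wirtinger Y p' q' z"
  shows "wirtinger (\<lambda>z. X z - Y z) (p - p') (q - q') z"
  using has_derivative_diff[OF assms[unfolded wirtinger_def]]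
  unfolding wirtinger_def by (rule has_derivative_eq_rhs) (auto simp: algebra_simps)

lemma wirtinger_mult:
  assumes "wirtinger X p q z" "wirtinger Y p' q' z"
  shows "wirtinger (\<lambda>z. X z * Y z) (X z * p' + p * Y z) (X z * q' + q * Y z) z"
  using has_derivative_mult[OF assms[unfolded wirtinger_def]]
  unfolding wirtinger_def by (rule has_derivative_eq_rhs) (auto simp: algebra_simps)

lemma wirtinger_sum:
  assumes "\<And>i. i \<in> A \<Longrightarrow> wirtinger (X i) (p i) (q i) z"
  shows "wirtinger (\<lambda>z. \<Sum>i\<in>A. X i z) (\<Sum>i\<in>A. p i) (\<Sum>i\<in>A. q i) z"
  using has_derivative_sum[OF assms[unfolded wirtinger_def]]
  unfolding wirtinger_def by (rule has_derivative_eq_rhs) (auto simp: sum.distrib sum_distrib_right)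

lemma wirtinger_inverse:
  assumes "wirtinger X p q z" "X z \<noteq> 0"
  shows "wirtinger (\<lambda>z. inverse (X z)) (- p / (X z)^2) (- q / (X z)^2) z"
  using Deriv.has_derivative_inverse[OF assms(2) assms(1)[unfolded wirtinger_def]]
  unfolding wirtinger_def by (rule has_derivative_eq_rhs) (auto simp: field_simps power2_eq_square add_divide_distrib)

lemma wirtinger_cong:
  "wirtinger X p q z \<Longrightarrow> p = p' \<Longrightarrow> q = q' \<Longrightarrow> wirtinger X p' q' z"
  by simp

lemma Stokes_dbar:
  assumes "\<And>z. z \<in> cball 0 1 \<Longrightarrow> wirtinger X (P z) (Q z) z"
    and "continuous_on (cball 0 1) P" "continuous_on (cball 0 1) Q"
  shows "(\<integral>z. Q z \<partial>dA) = circle_mean (\<lambda>z. X z * z) 1"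
  using assms by (intro circle_mean_integral_dA[where P=P]) (auto simp: wirtinger_def)

lemma circle_mean_cnj: "circle_mean (\<lambda>z. cnj (g z)) r = cnj (circle_mean g r)"
  by (simp add: circle_mean_def integral_cnj)

lemma Stokes_d:
  assumes "\<And>z. z \<in> cball 0 1 \<Longrightarrow> wirtinger X (P z) (Q z) z"
    and "continuous_on (cball 0 1) P" "continuous_on (cball 0 1) Q"
  shows "(\<integral>z. P z \<partial>dA) = circle_mean (\<lambda>z. X z * cnj z) 1"
proof -
  have "(\<integral>z. cnj (P z) \<partial>dA) = circle_mean (\<lambda>z. cnj (X z) * z) 1"
    by (rule Stokes_dbar[where P="\<lambda>z. cnj (Q z)"]) (use assms in \<open>auto intro!: wirtinger_cnj continuous_intros\<close>)
  then have "cnj (\<integral>z. P z \<partial>dA) = cnj (circle_mean (\<lambda>z. X z * cnj z) 1)"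
    unfolding circle_mean_cnj[symmetric] by simp
  then show ?thesis by simp
qed

lemma circle_mean_cong:
  assumes "\<And>z. cmod z = \<bar>r\<bar> \<Longrightarrow> f z = g z" shows "circle_mean f r = circle_mean g r"
  using assms by (simp add: circle_mean_def norm_mult)

lemma circle_mean_integrable:
  fixes f :: "complex \<Rightarrow> 'b::euclidean_space"
  assumes "continuous_on (sphere 0 \<bar>r\<bar>) f"
  shows "(\<lambda>t. f (of_real r * cis t)) integrable_on {0..2*pi}"
  by (intro integrable_continuous_real continuous_on_circle assms)

lemma circle_mean_add:
  fixes f g :: "complex \<Rightarrow> 'b::euclidean_space"
  assumes "continuous_on (sphere 0 \<bar>r\<bar>) f" "continuous_on (sphere 0 \<bar>r\<bar>) g"
  shows "circle_mean (\<lambda>z. f z + g z) r = circle_mean f r + circle_mean g r"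
  by (simp add: circle_mean_def integral_add circle_mean_integrable assms scaleR_add_right)

lemma circle_mean_sum:
  fixes f :: "'i \<Rightarrow> complex \<Rightarrow> 'b::euclidean_space"
  assumes "finite A" "\<And>i. i \<in> A \<Longrightarrow> continuous_on (sphere 0 \<bar>r\<bar>) (f i)"
  shows "circle_mean (\<lambda>z. \<Sum>i\<in>A. f i z) r = (\<Sum>i\<in>A. circle_mean (f i) r)"
  by (simp add: circle_mean_def integral_sum circle_mean_integrable assms scaleR_sum_right)

lemma circle_mean_mult:
  fixes f :: "complex \<Rightarrow> 'b::{real_normed_field,euclidean_space}"
  shows "circle_mean (\<lambda>z. c * f z) r = c * circle_mean f r"
  by (simp add: circle_mean_def)

lemma circle_mean_mono:
  fixes f g :: "complex \<Rightarrow> real"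
  assumes "continuous_on (sphere 0 \<bar>r\<bar>) f" "continuous_on (sphere 0 \<bar>r\<bar>) g"
    and "\<And>z. cmod z = \<bar>r\<bar> \<Longrightarrow> f z \<le> g z"
  shows "circle_mean f r \<le> circle_mean g r"
  unfolding circle_mean_def real_scaleR_def
  by (intro mult_left_mono integral_le circle_mean_integrable assms) (auto simp: norm_mult)

lemma circle_mean_nonneg:
  fixes f :: "complex \<Rightarrow> real"
  assumes "continuous_on (sphere 0 \<bar>r\<bar>) f" "\<And>z. cmod z = \<bar>r\<bar> \<Longrightarrow> 0 \<le> f z"
  shows "0 \<le> circle_mean f r"
  unfolding circle_mean_def real_scaleR_def
  by (intro mult_nonneg_nonneg integral_nonneg circle_mean_integrable assms) (auto simp: norm_mult)

lemma norm_circle_mean_le: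
  fixes f :: "complex \<Rightarrow> complex"
  assumes "continuous_on (sphere 0 \<bar>r\<bar>) f"
  shows "norm (circle_mean f r) \<le> circle_mean (\<lambda>z. norm (f z)) r"
  unfolding circle_mean_def norm_scaleR real_scaleR_def abs_of_pos[OF divide_pos_pos[OF zero_less_one mult_pos_pos[OF zero_less_numeral pi_gt_zero]]]
  by (intro mult_left_mono integral_norm_bound_integral circle_mean_integrable assms continuous_intros) auto

lemma circle_mean_of_real:
  assumes "continuous_on (sphere 0 \<bar>r\<bar>) f"
  shows "circle_mean (\<lambda>z. complex_of_real (f z)) r = of_real (circle_mean f r)"
proof -
  have "((\<lambda>t. f (of_real r * cis t)) has_integral integral {0..2*pi} (\<lambda>t. f (of_real r * cis t))) {0..2*pi}"
    by (intro integrable_integral circle_mean_integrable assms)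
  then have "((\<lambda>t. complex_of_real (f (of_real r * cis t))) has_integral of_real (integral {0..2*pi} (\<lambda>t. f (of_real r * cis t)))) {0..2*pi}"
    by (rule has_integral_of_real)
  then show ?thesis
    by (simp add: circle_mean_def integral_unique scaleR_conv_of_real)
qed

lemma circle_mean_const: "circle_mean (\<lambda>z. c) r = (c :: 'b::euclidean_space)"
  by (simp add: circle_mean_def)

text \<open>On the circle the line element is i z dt, hence the factor \<open>z\<close> in the
  mean.\<close>

lemma Cauchy_circle_mean:
  assumes f: "f holomorphic_on ball 0 R" and r: "0 < r" "r < R" and w: "cmod w < r"
  shows "circle_mean (\<lambda>z. f z * z / (z - w)) r = f w"
proof -
  have "((\<lambda>z. f z / (z - w)) has_contour_integral (2 * of_real pi * \<i> * f w)) (circlepath 0 r)"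
    by (rule Cauchy_integral_circlepath)
       (use r w in \<open>auto intro!: holomorphic_on_imp_continuous_on holomorphic_on_subset[OF f]\<close>)
  then have "((\<lambda>t. f (of_real r * cis t) / (of_real r * cis t - w) * of_real r * \<i> * cis t) has_integral
      (2 * of_real pi * \<i> * f w)) {0..2*pi}"
    unfolding circlepath_def by (subst (asm) has_contour_integral_part_circlepath_iff) auto
  from has_integral_divide[OF this, of \<i>] have "((\<lambda>t. f (of_real r * cis t) * (of_real r * cis t) / (of_real r * cis t - w)) has_integral
      (2 * of_real pi * f w)) {0..2*pi}"
    by (simp add: mult_ac)
  then show ?thesis by (simp add: circle_mean_def integral_unique scaleR_conv_of_real)
qed

lemma circle_mean_holomorphic:
  assumes f: "f holomorphic_on ball 0 R" and r: "0 \<le> r" "r < R"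
  shows "circle_mean f r = f 0"
proof (cases "r = 0")
  case True then show ?thesis by (simp add: circle_mean_def)
next
  case False
  have "circle_mean f r = circle_mean (\<lambda>z. f z * z / (z - 0)) r"
    using False by (intro circle_mean_cong) auto
  also have "\<dots> = f 0" using Cauchy_circle_mean[OF f, of r 0] r False by simp
  finally show ?thesis .
qed

text \<open>Polar coordinates are used twice, for \<open>f\<close> and for the constant
  \<open>f 0\<close>: their circle means agree on every circle inside the disc.\<close>

lemma mean_value_dA:
  assumes "f holomorphic_on disc" "integrable dA f"
  shows "(\<integral>z. f z \<partial>dA) = f 0"
proof -
  have "(\<integral>z. f z \<partial>dA) = (\<integral>r. indicator {0..<1} r *\<^sub>R ((2 * r) *\<^sub>R circle_mean f r) \<partial>lborel)"
    using assms by (intro polar_dA holomorphic_on_imp_continuous_on)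
  also have "\<dots> = (\<integral>r. indicator {0..<1} r *\<^sub>R ((2 * r) *\<^sub>R circle_mean (\<lambda>z. f 0) r) \<partial>lborel)"
    by (intro Bochner_Integration.integral_cong) (auto simp: indicator_def circle_mean_holomorphic[OF assms(1)] circle_mean_const)
  also have "\<dots> = (\<integral>z. f 0 \<partial>dA)"
    by (rule polar_dA[symmetric]) auto
  also have "\<dots> = f 0" by (simp add: measure_dA_disc)
  finally show ?thesis .
qed

context
  fixes h :: "complex \<Rightarrow> complex" and R :: real
  assumes h: "h holomorphic_on ball 0 R" and R: "1 < R"
begin

lemma continuous_on_cball_deriv:
  "continuous_on (cball 0 1) h" "continuous_on (cball 0 1) (deriv h)"
proof -
  have sub: "cball 0 1 \<subseteq> ball (0::complex) R" using R by auto
  show "continuous_on (cball 0 1) h"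
    by (rule continuous_on_subset[OF holomorphic_on_imp_continuous_on[OF h] sub])
  show "continuous_on (cball 0 1) (deriv h)"
    by (rule continuous_on_subset[OF holomorphic_on_imp_continuous_on[OF holomorphic_deriv[OF h open_ball]] sub])
qed

text \<open>Two applications of Stokes. With the weight 1 - |z|^2 the field (1 - |z|^2) cnj(h) h'
  has no boundary term and trades the weighted integral of |h'|^2 for that of z cnj(h) h'. The field
  z |h|^2 produces that same integral together with the circle mean of |h|^2.\<close>

lemma Littlewood_Paley:
  "(\<integral>z. (1 - (cmod z)^2) * (cmod (deriv h z))^2 \<partial>dA) + (\<integral>z. (cmod (h z))^2 \<partial>dA) = circle_mean (\<lambda>z. (cmod (h z))^2) 1"
proof -
  note c = continuous_on_cball_deriv
  have cs: "continuous_on (sphere 0 \<bar>1\<bar>) h" by (rule continuous_on_subset[OF c(1)]) auto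
  have wh: "wirtinger h (deriv h z) 0 z" and wh': "wirtinger (deriv h) (deriv (deriv h) z) 0 z" if "z \<in> cball 0 1" for z
  proof -
    have "z \<in> ball 0 R" using that R by auto
    then show "wirtinger h (deriv h z) 0 z" "wirtinger (deriv h) (deriv (deriv h) z) 0 z"
      by (auto intro!: wirtinger_holomorphic[of _ "ball 0 R"] h holomorphic_deriv)
  qed
  have c': "continuous_on (cball 0 1) (deriv (deriv h))"
    by (rule continuous_on_subset[OF holomorphic_on_imp_continuous_on[OF holomorphic_deriv[OF holomorphic_deriv[OF h open_ball] open_ball]]])
       (use R in auto)
  have "(\<integral>z. (1 - z * cnj z) * (cnj (deriv h z) * deriv h z) - z * (cnj (h z) * deriv h z) \<partial>dA)
      = circle_mean (\<lambda>z. (1 - z * cnj z) * (cnj (h z) * deriv h z) * z) 1"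
  proof (rule Stokes_dbar)
    fix z :: complex assume z: "z \<in> cball 0 1"
    show "wirtinger (\<lambda>z. (1 - z * cnj z) * (cnj (h z) * deriv h z))
       ((1 - z * cnj z) * (cnj (h z) * deriv (deriv h) z) - cnj z * (cnj (h z) * deriv h z))
       ((1 - z * cnj z) * (cnj (deriv h z) * deriv h z) - z * (cnj (h z) * deriv h z)) z"
      by (rule wirtinger_cong[OF wirtinger_mult[OF wirtinger_diff[OF wirtinger_const wirtinger_mult[OF wirtinger_ident wirtinger_cnj[OF wirtinger_ident]]]
         wirtinger_mult[OF wirtinger_cnj[OF wh[OF z]] wh'[OF z]]]]) (auto simp: algebra_simps)
  qed (intro continuous_intros c c')+
  also have "\<dots> = circle_mean (\<lambda>z. 0) 1"
    by (rule circle_mean_cong) (simp add: complex_norm_square[symmetric])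
  finally have 1: "(\<integral>z. (1 - z * cnj z) * (cnj (deriv h z) * deriv h z) \<partial>dA) = (\<integral>z. z * (cnj (h z) * deriv h z) \<partial>dA)"
    by (subst (asm) Bochner_Integration.integral_diff)
       (auto intro!: integrable_dA_continuous_cball continuous_intros c simp: circle_mean_const)
  have "(\<integral>z. h z * cnj (h z) + z * (cnj (h z) * deriv h z) \<partial>dA) = circle_mean (\<lambda>z. z * (h z * cnj (h z)) * cnj z) 1"
  proof (rule Stokes_d)
    fix z :: complex assume z: "z \<in> cball 0 1"
    show "wirtinger (\<lambda>z. z * (h z * cnj (h z))) (h z * cnj (h z) + z * (cnj (h z) * deriv h z)) (z * h z * cnj (deriv h z)) z"
      by (rule wirtinger_cong[OF wirtinger_mult[OF wirtinger_ident wirtinger_mult[OF wh[OF z] wirtinger_cnj[OF wh[OF z]]]]]) (auto simp: algebra_simps)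
  qed (intro continuous_intros c)+
  also have "\<dots> = circle_mean (\<lambda>z. complex_of_real ((cmod (h z))^2)) 1"
  proof (rule circle_mean_cong)
    fix z :: complex assume "cmod z = \<bar>1\<bar>"
    then have "z * cnj z = 1" by (simp add: complex_norm_square[symmetric])
    then have "z * (h z * cnj (h z)) * cnj z = h z * cnj (h z)" by (simp add: algebra_simps)
    then show "z * (h z * cnj (h z)) * cnj z = complex_of_real ((cmod (h z))^2)" by (simp only: complex_norm_square)
  qed
  also have "\<dots> = of_real (circle_mean (\<lambda>z. (cmod (h z))^2) 1)"
    by (intro circle_mean_of_real continuous_intros cs)
  finally have 2: "(\<integral>z. h z * cnj (h z) \<partial>dA) + (\<integral>z. z * (cnj (h z) * deriv h z) \<partial>dA) = of_real (circle_mean (\<lambda>z. (cmod (h z))^2) 1)"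
    by (subst (asm) Bochner_Integration.integral_add)
       (auto intro!: integrable_dA_continuous_cball continuous_intros c simp: circle_mean_const)
  have "complex_of_real ((\<integral>z. (1 - (cmod z)^2) * (cmod (deriv h z))^2 \<partial>dA) + (\<integral>z. (cmod (h z))^2 \<partial>dA))
     = (\<integral>z. (1 - z * cnj z) * (cnj (deriv h z) * deriv h z) \<partial>dA) + (\<integral>z. h z * cnj (h z) \<partial>dA)"
    by (simp add: complex_norm_square[unfolded of_real_power] mult.commute flip: integral_complex_of_real)
  also have "\<dots> = of_real (circle_mean (\<lambda>z. (cmod (h z))^2) 1)" using 1 2 by (simp add: add.commute)
  finally show ?thesis by (simp only: of_real_eq_iff)
qed

lemma Littlewood_Paley_le:
  "(\<integral>z. (1 - (cmod z)^2) * (cmod (deriv h z))^2 \<partial>dA) \<le> circle_mean (\<lambda>z. (cmod (h z))^2) 1"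
  "(\<integral>z. (1 - (cmod z)^2) * (cmod (h z))^2 \<partial>dA) \<le> circle_mean (\<lambda>z. (cmod (h z))^2) 1"
proof -
  note c = continuous_on_cball_deriv
  have 1: "0 \<le> (\<integral>z. (cmod (h z))^2 \<partial>dA)" by simp
  have 2: "0 \<le> (\<integral>z. (1 - (cmod z)^2) * (cmod (deriv h z))^2 \<partial>dA)"
    by (intro Bochner_Integration.integral_nonneg_AE AE_I2) (auto simp: abs_square_le_1 less_imp_le)
  have 3: "(\<integral>z. (1 - (cmod z)^2) * (cmod (h z))^2 \<partial>dA) \<le> (\<integral>z. (cmod (h z))^2 \<partial>dA)"
    by (intro Bochner_Integration.integral_mono integrable_dA_continuous_cball continuous_intros c)
       (auto simp: mult_le_cancel_right2)
  show "(\<integral>z. (1 - (cmod z)^2) * (cmod (deriv h z))^2 \<partial>dA) \<le> circle_mean (\<lambda>z. (cmod (h z))^2) 1"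
    "(\<integral>z. (1 - (cmod z)^2) * (cmod (h z))^2 \<partial>dA) \<le> circle_mean (\<lambda>z. (cmod (h z))^2) 1"
    using Littlewood_Paley 1 2 3 by linarith+
qed

end

section \<open>The corona estimate\<close>

text \<open>Continuous differentiability up to the circle, which is what the Stokes formulas ask.
  Both derivatives are explicit arguments, so the rules below compute them by unification and
  \<open>wdiff_cong\<close> only tidies the outcome.\<close>

definition wdiff :: "(complex \<Rightarrow> complex) \<Rightarrow> (complex \<Rightarrow> complex) \<Rightarrow> (complex \<Rightarrow> complex) \<Rightarrow> bool" where
  "wdiff X p q \<longleftrightarrow> (\<forall>z\<in>cball 0 1. wirtinger X (p z) (q z) z) \<and> continuous_on (cball 0 1) p \<and> continuous_on (cball 0 1) q"

lemma wdiff_continuous: "wdiff X p q \<Longrightarrow> continuous_on (cball 0 1) X"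
  unfolding wdiff_def wirtinger_def
  by (rule has_derivative_continuous_on[OF has_derivative_at_withinI]) auto

lemma wdiff_cong:
  assumes "wdiff X p q" "\<And>z. z \<in> cball 0 1 \<Longrightarrow> p z = p' z" "\<And>z. z \<in> cball 0 1 \<Longrightarrow> q z = q' z"
  shows "wdiff X p' q'"
  using assms continuous_on_eq[of "cball 0 1" p p'] continuous_on_eq[of "cball 0 1" q q']
  unfolding wdiff_def by auto

lemma wdiff_holomorphic:
  assumes "f holomorphic_on ball 0 R" "1 < R"
  shows "wdiff f (deriv f) (\<lambda>z. 0)"
  unfolding wdiff_def using continuous_on_cball_deriv[OF assms] assms
  by (auto intro!: wirtinger_holomorphic[of _ "ball 0 R"])

lemma wdiff_const: "wdiff (\<lambda>z. c) (\<lambda>z. 0) (\<lambda>z. 0)"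
  by (auto simp: wdiff_def wirtinger_const)

lemma wdiff_ident: "wdiff (\<lambda>z. z) (\<lambda>z. 1) (\<lambda>z. 0)"
  by (auto simp: wdiff_def wirtinger_ident)

lemma wdiff_cnj: "wdiff X p q \<Longrightarrow> wdiff (\<lambda>z. cnj (X z)) (\<lambda>z. cnj (q z)) (\<lambda>z. cnj (p z))"
  unfolding wdiff_def by (auto intro!: wirtinger_cnj continuous_intros)

lemma wdiff_diff: "wdiff X p q \<Longrightarrow> wdiff Y p' q' \<Longrightarrow> wdiff (\<lambda>z. X z - Y z) (\<lambda>z. p z - p' z) (\<lambda>z. q z - q' z)"
  unfolding wdiff_def by (auto intro!: wirtinger_diff continuous_intros)

lemma wdiff_mult:
  assumes "wdiff X p q" "wdiff Y p' q'"
  shows "wdiff (\<lambda>z. X z * Y z) (\<lambda>z. X z * p' z + p z * Y z) (\<lambda>z. X z * q' z + q z * Y z)"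
  using assms wdiff_continuous[OF assms(1)] wdiff_continuous[OF assms(2)]
  unfolding wdiff_def by (auto intro!: wirtinger_mult continuous_intros)

lemma wdiff_sum:
  assumes "\<And>i. i \<in> A \<Longrightarrow> wdiff (X i) (p i) (q i)"
  shows "wdiff (\<lambda>z. \<Sum>i\<in>A. X i z) (\<lambda>z. \<Sum>i\<in>A. p i z) (\<lambda>z. \<Sum>i\<in>A. q i z)"
  using assms unfolding wdiff_def by (auto intro!: wirtinger_sum continuous_intros)

lemma wdiff_inverse:
  assumes "wdiff X p q" "\<And>z. z \<in> cball 0 1 \<Longrightarrow> X z \<noteq> 0"
  shows "wdiff (\<lambda>z. inverse (X z)) (\<lambda>z. - p z / (X z)^2) (\<lambda>z. - q z / (X z)^2)"
  using assms wdiff_continuous[OF assms(1)]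
  unfolding wdiff_def by (intro conjI ballI wirtinger_inverse) (auto intro!: continuous_intros)

lemma wdiff_Stokes_dbar: "wdiff X p q \<Longrightarrow> (\<integral>z. q z \<partial>dA) = circle_mean (\<lambda>z. X z * z) 1"
  unfolding wdiff_def by (rule Stokes_dbar) auto

lemma wdiff_Stokes_d: "wdiff X p q \<Longrightarrow> (\<integral>z. p z \<partial>dA) = circle_mean (\<lambda>z. X z * cnj z) 1"
  unfolding wdiff_def by (rule Stokes_d) auto

lemma sum_squares_bound_2: "(x + y)^2 \<le> 2 * x^2 + 2 * y^2" for x y :: real
  using sum_squares_bound[of x y] by (simp add: power2_sum)

text \<open>The free weight \<open>k\<close> is what later allows the norm of \<open>h\<close> to be
  absorbed into the left-hand side.\<close>

lemma mult_le_weighted_squares: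
  fixes a b k :: real
  assumes "0 < k"
  shows "2 * a * b \<le> k * a^2 + b^2 / k"
proof -
  have "0 \<le> (k * a - b)^2 / k" using assms by simp
  also have "\<dots> = k * a^2 + b^2 / k - 2 * a * b"
    using assms by (simp add: field_simps power2_eq_square)
  finally show ?thesis by simp
qed

text \<open>The first summand is the constant (n + 4)(2 + 4n)/d^6 of the area estimate times 4 n^2,
  which dominates both of its coefficients n^2 and 4n. The summand 1/d^4 comes from bounding 1/Q on
  the circle, and \<open>n\<close> absorbs the n/2 left by the weighted squares.\<close>

definition corona_const :: "real \<Rightarrow> nat \<Rightarrow> real" where
  "corona_const d n = (real n + 4) * (2 + 4 * real n) * 4 * (real n)^2 / d ^ 6 + 1 / d ^ 4 + n"

text \<open>Wolff's argument in dual form: in the application \<open>h\<close> and \<open>v j\<close> are linear combinations of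
  Szego kernels and \<open>w j\<close> of difference quotients of \<open>f j\<close>, so that \<open>bd\<close> holds on the circle.\<close>

locale corona_data =
  fixes R d :: real and n :: nat and f w v :: "nat \<Rightarrow> complex \<Rightarrow> complex" and h :: "complex \<Rightarrow> complex"
  assumes R: "1 < R" and d: "0 < d" "d \<le> 1"
    and f: "\<And>j. j < n \<Longrightarrow> f j holomorphic_on ball 0 R"
    and f1: "\<And>j z. j < n \<Longrightarrow> z \<in> cball 0 1 \<Longrightarrow> cmod (f j z) \<le> 1"
    and fd: "\<And>z. z \<in> cball 0 1 \<Longrightarrow> d^2 \<le> (\<Sum>j<n. (cmod (f j z))^2)"
    and h: "h holomorphic_on ball 0 R"
    and w: "\<And>j. j < n \<Longrightarrow> w j holomorphic_on ball 0 R"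
    and v: "\<And>j. j < n \<Longrightarrow> v j holomorphic_on ball 0 R"
    and bd: "\<And>j z. j < n \<Longrightarrow> cmod z = 1 \<Longrightarrow> z * w j z = f j z * cnj (h z) - cnj (v j z)"
begin

lemma n_pos: "0 < n"
proof (rule ccontr)
  assume "\<not> 0 < n" then show False using fd[of 0] d by simp
qed

text \<open>\<open>Q\<close> is the squared length of the vector (f_0, ..., f_{n-1});
  \<open>Qd\<close> and \<open>Qb\<close> are its derivatives in z and in the conjugate of
  z.\<close>

definition "Q z = (\<Sum>m<n. f m z * cnj (f m z))"
definition "Qd z = (\<Sum>m<n. deriv (f m) z * cnj (f m z))"
definition "Qb z = (\<Sum>m<n. f m z * cnj (deriv (f m) z))"

lemma wQ: "wdiff Q Qd Qb"
  unfolding Q_def[abs_def]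
  by (rule wdiff_cong[OF wdiff_sum[OF wdiff_mult[OF wdiff_holomorphic[OF f R] wdiff_cnj[OF wdiff_holomorphic[OF f R]]]]])
     (auto simp: Qd_def Qb_def)

lemma Q_real: "Q z = of_real (\<Sum>m<n. (cmod (f m z))^2)"
  by (simp add: Q_def complex_norm_square[unfolded of_real_power])

lemma norm_Q: "z \<in> cball 0 1 \<Longrightarrow> d^2 \<le> cmod (Q z)"
  using fd[of z] unfolding Q_real by (simp add: sum_nonneg del: of_real_sum)

lemma Q_nz: "z \<in> cball 0 1 \<Longrightarrow> Q z \<noteq> 0"
  using norm_Q[of z] d by auto

lemma norm_iQ: "z \<in> cball 0 1 \<Longrightarrow> cmod (inverse (Q z)) \<le> 1 / d^2"
  using norm_Q[of z] d by (simp add: norm_inverse divide_inverse le_imp_inverse_le)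

lemma wiQ: "wdiff (\<lambda>z. inverse (Q z)) (\<lambda>z. - Qd z / (Q z)^2) (\<lambda>z. - Qb z / (Q z)^2)"
  by (rule wdiff_inverse[OF wQ Q_nz])

text \<open>The Koszul-type antisymmetrization of the data: \<open>G\<close> is the dbar derivative
  of the boundary expression in \<open>first_Stokes\<close>, with the non-analytic part confined to
  \<open>u\<close>. \<open>ud\<close> and \<open>Gd\<close> are the z-derivatives of
  \<open>u\<close> and \<open>G\<close>. Since \<open>u\<close> contains \<open>deriv (f j)\<close>
  only conjugated, no second derivative of \<open>f j\<close> appears in \<open>Gd\<close>.\<close>

definition "A j l z = f l z * w j z - f j z * w l z"
definition "u j l z = cnj (f l z) * cnj (deriv (f j) z) * (inverse (Q z) * inverse (Q z))"
definition "ud j l z = cnj (f l z) * cnj (deriv (f j) z) * (- 2 * inverse (Q z) * Qd z / (Q z)^2)"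
definition "G z = (\<Sum>j<n. \<Sum>l<n. h z * A j l z * u j l z)"
definition "Gd z = (\<Sum>j<n. \<Sum>l<n. (h z * deriv (A j l) z + deriv h z * A j l z) * u j l z + h z * A j l z * ud j l z)"

lemma A_hol: "j < n \<Longrightarrow> l < n \<Longrightarrow> A j l holomorphic_on ball 0 R"
  unfolding A_def[abs_def] by (intro holomorphic_intros f w)

lemma G_alt: "G z = h z * (\<Sum>j<n. \<Sum>l<n. A j l z * u j l z)"
  by (simp add: G_def sum_distrib_left mult.assoc)

lemma first_Stokes: "(\<integral>z. G z \<partial>dA) = circle_mean (\<lambda>z. h z * (\<Sum>j<n. cnj (f j z) * (inverse (Q z) * w j z)) * z) 1"
proof (rule wdiff_Stokes_dbar)
  \<comment> \<open>The quotient rule for the sum of cnj(f_j) w_j / Q. Putting both terms over Q^2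
    and expanding \<open>Q\<close> and \<open>Qb\<close> as sums makes the numerator antisymmetric
    in the entries of f and w, which is where \<open>A j l\<close> comes from.\<close>
  have alg: "(\<Sum>j<n. cnj (f j z) * (- (Qb z * w j z / (Q z)^2)) + cnj (deriv (f j) z) * (inverse (Q z) * w j z))
     = (\<Sum>j<n. \<Sum>l<n. A j l z * u j l z)" if "z \<in> cball 0 1" for z
  proof -
    have nz: "Q z \<noteq> 0" by (rule Q_nz[OF that])
    define i where "i = inverse (Q z)"
    have i: "i * Q z = 1" using nz by (simp add: i_def)
    have "(\<Sum>j<n. \<Sum>l<n. A j l z * u j l z)
      = i * i * ((\<Sum>j<n. \<Sum>l<n. (w j z * cnj (deriv (f j) z)) * (f l z * cnj (f l z)))
         - (\<Sum>j<n. \<Sum>l<n. (f j z * cnj (deriv (f j) z)) * (w l z * cnj (f l z))))"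
      unfolding sum_distrib_left sum_subtractf[symmetric]
      by (intro sum.cong refl) (simp add: A_def u_def i_def algebra_simps)
    also have "\<dots> = i * i * ((\<Sum>j<n. w j z * cnj (deriv (f j) z)) * Q z - Qb z * (\<Sum>l<n. w l z * cnj (f l z)))"
      unfolding Q_def Qb_def sum_product by simp
    also have "\<dots> = (i * Q z) * i * (\<Sum>j<n. w j z * cnj (deriv (f j) z)) - i * i * Qb z * (\<Sum>l<n. w l z * cnj (f l z))"
      by (simp add: algebra_simps)
    also have "\<dots> = (\<Sum>j<n. cnj (f j z) * (- (Qb z * w j z * (i * i))) + cnj (deriv (f j) z) * (i * w j z))"
      unfolding i by (simp add: sum.distrib sum_negf sum_subtractf sum_distrib_left algebra_simps)
    finally show ?thesis by (simp add: i_def divide_inverse power2_eq_square)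
  qed
  show "wdiff (\<lambda>z. h z * (\<Sum>j<n. cnj (f j z) * (inverse (Q z) * w j z)))
     (\<lambda>z. h z * (\<Sum>j<n. cnj (f j z) * (inverse (Q z) * deriv (w j) z - Qd z * w j z / (Q z)^2)) +
       deriv h z * (\<Sum>j<n. cnj (f j z) * (inverse (Q z) * w j z))) G"
    by (rule wdiff_cong[OF wdiff_mult[OF wdiff_holomorphic[OF h R] wdiff_sum[OF wdiff_mult[OF wdiff_cnj[OF wdiff_holomorphic[OF f R]] wdiff_mult[OF wiQ wdiff_holomorphic[OF w R]]]]]];
        use alg in \<open>simp add: G_alt\<close>)
qed

lemma G_wdiff: "\<exists>q. wdiff G Gd q"
proof -
  have wu: "\<exists>q. wdiff (u j l) (ud j l) q" if "j < n" "l < n" for j l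
    unfolding u_def[abs_def]
    by (rule exI, rule wdiff_cong[OF wdiff_mult[OF wdiff_mult[OF wdiff_cnj[OF wdiff_holomorphic[OF f R]]
         wdiff_cnj[OF wdiff_holomorphic[OF holomorphic_deriv[OF f open_ball] R]]] wdiff_mult[OF wiQ wiQ]]])
       (use that in \<open>auto simp: ud_def\<close>)
  then obtain q where q: "wdiff (u j l) (ud j l) (q j l)" if "j < n" "l < n" for j l by metis
  show ?thesis unfolding G_def[abs_def]
    by (rule exI, rule wdiff_cong[OF wdiff_sum[OF wdiff_sum[OF wdiff_mult[OF wdiff_mult[OF wdiff_holomorphic[OF h R] wdiff_holomorphic[OF A_hol R]] q]]]])
       (auto simp: Gd_def algebra_simps intro!: sum.cong)
qed

text \<open>The field z (1 - |z|^2) G vanishes on the circle. Its z-derivative contains (1 - 2|z|^2)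
  G = 2 (1 - |z|^2) G - G, so the plain integral of \<open>G\<close> is exchanged for one with the
  weight 1 - |z|^2 to which the Littlewood-Paley bounds apply.\<close>

lemma second_Stokes: "(\<integral>z. G z \<partial>dA) = (\<integral>z. (1 - z * cnj z) * (2 * G z + z * Gd z) \<partial>dA)"
proof -
  obtain q where q: "wdiff G Gd q" using G_wdiff by auto
  have c: "continuous_on (cball 0 1) G" "continuous_on (cball 0 1) Gd"
    using q wdiff_continuous[OF q] by (auto simp: wdiff_def)
  note W = wdiff_mult[OF wdiff_mult[OF wdiff_ident wdiff_diff[OF wdiff_const[of 1] wdiff_mult[OF wdiff_ident wdiff_cnj[OF wdiff_ident]]]] q]
  have "(\<integral>z. (1 - z * cnj z) * (2 * G z + z * Gd z) - G z \<partial>dA)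
     = circle_mean (\<lambda>z. z * (1 - z * cnj z) * G z * cnj z) 1"
    by (rule wdiff_Stokes_d[OF wdiff_cong[OF W _ refl]]) (auto simp: algebra_simps)
  also have "\<dots> = circle_mean (\<lambda>z. 0) 1"
    by (rule circle_mean_cong) (simp add: complex_norm_square[symmetric])
  finally show ?thesis
    by (subst (asm) Bochner_Integration.integral_diff)
       (auto intro!: integrable_dA_continuous_cball continuous_intros c simp: circle_mean_const)
qed

section \<open>Wolff's area estimate\<close>

definition "N g z = (cmod (g z))^2 + (cmod (deriv g z))^2 + (\<Sum>m<n. (cmod (g z * deriv (f m) z))^2)"

abbreviation "H2 g \<equiv> circle_mean (\<lambda>z. (cmod (g z))^2) 1"

text \<open>The measures (1 - |z|^2) |f_m'|^2 dA are Carleson measures: g f_m' = (g f_m)' - g' f_m,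
  Littlewood-Paley bounds both terms, and |f_m| \<le> 1. The value and the derivative of
  \<open>g\<close> contribute 2, each \<open>m\<close> contributes 4.\<close>

lemma integral_N:
  assumes g: "g holomorphic_on ball 0 R"
  shows "(\<integral>z. (1 - (cmod z)^2) * N g z \<partial>dA) \<le> (2 + 4 * n) * H2 g"
    "continuous_on (cball 0 1) (N g)"
proof -
  note cg = continuous_on_cball_deriv[OF g R]
  note cf = continuous_on_cball_deriv[OF f R]
  show "continuous_on (cball 0 1) (N g)"
    unfolding N_def by (intro continuous_intros cg cf) auto
  have gf: "(\<integral>z. (1 - (cmod z)^2) * (cmod (g z * deriv (f m) z))^2 \<partial>dA) \<le> 4 * H2 g" if m: "m < n" for m
  proof -
    have gfh: "(\<lambda>z. g z * f m z) holomorphic_on ball 0 R" by (intro holomorphic_intros g f m)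
    note cgf = continuous_on_cball_deriv[OF gfh R]
    have "(\<integral>z. (1 - (cmod z)^2) * (cmod (g z * deriv (f m) z))^2 \<partial>dA)
      \<le> (\<integral>z. 2 * ((1 - (cmod z)^2) * (cmod (deriv (\<lambda>z. g z * f m z) z))^2) + 2 * ((1 - (cmod z)^2) * (cmod (deriv g z))^2) \<partial>dA)"
    proof (intro Bochner_Integration.integral_mono integrable_dA_continuous_cball continuous_intros cg cf[OF m] cgf)
      fix z assume "z \<in> space dA"
      then have z: "cmod z < 1" by simp
      have "deriv (\<lambda>z. g z * f m z) z = g z * deriv (f m) z + deriv g z * f m z"
        using z R by (intro deriv_mult holomorphic_on_imp_differentiable_at[OF g open_ball]
          holomorphic_on_imp_differentiable_at[OF f[OF m] open_ball]) auto
      then have "g z * deriv (f m) z = deriv (\<lambda>z. g z * f m z) z - deriv g z * f m z" by simp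
      then have "cmod (g z * deriv (f m) z) \<le> cmod (deriv (\<lambda>z. g z * f m z) z) + cmod (deriv g z) * 1"
        using f1[OF m, of z] z by (metis norm_triangle_le_diff norm_mult mult_left_mono norm_ge_zero add_left_mono mem_cball_0 less_imp_le)
      then have "(cmod (g z * deriv (f m) z))^2 \<le> (cmod (deriv (\<lambda>z. g z * f m z) z) + cmod (deriv g z))^2"
        by (intro power_mono) auto
      also have "\<dots> \<le> 2 * (cmod (deriv (\<lambda>z. g z * f m z) z))^2 + 2 * (cmod (deriv g z))^2"
        by (rule sum_squares_bound_2)
      finally have "(1 - (cmod z)^2) * (cmod (g z * deriv (f m) z))^2 \<le> (1 - (cmod z)^2) * (2 * (cmod (deriv (\<lambda>z. g z * f m z) z))^2 + 2 * (cmod (deriv g z))^2)"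
        using z by (intro mult_left_mono) (auto simp: abs_square_le_1)
      then show "(1 - (cmod z)^2) * (cmod (g z * deriv (f m) z))^2 \<le> 2 * ((1 - (cmod z)^2) * (cmod (deriv (\<lambda>z. g z * f m z) z))^2) + 2 * ((1 - (cmod z)^2) * (cmod (deriv g z))^2)"
        by (simp add: algebra_simps)
    qed
    also have "\<dots> = 2 * (\<integral>z. (1 - (cmod z)^2) * (cmod (deriv (\<lambda>z. g z * f m z) z))^2 \<partial>dA) + 2 * (\<integral>z. (1 - (cmod z)^2) * (cmod (deriv g z))^2 \<partial>dA)"
      by (subst Bochner_Integration.integral_add)
         (auto intro!: integrable_dA_continuous_cball continuous_intros cg cf[OF m] cgf)
    also have "\<dots> \<le> 2 * H2 (\<lambda>z. g z * f m z) + 2 * H2 g"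
      by (intro add_mono mult_left_mono Littlewood_Paley_le[OF gfh R] Littlewood_Paley_le[OF g R]) auto
    also have "H2 (\<lambda>z. g z * f m z) \<le> H2 g"
    proof (rule circle_mean_mono)
      fix z :: complex assume "cmod z = \<bar>1\<bar>"
      then have "cmod (f m z) \<le> 1" using f1[OF m, of z] by simp
      then show "(cmod (g z * f m z))^2 \<le> (cmod (g z))^2"
        by (auto intro!: power_mono simp: norm_mult mult_left_le)
    qed (auto intro!: continuous_intros continuous_on_subset[OF cg(1)] continuous_on_subset[OF cf(1)[OF m]])
    finally show ?thesis by simp
  qed
  have "(\<integral>z. (1 - (cmod z)^2) * N g z \<partial>dA) = (\<integral>z. (1 - (cmod z)^2) * (cmod (g z))^2 \<partial>dA)
    + (\<integral>z. (1 - (cmod z)^2) * (cmod (deriv g z))^2 \<partial>dA) + (\<Sum>m<n. \<integral>z. (1 - (cmod z)^2) * (cmod (g z * deriv (f m) z))^2 \<partial>dA)"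
    unfolding N_def distrib_left sum_distrib_left
    by (subst Bochner_Integration.integral_add Bochner_Integration.integral_sum |
        auto intro!: integrable_dA_continuous_cball continuous_intros cg cf)+
  also have "\<dots> \<le> H2 g + H2 g + (\<Sum>m<n. 4 * H2 g)"
    by (intro add_mono sum_mono Littlewood_Paley_le[OF g R] gf) auto
  also have "\<dots> = (2 + 4 * n) * H2 g" by (simp add: algebra_simps)
  finally show "(\<integral>z. (1 - (cmod z)^2) * N g z \<partial>dA) \<le> (2 + 4 * n) * H2 g" .
qed

text \<open>Each factor 1/Q costs d^(-2). Since d \<le> 1 the bound with d^(-4) is weakened to
  d^(-6), so that both estimates carry one denominator.\<close>

lemma norm_terms:
  assumes z: "z \<in> cball 0 1" and jl: "j < n" "l < n"
  shows "cmod (u j l z) \<le> cmod (deriv (f j) z) / d ^ 6"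
    and "cmod (ud j l z) \<le> 2 * cmod (deriv (f j) z) * (\<Sum>m<n. cmod (deriv (f m) z)) / d ^ 6"
proof -
  have i: "cmod (inverse (Q z)) \<le> 1 / d^2" by (rule norm_iQ[OF z])
  have fl: "cmod (f l z) \<le> 1" using f1 jl z by blast
  have Qd: "cmod (Qd z) \<le> (\<Sum>m<n. cmod (deriv (f m) z))"
    unfolding Qd_def using f1[OF _ z] by (intro sum_norm_le) (auto simp: norm_mult mult_left_le)
  have d46: "1 / d ^ 4 \<le> 1 / d ^ 6" using d by (intro divide_left_mono power_decreasing) auto
  have "cmod (u j l z) \<le> 1 * cmod (deriv (f j) z) * ((1 / d^2) * (1 / d^2))"
    unfolding u_def norm_mult complex_mod_cnj by (intro mult_mono fl i order_refl mult_nonneg_nonneg) auto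
  also have "\<dots> = cmod (deriv (f j) z) * (1 / d ^ 4)" by (simp add: power_add[symmetric] flip: power_mult_distrib)
  also have "\<dots> \<le> cmod (deriv (f j) z) * (1 / d ^ 6)" by (intro mult_left_mono d46) auto
  finally show "cmod (u j l z) \<le> cmod (deriv (f j) z) / d ^ 6" by simp
  have "ud j l z = cnj (f l z) * cnj (deriv (f j) z) * (- 2 * (inverse (Q z) * inverse (Q z) * inverse (Q z)) * Qd z)"
    by (simp add: ud_def divide_inverse power2_eq_square mult_ac)
  then have "cmod (ud j l z) = cmod (f l z) * cmod (deriv (f j) z) * (2 * (cmod (inverse (Q z)) * cmod (inverse (Q z)) * cmod (inverse (Q z))) * cmod (Qd z))"
    by (simp only: norm_mult complex_mod_cnj) simp
  also have "\<dots> \<le> 1 * cmod (deriv (f j) z) * (2 * ((1 / d^2) * (1 / d^2) * (1 / d^2)) * (\<Sum>m<n. cmod (deriv (f m) z)))"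
    by (intro mult_mono fl i Qd order_refl mult_nonneg_nonneg) auto
  finally show "cmod (ud j l z) \<le> 2 * cmod (deriv (f j) z) * (\<Sum>m<n. cmod (deriv (f m) z)) / d ^ 6"
    by (simp add: power_add[symmetric] field_simps)
qed

text \<open>Every term carries the factor f_j' from \<open>u\<close> or \<open>ud\<close>. It is
  attached to \<open>h\<close> or to \<open>B\<close> so that each product has one factor whose
  square lies below \<open>N h z\<close> and one whose square lies below \<open>N B z\<close>; the
  weighted inequality then applies term by term. The \<open>n\<close> in n + 4 counts the summands
  of \<open>Qd\<close>.\<close>

lemma pointwise:
  assumes z: "z \<in> cball 0 1" and jl: "j < n" "l < n" and k: "0 < k"
  defines "B \<equiv> A j l"
  shows "cmod (2 * (h z * B z * u j l z) + z * ((h z * deriv B z + deriv h z * B z) * u j l z + h z * B z * ud j l z))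
    \<le> (n + 4) / d ^ 6 * (k * N h z + N B z / k)"
proof -
  define a0 a1 am b0 b1 bj where "a0 = cmod (h z)" "a1 = cmod (deriv h z)" "am = (\<lambda>m. cmod (h z * deriv (f m) z))"
    "b0 = cmod (B z)" "b1 = cmod (deriv B z)" "bj = cmod (B z * deriv (f j) z)"
  note defs = this
  define F where "F = cmod (deriv (f j) z)"
  have nn: "0 \<le> a0" "0 \<le> a1" "0 \<le> b0" "0 \<le> b1" "0 \<le> bj" "\<And>m. 0 \<le> am m" by (auto simp: defs)
  have am_le: "(am m)^2 \<le> N h z - a0^2 - a1^2" if "m < n" for m
    unfolding N_def defs using that by (auto intro!: member_le_sum[of m "{..<n}" "\<lambda>m. (cmod (h z * deriv (f m) z))^2"])
  have bj_le: "bj^2 \<le> N B z - b0^2 - b1^2"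
    unfolding N_def defs using jl by (auto intro!: member_le_sum[of j "{..<n}" "\<lambda>m. (cmod (B z * deriv (f m) z))^2"])
  have sq: "0 \<le> a0^2" "0 \<le> a1^2" "0 \<le> b0^2" "0 \<le> b1^2" "0 \<le> (am j)^2" "0 \<le> bj^2" by auto
  have le: "2 * x * y \<le> k * N h z + N B z / k" if "x^2 \<le> N h z" "y^2 \<le> N B z" for x y
  proof -
    have "2 * x * y \<le> k * x^2 + y^2 / k" by (rule mult_le_weighted_squares[OF k])
    also have "\<dots> \<le> k * N h z + N B z / k" using that k by (intro add_mono mult_left_mono divide_right_mono) auto
    finally show ?thesis .
  qed
  have t1: "2 * a0 * bj \<le> k * N h z + N B z / k" by (intro le; use am_le[OF jl(1)] bj_le sq in linarith)
  have t2: "2 * a1 * bj \<le> k * N h z + N B z / k" by (intro le; use am_le[OF jl(1)] bj_le sq in linarith)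
  have t3: "2 * am j * b1 \<le> k * N h z + N B z / k" by (intro le; use am_le[OF jl(1)] bj_le sq in linarith)
  have t4: "2 * am m * bj \<le> k * N h z + N B z / k" if "m < n" for m
    using zero_le_power2[of "am m"] by (intro le; use am_le[OF that] bj_le sq in linarith)
  have "(\<Sum>m<n. 2 * am m * bj) \<le> (\<Sum>m<n. k * N h z + N B z / k)" by (intro sum_mono t4) auto
  then have t5: "2 * (\<Sum>m<n. am m) * bj \<le> n * (k * N h z + N B z / k)" by (simp add: sum_distrib_left sum_distrib_right)
  have d6: "0 < d ^ 6" using d by simp
  have z1: "cmod z \<le> 1" using z by simp
  have U: "cmod (u j l z) \<le> F / d ^ 6" "cmod (ud j l z) \<le> 2 * F * (\<Sum>m<n. cmod (deriv (f m) z)) / d ^ 6"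
    using norm_terms[OF z jl] by (auto simp: F_def)
  have "cmod (2 * (h z * B z * u j l z) + z * ((h z * deriv B z + deriv h z * B z) * u j l z + h z * B z * ud j l z))
    \<le> cmod (2 * (h z * B z * u j l z)) + cmod z * cmod ((h z * deriv B z + deriv h z * B z) * u j l z + h z * B z * ud j l z)"
    by (metis norm_triangle_ineq norm_mult)
  also have "\<dots> \<le> cmod (2 * (h z * B z * u j l z)) + 1 * cmod ((h z * deriv B z + deriv h z * B z) * u j l z + h z * B z * ud j l z)"
    by (intro add_left_mono mult_right_mono z1) auto
  also have "cmod ((h z * deriv B z + deriv h z * B z) * u j l z + h z * B z * ud j l z)
     \<le> cmod (h z * deriv B z * u j l z) + cmod (deriv h z * B z * u j l z) + cmod (h z * B z * ud j l z)"
    by (rule order_trans[OF norm_triangle_ineq add_right_mono]) (simp only: distrib_right norm_triangle_ineq)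
  also have "cmod (2 * (h z * B z * u j l z)) = 2 * (a0 * b0) * cmod (u j l z)" by (simp add: norm_mult defs)
  also have "cmod (h z * deriv B z * u j l z) = a0 * b1 * cmod (u j l z)" by (simp add: norm_mult defs)
  also have "cmod (deriv h z * B z * u j l z) = a1 * b0 * cmod (u j l z)" by (simp add: norm_mult defs)
  also have "cmod (h z * B z * ud j l z) = a0 * b0 * cmod (ud j l z)" by (simp add: norm_mult defs)
  also have "2 * (a0 * b0) * cmod (u j l z) + 1 * (a0 * b1 * cmod (u j l z) + a1 * b0 * cmod (u j l z) + a0 * b0 * cmod (ud j l z))
    \<le> 2 * (a0 * b0) * (F / d ^ 6) + 1 * (a0 * b1 * (F / d ^ 6) + a1 * b0 * (F / d ^ 6) + a0 * b0 * (2 * F * (\<Sum>m<n. cmod (deriv (f m) z)) / d ^ 6))"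
    using nn by (intro add_mono mult_left_mono U) auto
  also have "\<dots> = (2 * a0 * (b0 * F) + (a0 * F) * b1 + a1 * (b0 * F) + 2 * (\<Sum>m<n. a0 * cmod (deriv (f m) z)) * (b0 * F)) / d ^ 6"
    using d6 by (simp add: field_simps sum_distrib_left)
  also have "\<dots> = (2 * a0 * bj + am j * b1 + a1 * bj + 2 * (\<Sum>m<n. am m) * bj) / d ^ 6"
    by (simp add: defs F_def norm_mult)
  also have "\<dots> \<le> ((n + 4) * (k * N h z + N B z / k)) / d ^ 6"
  proof (intro divide_right_mono)
    define X where "X = k * N h z + N B z / k"
    have "0 \<le> X" using le[of 0 0] bj_le am_le[OF jl(1)] sq by (simp add: X_def)
    moreover have "(real n + 4) * X = n * X + 4 * X" by (simp add: algebra_simps)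
    ultimately have "2 * a0 * bj + am j * b1 + a1 * bj + 2 * (\<Sum>m<n. am m) * bj \<le> (real n + 4) * X"
      using t1 t2 t3 t5 unfolding X_def[symmetric] mult.assoc by linarith
    then show "2 * a0 * bj + am j * b1 + a1 * bj + 2 * (\<Sum>m<n. am m) * bj \<le> (n + 4) * (k * N h z + N B z / k)"
      by (simp add: X_def)
  qed (use d6 in simp)
  finally show ?thesis by simp
qed

lemma H2_nonneg: "g holomorphic_on ball 0 R \<Longrightarrow> 0 \<le> H2 g"
  by (intro circle_mean_nonneg continuous_intros continuous_on_subset[OF continuous_on_cball_deriv(1)[OF _ R]]) auto

text \<open>On the circle \<open>bd\<close> turns z A_{jl} into f_j cnj(v_l) - f_l cnj(v_j): the
  contributions of \<open>h\<close> cancel, so \<open>A\<close> is controlled by \<open>v\<close>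
  alone.\<close>

lemma H2_A:
  assumes jl: "j < n" "l < n"
  shows "H2 (A j l) \<le> 2 * H2 (v j) + 2 * H2 (v l)"
proof -
  have c: "continuous_on (sphere 0 \<bar>1\<bar>) g" if "g holomorphic_on ball 0 R" for g
    by (rule continuous_on_subset[OF continuous_on_cball_deriv(1)[OF that R]]) auto
  have "H2 (A j l) \<le> circle_mean (\<lambda>z. 2 * (cmod (v j z))^2 + 2 * (cmod (v l z))^2) 1"
  proof (rule circle_mean_mono)
    fix z :: complex assume z: "cmod z = \<bar>1\<bar>"
    then have z1: "z \<in> cball 0 1" by simp
    have "z * A j l z = f l z * (z * w j z) - f j z * (z * w l z)" by (simp add: A_def algebra_simps)
    also have "\<dots> = f j z * cnj (v l z) - f l z * cnj (v j z)"
    proof -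
      have "cnj (v j z) = f j z * cnj (h z) - z * w j z" "cnj (v l z) = f l z * cnj (h z) - z * w l z"
        using bd[of j z] bd[of l z] jl z by (auto simp: algebra_simps)
      then show ?thesis by (simp only:) (simp add: algebra_simps)
    qed
    finally have "cmod (A j l z) = cmod (f j z * cnj (v l z) - f l z * cnj (v j z))" using z by (metis norm_mult abs_one mult_1)
    also have "\<dots> \<le> cmod (f j z) * cmod (v l z) + cmod (f l z) * cmod (v j z)"
      by (metis norm_triangle_ineq4 norm_mult complex_mod_cnj)
    also have "\<dots> \<le> 1 * cmod (v l z) + 1 * cmod (v j z)"
      by (intro add_mono mult_right_mono f1 jl z1) auto
    finally have "(cmod (A j l z))^2 \<le> (cmod (v j z) + cmod (v l z))^2" by (intro power_mono) auto
    also have "\<dots> \<le> 2 * (cmod (v j z))^2 + 2 * (cmod (v l z))^2" by (rule sum_squares_bound_2)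
    finally show "(cmod (A j l z))^2 \<le> 2 * (cmod (v j z))^2 + 2 * (cmod (v l z))^2" .
  qed (intro continuous_intros c A_hol v jl)+
  also have "\<dots> = 2 * H2 (v j) + 2 * H2 (v l)"
    by (subst circle_mean_add) (auto intro!: continuous_intros c c[simplified] v jl simp: circle_mean_mult)
  finally show ?thesis .
qed

text \<open>The weight gained in \<open>second_Stokes\<close> is matched with
  \<open>integral_N\<close>. In the double sum each \<open>v j\<close> enters once through the index
  j and once through l, each time with weight 2/k and multiplicity n, which makes 4n/k.\<close>

lemma estimate_area:
  fixes k :: real
  assumes k: "0 < k"
  shows "cmod (\<integral>z. G z \<partial>dA) \<le> (real n + 4) * (2 + 4 * real n) / d ^ 6 * (k * n^2 * H2 h + 4 * n * (\<Sum>j<n. H2 (v j)) / k)"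
proof -
  obtain q where q: "wdiff G Gd q" using G_wdiff by auto
  have cG: "continuous_on (cball 0 1) G" "continuous_on (cball 0 1) Gd"
    using q wdiff_continuous[OF q] by (auto simp: wdiff_def)
  define c where "c = (n + 4) / d ^ 6"
  have c0: "0 \<le> c" using d by (simp add: c_def)
  note cN = integral_N(2)
  have "cmod (\<integral>z. G z \<partial>dA) = cmod (\<integral>z. (1 - z * cnj z) * (2 * G z + z * Gd z) \<partial>dA)" by (simp add: second_Stokes)
  also have "\<dots> \<le> (\<integral>z. cmod ((1 - z * cnj z) * (2 * G z + z * Gd z)) \<partial>dA)" by (rule integral_norm_bound)
  also have "\<dots> \<le> (\<integral>z. (1 - (cmod z)^2) * (\<Sum>j<n. \<Sum>l<n. c * (k * N h z + N (A j l) z / k)) \<partial>dA)"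
  proof (intro Bochner_Integration.integral_mono integrable_dA_continuous_cball continuous_intros cG cN h A_hol)
    fix z assume "z \<in> space dA"
    then have z: "cmod z < 1" by simp
    then have p: "0 \<le> 1 - (cmod z)^2" by (simp add: abs_square_le_1)
    have "1 - z * cnj z = of_real (1 - (cmod z)^2)" by (simp add: complex_norm_square[unfolded of_real_power])
    then have "cmod (1 - z * cnj z) = 1 - (cmod z)^2" using p by (simp only: norm_of_real abs_of_nonneg)
    moreover have "cmod (2 * G z + z * Gd z) \<le> (\<Sum>j<n. \<Sum>l<n. c * (k * N h z + N (A j l) z / k))"
    proof -
      have eq: "2 * G z + z * Gd z = (\<Sum>j<n. \<Sum>l<n. 2 * (h z * A j l z * u j l z) + z * ((h z * deriv (A j l) z + deriv h z * A j l z) * u j l z + h z * A j l z * ud j l z))"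
        by (simp only: G_def Gd_def sum_distrib_left sum.distrib[symmetric])
      show ?thesis
        unfolding c_def eq using z k by (intro sum_norm_le pointwise) auto
    qed
    ultimately show "cmod ((1 - z * cnj z) * (2 * G z + z * Gd z)) \<le> (1 - (cmod z)^2) * (\<Sum>j<n. \<Sum>l<n. c * (k * N h z + N (A j l) z / k))"
      unfolding norm_mult using p by (simp add: mult_left_mono)
  qed (use k in auto)
  also have "\<dots> = (\<integral>z. (\<Sum>j<n. \<Sum>l<n. c * (k * ((1 - (cmod z)^2) * N h z) + ((1 - (cmod z)^2) * N (A j l) z) / k)) \<partial>dA)"
    by (intro Bochner_Integration.integral_cong refl) (simp add: sum_distrib_left algebra_simps)
  also have "\<dots> = (\<Sum>j<n. \<Sum>l<n. c * (k * (\<integral>z. (1 - (cmod z)^2) * N h z \<partial>dA) + (\<integral>z. (1 - (cmod z)^2) * N (A j l) z \<partial>dA) / k))"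
  proof -
    have i: "integrable dA (\<lambda>z. (1 - (cmod z)^2) * N h z)" "\<And>j l. j < n \<Longrightarrow> l < n \<Longrightarrow> integrable dA (\<lambda>z. (1 - (cmod z)^2) * N (A j l) z)"
      by (intro integrable_dA_continuous_cball continuous_intros cN h A_hol; simp)+
    show ?thesis
      by (subst Bochner_Integration.integral_sum, force intro!: i Bochner_Integration.integrable_sum, rule sum.cong[OF refl],
          subst Bochner_Integration.integral_sum, force intro!: i, rule sum.cong[OF refl])
         (simp add: i)
  qed
  also have "\<dots> \<le> (\<Sum>j<n. \<Sum>l<n. c * (k * ((2 + 4 * n) * H2 h) + ((2 + 4 * n) * (2 * H2 (v j) + 2 * H2 (v l))) / k))"
    using k
    by (intro sum_mono mult_left_mono add_mono divide_right_mono integral_N(1)[OF h] order_trans[OF integral_N(1)[OF A_hol]] H2_A c0) auto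
  also have "\<dots> = c * (2 + 4 * n) * (\<Sum>j<n. \<Sum>l<n. k * H2 h + (2 / k) * H2 (v j) + (2 / k) * H2 (v l))"
    unfolding sum_distrib_left using k by (intro sum.cong refl) (simp add: field_simps)
  also have "(\<Sum>j<n. \<Sum>l<n. k * H2 h + (2 / k) * H2 (v j) + (2 / k) * H2 (v l)) = k * n^2 * H2 h + 4 * n * (\<Sum>j<n. H2 (v j)) / k"
  proof -
    have "(\<Sum>j<n. \<Sum>l<n. x + t * H2 (v j) + t * H2 (v l))
      = n * (n * x) + n * (t * (\<Sum>j<n. H2 (v j))) + n * (t * (\<Sum>j<n. H2 (v j)))" for x t :: real
      by (simp add: sum.distrib sum_distrib_left distrib_left mult_ac)
    from this[of "k * H2 h" "2 / k"] show ?thesis by (simp add: power2_eq_square[of "real n"])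
  qed
  finally show ?thesis by (simp add: c_def)
qed

abbreviation "K \<equiv> corona_const d n"

text \<open>On the circle |h|^2 = h Q cnj(h) / Q, and by \<open>bd\<close> the product Q cnj(h) is
  the sum of cnj(f_j) (cnj(v_j) + z w_j). The \<open>v\<close> part is estimated directly on the
  circle; the \<open>w\<close> part is the boundary term of \<open>first_Stokes\<close>, hence the
  area integral of \<open>G\<close>.\<close>

lemma corona_estimate: "H2 h \<le> 4 * K^2 * (\<Sum>j<n. H2 (v j))"
proof -
  have c: "continuous_on (sphere 0 \<bar>1\<bar>) g" if "g holomorphic_on ball 0 R" for g
    by (rule continuous_on_subset[OF continuous_on_cball_deriv(1)[OF that R]]) auto
  have ciQ: "continuous_on (sphere 0 \<bar>1\<bar>) (\<lambda>z. inverse (Q z))"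
    by (rule continuous_on_subset[OF wdiff_continuous[OF wiQ]]) auto
  define V where "V = (\<Sum>j<n. H2 (v j))"
  have V0: "0 \<le> V" unfolding V_def by (intro sum_nonneg H2_nonneg v) auto
  have H0: "0 \<le> H2 h" by (rule H2_nonneg[OF h])
  have K0: "0 < K" unfolding corona_const_def using n_pos d by (intro add_nonneg_pos add_nonneg_nonneg) auto
  \<comment> \<open>Makes \<open>K * k\<close> equal to 1/2, so half of \<open>H2 h\<close> is
    absorbed on the left; the other coefficient \<open>K / k\<close> is 2 K^2 and doubles to the 4
    K^2 of the claim.\<close>
  define k where "k = 1 / (2 * K)"
  have k: "0 < k" using K0 by (simp add: k_def)
  have "complex_of_real (H2 h) = circle_mean (\<lambda>z. complex_of_real ((cmod (h z))^2)) 1"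
    by (rule circle_mean_of_real[symmetric]) (intro continuous_intros c h)
  also have "\<dots> = circle_mean (\<lambda>z. (\<Sum>j<n. h z * (cnj (f j z) * inverse (Q z) * cnj (v j z))) + h z * (\<Sum>j<n. cnj (f j z) * (inverse (Q z) * w j z)) * z) 1"
  proof (rule circle_mean_cong)
    fix z :: complex assume z: "cmod z = \<bar>1\<bar>"
    then have nz: "Q z \<noteq> 0" by (intro Q_nz) auto
    have "(\<Sum>j<n. h z * (cnj (f j z) * inverse (Q z) * cnj (v j z))) + h z * (\<Sum>j<n. cnj (f j z) * (inverse (Q z) * w j z)) * z
      = h z * inverse (Q z) * (\<Sum>j<n. cnj (f j z) * (cnj (v j z) + z * w j z))"
      by (simp add: sum_distrib_left sum_distrib_right sum.distrib algebra_simps)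
    also have "(\<Sum>j<n. cnj (f j z) * (cnj (v j z) + z * w j z)) = Q z * cnj (h z)"
      unfolding Q_def sum_distrib_right using bd z by (intro sum.cong) (auto simp: algebra_simps)
    also have "h z * inverse (Q z) * (Q z * cnj (h z)) = h z * cnj (h z)" using nz by simp
    finally show "complex_of_real ((cmod (h z))^2) = (\<Sum>j<n. h z * (cnj (f j z) * inverse (Q z) * cnj (v j z))) + h z * (\<Sum>j<n. cnj (f j z) * (inverse (Q z) * w j z)) * z"
      by (simp only: complex_norm_square)
  qed
  also have "\<dots> = (\<Sum>j<n. circle_mean (\<lambda>z. h z * (cnj (f j z) * inverse (Q z) * cnj (v j z))) 1) + (\<integral>z. G z \<partial>dA)"
  proof -
    have c1: "continuous_on (sphere 0 \<bar>1\<bar>) (\<lambda>z. h z * (cnj (f j z) * inverse (Q z) * cnj (v j z)))" if "j < n" for j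
      by (intro continuous_intros c h f v ciQ that)
    have c2: "continuous_on (sphere 0 \<bar>1\<bar>) (\<lambda>z. h z * (\<Sum>j<n. cnj (f j z) * (inverse (Q z) * w j z)) * z)"
      by (intro continuous_intros c h f w ciQ) auto
    show ?thesis unfolding first_Stokes
      by (subst circle_mean_add[OF continuous_on_sum c2], use c1 in force, subst circle_mean_sum, use c1 in auto)
  qed
  finally have "H2 h = cmod ((\<Sum>j<n. circle_mean (\<lambda>z. h z * (cnj (f j z) * inverse (Q z) * cnj (v j z))) 1) + (\<integral>z. G z \<partial>dA))"
    using H0 by (metis norm_of_real abs_of_nonneg)
  also have "\<dots> \<le> (\<Sum>j<n. cmod (circle_mean (\<lambda>z. h z * (cnj (f j z) * inverse (Q z) * cnj (v j z))) 1)) + cmod (\<integral>z. G z \<partial>dA)"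
    by (rule order_trans[OF norm_triangle_ineq add_right_mono]) (rule norm_sum)
  also have "\<dots> \<le> (\<Sum>j<n. (k * H2 h + H2 (v j) / (d ^ 4 * k)) / 2) + (real n + 4) * (2 + 4 * real n) / d ^ 6 * (k * n^2 * H2 h + 4 * n * V / k)"
  proof (intro add_mono sum_mono)
    fix j assume "j \<in> {..<n}"
    then have j: "j < n" by simp
    have cc: "continuous_on (sphere 0 \<bar>1\<bar>) (\<lambda>z. h z * (cnj (f j z) * inverse (Q z) * cnj (v j z)))"
      by (intro continuous_intros c h f v ciQ j)
    have "cmod (circle_mean (\<lambda>z. h z * (cnj (f j z) * inverse (Q z) * cnj (v j z))) 1)
      \<le> circle_mean (\<lambda>z. cmod (h z * (cnj (f j z) * inverse (Q z) * cnj (v j z)))) 1"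
      by (rule norm_circle_mean_le[OF cc])
    also have "\<dots> \<le> circle_mean (\<lambda>z. (k / 2) * (cmod (h z))^2 + (1 / (d ^ 4 * k) / 2) * (cmod (v j z))^2) 1"
    proof (rule circle_mean_mono)
      fix z :: complex assume "cmod z = \<bar>1\<bar>"
      then have z: "z \<in> cball 0 1" by simp
      have "2 * cmod (h z * (cnj (f j z) * inverse (Q z) * cnj (v j z))) \<le> 2 * (cmod (h z) * (1 * (1 / d^2) * cmod (v j z)))"
        unfolding norm_mult complex_mod_cnj
        by (intro mult_left_mono mult_mono f1 j z norm_iQ) auto
      also have "\<dots> = 2 * cmod (h z) * (cmod (v j z) / d^2)" by simp
      also have "\<dots> \<le> k * (cmod (h z))^2 + (cmod (v j z) / d^2)^2 / k" by (rule mult_le_weighted_squares[OF k])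
      also have "\<dots> = 2 * ((k / 2) * (cmod (h z))^2 + (1 / (d ^ 4 * k) / 2) * (cmod (v j z))^2)"
        by (simp add: power_divide power_mult[symmetric] field_simps)
      finally show "cmod (h z * (cnj (f j z) * inverse (Q z) * cnj (v j z))) \<le> (k / 2) * (cmod (h z))^2 + (1 / (d ^ 4 * k) / 2) * (cmod (v j z))^2"
        by simp
    qed (intro continuous_intros c h v j cc)+
    also have "\<dots> = (k / 2) * H2 h + (1 / (d ^ 4 * k) / 2) * H2 (v j)"
      by (subst circle_mean_add, (intro continuous_intros c h v j)+, simp only: circle_mean_mult)
    also have "\<dots> = (k * H2 h + H2 (v j) / (d ^ 4 * k)) / 2" by (simp add: add_divide_distrib)
    finally show "cmod (circle_mean (\<lambda>z. h z * (cnj (f j z) * inverse (Q z) * cnj (v j z))) 1) \<le> (k * H2 h + H2 (v j) / (d ^ 4 * k)) / 2" .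
  qed (use estimate_area[OF k] in \<open>simp add: V_def\<close>)
  also have "(\<Sum>j<n. (k * H2 h + H2 (v j) / (d ^ 4 * k)) / 2) = (n * k / 2) * H2 h + V / (d ^ 4 * k) / 2"
    by (simp add: sum.distrib add_divide_distrib V_def flip: sum_divide_distrib)
  finally have 1: "H2 h \<le> (n * k / 2) * H2 h + V / (d ^ 4 * k) / 2 + (real n + 4) * (2 + 4 * real n) / d ^ 6 * (k * n^2 * H2 h + 4 * n * V / k)" .
  define c0 where "c0 = (real n + 4) * (2 + 4 * real n) / d ^ 6"
  have c0: "0 \<le> c0" using d by (simp add: c0_def)
  have Kc: "K = c0 * 4 * (real n)^2 + 1 / d ^ 4 + n" by (simp add: corona_const_def c0_def)
  have n1: "real n \<le> (real n)^2" using n_pos by (simp add: power2_eq_square)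
  have d4: "0 < 1 / d ^ 4" using d by simp
  have n21: "c0 * real n \<le> c0 * (real n)^2" "0 \<le> c0 * (real n)^2" using c0 n1 by (auto intro: mult_left_mono)
  have "n * k / 2 + c0 * (k * n^2) \<le> K * k"
  proof -
    have "(n / 2 + c0 * n^2) * k \<le> K * k"
      using k n21 d4 unfolding Kc by (intro mult_right_mono) (auto simp: algebra_simps)
    then show ?thesis by (simp add: algebra_simps)
  qed
  moreover have "1 / (d ^ 4 * k) / 2 + c0 * (4 * n / k) \<le> K / k"
  proof -
    have "1 / d ^ 4 / 2 + 4 * (c0 * n) \<le> 4 * (c0 * (real n)^2) + 1 / d ^ 4 + n"
    proof -
      have "D / 2 + 4 * (c0 * n) \<le> 4 * (c0 * (real n)^2) + D + n" if "0 < D" for D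
        using n21 that of_nat_0_le_iff[of n] by linarith
      from this[OF d4] show ?thesis .
    qed
    then have "(1 / d ^ 4 / 2 + c0 * (4 * n)) / k \<le> K / k"
      using k unfolding Kc by (intro divide_right_mono) (auto simp: mult_ac)
    then show ?thesis by (simp add: add_divide_distrib)
  qed
  ultimately have "(n * k / 2 + c0 * (k * n^2)) * H2 h + (1 / (d ^ 4 * k) / 2 + c0 * (4 * n / k)) * V \<le> K * k * H2 h + K / k * V"
    using H0 V0 by (intro add_mono mult_right_mono)
  moreover have "H2 h \<le> (n * k / 2 + c0 * (k * n^2)) * H2 h + (1 / (d ^ 4 * k) / 2 + c0 * (4 * n / k)) * V"
    using 1 unfolding c0_def[symmetric] by (simp add: algebra_simps add_divide_distrib)
  ultimately have "H2 h \<le> K * k * H2 h + K / k * V" by linarith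
  moreover have "K * k = 1 / 2" "K / k = 2 * K^2" using K0 by (auto simp: k_def power2_eq_square)
  ultimately show ?thesis unfolding V_def by simp
qed

end

section \<open>Leech factorization at finitely many points\<close>

definition cdot :: "nat \<Rightarrow> (nat \<Rightarrow> complex) \<Rightarrow> (nat \<Rightarrow> complex) \<Rightarrow> complex" where
  "cdot m x y = (\<Sum>l<m. x l * cnj (y l))"

lemma cdot_self: "cdot m x x = of_real (\<Sum>l<m. (cmod (x l))^2)"
  by (simp add: cdot_def complex_norm_square[unfolded of_real_power])

lemma cdot_cnj: "cnj (cdot m x y) = cdot m y x"
  by (simp add: cdot_def mult.commute)

lemma cdot_diff_left: "cdot m (\<lambda>l. x l - y l) z = cdot m x z - cdot m y z"
  by (simp add: cdot_def left_diff_distrib sum_subtractf)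
lemma cdot_diff_right: "cdot m z (\<lambda>l. x l - y l) = cdot m z x - cdot m z y"
  by (simp add: cdot_def right_diff_distrib sum_subtractf)
lemma cdot_scale_left: "cdot m (\<lambda>l. c * x l) z = c * cdot m x z"
  by (simp add: cdot_def sum_distrib_left mult.assoc)
lemma cdot_scale_right: "cdot m z (\<lambda>l. c * x l) = cnj c * cdot m z x"
  by (simp add: cdot_def sum_distrib_left mult_ac)
lemma cdot_sum_left: "cdot m (\<lambda>l. \<Sum>i\<in>I. x i l) z = (\<Sum>i\<in>I. cdot m (x i) z)"
  unfolding cdot_def sum_distrib_right by (rule sum.swap)
lemma cdot_sum_right: "cdot m z (\<lambda>l. \<Sum>i\<in>I. x i l) = (\<Sum>i\<in>I. cdot m z (x i))"
  unfolding cdot_def sum_distrib_left cnj_sum by (rule sum.swap)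

lemma sum_mult_delta:
  fixes y c :: "nat \<Rightarrow> complex"
  assumes "r < R" "\<And>q. q < R \<Longrightarrow> c q = (if q = r then 1 else 0)"
  shows "(\<Sum>q<R. y q * c q) = y r"
proof -
  have "(\<Sum>q<R. y q * c q) = (\<Sum>q<R. if q = r then y q else 0)"
    using assms(2) by (intro sum.cong) auto
  also have "\<dots> = y r" using assms(1) by (simp only: sum.delta finite_lessThan lessThan_iff if_True)
  finally show ?thesis .
qed

text \<open>One index is eliminated at a time: the Schur complement \<open>M'\<close> of the entry
  \<open>M x x\<close> is again positive semidefinite, and the Gram vectors gain the coordinate
  \<open>M i x\<close> / sqrt(M x x).\<close>

lemma Cholesky:
  assumes "finite I"
    and herm: "\<And>i k. i \<in> I \<Longrightarrow> k \<in> I \<Longrightarrow> M k i = cnj (M i k)"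
    and psd: "\<And>c. 0 \<le> Re (\<Sum>i\<in>I. \<Sum>k\<in>I. c i * cnj (c k) * M i k)"
  shows "\<exists>m p. \<forall>i\<in>I. \<forall>k\<in>I. M i k = cdot m (p i) (p k)"
  using assms
proof (induction I arbitrary: M rule: finite_induct)
  case empty
  then show ?case by simp
next
  case (insert x I)
  note herm = insert.prems(1) and psd = insert.prems(2)
  have expand: "(\<Sum>i\<in>insert x I. \<Sum>k\<in>insert x I. c i * cnj (c k) * M i k)
     = c x * cnj (c x) * M x x + c x * (\<Sum>k\<in>I. cnj (c k) * M x k) + cnj (c x) * (\<Sum>i\<in>I. c i * M i x)
       + (\<Sum>i\<in>I. \<Sum>k\<in>I. c i * cnj (c k) * M i k)" for c
    using insert.hyps by (simp add: sum.distrib sum_distrib_left algebra_simps)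
  have single: "0 \<le> Re (c x * cnj (c x) * M x x + c x * cnj (c k) * M x k + cnj (c x) * c k * M k x + c k * cnj (c k) * M k k)"
    if k: "k \<in> I" for c k
  proof -
    define c' where "c' i = (if i = x \<or> i = k then c i else 0)" for i
    have xk: "x \<noteq> k" using k insert.hyps by auto
    have 1: "(\<Sum>i\<in>I. h i (c' i)) = h k (c k)" if "\<And>i. h i 0 = 0" for h :: "'a \<Rightarrow> complex \<Rightarrow> complex"
    proof -
      have "(\<Sum>i\<in>I. h i (c' i)) = (\<Sum>i\<in>I. if i = k then h k (c k) else 0)"
        using that insert.hyps by (intro sum.cong) (auto simp: c'_def)
      then show ?thesis using k insert.hyps by simp
    qed
    have "0 \<le> Re (\<Sum>i\<in>insert x I. \<Sum>k\<in>insert x I. c' i * cnj (c' k) * M i k)" by (rule psd)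
    also have "(\<Sum>i\<in>insert x I. \<Sum>k\<in>insert x I. c' i * cnj (c' k) * M i k) = c x * cnj (c x) * M x x + c x * cnj (c k) * M x k + cnj (c x) * c k * M k x + c k * cnj (c k) * M k k"
      unfolding expand using 1[of "\<lambda>k z. cnj z * M x k"] 1[of "\<lambda>i z. z * M i x"]
        1[of "\<lambda>i z. z * (\<Sum>k\<in>I. cnj (c' k) * M i k)"] 1[of "\<lambda>i z. cnj z * M k i"]
      by (simp add: sum_distrib_left mult.assoc c'_def[of x])
    finally show ?thesis .
  qed
  have hx: "M x k = cnj (M k x)" if "k \<in> I" for k by (rule herm) (use that in auto)
  have Mxx_real: "M x x = of_real (Re (M x x))" using herm[of x x] by (simp add: complex_eq_iff)
  have Mxx: "0 \<le> Re (M x x)"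
  proof -
    define c where "c i = (if i = x then 1 else 0 :: complex)" for i
    have "0 \<le> Re (\<Sum>i\<in>insert x I. \<Sum>k\<in>insert x I. c i * cnj (c k) * M i k)" by (rule psd)
    moreover have "(\<Sum>i\<in>I. c i * M i x) = 0" "(\<Sum>k\<in>I. cnj (c k) * M x k) = 0" "(\<Sum>i\<in>I. \<Sum>k\<in>I. c i * cnj (c k) * M i k) = 0"
      using insert.hyps by (auto intro!: sum.neutral simp: c_def)
    ultimately show ?thesis unfolding expand by (simp add: c_def[of x])
  qed
  have Mxk: "M x k = 0" if 0: "M x x = 0" and k: "k \<in> I" for k
  proof (rule ccontr)
    assume nz: "M x k \<noteq> 0"
    \<comment> \<open>With c x = - t cnj(M x k) and c k = 1 the form takes the value Re(M k k) -
      |Re(M k k)| - 1, which is negative.\<close>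
    define t where "t = (\<bar>Re (M k k)\<bar> + 1) / (2 * (cmod (M x k))^2)"
    define c where "c i = (if i = x then - of_real t * cnj (M x k) else 1)" for i
    have xk: "x \<noteq> k" using k insert.hyps by auto
    have Mkx: "M k x = cnj (M x k)" by (rule herm) (use k in auto)
    have "0 \<le> Re (- of_real t * cnj (M x k) * M x k + - of_real t * M x k * M k x + M k k)"
      using single[OF k, of c] xk 0 by (simp add: c_def)
    also have "\<dots> = - 2 * t * (cmod (M x k))^2 + Re (M k k)"
      unfolding Mkx by (simp add: cmod_def power2_eq_square algebra_simps)
    also have "\<dots> = - (\<bar>Re (M k k)\<bar> + 1) + Re (M k k)" using nz by (simp add: t_def)
    finally show False by linarith
  qed
  have Mix: "M i x = 0" if 0: "M x x = 0" and i: "i \<in> I" for i using Mxk[OF 0 i] hx[OF i] by simp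
  \<comment> \<open>If \<open>M x x = 0\<close> then the whole row vanishes, and with \<open>y / 0 = 0\<close> the Schur complement is just \<open>M\<close>.\<close>
  define s where "s = sqrt (Re (M x x))"
  have ss: "of_real s * of_real s = M x x" using Mxx Mxx_real by (simp add: s_def flip: of_real_mult)
  define M' where "M' i k = M i k - M i x * M x k / M x x" for i k
  have "0 \<le> Re (\<Sum>i\<in>I. \<Sum>k\<in>I. c i * cnj (c k) * M' i k)" for c
  proof -
    define S where "S = (\<Sum>i\<in>I. c i * M i x)"
    have cS: "(\<Sum>k\<in>I. cnj (c k) * M x k) = cnj S"
      unfolding S_def cnj_sum by (intro sum.cong refl) (simp add: hx)
    \<comment> \<open>The value at \<open>x\<close> that minimizes the quadratic form when the other
      coefficients are given; the minimum is the form of the Schur complement.\<close>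
    define c' where "c' = c(x := - S / M x x)"
    have S0: "S = 0" if "M x x = 0" unfolding S_def using Mix[OF that] by (intro sum.neutral) simp
    have cM: "cnj (M x x) = M x x" by (rule herm[symmetric]) auto
    have c'I: "(\<Sum>i\<in>I. h i (c' i)) = (\<Sum>i\<in>I. h i (c i))" for h :: "'a \<Rightarrow> complex \<Rightarrow> complex"
      using insert.hyps by (intro sum.cong) (auto simp: c'_def)
    have "0 \<le> Re (\<Sum>i\<in>insert x I. \<Sum>k\<in>insert x I. c' i * cnj (c' k) * M i k)" by (rule psd)
    also have "(\<Sum>i\<in>insert x I. \<Sum>k\<in>insert x I. c' i * cnj (c' k) * M i k)
       = c' x * cnj (c' x) * M x x + c' x * cnj S + cnj (c' x) * S + (\<Sum>i\<in>I. \<Sum>k\<in>I. c i * cnj (c k) * M i k)"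
    proof -
      have "(\<Sum>i\<in>I. \<Sum>k\<in>I. c' i * cnj (c' k) * M i k) = (\<Sum>i\<in>I. \<Sum>k\<in>I. c i * cnj (c k) * M i k)"
        using insert.hyps by (intro sum.cong refl) (auto simp: c'_def)
      then show ?thesis unfolding expand
        using c'I[of "\<lambda>k z. cnj z * M x k", unfolded cS] c'I[of "\<lambda>i z. z * M i x", folded S_def] by simp
    qed
    also have "\<dots> = (\<Sum>i\<in>I. \<Sum>k\<in>I. c i * cnj (c k) * M i k) - S * cnj S / M x x"
      using S0 by (cases "M x x = 0") (simp_all add: c'_def cM field_simps)
    also have "S * cnj S / M x x = (\<Sum>i\<in>I. \<Sum>k\<in>I. c i * cnj (c k) * (M i x * M x k / M x x))"
    proof -
      have "S * cnj S / M x x = (\<Sum>i\<in>I. c i * M i x) * (\<Sum>k\<in>I. cnj (c k) * M x k) / M x x"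
        unfolding cS S_def by simp
      then show ?thesis unfolding sum_product sum_divide_distrib by (simp add: mult_ac)
    qed
    also have "(\<Sum>i\<in>I. \<Sum>k\<in>I. c i * cnj (c k) * M i k) - \<dots> = (\<Sum>i\<in>I. \<Sum>k\<in>I. c i * cnj (c k) * M' i k)"
      unfolding sum_subtractf[symmetric] M'_def by (simp add: right_diff_distrib)
    finally show ?thesis .
  qed
  moreover have "M' k i = cnj (M' i k)" if "i \<in> I" "k \<in> I" for i k
  proof -
    have "M k i = cnj (M i k)" by (rule herm) (use that in auto)
    moreover have "cnj (M x x) = M x x" by (rule herm[symmetric]) auto
    ultimately show ?thesis using that by (simp add: M'_def hx mult.commute)
  qed
  ultimately obtain m p where p: "\<forall>i\<in>I. \<forall>k\<in>I. M' i k = cdot m (p i) (p k)"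
    using insert.IH[of M'] by blast
  define q where "q i l = (if l = m then M i x / of_real s else if i = x then 0 else p i l)" for i l
  have "M i k = cdot (Suc m) (q i) (q k)" if ik: "i \<in> insert x I" "k \<in> insert x I" for i k
  proof -
    have last: "(M i x / of_real s) * cnj (M k x / of_real s) = M i x * M x k / M x x"
    proof -
      have "cnj (M k x) = M x k" by (rule herm[symmetric]) (use ik in auto)
      then show ?thesis by (simp add: ss)
    qed
    have "cdot (Suc m) (q i) (q k) = (\<Sum>l<m. q i l * cnj (q k l)) + M i x * M x k / M x x"
      unfolding cdot_def using last by (simp add: q_def)
    also have "(\<Sum>l<m. q i l * cnj (q k l)) = M i k - M i x * M x k / M x x"
    proof (cases "i = x \<or> k = x")
      case True
      then have "M i x * M x k / M x x = M i k" using Mxk Mix ik by (cases "M x x = 0") auto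
      then show ?thesis using True by (auto simp: q_def)
    next
      case False
      then have "(\<Sum>l<m. q i l * cnj (q k l)) = cdot m (p i) (p k)" by (auto simp: q_def cdot_def)
      then show ?thesis using False ik p by (auto simp: M'_def)
    qed
    finally show ?thesis by simp
  qed
  then show ?case by blast
qed

text \<open>Gram-Schmidt run in parallel on both families. Its coefficients depend on inner products
  only, so equal Gram matrices allow the same \<open>t\<close> for both sides.\<close>

lemma equal_Gram_orthonormal:
  assumes "finite I"
    and gram: "\<And>i k. i \<in> I \<Longrightarrow> k \<in> I \<Longrightarrow> cdot A (a i) (a k) = cdot B (b i) (b k)"
  shows "\<exists>(R::nat) e e' t. (\<forall>r<R. \<forall>s<R. cdot A (e r) (e s) = (if r = s then 1 else 0) \<and> cdot B (e' r) (e' s) = (if r = s then 1 else 0))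
     \<and> (\<forall>r<R. e r = (\<lambda>l. \<Sum>i\<in>I. t r i * a i l) \<and> e' r = (\<lambda>l. \<Sum>i\<in>I. t r i * b i l))
     \<and> (\<forall>i\<in>I. (\<forall>l<A. a i l = (\<Sum>r<R. cdot A (a i) (e r) * e r l)) \<and> (\<forall>l<B. b i l = (\<Sum>r<R. cdot A (a i) (e r) * e' r l)))"
  using assms
proof (induction I rule: finite_induct)
  case empty
  show ?case by (rule exI[of _ 0]) auto
next
  case (insert x I)
  note gram = insert.prems
  obtain R :: nat and e e' t where
    on: "\<And>r s. r < R \<Longrightarrow> s < R \<Longrightarrow> cdot A (e r) (e s) = (if r = s then 1 else 0)"
        "\<And>r s. r < R \<Longrightarrow> s < R \<Longrightarrow> cdot B (e' r) (e' s) = (if r = s then 1 else 0)"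
    and e: "\<And>r. r < R \<Longrightarrow> e r = (\<lambda>l. \<Sum>i\<in>I. t r i * a i l)" "\<And>r. r < R \<Longrightarrow> e' r = (\<lambda>l. \<Sum>i\<in>I. t r i * b i l)"
    and ab: "\<And>i l. i \<in> I \<Longrightarrow> l < A \<Longrightarrow> a i l = (\<Sum>r<R. cdot A (a i) (e r) * e r l)"
       "\<And>i l. i \<in> I \<Longrightarrow> l < B \<Longrightarrow> b i l = (\<Sum>r<R. cdot A (a i) (e r) * e' r l)"
    using insert.IH[OF gram] by blast
  have ip: "cdot B (b i) (e' r) = cdot A (a i) (e r)" if "i \<in> insert x I" "r < R" for i r
    unfolding e[OF that(2)] cdot_sum_right cdot_scale_right using gram that by (intro sum.cong) auto
  define \<alpha> where "\<alpha> r = cdot A (a x) (e r)" for r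
  define s where "s l = a x l - (\<Sum>r<R. \<alpha> r * e r l)" for l
  define s' where "s' l = b x l - (\<Sum>r<R. \<alpha> r * e' r l)" for l
  have collapse: "(\<Sum>q<R. y q * cdot A (e q) (e r)) = y r" "(\<Sum>q<R. y q * cdot B (e' q) (e' r)) = y r" if "r < R" for y r
    using on that by (auto intro!: sum_mult_delta)
  have se: "cdot A s (e r) = 0" if "r < R" for r
    unfolding s_def[abs_def] cdot_diff_left cdot_sum_left cdot_scale_left using collapse(1)[OF that] by (simp add: \<alpha>_def)
  have se': "cdot B s' (e' r) = 0" if "r < R" for r
    unfolding s'_def[abs_def] cdot_diff_left cdot_sum_left cdot_scale_left using collapse(2)[OF that] ip[of x r] that by (simp add: \<alpha>_def)
  have sa: "cdot A s s = cdot A (a x) s"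
    by (subst (1) s_def[abs_def], unfold cdot_diff_left cdot_sum_left cdot_scale_left)
       (use se cdot_cnj[of A s] in \<open>auto intro!: sum.neutral\<close>, metis complex_cnj_zero)
  have sb: "cdot B s' s' = cdot B (b x) s'"
    by (subst (1) s'_def[abs_def], unfold cdot_diff_left cdot_sum_left cdot_scale_left)
       (use se' cdot_cnj[of B s'] in \<open>auto intro!: sum.neutral\<close>, metis complex_cnj_zero)
  \<comment> \<open>The residuals have equal norm. Hence both families either gain no new direction
    or gain one with the same normalization.\<close>
  have ns: "cdot A s s = cdot B s' s'"
  proof -
    have "cdot A (a x) s = cdot A (a x) (a x) - (\<Sum>r<R. cnj (\<alpha> r) * \<alpha> r)"
      unfolding s_def[abs_def] cdot_diff_right cdot_sum_right cdot_scale_right by (simp add: \<alpha>_def)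
    also have "\<dots> = cdot B (b x) (b x) - (\<Sum>r<R. cnj (\<alpha> r) * cdot B (b x) (e' r))"
      using gram ip[of x] by (simp add: \<alpha>_def)
    also have "\<dots> = cdot B (b x) s'"
      unfolding s'_def[abs_def] cdot_diff_right cdot_sum_right cdot_scale_right by simp
    finally show ?thesis using sa sb by simp
  qed
  show ?case
  proof (cases "cdot A s s = 0")
    case True
    have z: "\<forall>l<m. y l = 0" if "cdot m y y = 0" for m y
    proof -
      have "(\<Sum>l<m. (cmod (y l))^2) = 0" using that unfolding cdot_self by (simp only: of_real_eq_0_iff)
      then show ?thesis by (simp add: sum_nonneg_eq_0_iff)
    qed
    have "\<forall>l<A. s l = 0" "\<forall>l<B. s' l = 0" using z True ns by auto
    then have ax: "\<And>l. l < A \<Longrightarrow> a x l = (\<Sum>r<R. \<alpha> r * e r l)" "\<And>l. l < B \<Longrightarrow> b x l = (\<Sum>r<R. \<alpha> r * e' r l)"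
      by (auto simp: s_def s'_def)
    define t' where "t' r i = (if i = x then 0 else t r i)" for r i
    have t': "(\<Sum>i\<in>insert x I. t' r i * y i) = (\<Sum>i\<in>I. t r i * y i)" for r y
      using insert.hyps by (simp add: t'_def) (auto intro!: sum.cong)
    show ?thesis
      by (rule exI[of _ R], rule exI[of _ e], rule exI[of _ e'], rule exI[of _ t'])
         (use on e ab ax in \<open>auto simp: t' \<alpha>_def\<close>)
  next
    case False
    define \<nu> where "\<nu> = sqrt (\<Sum>l<A. (cmod (s l))^2)"
    have nn: "0 \<le> (\<Sum>l<A. (cmod (s l))^2)" by (simp add: sum_nonneg)
    have \<nu>2: "of_real \<nu> * of_real \<nu> = cdot A s s" using nn unfolding cdot_self \<nu>_def by (simp flip: of_real_mult)
    have \<nu>0: "of_real \<nu> \<noteq> (0::complex)" using False \<nu>2 by auto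
    define \<iota> where "\<iota> = 1 / complex_of_real \<nu>"
    have \<iota>: "\<iota> * (cnj \<iota> * cdot B s' s') = 1" "cnj \<iota> * (of_real \<nu> * of_real \<nu>) * \<iota> = 1"
      unfolding ns[symmetric] \<nu>2[symmetric] using \<nu>0 by (auto simp: \<iota>_def)
    define E where "E r = (if r = R then (\<lambda>l. \<iota> * s l) else e r)" for r
    define E' where "E' r = (if r = R then (\<lambda>l. \<iota> * s' l) else e' r)" for r
    define T where "T r i = (if r = R then (if i = x then 1 / of_real \<nu> else - (\<Sum>r<R. \<alpha> r * t r i) / of_real \<nu>) else if i = x then 0 else t r i)" for r i
    have es: "cdot A (e r) s = 0" "cdot B (e' r) s' = 0" if "r < R" for r
      using se[OF that] se'[OF that] cdot_cnj by (metis complex_cnj_zero)+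
    have 1: "cdot A (E r) (E q) = (if r = q then 1 else 0) \<and> cdot B (E' r) (E' q) = (if r = q then 1 else 0)"
      if "r < Suc R" "q < Suc R" for r q
      using that \<iota>(1) ns on se se' es by (auto simp: E_def E'_def less_Suc_eq cdot_scale_left cdot_scale_right)
    have comb: "(1 / of_real \<nu>) * (y x - (\<Sum>r<R. \<alpha> r * (\<Sum>i\<in>I. t r i * y i))) = (\<Sum>i\<in>insert x I. T R i * y i)" for y
    proof -
      have "(\<Sum>r<R. \<alpha> r * (\<Sum>i\<in>I. t r i * y i)) = (\<Sum>i\<in>I. (\<Sum>r<R. \<alpha> r * t r i) * y i)"
        unfolding sum_distrib_left sum_distrib_right by (subst sum.swap) (simp add: mult_ac)
      moreover have "(\<Sum>i\<in>insert x I. T R i * y i) = (1 / of_real \<nu>) * y x + (\<Sum>i\<in>I. - (\<Sum>r<R. \<alpha> r * t r i) / of_real \<nu> * y i)"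
        using insert.hyps by (simp add: T_def) (auto intro!: sum.cong)
      ultimately show ?thesis by (simp add: sum_distrib_left sum_negf right_diff_distrib)
    qed
    have comb': "(y x - (\<Sum>r<R. \<alpha> r * (\<Sum>i\<in>I. t r i * y i))) / of_real \<nu> = (\<Sum>i\<in>insert x I. T R i * y i)" for y
      using comb[of y] by simp
    have 2: "E r = (\<lambda>l. \<Sum>i\<in>insert x I. T r i * a i l) \<and> E' r = (\<lambda>l. \<Sum>i\<in>insert x I. T r i * b i l)" if "r < Suc R" for r
    proof (cases "r = R")
      case True
      then show ?thesis by (simp add: E_def E'_def s_def s'_def e \<iota>_def comb'[of "\<lambda>i. a i l" for l] comb'[of "\<lambda>i. b i l" for l] del: sum.insert)
    next
      case False
      then have "(\<Sum>i\<in>insert x I. T r i * y i) = (\<Sum>i\<in>I. t r i * y i)" for y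
        using insert.hyps by (simp add: T_def) (auto intro!: sum.cong)
      then show ?thesis using False that e by (auto simp: E_def E'_def)
    qed
    have xs: "cdot A (a x) s = of_real \<nu> * of_real \<nu>" using sa \<nu>2 by simp
    have Is: "cdot A (a i) s = 0" if "i \<in> I" for i
    proof -
      have "cdot A (a i) s = cdot A (\<lambda>l. \<Sum>r<R. cdot A (a i) (e r) * e r l) s"
        unfolding cdot_def[of A _ s] using ab(1)[OF that] by (intro sum.cong) auto
      also have "\<dots> = 0" unfolding cdot_sum_left cdot_scale_left using es by simp
      finally show ?thesis .
    qed
    have 3: "(\<forall>l<A. a i l = (\<Sum>r<Suc R. cdot A (a i) (E r) * E r l)) \<and> (\<forall>l<B. b i l = (\<Sum>r<Suc R. cdot A (a i) (E r) * E' r l))"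
      if "i \<in> insert x I" for i
    proof (cases "i = x")
      case True
      have "cdot A (a x) (E R) * \<iota> = 1" using \<iota>(2) by (simp add: E_def cdot_scale_right xs)
      then have "cdot A (a x) (E R) * (\<iota> * y) = y" for y by (simp flip: mult.assoc)
      then have "cdot A (a x) (E R) * E R l = s l" "cdot A (a x) (E R) * E' R l = s' l" for l by (auto simp: E_def E'_def)
      moreover have "(\<Sum>r<R. cdot A (a x) (E r) * E r l) = (\<Sum>r<R. \<alpha> r * e r l)"
        "(\<Sum>r<R. cdot A (a x) (E r) * E' r l) = (\<Sum>r<R. \<alpha> r * e' r l)" for l
        by (auto intro!: sum.cong simp: E_def E'_def \<alpha>_def)
      ultimately show ?thesis unfolding True sum.lessThan_Suc by (simp add: s_def s'_def)
    next
      case False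
      then have i: "i \<in> I" using that by simp
      have "cdot A (a i) (E R) = 0" using Is[OF i] by (simp add: E_def cdot_scale_right)
      then show ?thesis using ab[OF i] by (auto simp: E_def E'_def)
    qed
    show ?thesis
      by (rule exI[of _ "Suc R"], rule exI[of _ E], rule exI[of _ E'], rule exI[of _ T]) (use 1 2 3 in blast)
  qed
qed

text \<open>\<open>V\<close> is the partial isometry that sends \<open>e r\<close> to
  \<open>e' r\<close> and kills the orthogonal complement of the \<open>e r\<close>; the norm bound
  is Bessel's inequality.\<close>

lemma equal_Gram_contraction:
  assumes "finite I"
    and "\<And>i k. i \<in> I \<Longrightarrow> k \<in> I \<Longrightarrow> cdot A (a i) (a k) = cdot B (b i) (b k)"
  obtains V where "\<And>i l. i \<in> I \<Longrightarrow> l < B \<Longrightarrow> b i l = (\<Sum>k<A. V l k * a i k)"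
    and "\<And>x. (\<Sum>l<B. (cmod (\<Sum>k<A. V l k * x k))^2) \<le> (\<Sum>k<A. (cmod (x k))^2)"
proof -
  obtain R :: nat and e e' t where
    on: "\<And>r s. r < R \<Longrightarrow> s < R \<Longrightarrow> cdot A (e r) (e s) = (if r = s then 1 else 0)"
        "\<And>r s. r < R \<Longrightarrow> s < R \<Longrightarrow> cdot B (e' r) (e' s) = (if r = s then 1 else 0)"
    and e: "\<And>r. r < R \<Longrightarrow> e r = (\<lambda>l. \<Sum>i\<in>I. t r i * a i l)" "\<And>r. r < R \<Longrightarrow> e' r = (\<lambda>l. \<Sum>i\<in>I. t r i * b i l)"
    and ab: "\<And>i l. i \<in> I \<Longrightarrow> l < A \<Longrightarrow> a i l = (\<Sum>r<R. cdot A (a i) (e r) * e r l)"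
       "\<And>i l. i \<in> I \<Longrightarrow> l < B \<Longrightarrow> b i l = (\<Sum>r<R. cdot A (a i) (e r) * e' r l)"
    using equal_Gram_orthonormal[of I A a B b, OF assms(1)] assms(2) by blast
  define V where "V l k = (\<Sum>r<R. e' r l * cnj (e r k))" for l k
  have V: "(\<Sum>k<A. V l k * x k) = (\<Sum>r<R. cdot A x (e r) * e' r l)" for l x
    unfolding V_def cdot_def sum_distrib_right by (subst sum.swap) (simp add: mult_ac)
  have "(\<Sum>l<B. (cmod (\<Sum>k<A. V l k * x k))^2) \<le> (\<Sum>k<A. (cmod (x k))^2)" for x
  proof -
    define \<beta> where "\<beta> r = cdot A x (e r)" for r
    define y where "y l = x l - (\<Sum>r<R. \<beta> r * e r l)" for l
    define P where "P = (\<Sum>r<R. \<beta> r * cnj (\<beta> r))"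
    have "cdot B (\<lambda>l. \<Sum>r<R. \<beta> r * e' r l) (\<lambda>l. \<Sum>r<R. \<beta> r * e' r l) = P"
      unfolding cdot_sum_left cdot_scale_left cdot_sum_right cdot_scale_right P_def
      by (intro sum.cong refl arg_cong2[of _ _ _ _ "(*)"] sum_mult_delta) (auto simp: on)
    moreover have "cdot A y y = cdot A x x - P"
    proof -
      have 1: "cdot A (\<lambda>l. \<Sum>r<R. \<beta> r * e r l) (\<lambda>l. \<Sum>r<R. \<beta> r * e r l) = P"
        unfolding cdot_sum_left cdot_scale_left cdot_sum_right cdot_scale_right P_def
        by (intro sum.cong refl arg_cong2[of _ _ _ _ "(*)"] sum_mult_delta) (auto simp: on)
      have 2: "cdot A x (\<lambda>l. \<Sum>r<R. \<beta> r * e r l) = P"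
        unfolding cdot_sum_right cdot_scale_right P_def by (simp add: \<beta>_def mult.commute)
      have cP: "cnj P = P" by (simp add: P_def mult.commute)
      have 3: "cdot A (\<lambda>l. \<Sum>r<R. \<beta> r * e r l) x = P"
        using 2 cdot_cnj[of A x] cP by metis
      show ?thesis unfolding y_def[abs_def] cdot_diff_left cdot_diff_right 1 2 3 by simp
    qed
    ultimately have "cdot B (\<lambda>l. \<Sum>r<R. \<beta> r * e' r l) (\<lambda>l. \<Sum>r<R. \<beta> r * e' r l) = cdot A x x - cdot A y y" by simp
    then have "(\<Sum>l<B. (cmod (\<Sum>r<R. \<beta> r * e' r l))^2) = (\<Sum>l<A. (cmod (x l))^2) - (\<Sum>l<A. (cmod (y l))^2)"
      unfolding cdot_self by (simp only: of_real_eq_iff flip: of_real_diff)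
    moreover have "0 \<le> (\<Sum>l<A. (cmod (y l))^2)" by (simp add: sum_nonneg)
    ultimately show ?thesis unfolding V \<beta>_def by linarith
  qed
  moreover have "b i l = (\<Sum>k<A. V l k * a i k)" if "i \<in> I" "l < B" for i l
    unfolding V using ab(2)[OF that] .
  ultimately show ?thesis using that by blast
qed

lemma power_series_bounded_coeffs:
  fixes s :: "nat \<Rightarrow> complex"
  assumes "\<And>k. cmod (s k) \<le> 1"
  shows "(\<lambda>z. \<Sum>k. s k * z ^ k) holomorphic_on disc"
    and "z \<in> disc \<Longrightarrow> summable (\<lambda>k. s k * z ^ k)"
proof -
  have sm: "summable (\<lambda>k. s k * z ^ k)" if "z \<in> disc" for z
  proof (rule summable_comparison_test')
    show "summable (\<lambda>k. cmod z ^ k)" using that by (intro summable_geometric) auto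
    show "norm (s k * z ^ k) \<le> cmod z ^ k" if "0 \<le> k" for k
      using assms[of k] by (simp add: norm_mult norm_power mult_left_le_one_le)
  qed
  then show "z \<in> disc \<Longrightarrow> summable (\<lambda>k. s k * z ^ k)" .
  show "(\<lambda>z. \<Sum>k. s k * z ^ k) holomorphic_on disc"
    by (rule power_series_holomorphic[of 0 1 s]) (use sm summable_sums in auto)
qed

text \<open>A coisometric-type realization: the Gram matrices of the vectors \<open>(F i, z i * p i)\<close> and
  \<open>(1, p i)\<close> agree, so a contraction \<open>V\<close> maps the former to the latter, and its transfer function
  is the solution.\<close>

lemma Leech_finite:
  fixes z :: "nat \<Rightarrow> complex" and F :: "nat \<Rightarrow> nat \<Rightarrow> complex" and \<kappa> :: real
  assumes z: "\<And>i. i < N \<Longrightarrow> z i \<in> disc" and \<kappa>: "0 \<le> \<kappa>"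
    and psd: "\<And>c. 0 \<le> Re (\<Sum>i<N. \<Sum>k<N. c i * cnj (c k) * ((of_real \<kappa> * (\<Sum>j<n. F i j * cnj (F k j)) - 1) / (1 - z i * cnj (z k))))"
  obtains g where "\<And>j. j < n \<Longrightarrow> g j holomorphic_on disc"
    "\<And>j x. j < n \<Longrightarrow> x \<in> disc \<Longrightarrow> cmod (g j x) \<le> sqrt \<kappa>"
    "\<And>i. i < N \<Longrightarrow> (\<Sum>j<n. F i j * g j (z i)) = 1"
proof -
  define M where "M i k = (of_real \<kappa> * (\<Sum>j<n. F i j * cnj (F k j)) - 1) / (1 - z i * cnj (z k))" for i k
  have "\<exists>m p. \<forall>i\<in>{..<N}. \<forall>k\<in>{..<N}. M i k = cdot m (p i) (p k)"
    by (rule Cholesky) (use psd in \<open>auto simp: M_def mult.commute\<close>)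
  then obtain m :: nat and p where p: "\<And>i k. i < N \<Longrightarrow> k < N \<Longrightarrow> M i k = cdot m (p i) (p k)" by auto
  define a where "a i l = (if l < n then of_real (sqrt \<kappa>) * F i l else z i * p i (l - n))" for i l
  define b where "b i l = (if l = 0 then 1 else p i (l - 1))" for i l
  have split: "(\<Sum>l<n+m. h l) = (\<Sum>l<n. h l) + (\<Sum>r<m. h (n + r))" for h :: "nat \<Rightarrow> 'x::comm_monoid_add"
    by (induction m) (auto simp: add.assoc)
  have split1: "(\<Sum>l<Suc m. h l) = h 0 + (\<Sum>r<m. h (Suc r))" for h :: "nat \<Rightarrow> 'x::comm_monoid_add"
    by (rule sum.lessThan_Suc_shift)
  have gram: "cdot (n + m) (a i) (a k) = cdot (Suc m) (b i) (b k)" if "i \<in> {..<N}" "k \<in> {..<N}" for i k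
  proof -
    have nz: "1 - z i * cnj (z k) \<noteq> 0"
    proof
      assume "1 - z i * cnj (z k) = 0"
      then have "cmod (z i) * cmod (z k) = 1" by (metis complex_mod_cnj norm_mult norm_one right_minus_eq)
      moreover have "cmod (z i) * cmod (z k) < 1 * 1" using z that by (intro mult_strict_mono') auto
      ultimately show False by simp
    qed
    have sq: "complex_of_real (sqrt \<kappa>) * complex_of_real (sqrt \<kappa>) = of_real \<kappa>" using \<kappa> by (simp flip: of_real_mult)
    \<comment> \<open>Equality of the Gram matrices is the defining relation of \<open>M\<close>
      with its denominator cleared: \<kappa> F_i F_k^* + z_i cnj(z_k) M = 1 + M.\<close>
    have "cdot (n + m) (a i) (a k) = of_real \<kappa> * (\<Sum>j<n. F i j * cnj (F k j)) + z i * cnj (z k) * M i k"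
      using that unfolding cdot_def split by (simp add: a_def p cdot_def sum_distrib_left mult_ac flip: sq)
    also have "\<dots> = 1 + M i k"
      using nz unfolding M_def by (simp add: field_simps)
    also have "\<dots> = cdot (Suc m) (b i) (b k)"
      using that unfolding cdot_def split1 by (simp add: b_def p cdot_def)
    finally show ?thesis .
  qed
  obtain V where Vab: "\<And>i l. i \<in> {..<N} \<Longrightarrow> l < Suc m \<Longrightarrow> b i l = (\<Sum>k<n+m. V l k * a i k)"
    and Vc: "\<And>x. (\<Sum>l<Suc m. (cmod (\<Sum>k<n+m. V l k * x k))^2) \<le> (\<Sum>k<n+m. (cmod (x k))^2)"
    using equal_Gram_contraction[of "{..<N}" "n + m" a "Suc m" b] gram by blast
  define D where "D x r = (\<Sum>q<m. V (Suc r) (n + q) * x q)" for x :: "nat \<Rightarrow> complex" and r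
  define D0 where "D0 x = (\<Sum>q<m. V 0 (n + q) * x q)" for x :: "nat \<Rightarrow> complex"
  define Vin where "Vin u x k = (if k < n then u k else x (k - n))" for u x :: "nat \<Rightarrow> complex" and k
  have Vsum: "(\<Sum>k<n+m. V 0 k * Vin u x k) = (\<Sum>j<n. V 0 j * u j) + D0 x"
     "(\<Sum>k<n+m. V (Suc r) k * Vin u x k) = (\<Sum>j<n. V (Suc r) j * u j) + D x r" for u x r
    unfolding split D0_def D_def by (simp_all add: Vin_def)
  have contr: "(cmod ((\<Sum>j<n. V 0 j * u j) + D0 x))^2 + (\<Sum>r<m. (cmod ((\<Sum>j<n. V (Suc r) j * u j) + D x r))^2)
      \<le> (\<Sum>j<n. (cmod (u j))^2) + (\<Sum>r<m. (cmod (x r))^2)" for u x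
    using Vc[of "Vin u x"] unfolding split1 Vsum split by (simp add: Vin_def D_def D0_def)
  have contrD: "(\<Sum>r<m. (cmod (D x r))^2) \<le> (\<Sum>r<m. (cmod (x r))^2)" for x
  proof -
    have "(cmod (D0 x))^2 + (\<Sum>r<m. (cmod (D x r))^2) \<le> (\<Sum>r<m. (cmod (x r))^2)"
      using contr[of "\<lambda>_. 0" x] by simp
    then show ?thesis using zero_le_power2[of "cmod (D0 x)"] by linarith
  qed
  have sel: "(\<Sum>i<n. V l i * (if i = j then 1 else 0)) = V l j" "(\<Sum>i<n. (cmod (if i = j then 1 else 0))^2) = 1"
    if "j < n" for j l
  proof -
    have "(\<Sum>i<n. (cmod (if i = j then 1 else 0))^2) = (\<Sum>i<n. if i = j then 1 else 0)" by (intro sum.cong) auto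
    then show "(\<Sum>i<n. (cmod (if i = j then 1 else 0))^2) = 1" using that by simp
  qed (use that in \<open>simp add: if_distrib cong: if_cong\<close>)
  \<comment> \<open>The Taylor coefficients of (1 - x D)^(-1) applied to the \<open>j\<close>-th
    input column of \<open>V\<close>; since \<open>D\<close> is a contraction they are bounded by 1,
    so the series converges on the disc.\<close>
  define s where "s j k = (D ^^ k) (\<lambda>r. V (Suc r) j)" for j k
  have s_bound: "(\<Sum>r<m. (cmod (s j k r))^2) \<le> 1" if "j < n" for j k
  proof (induction k)
    case 0
    have "D0 (\<lambda>_. 0) = 0" "D (\<lambda>_. 0) r = 0" for r by (simp_all add: D0_def D_def)
    then have "(cmod (V 0 j))^2 + (\<Sum>r<m. (cmod (V (Suc r) j))^2) \<le> 1"
      using contr[of "\<lambda>i. if i = j then 1 else 0" "\<lambda>_. 0"] sel[OF that] by simp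
    then have "(\<Sum>r<m. (cmod (V (Suc r) j))^2) \<le> 1" using zero_le_power2[of "cmod (V 0 j)"] by linarith
    then show ?case by (simp add: s_def)
  next
    case (Suc k)
    then show ?case using contrD[of "s j k"] by (simp add: s_def)
  qed
  have s1: "cmod (s j k r) \<le> 1" if "j < n" "r < m" for j k r
  proof -
    have "(cmod (s j k r))^2 \<le> (\<Sum>r<m. (cmod (s j k r))^2)" using that by (intro member_le_sum) auto
    then have "(cmod (s j k r))^2 \<le> 1" using s_bound[OF that(1), of k] by simp
    then show ?thesis by (simp add: abs_square_le_1)
  qed
  define P where "P j x r = (\<Sum>k. s j k r * x ^ k)" for j x r
  have Phol: "(\<lambda>x. P j x r) holomorphic_on disc" and Psum: "x \<in> disc \<Longrightarrow> summable (\<lambda>k. s j k r * x ^ k)"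
    if "j < n" "r < m" for j r x
    unfolding P_def using power_series_bounded_coeffs[of "\<lambda>k. s j k r"] s1[OF that] by auto
  \<comment> \<open>The resolvent equation P = V_j + x D P. Together with the contractivity of
    \<open>V\<close> it bounds the transfer function, because |x P| \<le> |P|.\<close>
  have Peq: "P j x r = V (Suc r) j + D (\<lambda>q. x * P j x q) r" if "j < n" "r < m" "x \<in> disc" for j x r
  proof -
    have "P j x r = s j 0 r + (\<Sum>k. s j (Suc k) r * x ^ Suc k)"
      unfolding P_def using suminf_split_head[OF Psum[OF that]] by simp
    also have "(\<lambda>k. s j (Suc k) r * x ^ Suc k) = (\<lambda>k. \<Sum>q<m. V (Suc r) (n + q) * x * (s j k q * x ^ k))"
      by (auto simp: s_def D_def fun_eq_iff sum_distrib_left sum_distrib_right mult_ac)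
    also have "(\<Sum>k. \<Sum>q<m. V (Suc r) (n + q) * x * (s j k q * x ^ k)) = (\<Sum>q<m. \<Sum>k. V (Suc r) (n + q) * x * (s j k q * x ^ k))"
      using Psum that by (intro suminf_sum summable_mult) auto
    also have "\<dots> = (\<Sum>q<m. V (Suc r) (n + q) * x * P j x q)"
      unfolding P_def using Psum that by (intro sum.cong suminf_mult) auto
    finally show ?thesis by (simp add: s_def D_def mult_ac)
  qed
  define g where "g j x = of_real (sqrt \<kappa>) * (V 0 j + (\<Sum>q<m. V 0 (n + q) * (x * P j x q)))" for j x
  show ?thesis
  proof (rule that)
    show "g j holomorphic_on disc" if "j < n" for j
      unfolding g_def[abs_def] by (intro holomorphic_intros Phol that) auto
    show "cmod (g j x) \<le> sqrt \<kappa>" if "j < n" "x \<in> disc" for j x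
    proof -
      define w where "w = V 0 j + D0 (\<lambda>q. x * P j x q)"
      have "(cmod w)^2 + (\<Sum>r<m. (cmod (V (Suc r) j + D (\<lambda>q. x * P j x q) r))^2) \<le> 1 + (\<Sum>r<m. (cmod (x * P j x r))^2)"
        using contr[of "\<lambda>i. if i = j then 1 else 0" "\<lambda>q. x * P j x q"] sel[OF that(1)] by (simp add: w_def)
      moreover have "(\<Sum>r<m. (cmod (V (Suc r) j + D (\<lambda>q. x * P j x q) r))^2) = (\<Sum>r<m. (cmod (P j x r))^2)"
        using Peq[OF that(1) _ that(2)] by (intro sum.cong) auto
      moreover have "(\<Sum>r<m. (cmod (x * P j x r))^2) \<le> (\<Sum>r<m. (cmod (P j x r))^2)"
        using that(2) by (intro sum_mono power_mono) (auto simp: norm_mult mult_left_le_one_le)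
      ultimately have "(cmod w)^2 \<le> 1" by linarith
      then have "cmod w \<le> 1" by (simp add: abs_square_le_1)
      moreover have "g j x = of_real (sqrt \<kappa>) * w" by (simp add: g_def w_def D0_def)
      ultimately show ?thesis using \<kappa> by (simp add: norm_mult mult_left_le)
    qed
    show "(\<Sum>j<n. F i j * g j (z i)) = 1" if i: "i < N" for i
    proof -
      define Q where "Q r = (\<Sum>j<n. of_real (sqrt \<kappa>) * F i j * P j (z i) r)" for r
      have zi: "z i \<in> disc" by (rule z[OF i])
      have aeq: "a i = Vin (\<lambda>j. of_real (sqrt \<kappa>) * F i j) (\<lambda>r. z i * p i r)"
        by (auto simp: a_def Vin_def fun_eq_iff)
      have b0: "1 = (\<Sum>j<n. V 0 j * (of_real (sqrt \<kappa>) * F i j)) + D0 (\<lambda>r. z i * p i r)"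
        using Vab[of i 0] i unfolding aeq Vsum by (simp add: b_def)
      have bS: "p i r = (\<Sum>j<n. V (Suc r) j * (of_real (sqrt \<kappa>) * F i j)) + D (\<lambda>r. z i * p i r) r" if "r < m" for r
        using Vab[of i "Suc r"] i that unfolding aeq Vsum by (simp add: b_def)
      have Dlin: "(\<Sum>j<n. y j * D (\<lambda>q. x * X j q) r) = D (\<lambda>q. x * (\<Sum>j<n. y j * X j q)) r" for y x X r
        unfolding D_def sum_distrib_left by (subst sum.swap) (simp add: mult_ac)
      have D0lin: "(\<Sum>j<n. y j * D0 (\<lambda>q. x * X j q)) = D0 (\<lambda>q. x * (\<Sum>j<n. y j * X j q))" for y x X
        unfolding D0_def sum_distrib_left by (subst sum.swap) (simp add: mult_ac)
      have QS: "Q r = (\<Sum>j<n. V (Suc r) j * (of_real (sqrt \<kappa>) * F i j)) + D (\<lambda>r. z i * Q r) r" if "r < m" for r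
      proof -
        have "Q r = (\<Sum>j<n. of_real (sqrt \<kappa>) * F i j * (V (Suc r) j + D (\<lambda>q. z i * P j (z i) q) r))"
          unfolding Q_def using Peq[OF _ that zi] by (intro sum.cong) auto
        also have "\<dots> = (\<Sum>j<n. V (Suc r) j * (of_real (sqrt \<kappa>) * F i j)) + (\<Sum>j<n. (of_real (sqrt \<kappa>) * F i j) * D (\<lambda>q. z i * P j (z i) q) r)"
          by (simp add: distrib_left sum.distrib mult_ac)
        finally show ?thesis unfolding Dlin Q_def .
      qed
      \<comment> \<open>\<open>Q\<close> and \<open>p i\<close> solve the same equation X = input +
        D (z_i X). Their difference is fixed by z_i D, a strict contraction, so they
        coincide.\<close>
      define d where "d r = Q r - p i r" for r
      have dD: "d r = D (\<lambda>q. z i * d q) r" if "r < m" for r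
        unfolding d_def QS[OF that] bS[OF that] by (simp add: D_def sum_subtractf right_diff_distrib)
      have "(\<Sum>r<m. (cmod (d r))^2) = (\<Sum>r<m. (cmod (D (\<lambda>q. z i * d q) r))^2)"
        using dD by (intro sum.cong) auto
      also have "\<dots> \<le> (\<Sum>r<m. (cmod (z i * d r))^2)" by (rule contrD)
      also have "\<dots> = (cmod (z i))^2 * (\<Sum>r<m. (cmod (d r))^2)" by (simp add: norm_mult power_mult_distrib sum_distrib_left)
      finally have "(1 - (cmod (z i))^2) * (\<Sum>r<m. (cmod (d r))^2) \<le> 0" by (simp add: algebra_simps)
      moreover have "0 < 1 - (cmod (z i))^2" using zi by (simp add: abs_square_less_1)
      ultimately have "(\<Sum>r<m. (cmod (d r))^2) \<le> 0" by (simp add: mult_le_0_iff)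
      then have "(\<Sum>r<m. (cmod (d r))^2) = 0" by (simp add: antisym sum_nonneg)
      then have Qp: "Q r = p i r" if "r < m" for r using that by (simp add: sum_nonneg_eq_0_iff d_def)
      have "(\<Sum>j<n. F i j * g j (z i)) = (\<Sum>j<n. (of_real (sqrt \<kappa>) * F i j) * (V 0 j + D0 (\<lambda>q. z i * P j (z i) q)))"
        by (simp add: g_def D0_def mult_ac)
      also have "\<dots> = (\<Sum>j<n. V 0 j * (of_real (sqrt \<kappa>) * F i j)) + (\<Sum>j<n. (of_real (sqrt \<kappa>) * F i j) * D0 (\<lambda>q. z i * P j (z i) q))"
        by (simp add: distrib_left sum.distrib mult_ac)
      also have "\<dots> = (\<Sum>j<n. V 0 j * (of_real (sqrt \<kappa>) * F i j)) + D0 (\<lambda>q. z i * Q q)"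
        unfolding D0lin Q_def ..
      also have "D0 (\<lambda>q. z i * Q q) = D0 (\<lambda>r. z i * p i r)" unfolding D0_def using Qp by (intro sum.cong) auto
      finally show ?thesis using b0 by simp
    qed
  qed
qed

section \<open>The corona theorem\<close>

lemma Montel_family:
  fixes F :: "nat \<Rightarrow> nat \<Rightarrow> complex \<Rightarrow> complex"
  assumes "\<And>N j. j < n \<Longrightarrow> F N j holomorphic_on disc"
    and "\<And>N j z. j < n \<Longrightarrow> z \<in> disc \<Longrightarrow> cmod (F N j z) \<le> C"
  shows "\<exists>g (r::nat \<Rightarrow> nat). strict_mono r \<and> (\<forall>j<n. g j holomorphic_on disc) \<and>
     (\<forall>j<n. \<forall>z\<in>disc. (\<lambda>N. F (r N) j z) \<longlonglongrightarrow> g j z) \<and> (\<forall>j<n. \<forall>z\<in>disc. cmod (g j z) \<le> C)"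
  using assms
proof (induction n)
  case 0
  show ?case by (rule exI, rule exI[of _ id]) (auto simp: strict_mono_def)
next
  case (Suc n)
  obtain g r where r: "strict_mono (r :: nat \<Rightarrow> nat)" and g: "\<And>j. j < n \<Longrightarrow> g j holomorphic_on disc"
    "\<And>j z. j < n \<Longrightarrow> z \<in> disc \<Longrightarrow> (\<lambda>N. F (r N) j z) \<longlonglongrightarrow> g j z"
    "\<And>j z. j < n \<Longrightarrow> z \<in> disc \<Longrightarrow> cmod (g j z) \<le> C"
    using Suc.IH[OF Suc.prems(1)[OF less_SucI] Suc.prems(2)[OF less_SucI]] by blast
  obtain h s where h: "h holomorphic_on disc" "strict_mono (s :: nat \<Rightarrow> nat)"
    "\<And>x. x \<in> disc \<Longrightarrow> (\<lambda>N. F (r (s N)) n x) \<longlonglongrightarrow> h x"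
  proof (rule Montel[of disc "range (\<lambda>N. F (r N) n)" "\<lambda>N. F (r N) n"])
    fix K :: "complex set" assume "K \<subseteq> disc"
    then show "\<exists>B. \<forall>h\<in>range (\<lambda>N. F (r N) n). \<forall>z\<in>K. norm (h z) \<le> B"
      using Suc.prems(2)[of n] by (intro exI[of _ C]) auto
  qed (use Suc.prems(1)[of n] in auto)
  have "cmod (h z) \<le> C" if "z \<in> disc" for z
    by (rule tendsto_upperbound[OF tendsto_norm[OF h(3)[OF that]]]) (use Suc.prems that in auto)
  moreover have "(\<lambda>N. F (r (s N)) j z) \<longlonglongrightarrow> g j z" if "j < n" "z \<in> disc" for j z
    using LIMSEQ_subseq_LIMSEQ[OF g(2)[OF that] h(2)] by (simp add: o_def)
  ultimately show ?case
    using g h strict_mono_o[OF r h(2), unfolded o_def]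
    by (intro exI[of _ "g(n := h)"] exI[of _ "r \<circ> s"]) (auto simp: less_Suc_eq)
qed

section \<open>From Szego kernels to the corona theorem\<close>

text \<open>On the circle the conjugate of the Szego kernel at a is z/(z - a), so by Cauchy's
  formula pairing with the kernel evaluates at a. The condition R |a_i| < 1 keeps the poles outside
  the disc of radius R.\<close>

lemma Szego_H2:
  fixes a c :: "nat \<Rightarrow> complex"
  assumes R: "1 < R" and a: "\<And>i. i < N \<Longrightarrow> R * cmod (a i) < 1"
  defines "h \<equiv> \<lambda>z. \<Sum>i<N. c i / (1 - cnj (a i) * z)"
  shows "h holomorphic_on ball 0 R"
    and "complex_of_real (circle_mean (\<lambda>z. (cmod (h z))^2) 1) = (\<Sum>i<N. \<Sum>k<N. c i * cnj (c k) / (1 - cnj (a i) * a k))"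
    and "cmod z = 1 \<Longrightarrow> cnj (h z) = (\<Sum>i<N. cnj (c i) * (z / (z - a i)))"
proof -
  have a1: "cmod (a i) < 1" if "i < N" for i
  proof -
    have "1 * cmod (a i) \<le> R * cmod (a i)" using R by (intro mult_right_mono) auto
    then show ?thesis using a[OF that] by simp
  qed
  have nz: "1 - cnj (a i) * z \<noteq> 0" if "i < N" "cmod z < R" for i z
  proof
    assume "1 - cnj (a i) * z = 0"
    then have "cmod (a i) * cmod z = 1" by (metis complex_mod_cnj norm_mult norm_one right_minus_eq)
    moreover have "cmod (a i) * cmod z \<le> cmod (a i) * R" using that by (intro mult_left_mono) auto
    ultimately show False using a[OF that(1)] by (simp add: mult.commute)
  qed
  show hol: "h holomorphic_on ball 0 R"
    unfolding h_def using nz by (intro holomorphic_intros) auto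
  have cnjh: "cnj (h z) = (\<Sum>i<N. cnj (c i) * (z / (z - a i)))" if z: "cmod z = 1" for z
  proof -
    have *: "cnj (1 / (1 - cnj (a i) * z)) = z / (z - a i)" if "i < N" for i
    proof -
      have zz: "z * cnj z = 1" using z by (simp add: complex_norm_square[symmetric])
      have 1: "z - a i \<noteq> 0" using a1[OF that] z by auto
      have 2: "1 - a i * cnj z \<noteq> 0" using nz[OF that, of z] z R by (metis complex_cnj_cnj complex_cnj_diff complex_cnj_mult complex_cnj_one complex_cnj_zero_iff)
      have "z * (1 - a i * cnj z) = z - a i * (z * cnj z)" by (simp add: algebra_simps)
      then show ?thesis using 1 2 zz by (simp add: field_simps)
    qed
    have "cnj (c i / (1 - cnj (a i) * z)) = cnj (c i) * (z / (z - a i))" if "i < N" for i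
      unfolding *[OF that, symmetric] by simp
    then show ?thesis unfolding h_def cnj_sum by (intro sum.cong refl) auto
  qed
  then show "cmod z = 1 \<Longrightarrow> cnj (h z) = (\<Sum>i<N. cnj (c i) * (z / (z - a i)))" .
  have c: "continuous_on (sphere 0 \<bar>1\<bar>) h"
    by (rule continuous_on_subset[OF continuous_on_cball_deriv(1)[OF hol R]]) auto
  have "complex_of_real (circle_mean (\<lambda>z. (cmod (h z))^2) 1) = circle_mean (\<lambda>z. complex_of_real ((cmod (h z))^2)) 1"
    by (rule circle_mean_of_real[symmetric]) (intro continuous_intros c)
  also have "\<dots> = circle_mean (\<lambda>z. \<Sum>k<N. cnj (c k) * (h z * z / (z - a k))) 1"
  proof (rule circle_mean_cong)
    fix z :: complex assume "cmod z = \<bar>1\<bar>"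
    then have "h z * cnj (h z) = (\<Sum>k<N. cnj (c k) * (h z * z / (z - a k)))"
      by (simp add: cnjh sum_distrib_left mult_ac)
    then show "complex_of_real ((cmod (h z))^2) = (\<Sum>k<N. cnj (c k) * (h z * z / (z - a k)))"
      by (simp only: complex_norm_square)
  qed
  also have "\<dots> = (\<Sum>k<N. cnj (c k) * circle_mean (\<lambda>z. h z * z / (z - a k)) 1)"
  proof -
    have "continuous_on (sphere 0 \<bar>1\<bar>) (\<lambda>z. cnj (c k) * (h z * z / (z - a k)))" if "k < N" for k
      using a1[OF that] by (intro continuous_intros c) auto
    then show ?thesis by (subst circle_mean_sum[OF finite_lessThan]) (force, simp only: circle_mean_mult)
  qed
  also have "\<dots> = (\<Sum>k<N. cnj (c k) * h (a k))"
    using Cauchy_circle_mean[OF hol, of 1] R a1 by (intro sum.cong) auto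
  also have "\<dots> = (\<Sum>k<N. \<Sum>i<N. c i * cnj (c k) / (1 - cnj (a i) * a k))"
    unfolding h_def by (simp add: sum_distrib_left mult_ac)
  also have "\<dots> = (\<Sum>i<N. \<Sum>k<N. c i * cnj (c k) / (1 - cnj (a i) * a k))" by (rule sum.swap)
  finally show "complex_of_real (circle_mean (\<lambda>z. (cmod (h z))^2) 1) = (\<Sum>i<N. \<Sum>k<N. c i * cnj (c k) / (1 - cnj (a i) * a k))" .
qed

text \<open>The positivity demanded by Leech's theorem is \<kappa> times the sum of the
  \<open>H2 (v j)\<close> minus \<open>H2 h\<close>, written out by \<open>Szego_H2\<close> for
  combinations of Szego kernels. On the circle f_j cnj(h) - cnj(v_j) is z times a combination of
  difference quotients of f_j, which supplies an analytic \<open>w j\<close>; the corona estimate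
  does the rest.\<close>

lemma corona_finite_points:
  fixes f :: "nat \<Rightarrow> complex \<Rightarrow> complex" and a :: "nat \<Rightarrow> complex"
  assumes R: "1 < R" and d: "0 < d" "d \<le> 1"
    and f: "\<And>j. j < n \<Longrightarrow> f j holomorphic_on ball 0 R"
    and f1: "\<And>j z. j < n \<Longrightarrow> z \<in> cball 0 1 \<Longrightarrow> cmod (f j z) \<le> 1"
    and fd: "\<And>z. z \<in> cball 0 1 \<Longrightarrow> d^2 \<le> (\<Sum>j<n. (cmod (f j z))^2)"
    and a: "\<And>i. i < N \<Longrightarrow> a i \<in> disc"
  shows "\<exists>g. (\<forall>j<n. g j holomorphic_on disc \<and> (\<forall>z\<in>disc. cmod (g j z) \<le> 2 * corona_const d n)) \<and>
     (\<forall>i<N. (\<Sum>j<n. f j (a i) * g j (a i)) = 1)"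
proof -
  define \<rho> where "\<rho> = Max (insert 0 ((\<lambda>i. cmod (a i)) ` {..<N}))"
  have \<rho>: "0 \<le> \<rho>" "\<And>i. i < N \<Longrightarrow> cmod (a i) \<le> \<rho>"
    unfolding \<rho>_def by (auto intro!: Max_ge)
  have \<rho>1: "\<rho> < 1" unfolding \<rho>_def by (subst Max_less_iff) (use a in auto)
  note \<rho> = \<rho> \<rho>1
  \<comment> \<open>With \<rho> < 1 the radius 2/(1 + \<rho>) exceeds 1, while its product with
    \<rho> stays below 1, so all Szego kernels are analytic past the circle.\<close>
  define R' where "R' = min R (2 / (1 + \<rho>))"
  have R': "1 < R'" "R' \<le> R" using R \<rho> by (auto simp: R'_def field_simps)
  have aR: "R' * cmod (a i) < 1" if "i < N" for i
  proof -
    have "R' * cmod (a i) \<le> 2 / (1 + \<rho>) * \<rho>" unfolding R'_def using \<rho> that by (intro mult_mono) auto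
    also have "\<dots> < 1" using \<rho> by (simp add: field_simps)
    finally show ?thesis .
  qed
  have f': "f j holomorphic_on ball 0 R'" if "j < n" for j
    by (rule holomorphic_on_subset[OF f[OF that]]) (use R' in auto)
  define \<kappa> where "\<kappa> = 4 * (corona_const d n)^2"
  have "\<exists>g. (\<forall>j<n. g j holomorphic_on disc) \<and> (\<forall>j<n. \<forall>x\<in>disc. cmod (g j x) \<le> sqrt \<kappa>) \<and> (\<forall>i<N. (\<Sum>j<n. f j (a i) * g j (a i)) = 1)"
  proof (rule Leech_finite[of N a \<kappa> "\<lambda>i j. f j (a i)" n])
    fix c :: "nat \<Rightarrow> complex"
    define h where "h = (\<lambda>z. \<Sum>i<N. cnj (c i) / (1 - cnj (a i) * z))"
    define v where "v j = (\<lambda>z. \<Sum>i<N. (cnj (c i) * cnj (f j (a i))) / (1 - cnj (a i) * z))" for j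
    define w where "w j z = (\<Sum>i<N. c i * (if z = a i then deriv (f j) (a i) else (f j z - f j (a i)) / (z - a i)))" for j z
    have ah: "h holomorphic_on ball 0 R'" unfolding h_def by (rule Szego_H2[OF R'(1) aR])
    have av: "v j holomorphic_on ball 0 R'" for j unfolding v_def by (rule Szego_H2[OF R'(1) aR])
    interpret corona_data R' d n f w v h
    proof
      show "w j holomorphic_on ball 0 R'" if "j < n" for j
        unfolding w_def[abs_def]
      proof (intro holomorphic_intros pole_lemma f' that)
        fix i assume "i \<in> {..<N}"
        then show "a i \<in> interior (ball 0 R')" using a[of i] R' by auto
      qed
      show "z * w j z = f j z * cnj (h z) - cnj (v j z)" if "j < n" "cmod z = 1" for j z
      proof -
        have nz: "z \<noteq> a i" if "i < N" for i using a[OF that] \<open>cmod z = 1\<close> by auto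
        have "f j z * cnj (h z) - cnj (v j z) = (\<Sum>i<N. f j z * (c i * (z / (z - a i))) - c i * f j (a i) * (z / (z - a i)))"
        proof -
          have "cnj (h z) = (\<Sum>i<N. cnj (cnj (c i)) * (z / (z - a i)))"
            unfolding h_def by (rule Szego_H2(3)[OF R'(1) aR that(2)])
          moreover have "cnj (v j z) = (\<Sum>i<N. cnj (cnj (c i) * cnj (f j (a i))) * (z / (z - a i)))"
            unfolding v_def by (rule Szego_H2(3)[OF R'(1) aR that(2)])
          ultimately show ?thesis
            by (simp only: sum_distrib_left sum_subtractf[symmetric] complex_cnj_cnj complex_cnj_mult)
        qed
        also have "\<dots> = (\<Sum>i<N. z * (c i * (if z = a i then deriv (f j) (a i) else (f j z - f j (a i)) / (z - a i))))"
          using nz by (intro sum.cong refl) (auto simp: divide_inverse algebra_simps)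
        finally show ?thesis by (simp add: w_def sum_distrib_left)
      qed
    qed (use R' d f' f1 fd ah av in auto)
    have "0 \<le> \<kappa> * (\<Sum>j<n. H2 (v j)) - H2 h"
      using corona_estimate by (simp add: \<kappa>_def)
    also have "\<dots> = Re (of_real \<kappa> * (\<Sum>j<n. of_real (H2 (v j))) - of_real (H2 h))" by simp
    also have "of_real \<kappa> * (\<Sum>j<n. complex_of_real (H2 (v j))) - of_real (H2 h)
      = (\<Sum>i<N. \<Sum>k<N. cnj (c i) * c k * ((of_real \<kappa> * (\<Sum>j<n. cnj (f j (a i)) * f j (a k)) - 1) / (1 - cnj (a i) * a k)))"
    proof -
      have "(\<Sum>j<n. complex_of_real (H2 (v j))) = (\<Sum>j<n. \<Sum>i<N. \<Sum>k<N. (cnj (c i) * cnj (f j (a i))) * cnj (cnj (c k) * cnj (f j (a k))) / (1 - cnj (a i) * a k))"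
        unfolding v_def by (intro sum.cong refl Szego_H2(2)[OF R'(1) aR])
      also have "\<dots> = (\<Sum>i<N. \<Sum>k<N. \<Sum>j<n. (cnj (c i) * cnj (f j (a i))) * cnj (cnj (c k) * cnj (f j (a k))) / (1 - cnj (a i) * a k))"
        by (subst sum.swap, rule sum.cong[OF refl], rule sum.swap)
      also have "\<dots> = (\<Sum>i<N. \<Sum>k<N. cnj (c i) * c k * ((\<Sum>j<n. cnj (f j (a i)) * f j (a k)) / (1 - cnj (a i) * a k)))"
        by (intro sum.cong refl) (simp add: sum_distrib_left sum_divide_distrib mult_ac)
      finally have 1: "(\<Sum>j<n. complex_of_real (H2 (v j))) = (\<Sum>i<N. \<Sum>k<N. cnj (c i) * c k * ((\<Sum>j<n. cnj (f j (a i)) * f j (a k)) / (1 - cnj (a i) * a k)))" .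
      have 2: "complex_of_real (H2 h) = (\<Sum>i<N. \<Sum>k<N. cnj (c i) * c k * (1 / (1 - cnj (a i) * a k)))"
      proof -
        have "complex_of_real (H2 h) = (\<Sum>i<N. \<Sum>k<N. cnj (c i) * cnj (cnj (c k)) / (1 - cnj (a i) * a k))"
          unfolding h_def by (rule Szego_H2(2)[OF R'(1) aR])
        then show ?thesis by simp
      qed
      have lin: "of_real \<kappa> * (\<Sum>i<N. \<Sum>k<N. X i k) - (\<Sum>i<N. \<Sum>k<N. Y i k) = (\<Sum>i<N. \<Sum>k<N. of_real \<kappa> * X i k - Y i k)"
        for X Y :: "nat \<Rightarrow> nat \<Rightarrow> complex"
        by (simp add: sum_distrib_left sum_subtractf)
      show ?thesis unfolding 1 2 lin
        by (intro sum.cong refl) (simp add: diff_divide_distrib algebra_simps)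
    qed
    \<comment> \<open>The form obtained is the conjugate of the one in \<open>Leech_finite\<close>;
      its real part is the same.\<close>
    also have "\<dots> = cnj (\<Sum>i<N. \<Sum>k<N. c i * cnj (c k) * ((of_real \<kappa> * (\<Sum>j<n. f j (a i) * cnj (f j (a k))) - 1) / (1 - a i * cnj (a k))))"
      by simp
    finally show "0 \<le> Re (\<Sum>i<N. \<Sum>k<N. c i * cnj (c k) * ((of_real \<kappa> * (\<Sum>j<n. f j (a i) * cnj (f j (a k))) - 1) / (1 - a i * cnj (a k))))"
      by (simp only: cnj.simps)
  next
    fix g assume "\<And>j. j < n \<Longrightarrow> g j holomorphic_on disc" "\<And>j x. j < n \<Longrightarrow> x \<in> disc \<Longrightarrow> cmod (g j x) \<le> sqrt \<kappa>"
      "\<And>i. i < N \<Longrightarrow> (\<Sum>j<n. f j (a i) * g j (a i)) = 1"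
    then show "\<exists>g. (\<forall>j<n. g j holomorphic_on disc) \<and> (\<forall>j<n. \<forall>x\<in>disc. cmod (g j x) \<le> sqrt \<kappa>) \<and> (\<forall>i<N. (\<Sum>j<n. f j (a i) * g j (a i)) = 1)"
      by blast
  qed (use a in \<open>auto simp: \<kappa>_def\<close>)
  moreover have "0 \<le> corona_const d n"
    unfolding corona_const_def using d by simp
  ultimately show ?thesis by (auto simp: \<kappa>_def real_sqrt_mult)
qed

text \<open>Dilation by \<open>r N\<close> makes the data analytic past the circle, and at stage N
  the equation is solved at the first N points of a dense sequence. The bound 2
  \<open>corona_const e n\<close> does not depend on N, so a normal limit exists; it solves the
  equation on the dense set and hence everywhere by continuity.\<close>

theorem corona:
  fixes f :: "nat \<Rightarrow> complex \<Rightarrow> complex"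
  assumes d: "0 < d"
    and f: "\<And>j. j < n \<Longrightarrow> f j holomorphic_on disc"
    and f1: "\<And>j z. j < n \<Longrightarrow> z \<in> disc \<Longrightarrow> cmod (f j z) \<le> 1"
    and fd: "\<And>z. z \<in> disc \<Longrightarrow> d^2 \<le> (\<Sum>j<n. (cmod (f j z))^2)"
  shows "\<exists>g C. (\<forall>j<n. g j holomorphic_on disc \<and> (\<forall>z\<in>disc. cmod (g j z) \<le> C)) \<and> (\<forall>z\<in>disc. (\<Sum>j<n. f j z * g j z) = 1)"
proof -
  define e where "e = min d 1"
  have e: "0 < e" "e \<le> 1" using d by (auto simp: e_def)
  have ed: "e^2 \<le> d^2" using d by (intro power_mono) (auto simp: e_def)
  obtain D :: "complex set" where D: "countable D" "\<And>X. open X \<Longrightarrow> X \<noteq> {} \<Longrightarrow> \<exists>d\<in>D. d \<in> X"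
    using countable_dense_exists by blast
  define D' where "D' = D \<inter> disc"
  have D'c: "countable D'" using D by (auto simp: D'_def)
  have D'ne: "D' \<noteq> {}" using D(2)[of disc] by (auto simp: D'_def)
  define a where "a = from_nat_into D'"
  have ra: "range a = D'" unfolding a_def by (rule range_from_nat_into[OF D'ne D'c])
  have aD: "a i \<in> disc" for i using ra by (auto simp: D'_def)
  define r where "r N = 1 - 1 / (real N + 2)" for N
  have r: "0 < r N" "r N < 1" for N by (auto simp: r_def field_simps)
  have rlim: "r \<longlonglongrightarrow> 1" unfolding r_def[abs_def] by real_asymp
  have "\<exists>g. (\<forall>j<n. g j holomorphic_on disc \<and> (\<forall>z\<in>disc. cmod (g j z) \<le> 2 * corona_const e n)) \<and>
     (\<forall>i<N. (\<Sum>j<n. f j (of_real (r N) * a i) * g j (a i)) = 1)" for N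
  proof (rule corona_finite_points[of "1 / r N" e n "\<lambda>j z. f j (of_real (r N) * z)"])
    have m: "of_real (r N) * z \<in> disc" if "cmod z < 1 / r N" for z
      using that r[of N] by (simp add: norm_mult field_simps)
    have m1: "of_real (r N) * z \<in> disc" if "z \<in> cball 0 1" for z
    proof -
      have "r N * cmod z \<le> r N * 1" using that r[of N] by (intro mult_left_mono) auto
      then have "r N * cmod z < 1" using r[of N] by linarith
      then show ?thesis using r[of N] by (simp add: norm_mult)
    qed
    show "1 < 1 / r N" using r[of N] by (simp add: field_simps)
    show "(\<lambda>z. f j (of_real (r N) * z)) holomorphic_on ball 0 (1 / r N)" if "j < n" for j
    proof -
      have "(f j \<circ> (\<lambda>z. of_real (r N) * z)) holomorphic_on ball 0 (1 / r N)"
        by (rule holomorphic_on_compose_gen[OF _ f[OF that]]) (use m in \<open>auto intro!: holomorphic_intros\<close>)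
      then show ?thesis by (simp add: o_def)
    qed
    show "cmod (f j (of_real (r N) * z)) \<le> 1" if "j < n" "z \<in> cball 0 1" for j z using f1 m1 that by blast
    show "e^2 \<le> (\<Sum>j<n. (cmod (f j (of_real (r N) * z)))^2)" if "z \<in> cball 0 1" for z
      using fd[OF m1[OF that]] ed by linarith
  qed (use e aD in auto)
  then obtain G where G: "\<And>N j. j < n \<Longrightarrow> G N j holomorphic_on disc"
    "\<And>N j z. j < n \<Longrightarrow> z \<in> disc \<Longrightarrow> cmod (G N j z) \<le> 2 * corona_const e n"
    "\<And>N i. i < N \<Longrightarrow> (\<Sum>j<n. f j (of_real (r N) * a i) * G N j (a i)) = 1"
    by metis
  obtain g s where s: "strict_mono (s :: nat \<Rightarrow> nat)" and g: "\<And>j. j < n \<Longrightarrow> g j holomorphic_on disc"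
    "\<And>j z. j < n \<Longrightarrow> z \<in> disc \<Longrightarrow> (\<lambda>N. G (s N) j z) \<longlonglongrightarrow> g j z"
    "\<And>j z. j < n \<Longrightarrow> z \<in> disc \<Longrightarrow> cmod (g j z) \<le> 2 * corona_const e n"
    using Montel_family[of n G "2 * corona_const e n"] G(1,2) by blast
  have eq: "(\<Sum>j<n. f j (a i) * g j (a i)) = 1" for i
  proof -
    have "(\<lambda>N. f j (of_real (r (s N)) * a i)) \<longlonglongrightarrow> f j (a i)" if "j < n" for j
    proof -
      have "isCont (f j) (a i)"
        using holomorphic_on_imp_continuous_on[OF f[OF that]] aD[of i] by (simp add: continuous_on_eq_continuous_at)
      moreover have "(\<lambda>N. of_real (r (s N)) * a i) \<longlonglongrightarrow> of_real 1 * a i"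
        using LIMSEQ_subseq_LIMSEQ[OF rlim s] by (intro tendsto_intros) (simp add: o_def)
      ultimately show ?thesis using isCont_tendsto_compose by fastforce
    qed
    then have "(\<lambda>N. \<Sum>j<n. f j (of_real (r (s N)) * a i) * G (s N) j (a i)) \<longlonglongrightarrow> (\<Sum>j<n. f j (a i) * g j (a i))"
      using g(2) aD by (intro tendsto_sum tendsto_mult) auto
    moreover have "\<forall>\<^sub>F N in sequentially. (\<Sum>j<n. f j (of_real (r (s N)) * a i) * G (s N) j (a i)) = 1"
      using eventually_gt_at_top[of i]
    proof eventually_elim
      case (elim N)
      then have "i < s N" using seq_suble[OF s, of N] by linarith
      then show ?case by (rule G(3))
    qed
    ultimately show ?thesis by (rule LIMSEQ_unique[OF _ tendsto_eventually])
  qed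
  have all: "(\<Sum>j<n. f j z * g j z) = 1" if z: "z \<in> disc" for z
  proof (rule ccontr)
    assume neq: "(\<Sum>j<n. f j z * g j z) \<noteq> 1"
    have cont: "continuous_on disc (\<lambda>z. \<Sum>j<n. f j z * g j z)"
      using f g(1) by (intro continuous_intros holomorphic_on_imp_continuous_on) auto
    have "open ((\<lambda>z. \<Sum>j<n. f j z * g j z) -` (- {1}) \<inter> disc)"
      using cont by (simp add: continuous_on_open_vimage open_Compl)
    moreover have "z \<in> (\<lambda>z. \<Sum>j<n. f j z * g j z) -` (- {1}) \<inter> disc" using neq z by simp
    ultimately have "\<exists>x\<in>D. x \<in> (\<lambda>z. \<Sum>j<n. f j z * g j z) -` (- {1}) \<inter> disc" using D(2) by blast
    then obtain x where x: "x \<in> D" "x \<in> disc" "(\<Sum>j<n. f j x * g j x) \<noteq> 1" by auto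
    then have "x \<in> range a" unfolding ra D'_def by simp
    then show False using eq x(3) by auto
  qed
  show ?thesis
    by (rule exI[of _ g], rule exI[of _ "2 * corona_const e n"]) (use g all in auto)
qed

section \<open>Pseudohyperbolic geometry\<close>

lemma disc_aut_denom:
  assumes "z \<in> disc" "w \<in> disc" shows "1 - cnj z * w \<noteq> 0"
proof
  assume "1 - cnj z * w = 0"
  then have "cmod z * cmod w = 1" by (metis complex_mod_cnj norm_mult norm_one right_minus_eq)
  moreover have "cmod z * cmod w < 1 * 1" using assms by (intro mult_strict_mono') auto
  ultimately show False by simp
qed

lemma one_minus_disc_aut:
  assumes "z \<in> disc" "w \<in> disc"
  shows "1 - (cmod (disc_aut z w))^2 = (1 - (cmod z)^2) * (1 - (cmod w)^2) / (cmod (1 - cnj z * w))^2"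
proof -
  have nz: "(cmod (1 - cnj z * w))^2 \<noteq> 0" using disc_aut_denom[OF assms] by simp
  have "complex_of_real ((cmod (1 - cnj z * w))^2 - (cmod (z - w))^2) = of_real ((1 - (cmod z)^2) * (1 - (cmod w)^2))"
    by (simp add: complex_norm_square[unfolded of_real_power] algebra_simps)
  then have "(cmod (1 - cnj z * w))^2 - (cmod (z - w))^2 = (1 - (cmod z)^2) * (1 - (cmod w)^2)"
    by (simp only: of_real_eq_iff)
  then show ?thesis using nz by (simp add: disc_aut_def norm_divide power_divide field_simps)
qed

lemma disc_aut_in_disc:
  assumes "z \<in> disc" "w \<in> disc" shows "disc_aut z w \<in> disc"
proof -
  have "0 < (1 - (cmod z)^2) * (1 - (cmod w)^2) / (cmod (1 - cnj z * w))^2"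
    using assms disc_aut_denom[OF assms] by (intro divide_pos_pos mult_pos_pos) (auto simp: abs_square_less_1)
  then have "(cmod (disc_aut z w))^2 < 1" using one_minus_disc_aut[OF assms] by simp
  then show ?thesis by (simp add: abs_square_less_1)
qed

lemma disc_aut_invol:
  assumes "z \<in> disc" "w \<in> disc" shows "disc_aut z (disc_aut z w) = w"
proof -
  have 1: "1 - cnj z * w \<noteq> 0" by (rule disc_aut_denom[OF assms])
  have 2: "1 - z * cnj z \<noteq> 0" using disc_aut_denom[OF assms(1) assms(1)] by (simp add: mult.commute)
  have "z - disc_aut z w = w * (1 - z * cnj z) / (1 - cnj z * w)"
    using 1 by (simp add: disc_aut_def field_simps)
  moreover have "1 - cnj z * disc_aut z w = (1 - z * cnj z) / (1 - cnj z * w)"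
    using 1 by (simp add: disc_aut_def field_simps)
  ultimately show ?thesis using 1 2 by (simp add: disc_aut_def[of z "disc_aut z w"])
qed

lemma disc_aut_0 [simp]: "disc_aut z 0 = z" and disc_aut_self [simp]: "disc_aut z z = 0"
  by (auto simp: disc_aut_def)

lemma bij_betw_disc_aut:
  assumes "z \<in> disc" shows "bij_betw (disc_aut z) disc disc"
  by (rule bij_betwI[of _ _ _ "disc_aut z"]) (use assms disc_aut_in_disc[OF assms] disc_aut_invol[OF assms] in auto)

lemma holomorphic_disc_aut:
  assumes "z \<in> disc" shows "disc_aut z holomorphic_on disc"
  unfolding disc_aut_def[abs_def] using disc_aut_denom[OF assms] by (intro holomorphic_intros) auto

lemma holomorphic_disc_aut_compose:
  assumes "z \<in> disc" "f holomorphic_on disc"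
  shows "(\<lambda>w. f (disc_aut z w)) holomorphic_on disc"
  using holomorphic_on_compose_gen[OF holomorphic_disc_aut[OF assms(1)] assms(2)] disc_aut_in_disc[OF assms(1)]
  by (auto simp: o_def image_subset_iff)

lemma has_field_derivative_disc_aut:
  assumes "z \<in> disc" "w \<in> disc"
  shows "(disc_aut z has_field_derivative - (1 - (cmod z)^2) / (1 - cnj z * w)^2) (at w)"
proof -
  have "1 - cnj z * w \<noteq> 0" by (rule disc_aut_denom[OF assms])
  then have "((\<lambda>w. (z - w) / (1 - cnj z * w)) has_field_derivative
     ((-1) * (1 - cnj z * w) - (z - w) * (- cnj z)) / ((1 - cnj z * w) * (1 - cnj z * w))) (at w)"
    by (auto intro!: derivative_eq_intros)
  moreover have eq: "(-1) * (1 - cnj z * w) - (z - w) * (- cnj z) = - (1 - (cmod z)^2)"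
    by (simp add: complex_norm_square[unfolded of_real_power] algebra_simps)
  ultimately show ?thesis
    unfolding disc_aut_def[abs_def] power2_eq_square[of "1 - cnj z * w"] by (simp only: eq)
qed

definition rho :: "complex \<Rightarrow> complex \<Rightarrow> real" where "rho z w = cmod (disc_aut z w)"

text \<open>By \<open>q_eq\<close> this is (1 - |z|^2)(1 - |w|^2)/|1 - cnj(z) w|^2; uniform bounds
  for its sums over a set of points are the Carleson condition for that set.\<close>

definition q :: "complex \<Rightarrow> complex \<Rightarrow> real" where "q z w = 1 - (rho z w)^2"

lemma rho_less_1: "z \<in> disc \<Longrightarrow> w \<in> disc \<Longrightarrow> rho z w < 1"
  using disc_aut_in_disc[of z w] by (simp add: rho_def)

lemma rho_nonneg [simp]: "0 \<le> rho z w" by (simp add: rho_def)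

lemma rho_self [simp]: "rho z z = 0" by (simp add: rho_def)

lemma rho_zero [simp]: "rho z 0 = cmod z" "rho 0 z = cmod z" by (simp_all add: rho_def disc_aut_def)

lemma q_eq: "z \<in> disc \<Longrightarrow> w \<in> disc \<Longrightarrow> q z w = (1 - (cmod z)^2) * (1 - (cmod w)^2) / (cmod (1 - cnj z * w))^2"
  using one_minus_disc_aut by (simp add: q_def rho_def)

lemma q_pos: "z \<in> disc \<Longrightarrow> w \<in> disc \<Longrightarrow> 0 < q z w"
  using rho_less_1[of z w] by (simp add: q_def abs_square_less_1)

lemma rho_commute: "rho z w = rho w z"
proof -
  have "1 - cnj z * w = cnj (1 - cnj w * z)" by (simp add: mult.commute)
  then have "cmod (1 - cnj z * w) = cmod (1 - cnj w * z)" by (simp only: complex_mod_cnj)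
  then show ?thesis by (simp add: rho_def disc_aut_def norm_divide norm_minus_commute)
qed

lemma q_commute: "q z w = q w z" by (simp add: q_def rho_commute)

lemma rho_disc_aut:
  assumes "z \<in> disc" "a \<in> disc" "b \<in> disc"
  shows "rho (disc_aut z a) (disc_aut z b) = rho a b"
proof -
  have n: "1 - cnj z * a \<noteq> 0" "1 - cnj z * b \<noteq> 0" "1 - cnj z * z \<noteq> 0" "1 - cnj a * b \<noteq> 0"
    using disc_aut_denom assms by auto
  have n': "1 - z * cnj a \<noteq> 0" using disc_aut_denom[OF assms(2,1)] by (simp add: mult.commute)
  have 1: "disc_aut z a - disc_aut z b = - ((a - b) * (1 - cnj z * z)) / ((1 - cnj z * a) * (1 - cnj z * b))"
    using n by (simp add: disc_aut_def field_simps)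
  have 2: "1 - cnj (disc_aut z a) * disc_aut z b = ((1 - cnj a * b) * (1 - cnj z * z)) / ((1 - z * cnj a) * (1 - cnj z * b))"
  proof -
    have "1 - cnj (disc_aut z a) * disc_aut z b
       = ((1 - z * cnj a) * (1 - cnj z * b) - (cnj z - cnj a) * (z - b)) / ((1 - z * cnj a) * (1 - cnj z * b))"
    proof -
      have "1 - (u / D) * (w / E) = (D * E - u * w) / (D * E)" if "D \<noteq> 0" "E \<noteq> 0" for u w D E :: complex
        using that by (simp add: diff_divide_distrib)
      then show ?thesis using n n' by (simp add: disc_aut_def)
    qed
    also have "(1 - z * cnj a) * (1 - cnj z * b) - (cnj z - cnj a) * (z - b) = (1 - cnj a * b) * (1 - cnj z * z)"
      by (simp add: algebra_simps)
    finally show ?thesis .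
  qed
  have 3: "cmod (1 - cnj z * a) = cmod (1 - z * cnj a)"
    by (metis complex_cnj_cnj complex_cnj_diff complex_cnj_mult complex_cnj_one complex_mod_cnj)
  show ?thesis
    unfolding rho_def disc_aut_def[of "disc_aut z a"] disc_aut_def[of a b] 1 2 norm_divide norm_mult norm_minus_cancel 3
    using n n' by simp
qed

lemma q_disc_aut: "z \<in> disc \<Longrightarrow> a \<in> disc \<Longrightarrow> b \<in> disc \<Longrightarrow> q (disc_aut z a) (disc_aut z b) = q a b"
  by (simp add: q_def rho_disc_aut)

lemma rho_disc_aut_right: "z \<in> disc \<Longrightarrow> a \<in> disc \<Longrightarrow> rho z (disc_aut z a) = cmod a"
  by (simp add: rho_def disc_aut_invol)

text \<open>After moving \<open>y\<close> to the origin the claim compares 1 - |b|^2 with its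
  quotient by |1 - cnj(b) v|^2, where |v| \<le> r keeps the denominator above (1 - r)^2.\<close>

lemma q_Harnack:
  assumes "a \<in> disc" "x \<in> disc" "y \<in> disc" "rho x y \<le> r" "r < 1"
  shows "q a x \<le> q a y / (1 - r)^2"
proof -
  define b v where "b = disc_aut y a" and "v = disc_aut y x"
  have bv: "b \<in> disc" "v \<in> disc" unfolding b_def v_def using assms disc_aut_in_disc by auto
  have v: "cmod v \<le> r"
  proof -
    have "rho y x \<le> r" using assms(4) by (subst rho_commute)
    then show ?thesis by (simp add: v_def rho_def)
  qed
  have r0: "0 \<le> r" using v norm_ge_zero order_trans by blast
  have qx: "q a x = q b v" unfolding b_def v_def using q_disc_aut assms by simp
  have qy: "q a y = 1 - (cmod b)^2" using q_disc_aut[OF assms(3) assms(1) assms(3)] by (simp add: b_def q_def)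
  have "1 - r \<le> 1 - cmod (cnj b * v)"
    using bv v r0 mult_mono[of "cmod b" 1 "cmod v" r] by (simp add: norm_mult)
  also have "\<dots> \<le> cmod (1 - cnj b * v)" using norm_triangle_ineq2[of 1 "cnj b * v"] by simp
  finally have d: "(1 - r)^2 \<le> (cmod (1 - cnj b * v))^2" using assms(5) by (intro power_mono) auto
  have "q b v = (1 - (cmod b)^2) * (1 - (cmod v)^2) / (cmod (1 - cnj b * v))^2" by (rule q_eq[OF bv])
  also have "\<dots> \<le> ((1 - (cmod b)^2) * 1) / (1 - r)^2"
    using bv d assms(5) by (intro frac_le mult_left_mono) (auto simp: abs_square_le_1)
  finally show ?thesis unfolding qx qy by simp
qed

text \<open>Dividing f \<circ> \<phi>_z - f z by 3C rather than 2C gives the strict bound by 1 that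
  the Schwarz lemma asks for.\<close>

lemma Schwarz_Pick:
  assumes f: "f holomorphic_on disc" and C: "\<And>z. z \<in> disc \<Longrightarrow> cmod (f z) \<le> C" and zw: "z \<in> disc" "w \<in> disc"
  shows "cmod (f z - f w) \<le> 3 * C * rho z w"
proof (cases "C \<le> 0")
  case True
  then have "cmod (f z) \<le> 0" "cmod (f w) \<le> 0" using C[OF zw(1)] C[OF zw(2)] by linarith+
  then have "f z = 0" "f w = 0" by simp_all
  moreover have "C = 0" using C[OF zw(1)] True norm_ge_zero[of "f z"] by linarith
  ultimately show ?thesis by simp
next
  case False
  define g where "g v = (f (disc_aut z v) - f z) / of_real (3 * C)" for v
  have "cmod (g (disc_aut z w)) \<le> cmod (disc_aut z w)"
  proof (rule Schwarz_Lemma)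
    show "g holomorphic_on disc"
      unfolding g_def[abs_def] using False by (intro holomorphic_intros holomorphic_disc_aut_compose zw f) auto
    show "g 0 = 0" by (simp add: g_def)
    show "cmod (g v) < 1" if "cmod v < 1" for v
    proof -
      have "cmod (f (disc_aut z v) - f z) \<le> C + C"
        using C[OF disc_aut_in_disc[OF zw(1)], of v] C[OF zw(1)] that by (intro order_trans[OF norm_triangle_ineq4] add_mono) auto
      then show ?thesis using False by (simp add: g_def norm_divide)
    qed
    show "cmod (disc_aut z w) < 1" using disc_aut_in_disc[OF zw] by simp
  qed
  then show ?thesis using False zw
    by (simp add: g_def disc_aut_invol rho_def norm_divide norm_minus_commute field_simps)
qed

section \<open>The maximal ideal space\<close>

text \<open>Functionals carry the product topology of the function type; the instances up to
  Hausdorff bring them into the scope of Stone-Weierstrass.\<close>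

instance "fun" :: (type, t0_space) t0_space
proof
  fix f g :: "'a \<Rightarrow> 'b" assume "f \<noteq> g"
  then obtain x where x: "f x \<noteq> g x" by auto
  from iffD1[OF separation_t0 x] obtain U where U: "open U" "\<not> (f x \<in> U \<longleftrightarrow> g x \<in> U)" by (elim exE conjE)
  have "open ((\<lambda>h. h x) -` U :: ('a \<Rightarrow> 'b) set)"
    using U by (auto intro!: open_vimage continuous_on_product_coordinates)
  then show "\<exists>U. open U \<and> \<not> (f \<in> U \<longleftrightarrow> g \<in> U)"
    using U by (intro exI[of _ "(\<lambda>h. h x) -` U"]) auto
qed

instance "fun" :: (type, t1_space) t1_space
proof
  fix f g :: "'a \<Rightarrow> 'b" assume "f \<noteq> g"
  then obtain x where x: "f x \<noteq> g x" by auto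
  from iffD1[OF separation_t1 x] obtain U where U: "open U" "f x \<in> U" "g x \<notin> U" by (elim exE conjE)
  have "open ((\<lambda>h. h x) -` U :: ('a \<Rightarrow> 'b) set)"
    using U by (auto intro!: open_vimage continuous_on_product_coordinates)
  then show "\<exists>U. open U \<and> f \<in> U \<and> g \<notin> U"
    using U by (intro exI[of _ "(\<lambda>h. h x) -` U"]) auto
qed

instance "fun" :: (type, t2_space) t2_space
proof
  fix f g :: "'a \<Rightarrow> 'b" assume "f \<noteq> g"
  then obtain x where x: "f x \<noteq> g x" by auto
  from hausdorff[OF x] obtain U V where UV: "open U" "open V" "f x \<in> U" "g x \<in> V" "U \<inter> V = {}" by (elim exE conjE)
  have "open ((\<lambda>h. h x) -` U :: ('a \<Rightarrow> 'b) set)" "open ((\<lambda>h. h x) -` V :: ('a \<Rightarrow> 'b) set)"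
    using UV by (auto intro!: open_vimage continuous_on_product_coordinates)
  then show "\<exists>U V. open U \<and> open V \<and> f \<in> U \<and> g \<in> V \<and> U \<inter> V = {}"
    using UV by (intro exI[of _ "(\<lambda>h. h x) -` U"] exI[of _ "(\<lambda>h. h x) -` V"]) auto
qed

abbreviation (input) "M \<equiv> max_ideal_space"

lemma Hinf_bound: "f \<in> Hinf \<Longrightarrow> \<exists>C>0. \<forall>z\<in>disc. cmod (f z) \<le> C"
  unfolding Hinf_def by (auto simp: bounded_pos)

lemma HinfI:
  assumes "h holomorphic_on disc" "\<And>z. z \<in> disc \<Longrightarrow> cmod (h z) \<le> C"
  shows "(\<lambda>z. if z \<in> disc then h z else 0) \<in> Hinf"
proof -
  have "(\<lambda>z. if z \<in> disc then h z else 0) holomorphic_on disc"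
    by (rule holomorphic_transform[OF assms(1)]) auto
  then show ?thesis using assms(2) by (auto simp: Hinf_def intro!: boundedI[of _ C])
qed

lemma Hinf_add: "f \<in> Hinf \<Longrightarrow> g \<in> Hinf \<Longrightarrow> (\<lambda>z. f z + g z) \<in> Hinf"
  unfolding Hinf_def by (auto intro!: holomorphic_intros bounded_plus_comp)

lemma Hinf_mult:
  assumes "f \<in> Hinf" "g \<in> Hinf" shows "(\<lambda>z. f z * g z) \<in> Hinf"
proof -
  obtain C D where CD: "0 < C" "\<forall>z\<in>disc. cmod (f z) \<le> C" "0 < D" "\<forall>z\<in>disc. cmod (g z) \<le> D"
    using Hinf_bound assms by metis
  have "cmod (f z * g z) \<le> C * D" if "z \<in> disc" for z
    unfolding norm_mult using CD that by (intro mult_mono) auto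
  then have "bounded ((\<lambda>z. f z * g z) ` disc)" by (auto intro!: boundedI[of _ "C * D"])
  then show ?thesis using assms unfolding Hinf_def by (auto intro!: holomorphic_intros)
qed

lemma Hinf_one: "indicator disc \<in> Hinf"
proof -
  have "(\<lambda>z. if z \<in> disc then 1 else 0) \<in> Hinf" by (rule HinfI[of _ 1]) auto
  then show ?thesis by (simp add: indicator_def[abs_def] of_bool_def)
qed

lemma Hinf_cmult:
  assumes "f \<in> Hinf" shows "(\<lambda>z. c * f z) \<in> Hinf"
proof -
  have "(\<lambda>z. if z \<in> disc then c else 0) \<in> Hinf" by (rule HinfI[of _ "cmod c"]) auto
  from Hinf_mult[OF this assms] have "(\<lambda>z. (if z \<in> disc then c else 0) * f z) \<in> Hinf" .
  moreover have "(\<lambda>z. (if z \<in> disc then c else 0) * f z) = (\<lambda>z. c * f z)"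
    using assms by (auto simp: Hinf_def)
  ultimately show ?thesis by simp
qed

lemma Hinf_id: "(\<lambda>z. if z \<in> disc then z else 0) \<in> Hinf"
  by (rule HinfI[of _ 1]) auto

lemma mult_functionals_add: "m \<in> mult_functionals \<Longrightarrow> f \<in> Hinf \<Longrightarrow> g \<in> Hinf \<Longrightarrow> m (\<lambda>z. f z + g z) = m f + m g"
  and mult_functionals_cmult: "m \<in> mult_functionals \<Longrightarrow> f \<in> Hinf \<Longrightarrow> m (\<lambda>z. c * f z) = c * m f"
  and mult_functionals_mult: "m \<in> mult_functionals \<Longrightarrow> f \<in> Hinf \<Longrightarrow> g \<in> Hinf \<Longrightarrow> m (\<lambda>z. f z * g z) = m f * m g"
  and mult_functionals_ext: "m \<in> mult_functionals \<Longrightarrow> f \<notin> Hinf \<Longrightarrow> m f = undefined"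
  by (auto simp: mult_functionals_def extensional_def)

lemma Hinf_mult_one: "f \<in> Hinf \<Longrightarrow> (\<lambda>z. f z * indicator disc z) = f"
  by (auto simp: Hinf_def indicator_def fun_eq_iff)

lemma mult_functionals_one:
  assumes "m \<in> mult_functionals" shows "m (indicator disc) = 1"
proof -
  have "1 \<in> m ` Hinf" using assms by (simp add: mult_functionals_def)
  then obtain f where f: "f \<in> Hinf" "m f = 1" by (metis imageE)
  then show ?thesis using mult_functionals_mult[OF assms f(1) Hinf_one] by (simp add: Hinf_mult_one)
qed

text \<open>Being onto is not visibly a closed condition. It is replaced by the value at the unit,
  which is \<open>indicator disc\<close> because members of \<open>Hinf\<close> vanish off the
  disc.\<close>

lemma mult_functionals_iff:
  "m \<in> mult_functionals \<longleftrightarrow> m \<in> extensional Hinf \<and>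
     (\<forall>f\<in>Hinf. \<forall>g\<in>Hinf. m (\<lambda>z. f z + g z) = m f + m g) \<and>
     (\<forall>c. \<forall>f\<in>Hinf. m (\<lambda>z. c * f z) = c * m f) \<and>
     (\<forall>f\<in>Hinf. \<forall>g\<in>Hinf. m (\<lambda>z. f z * g z) = m f * m g) \<and> m (indicator disc) = 1"
proof -
  have "UNIV = m ` Hinf" if "\<forall>c. \<forall>f\<in>Hinf. m (\<lambda>z. c * f z) = c * m f" "m (indicator disc) = 1"
  proof (rule UNIV_eq_I)
    fix c
    have "m (\<lambda>z. c * indicator disc z) = c" using that Hinf_one by auto
    then show "c \<in> m ` Hinf" using Hinf_cmult[OF Hinf_one, of c] by (metis imageI)
  qed
  then show ?thesis using mult_functionals_one by (auto simp: mult_functionals_def)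
qed

lemma mult_functionals_diff_const:
  assumes "m \<in> mult_functionals" "f \<in> Hinf"
  shows "(\<lambda>z. f z + c * indicator disc z) \<in> Hinf" "m (\<lambda>z. f z + c * indicator disc z) = m f + c"
  using assms mult_functionals_add[OF assms Hinf_cmult[OF Hinf_one]] mult_functionals_cmult[OF assms(1) Hinf_one] mult_functionals_one
  by (auto intro!: Hinf_add Hinf_cmult Hinf_one)

lemma mult_functionals_sum:
  assumes m: "m \<in> mult_functionals" and "finite I" "\<And>i. i \<in> I \<Longrightarrow> f i \<in> Hinf"
  shows "(\<lambda>z. \<Sum>i\<in>I. f i z) \<in> Hinf \<and> m (\<lambda>z. \<Sum>i\<in>I. f i z) = (\<Sum>i\<in>I. m (f i))"
  using assms(2,3)
proof (induction I rule: finite_induct)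
  case empty
  have "(\<lambda>z. 0 * indicator disc z) \<in> Hinf" "m (\<lambda>z. 0 * indicator disc z) = 0 * m (indicator disc)"
    using mult_functionals_cmult[OF m Hinf_one] Hinf_cmult[OF Hinf_one] by blast+
  then show ?case by simp
next
  case (insert x I)
  then show ?case using mult_functionals_add[OF m, of "f x" "\<lambda>z. \<Sum>i\<in>I. f i z"] Hinf_add[of "f x" "\<lambda>z. \<Sum>i\<in>I. f i z"]
    by simp
qed

text \<open>If |m f| > C then f - m f is bounded away from zero, hence invertible in
  \<open>Hinf\<close>; but \<open>m\<close> annihilates it.\<close>

lemma norm_mult_functional_le:
  assumes m: "m \<in> mult_functionals" and f: "f \<in> Hinf" and C: "\<And>z. z \<in> disc \<Longrightarrow> cmod (f z) \<le> C"
  shows "cmod (m f) \<le> C"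
proof (rule ccontr)
  assume neg: "\<not> cmod (m f) \<le> C"
  define l where "l = m f"
  have low: "cmod l - C \<le> cmod (f z - l)" if "z \<in> disc" for z
    using C[OF that] norm_triangle_ineq2[of l "f z"] by (simp add: norm_minus_commute)
  have pos: "0 < cmod l - C" using neg by (simp add: l_def)
  have nz: "f z - l \<noteq> 0" if "z \<in> disc" for z using low[OF that] pos by auto
  have fh: "f holomorphic_on disc" and "\<And>z. z \<notin> disc \<Longrightarrow> f z = 0" using f by (auto simp: Hinf_def)
  define g where "g = (\<lambda>z. if z \<in> disc then inverse (f z - l) else 0)"
  have g: "g \<in> Hinf" unfolding g_def
  proof (rule HinfI)
    show "(\<lambda>z. inverse (f z - l)) holomorphic_on disc" using nz by (intro holomorphic_intros fh) auto
    show "cmod (inverse (f z - l)) \<le> inverse (cmod l - C)" if "z \<in> disc" for z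
      using low[OF that] pos by (simp add: norm_inverse le_imp_inverse_le)
  qed
  have "(\<lambda>z. (f z + (- l) * indicator disc z) * g z) = indicator disc"
    using nz by (auto simp: g_def indicator_def fun_eq_iff)
  then have "m (\<lambda>z. f z + (- l) * indicator disc z) * m g = 1"
    using mult_functionals_mult[OF m mult_functionals_diff_const(1)[OF m f] g, of "- l"] mult_functionals_one[OF m] by simp
  then show False using mult_functionals_diff_const(2)[OF m f, of "- l"] by (simp add: l_def)
qed

lemma point_eval_mult: "z \<in> disc \<Longrightarrow> point_eval z \<in> mult_functionals"
  unfolding mult_functionals_iff point_eval_def
  by (auto simp: Hinf_add Hinf_cmult Hinf_mult Hinf_one)

text \<open>Functionals equal \<open>undefined\<close> off \<open>Hinf\<close>, so the coordinates
  outside \<open>Hinf\<close> are constant on \<open>mult_functionals\<close>, and the products over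
  \<open>Hinf\<close> and over all functions induce the same topology. Type class topology becomes
  available.\<close>

lemma max_ideal_space_eq: "M = top_of_set mult_functionals"
proof -
  have ext: "mult_functionals \<subseteq> extensional Hinf" by (auto simp: mult_functionals_def)
  have c1: "continuous_map (top_of_set mult_functionals) M id"
    unfolding max_ideal_space_def
  proof (rule continuous_map_into_subtopology)
    show "continuous_map (top_of_set mult_functionals) (product_topology (\<lambda>_. euclidean) Hinf) id"
      unfolding continuous_map_componentwise using ext
      by (auto intro!: continuous_on_subset[OF continuous_on_product_coordinates])
  qed auto
  have tM: "topspace M = mult_functionals"
    unfolding max_ideal_space_def using ext by (auto simp: topspace_subtopology PiE_def)
  have c2: "continuous_map M (top_of_set mult_functionals) id"
  proof (rule continuous_map_into_subtopology)
    show "continuous_map M euclidean id"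
      unfolding euclidean_product_topology[symmetric] continuous_map_componentwise
    proof (intro conjI ballI)
      fix f :: "complex \<Rightarrow> complex"
      show "continuous_map M euclidean (\<lambda>x. id x f)"
      proof (cases "f \<in> Hinf")
        case True
        then show ?thesis unfolding max_ideal_space_def
          using continuous_map_product_projection[OF True, of "\<lambda>_. euclidean"] by (auto intro: continuous_map_from_subtopology)
      next
        case False
        have "continuous_map M euclidean (\<lambda>x. undefined :: complex)" by simp
        moreover have "undefined = id x f" if "x \<in> topspace M" for x :: functional
          using mult_functionals_ext[of x f] that False tM by simp
        ultimately show ?thesis by (rule continuous_map_eq)
      qed
    qed auto
  qed (auto simp: tM)
  have "openin M U \<longleftrightarrow> openin (top_of_set mult_functionals) U" for U
  proof
    assume U: "openin M U"
    then have "openin (top_of_set mult_functionals) {x \<in> mult_functionals. id x \<in> U}"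
      using openin_continuous_map_preimage[OF c1 U] by simp
    moreover have "{x \<in> mult_functionals. id x \<in> U} = U" using openin_subset[OF U] tM by auto
    ultimately show "openin (top_of_set mult_functionals) U" by simp
  next
    assume U: "openin (top_of_set mult_functionals) U"
    then have "openin M {x \<in> mult_functionals. id x \<in> U}"
      using openin_continuous_map_preimage[OF c2 U] tM by simp
    moreover have "{x \<in> mult_functionals. id x \<in> U} = U" using openin_subset[OF U] by auto
    ultimately show "openin M U" by simp
  qed
  then show ?thesis by (simp add: topology_eq)
qed

lemma topspace_M [simp]: "topspace M = mult_functionals"
  by (simp add: max_ideal_space_eq)

lemma continuous_map_M_iff: "continuous_map M euclidean F \<longleftrightarrow> continuous_on mult_functionals F"
  by (simp add: max_ideal_space_eq)

text \<open>The Banach-Alaoglu argument: a closed subset of a product of compact discs, cut out by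
  the algebraic identities. Coordinates off \<open>Hinf\<close> range over the singleton of
  \<open>undefined\<close>.\<close>

lemma compact_mult_functionals: "compact mult_functionals"
proof -
  define B where "B f = (SOME C. \<forall>z\<in>disc. cmod (f z) \<le> C)" for f :: "complex \<Rightarrow> complex"
  have B: "\<forall>z\<in>disc. cmod (f z) \<le> B f" if "f \<in> Hinf" for f
    unfolding B_def by (rule someI_ex) (use Hinf_bound[OF that] in auto)
  define K where "K = (PiE UNIV (\<lambda>f. if f \<in> Hinf then cball 0 (B f) else {undefined}) :: functional set)"
  have "compactin (product_topology (\<lambda>_. euclidean) UNIV) K"
    unfolding K_def compactin_PiE by auto
  then have K: "compact K" by (simp add: euclidean_product_topology)
  have c: "continuous_on UNIV (\<lambda>m::functional. m f)" for f by (rule continuous_on_product_coordinates)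
  have eq: "mult_functionals = K \<inter> {m. \<forall>f g. f \<in> Hinf \<and> g \<in> Hinf \<longrightarrow> m (\<lambda>z. f z + g z) = m f + m g}
      \<inter> {m. \<forall>c f. f \<in> Hinf \<longrightarrow> m (\<lambda>z. c * f z) = c * m f}
      \<inter> {m. \<forall>f g. f \<in> Hinf \<and> g \<in> Hinf \<longrightarrow> m (\<lambda>z. f z * g z) = m f * m g} \<inter> {m. m (indicator disc) = 1}" (is "_ = K \<inter> ?a \<inter> ?b \<inter> ?c \<inter> ?d")
  proof (intro equalityI subsetI)
    fix m assume m: "m \<in> mult_functionals"
    then have "m \<in> K" unfolding K_def
      using norm_mult_functional_le[OF m] B mult_functionals_ext[OF m] by auto
    then show "m \<in> K \<inter> ?a \<inter> ?b \<inter> ?c \<inter> ?d" using m unfolding mult_functionals_iff by blast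
  next
    fix m assume m: "m \<in> K \<inter> ?a \<inter> ?b \<inter> ?c \<inter> ?d"
    then have "m f = undefined" if "f \<notin> Hinf" for f using that by (auto simp: K_def PiE_def Pi_def split: if_splits)
    then have "m \<in> extensional Hinf" by (auto simp: extensional_def)
    then show "m \<in> mult_functionals" using m unfolding mult_functionals_iff by blast
  qed
  have "closed ?a" by (intro closed_Collect_all closed_Collect_imp open_Collect_const closed_Collect_eq continuous_intros c)
  moreover have "closed ?b" by (intro closed_Collect_all closed_Collect_imp open_Collect_const closed_Collect_eq continuous_intros c)
  moreover have "closed ?c" by (intro closed_Collect_all closed_Collect_imp open_Collect_const closed_Collect_eq continuous_intros c)
  moreover have "closed ?d" by (intro closed_Collect_eq continuous_intros c)
  ultimately show ?thesis unfolding eq using K by (intro compact_Int_closed)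
qed

text \<open>The class \<open>P\<close> is kept abstract because two are needed:
  \<open>hyp_lipschitz\<close> for uniform continuity, and membership in \<open>algebra_U\<close>.
  The error e/2 is spent on the real part and again on the imaginary part.\<close>

lemma Stone_Weierstrass_M:
  fixes P :: "(complex \<Rightarrow> complex) \<Rightarrow> bool"
  assumes P: "\<And>u v. P u \<Longrightarrow> P v \<Longrightarrow> P (\<lambda>z. u z + v z)" "\<And>u v. P u \<Longrightarrow> P v \<Longrightarrow> P (\<lambda>z. u z * v z)"
      "\<And>c u. P u \<Longrightarrow> P (\<lambda>z. c * u z)" "\<And>u. P u \<Longrightarrow> P (\<lambda>z. cnj (u z))" "\<And>h. h \<in> Hinf \<Longrightarrow> P h"
    and F: "continuous_map M euclidean F" and e: "0 < e"
  shows "\<exists>v. P v \<and> (\<forall>z\<in>disc. cmod (F (point_eval z) - v z) < e)"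
proof -
  define A where "A g \<longleftrightarrow> continuous_on mult_functionals g \<and> (\<exists>v. P v \<and> (\<forall>z\<in>disc. v z = complex_of_real (g (point_eval z))))" for g
  have real: "\<exists>g. A g \<and> (\<forall>m\<in>mult_functionals. \<bar>G m - g m\<bar> < e / 2)" if G: "continuous_on mult_functionals G" for G
  proof (rule Stone_Weierstrass_HOL[OF compact_mult_functionals])
    show "A (\<lambda>x. c)" for c
      unfolding A_def
      by (intro conjI exI[of _ "\<lambda>z. of_real c * indicator disc z"] P(3) P(5) Hinf_one) auto
    show "A (\<lambda>x. f x + g x)" if fg: "A f \<and> A g" for f g
    proof -
      obtain u v where "P u" "P v" "\<forall>z\<in>disc. u z = complex_of_real (f (point_eval z))" "\<forall>z\<in>disc. v z = complex_of_real (g (point_eval z))"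
        using fg unfolding A_def by blast
      then have "P (\<lambda>z. u z + v z) \<and> (\<forall>z\<in>disc. u z + v z = complex_of_real (f (point_eval z) + g (point_eval z)))"
        using P(1) by simp
      then show ?thesis using that unfolding A_def by (intro conjI continuous_intros) auto
    qed
    show "A (\<lambda>x. f x * g x)" if fg: "A f \<and> A g" for f g
    proof -
      obtain u v where "P u" "P v" "\<forall>z\<in>disc. u z = complex_of_real (f (point_eval z))" "\<forall>z\<in>disc. v z = complex_of_real (g (point_eval z))"
        using fg unfolding A_def by blast
      then have "P (\<lambda>z. u z * v z) \<and> (\<forall>z\<in>disc. u z * v z = complex_of_real (f (point_eval z) * g (point_eval z)))"
        using P(2) by simp
      then show ?thesis using that unfolding A_def by (intro conjI continuous_intros) auto
    qed
    show "\<exists>f. A f \<and> f x \<noteq> f y" if xy: "x \<in> mult_functionals \<and> y \<in> mult_functionals \<and> x \<noteq> y" for x y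
    proof -
      obtain f where f: "f \<in> Hinf" "x f \<noteq> y f"
        using xy mult_functionals_ext by (metis ext)
      have c: "continuous_on mult_functionals (\<lambda>m::functional. m f)"
        by (rule continuous_on_subset[OF continuous_on_product_coordinates]) auto
      have Re: "A (\<lambda>m. Re (m f))"
      proof -
        have "P (\<lambda>z. (1 / 2) * (f z + cnj (f z)))" using f by (intro P)
        moreover have "\<forall>z\<in>disc. (1 / 2) * (f z + cnj (f z)) = complex_of_real (Re (point_eval z f))"
          using f(1) by (auto simp: point_eval_def complex_eq_iff)
        ultimately show ?thesis unfolding A_def by (intro conjI continuous_intros c) blast
      qed
      have Im: "A (\<lambda>m. Im (m f))"
      proof -
        have "P (\<lambda>z. (- \<i> / 2) * (f z + (-1) * cnj (f z)))" using f by (intro P)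
        moreover have "\<forall>z\<in>disc. (- \<i> / 2) * (f z + (-1) * cnj (f z)) = complex_of_real (Im (point_eval z f))"
          using f(1) by (auto simp: point_eval_def complex_eq_iff)
        ultimately show ?thesis unfolding A_def by (intro conjI continuous_intros c) blast
      qed
      show ?thesis using f(2) Re Im by (auto simp: complex_eq_iff)
    qed
  qed (use G e in \<open>auto simp: A_def\<close>)
  have cF: "continuous_on mult_functionals F" using F by (simp add: continuous_map_M_iff)
  obtain g1 where g1: "A g1" "\<And>m. m \<in> mult_functionals \<Longrightarrow> \<bar>Re (F m) - g1 m\<bar> < e / 2"
    using real[of "\<lambda>m. Re (F m)"] cF by (auto intro!: continuous_intros)
  obtain g2 where g2: "A g2" "\<And>m. m \<in> mult_functionals \<Longrightarrow> \<bar>Im (F m) - g2 m\<bar> < e / 2"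
    using real[of "\<lambda>m. Im (F m)"] cF by (auto intro!: continuous_intros)
  obtain v1 where v1: "P v1" "\<And>z. z \<in> disc \<Longrightarrow> v1 z = complex_of_real (g1 (point_eval z))" using g1(1) by (auto simp: A_def)
  obtain v2 where v2: "P v2" "\<And>z. z \<in> disc \<Longrightarrow> v2 z = complex_of_real (g2 (point_eval z))" using g2(1) by (auto simp: A_def)
  have "P (\<lambda>z. v1 z + \<i> * v2 z)" by (intro P v1 v2)
  moreover have "cmod (F (point_eval z) - (v1 z + \<i> * v2 z)) < e" if z: "z \<in> disc" for z
  proof -
    have "cmod (F (point_eval z) - (v1 z + \<i> * v2 z)) \<le> \<bar>Re (F (point_eval z)) - g1 (point_eval z)\<bar> + \<bar>Im (F (point_eval z)) - g2 (point_eval z)\<bar>"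
      by (rule order_trans[OF cmod_le]) (simp add: v1(2)[OF z] v2(2)[OF z])
    then show ?thesis using g1(2)[OF point_eval_mult[OF z]] g2(2)[OF point_eval_mult[OF z]] by linarith
  qed
  ultimately show ?thesis by blast
qed

section \<open>Approach to the maximal ideal space along the disc\<close>

lemma eventually_disc_to:
  assumes "m \<in> mult_functionals"
  shows "eventually P (disc_to m) \<longleftrightarrow> (\<exists>U. openin M U \<and> m \<in> U \<and> (\<forall>z\<in>disc. point_eval z \<in> U \<longrightarrow> P z))"
proof -
  have "eventually P (disc_to m) \<longleftrightarrow> (\<exists>Q. (\<exists>U. openin M U \<and> m \<in> U \<and> (\<forall>x\<in>U. Q x)) \<and> (\<forall>z. Q (point_eval z) \<longrightarrow> z \<in> disc \<longrightarrow> P z))"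
    unfolding disc_to_def eventually_inf_principal eventually_filtercomap eventually_nhdsin using assms by simp
  also have "\<dots> \<longleftrightarrow> (\<exists>U. openin M U \<and> m \<in> U \<and> (\<forall>z\<in>disc. point_eval z \<in> U \<longrightarrow> P z))"
  proof (intro iffI; elim exE conjE)
    fix Q U assume "openin M U" "m \<in> U" "\<forall>x\<in>U. Q x" "\<forall>z. Q (point_eval z) \<longrightarrow> z \<in> disc \<longrightarrow> P z"
    then show "\<exists>U. openin M U \<and> m \<in> U \<and> (\<forall>z\<in>disc. point_eval z \<in> U \<longrightarrow> P z)" by (intro exI[of _ U]) auto
  next
    fix U assume "openin M U" "m \<in> U" "\<forall>z\<in>disc. point_eval z \<in> U \<longrightarrow> P z"
    then show "\<exists>Q. (\<exists>U. openin M U \<and> m \<in> U \<and> (\<forall>x\<in>U. Q x)) \<and> (\<forall>z. Q (point_eval z) \<longrightarrow> z \<in> disc \<longrightarrow> P z)"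
      by (intro exI[of _ "\<lambda>x. x \<in> U"]) auto
  qed
  finally show ?thesis .
qed

lemma eventually_disc_to_disc: "m \<in> mult_functionals \<Longrightarrow> eventually (\<lambda>z. z \<in> disc) (disc_to m)"
  by (auto simp: disc_to_def eventually_inf_principal)

lemma tendsto_disc_to:
  fixes F :: "functional \<Rightarrow> 'a::topological_space"
  assumes m: "m \<in> mult_functionals" and F: "continuous_map M euclidean F"
  shows "((\<lambda>z. F (point_eval z)) \<longlongrightarrow> F m) (disc_to m)"
proof (rule topological_tendstoI)
  fix S assume S: "open S" "F m \<in> S"
  have "openin M {x \<in> topspace M. F x \<in> S}" using openin_continuous_map_preimage[OF F, of S] S by simp
  then show "eventually (\<lambda>z. F (point_eval z) \<in> S) (disc_to m)"
    unfolding eventually_disc_to[OF m] using m S by (intro exI[of _ "{x \<in> topspace M. F x \<in> S}"]) auto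
qed

lemma tendsto_Hinf_disc_to:
  assumes "m \<in> mult_functionals" "f \<in> Hinf"
  shows "(f \<longlongrightarrow> m f) (disc_to m)"
proof -
  have "continuous_map M euclidean (\<lambda>m. m f)"
    unfolding continuous_map_M_iff by (rule continuous_on_subset[OF continuous_on_product_coordinates]) auto
  from tendsto_disc_to[OF assms(1) this] show ?thesis using assms(2) by (simp add: point_eval_def)
qed

text \<open>A neighbourhood of \<open>m\<close> that misses the disc contains a basic one, given by
  finitely many \<phi>_i and e > 0: at every point of the disc some |\<phi>_i - m \<phi>_i| is at
  least e. The corona theorem then solves the sum of (\<phi>_i - m \<phi>_i) g_i = 1 in
  \<open>Hinf\<close>, and applying \<open>m\<close> gives 0 = 1.\<close>

theorem disc_dense:
  assumes m: "m \<in> mult_functionals" shows "disc_to m \<noteq> bot"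
proof
  assume "disc_to m = bot"
  then have "eventually (\<lambda>z. False) (disc_to m)" by simp
  then obtain U where U: "openin M U" "m \<in> U" "\<And>z. z \<in> disc \<Longrightarrow> point_eval z \<notin> U"
    unfolding eventually_disc_to[OF m] by auto
  obtain W where W: "openin (product_topology (\<lambda>_. euclidean) Hinf) W" "U = W \<inter> mult_functionals"
    using U(1) unfolding max_ideal_space_def openin_subtopology by auto
  obtain X where X: "finite {f \<in> Hinf. X f \<noteq> topspace euclidean}" "\<And>f. f \<in> Hinf \<Longrightarrow> openin euclidean (X f)" "m \<in> PiE Hinf X" "PiE Hinf X \<subseteq> W"
  proof -
    have "m \<in> W" using W U(2) by simp
    from bspec[OF iffD1[OF openin_product_topology_alt W(1)] this] show ?thesis
      using that by (elim exE conjE) simp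
  qed
  define J where "J = {f \<in> Hinf. X f \<noteq> UNIV}"
  have J: "finite J" "J \<subseteq> Hinf" using X(1) by (auto simp: J_def)
  have "\<exists>e>0. \<forall>f\<in>J. ball (m f) e \<subseteq> X f"
  proof -
    have "\<forall>f\<in>J. \<exists>e>0. ball (m f) e \<subseteq> X f"
      using X(2,3) by (auto simp: J_def PiE_def Pi_def open_contains_ball)
    then obtain e where e: "\<And>f. f \<in> J \<Longrightarrow> 0 < e f \<and> ball (m f) (e f) \<subseteq> X f" by metis
    show ?thesis
    proof (intro exI conjI ballI)
      show "0 < Min (insert 1 (e ` J))" using J e by (subst Min_gr_iff) auto
      fix f assume f: "f \<in> J"
      then have "Min (insert 1 (e ` J)) \<le> e f" using J by (intro Min_le) auto
      then show "ball (m f) (Min (insert 1 (e ` J))) \<subseteq> X f" using e[OF f] by (meson order_trans subset_ball)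
    qed
  qed
  then obtain e where e: "0 < e" "\<And>f. f \<in> J \<Longrightarrow> ball (m f) e \<subseteq> X f" by auto
  have away: "\<exists>f\<in>J. e \<le> cmod (f z - m f)" if z: "z \<in> disc" for z
  proof (rule ccontr)
    assume "\<not> ?thesis"
    then have "f z \<in> X f" if "f \<in> J" for f using e(2)[OF that] that by (force simp: dist_norm norm_minus_commute)
    then have "point_eval z \<in> PiE Hinf X" using J by (auto simp: point_eval_def J_def PiE_def extensional_def)
    then show False using X(4) W(2) U(3)[OF z] point_eval_mult[OF z] by auto
  qed
  obtain n \<phi> where \<phi>: "J = \<phi> ` {i::nat. i < n}" "inj_on \<phi> {i. i < n}"
    using finite_imp_nat_seg_image_inj_on[OF J(1)] by auto
  have \<phi>J: "\<phi> i \<in> J" "\<phi> i \<in> Hinf" if "i < n" for i using \<phi>(1) that J(2) by auto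
  have "\<exists>C>0. \<forall>i<n. \<forall>z\<in>disc. cmod (\<phi> i z) \<le> C"
  proof -
    have "\<forall>i\<in>{..<n}. \<exists>C>0. \<forall>z\<in>disc. cmod (\<phi> i z) \<le> C" using \<phi>J Hinf_bound by auto
    then obtain C where C: "\<And>i. i < n \<Longrightarrow> 0 < C i \<and> (\<forall>z\<in>disc. cmod (\<phi> i z) \<le> C i)" by (metis lessThan_iff)
    have le: "C i \<le> Max (insert 1 (C ` {..<n}))" if "i < n" for i using that by (intro Max_ge) auto
    show ?thesis
    proof (intro exI conjI allI impI ballI)
      show "0 < Max (insert 1 (C ` {..<n}))" by (rule less_le_trans[OF zero_less_one Max_ge]) auto
      fix i z assume "i < n" "z \<in> disc"
      then show "cmod (\<phi> i z) \<le> Max (insert 1 (C ` {..<n}))" using C[of i] le[of i] order_trans by blast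
    qed
  qed
  then obtain C where C: "0 < C" "\<And>i z. i < n \<Longrightarrow> z \<in> disc \<Longrightarrow> cmod (\<phi> i z) \<le> C" by auto
  define f where "f i z = (\<phi> i z - m (\<phi> i)) / of_real (2 * C)" for i z
  have bnd: "cmod (f i z) \<le> 1" if "i < n" "z \<in> disc" for i z
  proof -
    have "cmod (\<phi> i z - m (\<phi> i)) \<le> C + C"
      using C(2)[OF that] norm_mult_functional_le[OF m \<phi>J(2)[OF that(1)], of C] C(2)[OF that(1)]
      by (intro order_trans[OF norm_triangle_ineq4] add_mono) auto
    then show ?thesis using C(1) by (simp add: f_def norm_divide)
  qed
  have "\<exists>g C. (\<forall>j<n. g j holomorphic_on disc \<and> (\<forall>z\<in>disc. cmod (g j z) \<le> C)) \<and> (\<forall>z\<in>disc. (\<Sum>j<n. f j z * g j z) = 1)"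
  proof (rule corona[of "e / (2 * C)"])
    show "f j holomorphic_on disc" if "j < n" for j
      using \<phi>J(2)[OF that] unfolding f_def[abs_def] Hinf_def using C(1) by (intro holomorphic_intros) auto
    show "(e / (2 * C))^2 \<le> (\<Sum>j<n. (cmod (f j z))^2)" if "z \<in> disc" for z
    proof -
      obtain i where i: "i < n" "e \<le> cmod (\<phi> i z - m (\<phi> i))" using away[OF \<open>z \<in> disc\<close>] \<phi>(1) by auto
      have "e / (2 * C) \<le> cmod (f i z)" using i(2) C(1) by (simp add: f_def norm_divide divide_right_mono)
      then have "(e / (2 * C))^2 \<le> (cmod (f i z))^2" using e C by (intro power_mono) auto
      also have "\<dots> \<le> (\<Sum>j<n. (cmod (f j z))^2)" using i by (intro member_le_sum) auto
      finally show ?thesis .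
    qed
  qed (use e C bnd in auto)
  then obtain g D where g: "\<And>j. j < n \<Longrightarrow> g j holomorphic_on disc" "\<And>j z. j < n \<Longrightarrow> z \<in> disc \<Longrightarrow> cmod (g j z) \<le> D"
    "\<And>z. z \<in> disc \<Longrightarrow> (\<Sum>j<n. f j z * g j z) = 1" by blast
  define G where "G j = (\<lambda>z. if z \<in> disc then g j z else 0)" for j
  have G: "G j \<in> Hinf" if "j < n" for j unfolding G_def using g that by (intro HinfI) auto
  define f' where "f' j = (\<lambda>z. (1 / of_real (2 * C)) * (\<phi> j z + (- m (\<phi> j)) * indicator disc z))" for j
  have f': "f' j \<in> Hinf" "m (f' j) = 0" if "j < n" for j
  proof -
    note d = mult_functionals_diff_const[OF m \<phi>J(2)[OF that], of "- m (\<phi> j)"]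
    show "f' j \<in> Hinf" unfolding f'_def by (intro Hinf_cmult d)
    show "m (f' j) = 0" unfolding f'_def mult_functionals_cmult[OF m d(1)] d(2) by simp
  qed
  have "(\<lambda>z. \<Sum>j<n. f' j z * G j z) = indicator disc"
  proof
    fix z show "(\<Sum>j<n. f' j z * G j z) = indicator disc z"
      using g(3)[of z] by (cases "z \<in> disc") (auto simp: f'_def G_def f_def)
  qed
  moreover have "m (\<lambda>z. \<Sum>j<n. f' j z * G j z) = (\<Sum>j<n. m (\<lambda>z. f' j z * G j z))"
    using mult_functionals_sum[OF m, of "{..<n}" "\<lambda>j z. f' j z * G j z"] f' G Hinf_mult by auto
  moreover have "\<dots> = 0"
    using mult_functionals_mult[OF m] f' G by (intro sum.neutral) auto
  ultimately show False using mult_functionals_one[OF m] by simp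
qed

text \<open>If \<open>u\<close> stays within e/2 of \<open>F m\<close> on the disc part of an open
  \<open>U\<close>, then passing to the limit at another point m' of \<open>U\<close>, possible
  because \<open>disc_to m'\<close> is proper, keeps \<open>F m'\<close> within e/2 of
  \<open>F m\<close>. Limits along the disc at all points are therefore automatically
  continuous.\<close>

lemma continuous_extension_exists:
  fixes u :: "complex \<Rightarrow> 'a::metric_space"
  assumes L: "\<And>m. m \<in> mult_functionals \<Longrightarrow> (u \<longlongrightarrow> F m) (disc_to m)"
  shows "continuous_map M euclidean F"
  unfolding continuous_map_M_iff continuous_on_def
proof (intro ballI tendstoI)
  fix m and e :: real assume m: "m \<in> mult_functionals" and e: "0 < e"
  have "eventually (\<lambda>z. dist (u z) (F m) < e / 2) (disc_to m)" using tendstoD[OF L[OF m], of "e / 2"] e by simp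
  then obtain U where U: "openin M U" "m \<in> U" "\<And>z. z \<in> disc \<Longrightarrow> point_eval z \<in> U \<Longrightarrow> dist (u z) (F m) < e / 2"
    unfolding eventually_disc_to[OF m] by auto
  have close: "dist (F m') (F m) < e" if m': "m' \<in> U" for m'
  proof -
    have m'M: "m' \<in> mult_functionals" using openin_subset[OF U(1)] m' by auto
    have "eventually (\<lambda>z. dist (u z) (F m) < e / 2) (disc_to m')"
      unfolding eventually_disc_to[OF m'M] using U m' by blast
    then have "dist (F m') (F m) \<le> e / 2"
      by (intro tendsto_upperbound[OF tendsto_dist[OF L[OF m'M] tendsto_const] _ disc_dense[OF m'M]]) (auto elim: eventually_mono)
    then show ?thesis using e by simp
  qed
  obtain V where "open V" "U = mult_functionals \<inter> V"
    using U(1) unfolding max_ideal_space_eq openin_open by auto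
  then show "eventually (\<lambda>x. dist (F x) (F m) < e) (at m within mult_functionals)"
    unfolding eventually_at_topological using U(2) close by blast
qed

text \<open>The coordinate function belongs to \<open>Hinf\<close>, so convergence to an evaluation
  forces convergence in the plane.\<close>

lemma disc_to_point_eval:
  assumes z: "z \<in> disc" shows "disc_to (point_eval z) \<le> nhds z"
proof -
  have "((\<lambda>z. if z \<in> disc then z else 0) \<longlongrightarrow> z) (disc_to (point_eval z))"
  proof -
    have "point_eval z (\<lambda>z. if z \<in> disc then z else 0) = z"
      using Hinf_id z unfolding point_eval_def by (subst restrict_apply') auto
    then show ?thesis using tendsto_Hinf_disc_to[OF point_eval_mult[OF z] Hinf_id] by (simp only:)
  qed
  then have "((\<lambda>z. z) \<longlongrightarrow> z) (disc_to (point_eval z))"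
    by (rule Lim_transform_eventually) (use eventually_disc_to_disc[OF point_eval_mult[OF z]] in \<open>auto elim: eventually_mono\<close>)
  then show ?thesis by (simp add: filterlim_def filtermap_ident)
qed

section \<open>Interpolation by bounded analytic functions\<close>

lemma nn_integral_dA_scale:
  assumes F: "F \<in> borel_measurable borel" and R: "0 < R" and sub: "ball c R \<subseteq> disc"
  shows "ennreal (R^2) * (\<integral>\<^sup>+w. F (c + of_real R * w) \<partial>dA) = (\<integral>\<^sup>+x. F x * indicator (ball c R) x \<partial>dA)"
proof -
  have m: "(\<lambda>x. F x * indicator (ball c R) x) \<in> borel_measurable borel"
    by (intro borel_measurable_times_ennreal F borel_measurable_indicator) auto
  have T: "(\<lambda>w::complex. c + R *\<^sub>R w) \<in> borel_measurable borel" by (intro borel_measurable_continuous_onI continuous_intros)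
  have "(\<integral>\<^sup>+x. F x * indicator (ball c R) x \<partial>lborel) = (\<integral>\<^sup>+x. F x * indicator (ball c R) x \<partial>density (distr lborel borel (\<lambda>x. c + R *\<^sub>R x)) (\<lambda>_. \<bar>R\<bar> ^ DIM(complex)))"
    using R by (subst lborel_affine[of R c]) auto
  also have "\<dots> = (\<integral>\<^sup>+x. ennreal (R^2) * (F x * indicator (ball c R) x) \<partial>distr lborel borel (\<lambda>x. c + R *\<^sub>R x))"
    using m R by (subst nn_integral_density) auto
  also have "\<dots> = (\<integral>\<^sup>+w. ennreal (R^2) * (F (c + R *\<^sub>R w) * indicator (ball c R) (c + R *\<^sub>R w)) \<partial>lborel)"
    using m T by (subst nn_integral_distr) auto
  also have "\<dots> = (\<integral>\<^sup>+w. ennreal (R^2) * (F (c + of_real R * w) * indicator disc w) \<partial>lborel)"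
    using R by (intro nn_integral_cong) (auto simp: indicator_def dist_norm norm_mult scaleR_conv_of_real)
  also have "\<dots> = ennreal (R^2) * (\<integral>\<^sup>+w. F (c + of_real R * w) * indicator disc w \<partial>lborel)"
  proof (rule nn_integral_cmult)
    have "(\<lambda>w. F (c + of_real R * w)) \<in> borel_measurable borel"
      by (intro measurable_compose[OF _ F] borel_measurable_continuous_onI continuous_intros)
    then show "(\<lambda>w. F (c + of_real R * w) * indicator disc w) \<in> borel_measurable lborel"
      unfolding measurable_lborel2 by (intro borel_measurable_times_ennreal borel_measurable_indicator) auto
  qed
  finally have "(\<integral>\<^sup>+x. F x * indicator (ball c R) x \<partial>lborel) = ennreal (R^2) * (\<integral>\<^sup>+w. F (c + of_real R * w) * indicator disc w \<partial>lborel)" .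
  moreover have "(\<integral>\<^sup>+x. F x * indicator (ball c R) x * indicator disc x \<partial>lborel) = (\<integral>\<^sup>+x. F x * indicator (ball c R) x \<partial>lborel)"
    using sub by (intro nn_integral_cong) (auto simp: indicator_def)
  moreover have "(\<lambda>w. F (c + of_real R * w)) \<in> borel_measurable dA"
    by (intro borel_measurable_dA_I measurable_compose[OF _ F] borel_measurable_continuous_onI continuous_intros)
  ultimately show ?thesis
    using m by (subst (1 2) nn_integral_dA) (auto intro: borel_measurable_dA_I simp: ennreal_times_divide)
qed

text \<open>The mean value property is applied to the square of \<open>g\<close> on the rescaled
  disc; R^2 is the normalized area of that disc.\<close>

lemma norm_square_le_ball_mean:
  assumes g: "g holomorphic_on disc" and R: "0 < R" and sub: "cball c R \<subseteq> disc"
  shows "ennreal (R^2 * (cmod (g c))^2) \<le> (\<integral>\<^sup>+x. ennreal ((cmod (g x))^2) * indicator (ball c R) x \<partial>dA)"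
proof -
  define F where "F x = ennreal ((cmod (indicator disc x *\<^sub>R g x))^2)" for x
  have F: "F \<in> borel_measurable borel"
  proof -
    have "(\<lambda>x. indicator disc x *\<^sub>R g x) \<in> borel_measurable borel"
      by (intro borel_measurable_continuous_on_indicator holomorphic_on_imp_continuous_on g) auto
    then show ?thesis unfolding F_def by measurable
  qed
  define h where "h w = (g (c + of_real R * w))^2" for w
  have inb: "c + of_real R * w \<in> cball c R" if "w \<in> cball 0 1" for w
    using that R by (simp add: dist_norm norm_mult mult_left_le)
  have h: "h holomorphic_on disc"
  proof -
    have "(g \<circ> (\<lambda>w. c + of_real R * w)) holomorphic_on disc"
      by (rule holomorphic_on_compose_gen[OF _ g]) (use inb sub in \<open>auto intro!: holomorphic_intros\<close>)
    then show ?thesis unfolding h_def[abs_def] by (intro holomorphic_intros) (simp add: o_def)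
  qed
  have cont: "continuous_on (cball 0 1) h"
    unfolding h_def[abs_def]
    by (intro continuous_intros continuous_on_compose2[OF holomorphic_on_imp_continuous_on[OF g]]) (use inb sub in auto)
  have "g c ^ 2 = (\<integral>w. h w \<partial>dA)"
    using mean_value_dA[OF h integrable_dA_continuous_cball[OF cont]] by (simp add: h_def)
  then have "(cmod (g c))^2 = cmod (\<integral>w. h w \<partial>dA)" by (metis norm_power)
  also have "ennreal \<dots> \<le> (\<integral>\<^sup>+w. ennreal (cmod (h w)) \<partial>dA)"
    by (rule integral_norm_bound_ennreal[OF integrable_dA_continuous_cball[OF cont]])
  also have "\<dots> = (\<integral>\<^sup>+w. F (c + of_real R * w) \<partial>dA)"
    using inb sub by (intro nn_integral_cong) (auto simp: F_def h_def norm_power indicator_def subset_iff)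
  finally have "ennreal (R^2) * ennreal ((cmod (g c))^2) \<le> ennreal (R^2) * (\<integral>\<^sup>+w. F (c + of_real R * w) \<partial>dA)"
    by (rule mult_left_mono) simp
  also have "\<dots> = (\<integral>\<^sup>+x. F x * indicator (ball c R) x \<partial>dA)"
    by (rule nn_integral_dA_scale[OF F R]) (use sub in auto)
  also have "\<dots> = (\<integral>\<^sup>+x. ennreal ((cmod (g x))^2) * indicator (ball c R) x \<partial>dA)"
    by (intro nn_integral_cong) (auto simp: F_def)
  finally show ?thesis by (simp add: ennreal_mult)
qed

text \<open>The identity holds for the dilates of \<open>f\<close>, which are analytic past the
  circle and bounded by 1 there; Fatou's lemma removes the dilation.\<close>

lemma Littlewood_Paley_bounded:
  assumes f: "f holomorphic_on disc" and f1: "\<And>z. z \<in> disc \<Longrightarrow> cmod (f z) \<le> 1"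
  shows "(\<integral>\<^sup>+x. ennreal ((1 - (cmod x)^2) * (cmod (deriv f x))^2) \<partial>dA) \<le> 1"
proof -
  define r where "r N = 1 - 1 / (real N + 2)" for N
  have r: "0 < r N" "r N < 1" for N by (auto simp: r_def field_simps)
  have rlim: "r \<longlonglongrightarrow> 1"
  proof -
    have "(\<lambda>N. 1 - 1 / (real N + 2)) \<longlonglongrightarrow> 1 - 0"
      by (intro tendsto_intros tendsto_divide_0[OF tendsto_const] filterlim_at_top_imp_at_infinity
          filterlim_tendsto_add_at_top[OF tendsto_const, of _ _ 2, simplified add.commute] filterlim_real_sequentially)
    then show ?thesis by (simp add: r_def[abs_def])
  qed
  define u where "u N x = (1 - (cmod x)^2) * (cmod (of_real (r N) * deriv f (of_real (r N) * x)))^2" for N x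
  have bound: "(\<integral>\<^sup>+x. ennreal (u N x) \<partial>dA) \<le> 1" and um: "u N \<in> borel_measurable dA" for N
  proof -
    have R: "1 < 1 / r N" using r[of N] by (simp add: field_simps)
    have m: "of_real (r N) * z \<in> disc" if "z \<in> ball 0 (1 / r N)" for z
      using that r[of N] by (simp add: norm_mult field_simps)
    define g where "g = (\<lambda>z. f (of_real (r N) * z))"
    have gh: "g holomorphic_on ball 0 (1 / r N)"
    proof -
      have "(f \<circ> (\<lambda>z. of_real (r N) * z)) holomorphic_on ball 0 (1 / r N)"
        by (rule holomorphic_on_compose_gen[OF _ f]) (use m in \<open>auto intro!: holomorphic_intros\<close>)
      then show ?thesis by (simp add: o_def g_def)
    qed
    have dg: "deriv g x = of_real (r N) * deriv f (of_real (r N) * x)" if "x \<in> ball 0 (1 / r N)" for x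
    proof -
      have "(f has_field_derivative deriv f (of_real (r N) * x)) (at (of_real (r N) * x))"
        by (rule holomorphic_derivI[OF f open_ball m[OF that]])
      then have "((\<lambda>z. f (of_real (r N) * z)) has_field_derivative deriv f (of_real (r N) * x) * of_real (r N)) (at x)"
        by (intro DERIV_chain2[where g="\<lambda>z. of_real (r N) * z"]) (auto intro!: derivative_eq_intros)
      then show ?thesis unfolding g_def by (simp add: DERIV_imp_deriv mult.commute)
    qed
    note c = continuous_on_cball_deriv[OF gh R]
    have c': "continuous_on (cball 0 1) (\<lambda>x. (1 - (cmod x)^2) * (cmod (deriv g x))^2)" by (intro continuous_intros c)
    have ueq: "u N x = (1 - (cmod x)^2) * (cmod (deriv g x))^2" if "x \<in> disc" for x
      using dg[of x] that R by (simp add: u_def)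
    have "(\<lambda>x. (1 - (cmod x)^2) * (cmod (deriv g x))^2) \<in> borel_measurable dA"
      by (rule continuous_on_borel_measurable_dA[OF continuous_on_subset[OF c']]) auto
    then show "u N \<in> borel_measurable dA"
      by (rule measurable_cong[THEN iffD2, rotated]) (use ueq in auto)
    have "(\<integral>\<^sup>+x. ennreal (u N x) \<partial>dA) = (\<integral>\<^sup>+x. ennreal ((1 - (cmod x)^2) * (cmod (deriv g x))^2) \<partial>dA)"
      by (intro nn_integral_cong) (simp add: ueq)
    also have "\<dots> = ennreal (\<integral>x. (1 - (cmod x)^2) * (cmod (deriv g x))^2 \<partial>dA)"
      by (rule nn_integral_eq_integral[OF integrable_dA_continuous_cball[OF c']])
         (auto intro!: AE_I2 mult_nonneg_nonneg simp: abs_square_le_1 less_imp_le)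
    also have "\<dots> \<le> ennreal (circle_mean (\<lambda>z. (cmod (g z))^2) 1)"
      by (intro ennreal_leI Littlewood_Paley_le[OF gh R])
    also have "\<dots> \<le> ennreal (circle_mean (\<lambda>z. 1) 1)"
    proof (intro ennreal_leI circle_mean_mono)
      show "continuous_on (sphere 0 \<bar>1\<bar>) (\<lambda>z. (cmod (g z))^2)"
        by (intro continuous_intros continuous_on_subset[OF c(1)]) auto
      show "(cmod (g z))^2 \<le> 1" if "cmod z = \<bar>1\<bar>" for z
        using f1[OF m[of z]] that R by (simp add: g_def abs_square_le_1)
    qed auto
    also have "\<dots> = 1" by (simp add: circle_mean_const)
    finally show "(\<integral>\<^sup>+x. ennreal (u N x) \<partial>dA) \<le> 1" .
  qed
  have lim: "(\<lambda>N. ennreal (u N x)) \<longlonglongrightarrow> ennreal ((1 - (cmod x)^2) * (cmod (deriv f x))^2)" if x: "x \<in> disc" for x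
  proof -
    have "isCont (deriv f) x"
      using holomorphic_on_imp_continuous_on[OF holomorphic_deriv[OF f open_ball]] x by (simp add: continuous_on_eq_continuous_at)
    moreover have "(\<lambda>N. of_real (r N) * x) \<longlonglongrightarrow> of_real 1 * x" by (intro tendsto_intros rlim)
    ultimately have "(\<lambda>N. deriv f (of_real (r N) * x)) \<longlonglongrightarrow> deriv f x"
      using isCont_tendsto_compose by fastforce
    then have "(\<lambda>N. u N x) \<longlonglongrightarrow> (1 - (cmod x)^2) * (cmod (of_real 1 * deriv f x))^2"
      unfolding u_def by (intro tendsto_intros rlim)
    then show ?thesis by (intro tendsto_ennrealI) simp
  qed
  have "(\<integral>\<^sup>+x. ennreal ((1 - (cmod x)^2) * (cmod (deriv f x))^2) \<partial>dA) = (\<integral>\<^sup>+x. liminf (\<lambda>N. ennreal (u N x)) \<partial>dA)"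
    by (intro nn_integral_cong) (use lim in \<open>auto intro!: lim_imp_Liminf[symmetric]\<close>)
  also have "\<dots> \<le> liminf (\<lambda>N. \<integral>\<^sup>+x. ennreal (u N x) \<partial>dA)"
    using um by (intro nn_integral_liminf) auto
  also have "\<dots> \<le> 1"
    by (rule Liminf_le) (use bound in auto)
  finally show ?thesis .
qed

lemma rho_le_of_ball:
  assumes "z \<in> disc" "x \<in> disc" "cmod (z - x) \<le> c * (1 - cmod z)"
  shows "rho z x \<le> c"
proof -
  have "cmod (cnj z * x) \<le> cmod z * 1" using assms by (simp add: norm_mult mult_left_le)
  then have d: "1 - cmod z \<le> cmod (1 - cnj z * x)" using norm_triangle_ineq2[of 1 "cnj z * x"] by simp
  have z: "0 < 1 - cmod z" using assms by simp
  have c: "0 \<le> c" using assms(3) z norm_ge_zero[of "z - x"] by (meson not_le mult_neg_pos order_trans le_less_trans)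
  have "cmod (z - x) \<le> c * cmod (1 - cnj z * x)" using assms(3) d c by (meson mult_left_mono order_trans)
  moreover have "0 < cmod (1 - cnj z * x)" using d z by linarith
  ultimately show ?thesis by (simp add: rho_def disc_aut_def norm_divide divide_le_eq)
qed

text \<open>Discs of radius (1 - |z|)/4 around the points are disjoint. On each of them the integral
  of (1 - |x|^2)|f'|^2 is at least e^2 (1 - |z|^2)/200 by subharmonicity, and the total integral is
  at most 1.\<close>

lemma sum_separated_le:
  assumes f: "f holomorphic_on disc" and f1: "\<And>z. z \<in> disc \<Longrightarrow> cmod (f z) \<le> 1"
    and S: "finite S" "S \<subseteq> disc" and e: "0 < e"
    and low: "\<And>z. z \<in> S \<Longrightarrow> e \<le> (1 - (cmod z)^2) * cmod (deriv f z)"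
    and sep: "\<And>z z'. z \<in> S \<Longrightarrow> z' \<in> S \<Longrightarrow> z \<noteq> z' \<Longrightarrow> q z z' \<le> 1/2"
  shows "(\<Sum>z\<in>S. 1 - (cmod z)^2) \<le> 200 / e^2"
proof -
  define R where "R z = (1 - cmod z) / 4" for z :: complex
  define V where "V x = ennreal ((1 - (cmod x)^2) * (cmod (deriv f x))^2)" for x
  have df: "deriv f holomorphic_on disc" by (intro holomorphic_deriv f) auto
  have Vm: "V \<in> borel_measurable dA" unfolding V_def
    by (intro measurable_compose[OF _ measurable_ennreal] continuous_on_borel_measurable_dA continuous_intros
        holomorphic_on_imp_continuous_on df)
  have Bsub: "cball z (R z) \<subseteq> disc" if "z \<in> S" for z
  proof
    fix x assume "x \<in> cball z (R z)"
    then have "cmod (z - x) \<le> R z" by (simp add: dist_norm)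
    then have "cmod x \<le> cmod z + R z" using norm_triangle_ineq2[of x z] by (simp add: norm_minus_commute)
    moreover have "cmod z < 1" using that S by auto
    ultimately have "cmod x < 1" unfolding R_def by argo
    then show "x \<in> disc" by simp
  qed
  \<comment> \<open>At a common point x, Harnack with r = 1/4 gives q(z',x) \<le> (1/2)(16/9) = 8/9,
    whereas rho(z',x) \<le> 1/4 gives q(z',x) \<ge> 15/16.\<close>
  have disj: "ball z (R z) \<inter> ball z' (R z') = {}" if zz: "z \<in> S" "z' \<in> S" "z \<noteq> z'" for z z'
  proof (rule ccontr)
    assume "ball z (R z) \<inter> ball z' (R z') \<noteq> {}"
    then obtain x where x: "x \<in> ball z (R z)" "x \<in> ball z' (R z')" by auto
    have xd: "x \<in> disc" using subsetD[OF Bsub[OF zz(1)], of x] x(1) by simp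
    have r1: "rho z x \<le> 1/4" using x(1) zz S xd by (intro rho_le_of_ball) (auto simp: R_def dist_norm)
    have r2: "rho z' x \<le> 1/4" using x(2) zz S xd by (intro rho_le_of_ball) (auto simp: R_def dist_norm)
    have "q z' x \<le> q z' z / (1 - 1/4)^2"
      using zz S xd r1 by (intro q_Harnack) (auto simp: rho_commute)
    moreover have "15/16 \<le> q z' x"
      using power_mono[OF r2, of 2] by (simp add: q_def power2_eq_square)
    moreover have "q z' z \<le> 1/2" using sep zz by (metis q_commute)
    ultimately show False by (simp add: power2_eq_square)
  qed
  have single: "ennreal (1 - (cmod z)^2) \<le> ennreal (200 / e^2) * (\<integral>\<^sup>+x. V x * indicator (ball z (R z)) x \<partial>dA)" if z: "z \<in> S" for z
  proof -
    have zd: "cmod z < 1" using z S by auto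
    have R0: "0 < R z" using zd by (simp add: R_def)
    define a where "a = 1 - (cmod z)^2"
    have "a = (1 - cmod z) * (1 + cmod z)" by (simp add: a_def power2_eq_square algebra_simps)
    also have "\<dots> \<le> (1 - cmod z) * 2" using zd by (intro mult_left_mono) auto
    finally have a: "0 < a" "a \<le> 8 * R z" using zd by (auto simp: a_def R_def abs_square_less_1)
    have low': "e^2 \<le> a^2 * (cmod (deriv f z))^2"
      using power_mono[OF low[OF z], of 2] e by (simp add: a_def power_mult_distrib)
    \<comment> \<open>Source of the 200: the weight is at least 3a/8 on the disc, and 64 a \<le> 200
      (3a/8); the 64 comes from the square of a \<le> 8 R.\<close>
    have onball: "3 * a / 8 \<le> 1 - (cmod x)^2" if "x \<in> ball z (R z)" for x
    proof -
      have "cmod x \<le> cmod z + R z" using that norm_triangle_ineq2[of x z] by (simp add: dist_norm norm_minus_commute)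
      then have x: "3 * R z \<le> 1 - cmod x" unfolding R_def by argo
      then have "cmod x \<le> 1" using R0 by linarith
      then have "(cmod x)^2 \<le> cmod x" by (simp add: power2_eq_square mult_left_le)
      then show ?thesis using x a by linarith
    qed
    have "ennreal (e^2 * a) \<le> ennreal (64 * a * ((R z)^2 * (cmod (deriv f z))^2))"
    proof (rule ennreal_leI)
      have "e^2 * a \<le> a^2 * (cmod (deriv f z))^2 * a" using low' a by (intro mult_right_mono) auto
      also have "\<dots> = a * (cmod (deriv f z))^2 * a^2" by simp
      also have "\<dots> \<le> a * (cmod (deriv f z))^2 * (8 * R z)^2" using a by (intro mult_left_mono power_mono) auto
      finally show "e^2 * a \<le> 64 * a * ((R z)^2 * (cmod (deriv f z))^2)" by (simp add: power_mult_distrib mult_ac)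
    qed
    also have "\<dots> = ennreal (64 * a) * ennreal ((R z)^2 * (cmod (deriv f z))^2)" using a by (subst ennreal_mult) auto
    also have "\<dots> \<le> ennreal (64 * a) * (\<integral>\<^sup>+x. ennreal ((cmod (deriv f x))^2) * indicator (ball z (R z)) x \<partial>dA)"
      by (intro mult_left_mono norm_square_le_ball_mean[OF df R0 Bsub[OF z]]) auto
    also have "\<dots> = (\<integral>\<^sup>+x. ennreal (64 * a) * (ennreal ((cmod (deriv f x))^2) * indicator (ball z (R z)) x) \<partial>dA)"
    proof (rule nn_integral_cmult[symmetric])
      have "ball z (R z) \<in> sets dA" using Bsub[OF z] by (auto simp: sets_dA sets_restrict_space_iff)
      moreover have "(\<lambda>x. ennreal ((cmod (deriv f x))^2)) \<in> borel_measurable dA"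
        by (intro measurable_compose[OF _ measurable_ennreal] continuous_on_borel_measurable_dA continuous_intros
            holomorphic_on_imp_continuous_on df)
      ultimately show "(\<lambda>x. ennreal ((cmod (deriv f x))^2) * indicator (ball z (R z)) x) \<in> borel_measurable dA" by measurable
    qed
    also have "\<dots> \<le> (\<integral>\<^sup>+x. ennreal 200 * (V x * indicator (ball z (R z)) x) \<partial>dA)"
    proof (rule nn_integral_mono)
      fix x
      have "64 * a * (cmod (deriv f x))^2 \<le> 200 * ((1 - (cmod x)^2) * (cmod (deriv f x))^2)" if "x \<in> ball z (R z)"
      proof -
        have "64 * a \<le> 200 * (1 - (cmod x)^2)"
        proof -
          have "200 * (3 * a / 8) \<le> 200 * (1 - (cmod x)^2)" by (intro mult_left_mono onball that) auto
          then show ?thesis using a(1) by simp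
        qed
        from mult_right_mono[OF this, of "(cmod (deriv f x))^2"] show ?thesis by (simp only: mult.assoc) simp
      qed
      then show "ennreal (64 * a) * (ennreal ((cmod (deriv f x))^2) * indicator (ball z (R z)) x) \<le> ennreal 200 * (V x * indicator (ball z (R z)) x)"
        using a by (cases "x \<in> ball z (R z)") (auto simp: V_def indicator_def simp flip: ennreal_mult' ennreal_numeral intro!: ennreal_leI)
    qed
    also have "\<dots> = ennreal 200 * (\<integral>\<^sup>+x. V x * indicator (ball z (R z)) x \<partial>dA)"
    proof (rule nn_integral_cmult)
      have "ball z (R z) \<in> sets dA" using Bsub[OF z] by (auto simp: sets_dA sets_restrict_space_iff)
      then show "(\<lambda>x. V x * indicator (ball z (R z)) x) \<in> borel_measurable dA" using Vm by measurable
    qed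
    finally have "ennreal (1 / e^2) * ennreal (e^2 * a) \<le> ennreal (1 / e^2) * (ennreal 200 * (\<integral>\<^sup>+x. V x * indicator (ball z (R z)) x \<partial>dA))"
      by (rule mult_left_mono) simp
    then show ?thesis using e a
      by (simp add: a_def[symmetric] mult.assoc[symmetric] flip: ennreal_mult' ennreal_numeral)
  qed
  have "ennreal (\<Sum>z\<in>S. 1 - (cmod z)^2) = (\<Sum>z\<in>S. ennreal (1 - (cmod z)^2))"
    using S by (intro sum_ennreal[symmetric]) (auto simp: abs_square_le_1 less_imp_le subset_iff)
  also have "\<dots> \<le> (\<Sum>z\<in>S. ennreal (200 / e^2) * (\<integral>\<^sup>+x. V x * indicator (ball z (R z)) x \<partial>dA))"
    by (intro sum_mono single)
  also have "\<dots> = ennreal (200 / e^2) * (\<Sum>z\<in>S. \<integral>\<^sup>+x. V x * indicator (ball z (R z)) x \<partial>dA)"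
    by (simp add: sum_distrib_left)
  also have "(\<Sum>z\<in>S. \<integral>\<^sup>+x. V x * indicator (ball z (R z)) x \<partial>dA) = (\<integral>\<^sup>+x. (\<Sum>z\<in>S. V x * indicator (ball z (R z)) x) \<partial>dA)"
  proof (rule nn_integral_sum[symmetric])
    fix z assume "z \<in> S"
    then have "ball z (R z) \<in> sets dA" using Bsub by (force simp: sets_dA sets_restrict_space_iff)
    then show "(\<lambda>x. V x * indicator (ball z (R z)) x) \<in> borel_measurable dA" using Vm by measurable
  qed
  also have "\<dots> \<le> (\<integral>\<^sup>+x. V x \<partial>dA)"
  proof (rule nn_integral_mono)
    fix x
    have "(\<Sum>z\<in>S. indicator (ball z (R z)) x) = (indicator (\<Union>z\<in>S. ball z (R z)) x :: ennreal)"
      using disj S(1) by (intro indicator_UN_disjoint[symmetric]) (auto simp: disjoint_family_on_def)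
    then have "(\<Sum>z\<in>S. V x * indicator (ball z (R z)) x) = V x * indicator (\<Union>z\<in>S. ball z (R z)) x"
      by (simp flip: sum_distrib_left)
    also have "\<dots> \<le> V x * 1" by (intro mult_left_mono) (auto simp: indicator_def)
    finally show "(\<Sum>z\<in>S. V x * indicator (ball z (R z)) x) \<le> V x" by simp
  qed
  also have "\<dots> \<le> 1" unfolding V_def by (rule Littlewood_Paley_bounded[OF f f1])
  finally have "ennreal (\<Sum>z\<in>S. 1 - (cmod z)^2) \<le> ennreal (200 / e^2)" by (simp add: mult_left_mono)
  then show ?thesis by (simp add: ennreal_le_iff)
qed

text \<open>The quantity (1 - |x|^2)|f'(x)| is the size of the derivative measured in the hyperbolic
  metric, hence conformally invariant.\<close>

lemma norm_deriv_disc_aut: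
  assumes f: "f holomorphic_on disc" and a: "a \<in> disc" and x: "x \<in> disc"
  shows "(1 - (cmod x)^2) * cmod (deriv (\<lambda>z. f (disc_aut a z)) x)
     = (1 - (cmod (disc_aut a x))^2) * cmod (deriv f (disc_aut a x))"
proof -
  have "(f has_field_derivative deriv f (disc_aut a x)) (at (disc_aut a x))"
    by (rule holomorphic_derivI[OF f open_ball disc_aut_in_disc[OF a x]])
  from DERIV_chain2[OF this has_field_derivative_disc_aut[OF a x]]
  have dg: "deriv (\<lambda>z. f (disc_aut a z)) x = deriv f (disc_aut a x) * (- (1 - (cmod a)^2) / (1 - cnj a * x)^2)"
    by (rule DERIV_imp_deriv)
  have "cmod (- (1 - (cmod a)^2) / (1 - cnj a * x)^2) = \<bar>1 - (cmod a)^2\<bar> / (cmod (1 - cnj a * x))^2"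
  proof -
    have "cmod (- (1 - (cmod a)^2)) = cmod (complex_of_real (1 - (cmod a)^2))" by (metis norm_minus_cancel of_real_minus)
    then show ?thesis unfolding norm_divide norm_power norm_of_real by simp
  qed
  also have "\<bar>1 - (cmod a)^2\<bar> = 1 - (cmod a)^2" using a by (simp add: abs_square_le_1 less_imp_le)
  finally show ?thesis
    unfolding dg norm_mult one_minus_disc_aut[OF a x] by (simp add: mult_ac)
qed

text \<open>The set of points near which \<open>f\<close> is hyperbolically steep satisfies a Carleson condition.\<close>

lemma sum_q_separated_le:
  assumes f: "f holomorphic_on disc" and f1: "\<And>z. z \<in> disc \<Longrightarrow> cmod (f z) \<le> 1"
    and S: "finite S" "S \<subseteq> disc" and e: "0 < e" and r: "0 \<le> r" "r < 1" and a: "a \<in> disc"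
    and near: "\<And>z. z \<in> S \<Longrightarrow> \<exists>y\<in>disc. rho z y \<le> r \<and> e \<le> (1 - (cmod y)^2) * cmod (deriv f y)"
    and sep: "\<And>z z'. z \<in> S \<Longrightarrow> z' \<in> S \<Longrightarrow> z \<noteq> z' \<Longrightarrow> q z z' \<le> (1 - r) ^ 4 / 2"
  shows "(\<Sum>z\<in>S. q a z) \<le> 200 / (e^2 * (1 - r)^2)"
proof -
  obtain y where y: "\<And>z. z \<in> S \<Longrightarrow> y z \<in> disc" "\<And>z. z \<in> S \<Longrightarrow> rho z (y z) \<le> r"
     "\<And>z. z \<in> S \<Longrightarrow> e \<le> (1 - (cmod (y z))^2) * cmod (deriv f (y z))"
    using near by metis
  have Sd: "z \<in> disc" if "z \<in> S" for z using that S by auto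
  \<comment> \<open>Both points are moved by rho at most r, and each move costs a Harnack factor (1
    - r)^(-2); the hypothesis carries (1 - r)^4 to pay for them.\<close>
  have sepy: "q (y z) (y z') \<le> 1/2" if zz: "z \<in> S" "z' \<in> S" "z \<noteq> z'" for z z'
  proof -
    have "q (y z) (y z') \<le> q (y z) z' / (1 - r)^2"
      using y[OF zz(2)] y[OF zz(1)] Sd zz r by (intro q_Harnack) (auto simp: rho_commute)
    also have "q (y z) z' = q z' (y z)" by (rule q_commute)
    also have "q z' (y z) / (1 - r)^2 \<le> (q z' z / (1 - r)^2) / (1 - r)^2"
      using y[OF zz(1)] Sd zz r by (intro divide_right_mono q_Harnack) (auto simp: rho_commute)
    also have "\<dots> \<le> (((1 - r) ^ 4 / 2) / (1 - r)^2) / (1 - r)^2"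
      using sep[OF zz(2,1)] zz by (intro divide_right_mono) auto
    also have "\<dots> = 1/2" using r by (simp add: power4_eq_xxxx power2_eq_square)
    finally show ?thesis .
  qed
  \<comment> \<open>Moves \<open>a\<close> to the origin, where q(a, y z) becomes 1 - |\<psi> z|^2
    and the unweighted estimate applies to f \<circ> \<phi>_a.\<close>
  define \<psi> where "\<psi> z = disc_aut a (y z)" for z
  have inj: "inj_on \<psi> S"
  proof (rule inj_onI)
    fix z z' assume zz: "z \<in> S" "z' \<in> S" "\<psi> z = \<psi> z'"
    then have "y z = y z'" unfolding \<psi>_def by (metis disc_aut_invol a y(1))
    then show "z = z'" using sepy[OF zz(1,2)] by (auto simp: q_def)
  qed
  define g where "g = (\<lambda>z. f (disc_aut a z))"
  have "(\<Sum>z\<in>\<psi> ` S. 1 - (cmod z)^2) \<le> 200 / e^2"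
  proof (rule sum_separated_le[of g])
    show "g holomorphic_on disc" unfolding g_def by (rule holomorphic_disc_aut_compose[OF a f])
    show "cmod (g z) \<le> 1" if "z \<in> disc" for z unfolding g_def by (rule f1[OF disc_aut_in_disc[OF a that]])
    show "\<psi> ` S \<subseteq> disc" using y(1) disc_aut_in_disc[OF a] by (auto simp: \<psi>_def)
    show "e \<le> (1 - (cmod x)^2) * cmod (deriv g x)" if xS: "x \<in> \<psi> ` S" for x
    proof -
      obtain z where z: "z \<in> S" "x = \<psi> z" using xS by auto
      have xd: "x \<in> disc" and ax: "disc_aut a x = y z"
        using z y(1) disc_aut_in_disc[OF a] disc_aut_invol[OF a] by (auto simp: \<psi>_def)
      have "(1 - (cmod x)^2) * cmod (deriv g x) = (1 - (cmod (y z))^2) * cmod (deriv f (y z))"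
        unfolding g_def norm_deriv_disc_aut[OF f a xd] ax ..
      then show ?thesis using y(3)[OF z(1)] by simp
    qed
    show "q v v' \<le> 1/2" if v: "v \<in> \<psi> ` S" "v' \<in> \<psi> ` S" "v \<noteq> v'" for v v'
    proof -
      obtain z z' where z: "z \<in> S" "z' \<in> S" "v = \<psi> z" "v' = \<psi> z'" using v by auto
      then have "z \<noteq> z'" using v by auto
      then show ?thesis using sepy[OF z(1,2)] y(1) a z by (simp add: \<psi>_def q_disc_aut)
    qed
  qed (use S e in auto)
  then have s: "(\<Sum>z\<in>S. q a (y z)) \<le> 200 / e^2"
    unfolding sum.reindex[OF inj] by (simp add: \<psi>_def q_def rho_def)
  have "(\<Sum>z\<in>S. q a z) \<le> (\<Sum>z\<in>S. q a (y z) / (1 - r)^2)"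
    using y Sd r a by (intro sum_mono q_Harnack) auto
  also have "\<dots> = (\<Sum>z\<in>S. q a (y z)) / (1 - r)^2" by (simp add: sum_divide_distrib)
  also have "\<dots> \<le> (200 / e^2) / (1 - r)^2" by (intro divide_right_mono s) auto
  finally show ?thesis by (simp add: mult.commute)
qed

section \<open>Finite Blaschke products and interpolation\<close>

definition blaschke :: "complex set \<Rightarrow> complex \<Rightarrow> complex" where
  "blaschke S x = (\<Prod>z\<in>S. disc_aut z x)"

text \<open>For t \<le> 3/4 one has ln(1 - t) \<ge> - t/(1 - t) \<ge> -4t, and rho^2 = 1 -
  q.\<close>

lemma exp_le_rho:
  assumes "0 \<le> q z x" "q z x \<le> 3/4" shows "exp (- 2 * q z x) \<le> rho z x"
proof -
  define t where "t = q z x"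
  have t: "0 \<le> t" "t \<le> 3/4" using assms by (simp_all add: t_def)
  have "- (4 * t) \<le> 1 - 1 / (1 - t)"
  proof -
    have "t / (1 - t) \<le> t / (1/4)" using t by (intro divide_left_mono) auto
    moreover have "1 - 1 / (1 - t) = - (t / (1 - t))" using t by (simp add: field_simps)
    ultimately show ?thesis by simp
  qed
  also have "\<dots> \<le> ln (1 - t)" using ln_le_minus_one[of "1 / (1 - t)"] t by (simp add: ln_div)
  finally have "exp (- (4 * t)) \<le> exp (ln (1 - t))" by simp
  also have "exp (ln (1 - t)) = 1 - t" using t by simp
  also have "\<dots> = (rho z x)^2" by (simp add: t_def q_def)
  also have "exp (- (4 * t)) = (exp (- 2 * t))^2" by (simp add: power2_eq_square flip: exp_add)
  finally have "(exp (- 2 * t))^2 \<le> (rho z x)^2" .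
  then show ?thesis unfolding t_def by (rule power2_le_imp_le) simp
qed

lemma prod_rho_ge:
  assumes "finite S" "\<And>z. z \<in> S \<Longrightarrow> 0 \<le> q z x \<and> q z x \<le> 3/4" "(\<Sum>z\<in>S. q z x) \<le> C"
  shows "exp (- 2 * C) \<le> (\<Prod>z\<in>S. rho z x)"
proof -
  have "exp (- 2 * C) \<le> exp (\<Sum>z\<in>S. - 2 * q z x)" using assms(3) by (simp flip: sum_distrib_left add: sum_negf)
  also have "\<dots> = (\<Prod>z\<in>S. exp (- 2 * q z x))" by (rule exp_sum[OF assms(1)])
  also have "\<dots> \<le> (\<Prod>z\<in>S. rho z x)" using assms(2) by (intro prod_mono conjI exp_le_rho) auto
  finally show ?thesis .
qed

lemma holomorphic_blaschke:
  "S \<subseteq> disc \<Longrightarrow> blaschke S holomorphic_on disc"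
  unfolding blaschke_def[abs_def] by (intro holomorphic_intros holomorphic_disc_aut) auto

lemma norm_blaschke: "cmod (blaschke S x) = (\<Prod>z\<in>S. rho z x)"
  by (simp add: blaschke_def rho_def prod_norm)

lemma blaschke_le:
  assumes "finite S" "S \<subseteq> disc" "x \<in> disc"
  shows "cmod (blaschke S x) \<le> 1" "z \<in> S \<Longrightarrow> cmod (blaschke S x) \<le> rho z x"
proof -
  have 1: "(\<Prod>z\<in>T. rho z x) \<le> 1" if "T \<subseteq> S" for T
  proof -
    have "rho z x \<le> 1" if "z \<in> S" for z by (rule less_imp_le[OF rho_less_1[OF subsetD[OF assms(2) that] assms(3)]])
    then show ?thesis using that by (intro prod_le_1) auto
  qed
  show "cmod (blaschke S x) \<le> 1" unfolding norm_blaschke by (rule 1) auto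
  show "cmod (blaschke S x) \<le> rho z x" if "z \<in> S"
    unfolding norm_blaschke prod.remove[OF assms(1) that] using 1[of "S - {z}"] by (simp add: mult_left_le)
qed

text \<open>Only the point of \<open>S\<close> nearest to \<open>x\<close> can be hyperbolically
  close to \<open>x\<close>. It contributes at least \<open>t\<close>; the others fall under
  \<open>prod_rho_ge\<close>.\<close>

lemma blaschke_ge:
  assumes S: "finite S" "S \<subseteq> disc" and x: "x \<in> disc"
    and sep: "\<And>z z'. z \<in> S \<Longrightarrow> z' \<in> S \<Longrightarrow> z \<noteq> z' \<Longrightarrow> q z z' \<le> 1/8"
    and C: "(\<Sum>z\<in>S. q z x) \<le> C" and t: "0 \<le> t" "t \<le> 1" "\<And>z. z \<in> S \<Longrightarrow> t \<le> rho z x"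
  shows "t * exp (- 2 * C) \<le> cmod (blaschke S x)"
proof -
  have qp: "0 \<le> q z x" if "z \<in> S" for z using q_pos[of z x] S x that by auto
  have C0: "0 \<le> C" using C sum_nonneg[of S "\<lambda>z. q z x", OF qp] by linarith
  show ?thesis
  proof (cases "S = {}")
    case True
    have "t * exp (- 2 * C) \<le> 1 * 1" using t C0 by (intro mult_mono) auto
    then show ?thesis using True by (simp add: blaschke_def)
  next
    case False
    obtain z0 where z0: "z0 \<in> S" "\<And>z. z \<in> S \<Longrightarrow> rho z0 x \<le> rho z x"
      using arg_min_if_finite[OF S(1) False, of "\<lambda>z. rho z x"] by (metis not_le)
    \<comment> \<open>If a second point had q > 3/4, the nearest one would also lie within 1/2 of
      \<open>x\<close>, and Harnack with the separation 1/8 would force q \<le> 1/2.\<close>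
    have far: "q z x \<le> 3/4" if z: "z \<in> S" "z \<noteq> z0" for z
    proof (rule ccontr)
      assume "\<not> q z x \<le> 3/4"
      then have "(rho z x)^2 < (1/2)^2" by (simp add: q_def power2_eq_square)
      then have "rho z x < 1/2" by (rule power2_less_imp_less) simp
      then have "rho z0 x \<le> 1/2" using z0(2)[OF z(1)] by linarith
      then have "q z x \<le> q z z0 / (1 - 1/2)^2"
        using z z0 S x by (intro q_Harnack) (auto simp: rho_commute)
      also have "\<dots> \<le> 1/2" using sep[OF z(1) z0(1) z(2)] by (simp add: power2_eq_square)
      finally show False using \<open>\<not> q z x \<le> 3/4\<close> by simp
    qed
    have "(\<Sum>z\<in>S - {z0}. q z x) \<le> (\<Sum>z\<in>S. q z x)" using S qp by (intro sum_mono2) auto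
    then have "exp (- 2 * C) \<le> (\<Prod>z\<in>S - {z0}. rho z x)"
      using S qp far C by (intro prod_rho_ge) auto
    then have "t * exp (- 2 * C) \<le> rho z0 x * (\<Prod>z\<in>S - {z0}. rho z x)"
      using t z0(1) by (intro mult_mono) auto
    then show ?thesis unfolding norm_blaschke prod.remove[OF S(1) z0(1)] .
  qed
qed

text \<open>A lower Riemann sum of exp(-s) over the interval from 0 to the total weight, with the
  nodes ordered by decreasing \<open>m\<close>; ties only decrease the summands.\<close>

lemma sum_weight_exp_le_1:
  fixes t m :: "'a \<Rightarrow> real"
  assumes "finite S" "\<And>k. k \<in> S \<Longrightarrow> 0 \<le> t k"
  shows "(\<Sum>j\<in>S. t j * exp (- (\<Sum>k | k \<in> S \<and> m j \<le> m k. t k))) \<le> 1 - exp (- (\<Sum>k\<in>S. t k))"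
  using assms
proof (induction "card S" arbitrary: S)
  case 0
  then show ?case by simp
next
  case (Suc n)
  then have "S \<noteq> {}" by auto
  obtain x where x: "x \<in> S" "\<And>z. z \<in> S \<Longrightarrow> m x \<le> m z"
    using arg_min_if_finite[OF Suc.prems(1) \<open>S \<noteq> {}\<close>, of m] by (metis not_le)
  define T where "T = S - {x}"
  have T: "finite T" "card T = n" "S = insert x T" "x \<notin> T" using Suc x by (auto simp: T_def)
  have nn: "\<And>k. k \<in> S \<Longrightarrow> 0 \<le> t k" by fact
  have all: "{k \<in> S. m x \<le> m k} = S" using x(2) by auto
  have "(\<Sum>j\<in>S. t j * exp (- (\<Sum>k | k \<in> S \<and> m j \<le> m k. t k)))
     = t x * exp (- (\<Sum>k\<in>S. t k)) + (\<Sum>j\<in>T. t j * exp (- (\<Sum>k | k \<in> S \<and> m j \<le> m k. t k)))"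
    by (subst sum.remove[OF Suc.prems(1) x(1)]) (simp add: T_def all)
  also have "(\<Sum>j\<in>T. t j * exp (- (\<Sum>k | k \<in> S \<and> m j \<le> m k. t k))) \<le> (\<Sum>j\<in>T. t j * exp (- (\<Sum>k | k \<in> T \<and> m j \<le> m k. t k)))"
  proof (intro sum_mono mult_left_mono)
    fix j assume "j \<in> T"
    have "(\<Sum>k | k \<in> T \<and> m j \<le> m k. t k) \<le> (\<Sum>k | k \<in> S \<and> m j \<le> m k. t k)"
      using T(3) Suc.prems nn by (intro sum_mono2) auto
    then show "exp (- (\<Sum>k | k \<in> S \<and> m j \<le> m k. t k)) \<le> exp (- (\<Sum>k | k \<in> T \<and> m j \<le> m k. t k))" by simp
    show "0 \<le> t j" using nn T(3) \<open>j \<in> T\<close> by auto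
  qed
  also have "\<dots> \<le> 1 - exp (- (\<Sum>k\<in>T. t k))"
    using Suc.hyps(1)[of T] T nn by auto
  also have "t x * exp (- (\<Sum>k\<in>S. t k)) + (1 - exp (- (\<Sum>k\<in>T. t k))) \<le> 1 - exp (- (\<Sum>k\<in>S. t k))"
  proof -
    have "(\<Sum>k\<in>S. t k) = t x + (\<Sum>k\<in>T. t k)" using T by simp
    then have eq: "exp (- (\<Sum>k\<in>T. t k)) = exp (t x) * exp (- (\<Sum>k\<in>S. t k))" by (simp flip: exp_add)
    have "(1 + t x) * exp (- (\<Sum>k\<in>S. t k)) \<le> exp (t x) * exp (- (\<Sum>k\<in>S. t k))"
      by (intro mult_right_mono) auto
    then show ?thesis unfolding eq by (simp add: algebra_simps)
  qed
  finally show ?case by simp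
qed

text \<open>This is P. Jones's explicit solution.\<close>

lemma Jones_interpolation:
  fixes c :: "complex \<Rightarrow> complex"
  assumes S: "finite S" "S \<subseteq> disc"
    and sep: "\<And>z z'. z \<in> S \<Longrightarrow> z' \<in> S \<Longrightarrow> z \<noteq> z' \<Longrightarrow> q z z' \<le> 1/8"
    and C: "\<And>a. a \<in> S \<Longrightarrow> (\<Sum>z\<in>S. q z a) \<le> C" and c: "\<And>z. z \<in> S \<Longrightarrow> cmod (c z) \<le> 1"
  shows "\<exists>G. G holomorphic_on disc \<and> (\<forall>x\<in>disc. cmod (G x) \<le> exp (4 * C)) \<and> (\<forall>z\<in>S. G z = c z)"
proof -
  define a where "a k = 1 - (cmod k)^2" for k :: complex
  define h where "h k x = (1 + cnj k * x) / (1 - cnj k * x)" for k x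
  define t where "t k x = (a k / cmod (1 - cnj k * x))^2" for k x
  \<comment> \<open>The points at least as close to the circle as \<open>z\<close>. For these a_k
    Re(h_k(z)) \<le> 2 q(k,z), so normalizing \<open>E z\<close> to be 1 at \<open>z\<close> costs
    at most exp(2C).\<close>
  define up where "up z = {k \<in> S. cmod z \<le> cmod k}" for z
  define E where "E z x = exp (- (\<Sum>k\<in>up z. of_real (a k) * (h k x - h k z)))" for z x
  \<comment> \<open>The Blaschke quotient is 1 at \<open>z\<close> and 0 on the rest of
    \<open>S\<close>. The squared kernel is 1 at \<open>z\<close> and has modulus
    \<open>t z x\<close>. The factor \<open>E\<close> decays at least like exp(- sum of
    \<open>t k x\<close>) up to a constant, so that summing over \<open>S\<close> meets
    \<open>sum_weight_exp_le_1\<close>.\<close>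
  define F where "F z x = blaschke (S - {z}) x / blaschke (S - {z}) z * (of_real (a z) / (1 - cnj z * x))^2 * E z x" for z x
  define G where "G x = (\<Sum>z\<in>S. c z * F z x)" for x
  have Sd: "z \<in> disc" if "z \<in> S" for z using that S by auto
  have a0: "0 < a z" if "z \<in> S" for z using Sd[OF that] by (simp add: a_def abs_square_less_1)
  have den: "1 - cnj z * x \<noteq> 0" if "z \<in> S" "x \<in> disc" for z x by (rule disc_aut_denom[OF Sd[OF that(1)] that(2)])
  have bz: "exp (- 2 * C) \<le> cmod (blaschke (S - {z}) z)" if z: "z \<in> S" for z
    unfolding norm_blaschke
  proof (rule prod_rho_ge)
    show "0 \<le> q k z \<and> q k z \<le> 3/4" if "k \<in> S - {z}" for k
      using sep[of k z] q_pos[OF Sd Sd, of k z] that z by fastforce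
    have "(\<Sum>k\<in>S - {z}. q k z) \<le> (\<Sum>k\<in>S. q k z)"
      using S z by (intro sum_mono2) (auto intro!: less_imp_le[OF q_pos] Sd)
    then show "(\<Sum>k\<in>S - {z}. q k z) \<le> C" using C[OF z] by linarith
  qed (use S in auto)
  then have bnz: "blaschke (S - {z}) z \<noteq> 0" if "z \<in> S" for z
    using that exp_gt_zero[of "- 2 * C"] by (metis norm_zero not_le)
  have Re_h: "a k * Re (h k x) = a k * (1 - (cmod k)^2 * (cmod x)^2) / (cmod (1 - cnj k * x))^2" if "k \<in> S" "x \<in> disc" for k x
  proof -
    have "Re (h k x) = Re ((1 + cnj k * x) * cnj (1 - cnj k * x)) / (cmod (1 - cnj k * x))^2"
      unfolding h_def by (subst complex_div_cnj) (simp add: Re_divide_of_real)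
    also have "Re ((1 + cnj k * x) * cnj (1 - cnj k * x)) = 1 - (cmod k)^2 * (cmod x)^2"
      by (simp add: cmod_power2 algebra_simps) (simp add: power2_eq_square algebra_simps)
    finally show ?thesis by simp
  qed
  have Re_h_ge: "t k x \<le> a k * Re (h k x)" if kx: "k \<in> S" "x \<in> disc" for k x
  proof -
    have "(cmod k)^2 * (cmod x)^2 \<le> (cmod k)^2 * 1" using kx(2) by (intro mult_left_mono) (auto simp: abs_square_le_1)
    then have "a k * a k \<le> a k * (1 - (cmod k)^2 * (cmod x)^2)" using a0[OF kx(1)] by (intro mult_left_mono) (auto simp: a_def)
    then show ?thesis unfolding Re_h[OF kx] t_def power_divide power2_eq_square[of "a k"] by (intro divide_right_mono) auto
  qed
  have Re_h_le: "a k * Re (h k z) \<le> 2 * q k z" if z: "z \<in> S" and k: "k \<in> up z" for k z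
  proof -
    have kS: "k \<in> S" and kz: "cmod z \<le> cmod k" using k by (auto simp: up_def)
    have z1: "(cmod z)^2 \<le> 1" using Sd[OF z] by (simp add: abs_square_le_1)
    have "(cmod z)^2 * (cmod z)^2 \<le> (cmod k)^2 * (cmod z)^2" using kz by (intro mult_right_mono power_mono) auto
    moreover have "(1 - (cmod z)^2) * (1 + (cmod z)^2) \<le> (1 - (cmod z)^2) * 2" using z1 by (intro mult_left_mono) auto
    ultimately have "1 - (cmod k)^2 * (cmod z)^2 \<le> 2 * (1 - (cmod z)^2)" by (simp add: algebra_simps)
    then have "a k * (1 - (cmod k)^2 * (cmod z)^2) \<le> a k * (2 * (1 - (cmod z)^2))" using a0[OF kS] by (intro mult_left_mono) auto
    then have "a k * Re (h k z) \<le> a k * (2 * (1 - (cmod z)^2)) / (cmod (1 - cnj k * z))^2"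
      unfolding Re_h[OF kS Sd[OF z]] by (intro divide_right_mono) auto
    also have "\<dots> = 2 * q k z" unfolding q_eq[OF Sd[OF kS] Sd[OF z]] by (simp add: a_def)
    finally show ?thesis .
  qed
  have E_le: "cmod (E z x) \<le> exp (2 * C) * exp (- (\<Sum>k\<in>up z. t k x))" if z: "z \<in> S" "x \<in> disc" for z x
  proof -
    have upS: "up z \<subseteq> S" "finite (up z)" using S by (auto simp: up_def)
    have "cmod (E z x) = exp (- (\<Sum>k\<in>up z. a k * (Re (h k x) - Re (h k z))))"
      unfolding E_def norm_exp_eq_Re by simp
    also have "- (\<Sum>k\<in>up z. a k * (Re (h k x) - Re (h k z))) = (\<Sum>k\<in>up z. a k * Re (h k z)) - (\<Sum>k\<in>up z. a k * Re (h k x))"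
      by (simp add: right_diff_distrib sum_subtractf)
    also have "exp \<dots> \<le> exp (2 * C + - (\<Sum>k\<in>up z. t k x))"
    proof -
      have "(\<Sum>k\<in>up z. a k * Re (h k z)) \<le> (\<Sum>k\<in>up z. 2 * q k z)" by (intro sum_mono Re_h_le z)
      also have "\<dots> \<le> (\<Sum>k\<in>S. 2 * q k z)"
        using upS S z by (intro sum_mono2) (auto intro!: less_imp_le[OF q_pos] Sd)
      also have "\<dots> \<le> 2 * C" using C[OF z(1)] by (simp flip: sum_distrib_left)
      finally have 1: "(\<Sum>k\<in>up z. a k * Re (h k z)) \<le> 2 * C" .
      have 2: "(\<Sum>k\<in>up z. t k x) \<le> (\<Sum>k\<in>up z. a k * Re (h k x))"
        using upS z by (intro sum_mono Re_h_ge) auto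
      show ?thesis using 1 2 by simp
    qed
    finally show ?thesis by (simp add: exp_diff exp_minus divide_inverse)
  qed
  have F_le: "cmod (F z x) \<le> exp (4 * C) * (t z x * exp (- (\<Sum>k\<in>up z. t k x)))" if z: "z \<in> S" "x \<in> disc" for z x
  proof -
    have b1: "cmod (blaschke (S - {z}) x) \<le> 1" by (rule blaschke_le) (use S z in auto)
    have bq: "cmod (blaschke (S - {z}) x / blaschke (S - {z}) z) \<le> exp (2 * C)"
    proof -
      have "cmod (blaschke (S - {z}) x) / cmod (blaschke (S - {z}) z) \<le> 1 / exp (- 2 * C)"
        using b1 bz[OF z(1)] by (intro frac_le) auto
      then show ?thesis by (simp add: norm_divide exp_minus field_simps)
    qed
    have tt: "cmod ((of_real (a z) / (1 - cnj z * x))^2) = t z x"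
      using a0[OF z(1)] by (simp add: t_def norm_power norm_divide)
    have "cmod (F z x) = cmod (blaschke (S - {z}) x / blaschke (S - {z}) z) * t z x * cmod (E z x)"
      unfolding F_def norm_mult tt ..
    also have "\<dots> \<le> exp (2 * C) * t z x * (exp (2 * C) * exp (- (\<Sum>k\<in>up z. t k x)))"
      by (intro mult_mono bq E_le z order_refl mult_nonneg_nonneg) (auto simp: t_def)
    also have "\<dots> = (exp (2 * C) * exp (2 * C)) * (t z x * exp (- (\<Sum>k\<in>up z. t k x)))" by simp
    also have "exp (2 * C) * exp (2 * C) = exp (4 * C)" by (simp flip: exp_add)
    finally show ?thesis .
  qed
  have "G holomorphic_on disc"
    unfolding G_def[abs_def] F_def[abs_def] E_def[abs_def] h_def
    by (intro holomorphic_intros holomorphic_blaschke) (use S den bnz in \<open>auto simp: up_def\<close>)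
  moreover have "cmod (G x) \<le> exp (4 * C)" if x: "x \<in> disc" for x
  proof -
    have "cmod (G x) \<le> (\<Sum>z\<in>S. 1 * (exp (4 * C) * (t z x * exp (- (\<Sum>k\<in>up z. t k x)))))"
      unfolding G_def by (intro sum_norm_le) (simp only: norm_mult, intro mult_mono F_le x c, auto)
    also have "\<dots> = exp (4 * C) * (\<Sum>z\<in>S. t z x * exp (- (\<Sum>k | k \<in> S \<and> cmod z \<le> cmod k. t k x)))"
      by (simp add: sum_distrib_left up_def)
    also have "\<dots> \<le> exp (4 * C) * (1 - exp (- (\<Sum>k\<in>S. t k x)))"
      by (intro mult_left_mono sum_weight_exp_le_1[OF S(1), of "\<lambda>k. t k x" cmod]) (auto simp: t_def)
    also have "\<dots> \<le> exp (4 * C) * 1" by (intro mult_left_mono) auto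
    finally show ?thesis by simp
  qed
  moreover have "G z = c z" if z: "z \<in> S" for z
  proof -
    have F0: "F k z = 0" if "k \<in> S" "k \<noteq> z" for k
    proof -
      have "blaschke (S - {k}) z = 0" unfolding blaschke_def using that z S by (intro prod_zero) (auto intro!: bexI[of _ z])
      then show ?thesis by (simp add: F_def)
    qed
    have "complex_of_real (a z) = 1 - cnj z * z"
      by (simp add: a_def complex_norm_square[unfolded of_real_power] mult.commute)
    then have F1: "F z z = 1" using bnz[OF z] den[OF z Sd[OF z]] by (simp add: F_def E_def)
    have "G z = c z * F z z + (\<Sum>k\<in>S - {z}. c k * F k z)" unfolding G_def by (rule sum.remove[OF S(1) z])
    also have "(\<Sum>k\<in>S - {z}. c k * F k z) = 0" using F0 by (intro sum.neutral) auto
    finally show ?thesis using F1 by simp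
  qed
  ultimately show ?thesis by blast
qed

section \<open>Hoffman maps\<close>

text \<open>The value 1/4 is also a covering radius: a maximal separated subset of a set covers it
  with rho below 1/4, and the shifts v used later fill the disc of radius 1/4.\<close>

definition separated :: "complex set \<Rightarrow> bool" where
  "separated T \<longleftrightarrow> (\<forall>z\<in>T. \<forall>z'\<in>T. z \<noteq> z' \<longrightarrow> 1/4 \<le> rho z z')"

text \<open>A Euclidean net of mesh (1 - R)/10: two points in one cell would have rho at most 1/5,
  below the separation 1/4.\<close>

lemma rho_packing:
  assumes R: "R < 1"
  shows "\<exists>D. \<forall>T. T \<subseteq> cball 0 R \<and> separated T \<longrightarrow> finite T \<and> card T \<le> D"
proof -
  have e: "0 < (1 - R) / 10" using R by simp
  obtain k where k: "finite k" "cball (0::complex) R \<subseteq> (\<Union>x\<in>k. ball x ((1 - R) / 10))"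
    using seq_compact_imp_totally_bounded[OF compact_imp_seq_compact[OF compact_cball], of "0::complex" R, rule_format, OF e] by auto
  have "finite T \<and> card T \<le> card k" if T: "T \<subseteq> cball 0 R" "separated T" for T
  proof -
    have "\<forall>z\<in>T. \<exists>x\<in>k. dist x z < (1 - R) / 10" using T(1) k(2) by (auto simp: subset_iff)
    then obtain c where c: "\<And>z. z \<in> T \<Longrightarrow> c z \<in> k" "\<And>z. z \<in> T \<Longrightarrow> dist (c z) z < (1 - R) / 10" by metis
    have inj: "inj_on c T"
    proof (rule inj_onI, rule ccontr)
      fix z z' assume zz: "z \<in> T" "z' \<in> T" "c z = c z'" "z \<noteq> z'"
      have "cmod (z - z') \<le> dist (c z) z + dist (c z) z'"
        by (metis dist_commute dist_norm dist_triangle)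
      also have "\<dots> < (1 - R) / 10 + (1 - R) / 10" using c(2)[OF zz(1)] c(2)[OF zz(2)] zz(3) by (intro add_strict_mono) auto
      finally have "cmod (z - z') \<le> (1/5) * (1 - R)" by simp
      moreover have zR: "cmod z \<le> R" "cmod z' \<le> R" using T(1) zz by auto
      moreover have "(1/5) * (1 - R) \<le> (1/5) * (1 - cmod z)" using zR by (intro mult_left_mono) auto
      ultimately have "cmod (z - z') \<le> (1/5) * (1 - cmod z)" by (blast intro: order_trans)
      then have "rho z z' \<le> 1/5" using zR R by (intro rho_le_of_ball) auto
      moreover have "1/4 \<le> rho z z'" using T(2) zz by (auto simp: separated_def)
      ultimately show False by simp
    qed
    have "finite T" by (rule inj_on_finite[OF inj _ k(1)]) (use c in auto)
    moreover have "card T \<le> card k" by (rule card_inj_on_le[OF inj _ k(1)]) (use c in auto)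
    ultimately show ?thesis by simp
  qed
  then show ?thesis by blast
qed

text \<open>Used to split a net into boundedly many subsets that are sparse enough for
  interpolation; degree at most \<open>d\<close> leaves one of the d + 1 colours free for the new
  vertex.\<close>

lemma greedy_colouring:
  assumes "finite V" and sym: "\<And>x y. adj x y \<Longrightarrow> adj y x"
    and "\<And>x. x \<in> V \<Longrightarrow> card {y \<in> V. y \<noteq> x \<and> adj x y} \<le> d"
  shows "\<exists>col :: 'a \<Rightarrow> nat. (\<forall>x\<in>V. col x \<le> d) \<and> (\<forall>x\<in>V. \<forall>y\<in>V. x \<noteq> y \<and> adj x y \<longrightarrow> col x \<noteq> col y)"
  using assms(1,3)
proof (induction V rule: finite_induct)
  case empty then show ?case by auto
next
  case (insert x V)
  have IHp: "card {y \<in> V. y \<noteq> z \<and> adj z y} \<le> d" if "z \<in> V" for z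
  proof -
    have "card {y \<in> V. y \<noteq> z \<and> adj z y} \<le> card {y \<in> insert x V. y \<noteq> z \<and> adj z y}"
      using insert.hyps by (intro card_mono) auto
    also have "\<dots> \<le> d" by (rule insert.prems) (use that in auto)
    finally show ?thesis .
  qed
  have "\<exists>col :: 'a \<Rightarrow> nat. (\<forall>x\<in>V. col x \<le> d) \<and> (\<forall>x\<in>V. \<forall>y\<in>V. x \<noteq> y \<and> adj x y \<longrightarrow> col x \<noteq> col y)"
    by (rule insert.IH) (rule IHp)
  then obtain col :: "'a \<Rightarrow> nat" where col0: "\<forall>z\<in>V. col z \<le> d"
    "\<forall>y\<in>V. \<forall>z\<in>V. y \<noteq> z \<and> adj y z \<longrightarrow> col y \<noteq> col z"
    by (elim exE conjE)
  then have col: "\<And>z. z \<in> V \<Longrightarrow> col z \<le> d"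
    "\<And>y z. y \<in> V \<Longrightarrow> z \<in> V \<Longrightarrow> y \<noteq> z \<Longrightarrow> adj y z \<Longrightarrow> col y \<noteq> col z" by simp_all
  define N where "N = {y \<in> insert x V. y \<noteq> x \<and> adj x y}"
  have N: "N \<subseteq> V" "finite N" "card N \<le> d" using insert by (auto simp: N_def)
  have "\<not> {..d} \<subseteq> col ` N"
  proof
    assume "{..d} \<subseteq> col ` N"
    then have "card {..d} \<le> card (col ` N)" using N by (intro card_mono) auto
    also have "\<dots> \<le> card N" by (rule card_image_le[OF N(2)])
    finally show False using N by simp
  qed
  then obtain i where i: "i \<le> d" "i \<notin> col ` N" by auto
  have adjN: "y \<in> N" if "y \<in> V" "adj x y" for y using that insert.hyps by (auto simp: N_def)
  show ?case
  proof (intro exI[of _ "col(x := i)"] conjI ballI impI)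
    show "(col(x := i)) z \<le> d" if "z \<in> insert x V" for z using that i col by auto
    fix y z assume yz: "y \<in> insert x V" "z \<in> insert x V" "y \<noteq> z \<and> adj y z"
    show "(col(x := i)) y \<noteq> (col(x := i)) z"
    proof (cases "y = x")
      case True
      then have "z \<in> N" using yz adjN by auto
      then show ?thesis using True yz i by auto
    next
      case False
      show ?thesis
      proof (cases "z = x")
        case True
        then have "y \<in> N" using yz adjN False sym by auto
        then show ?thesis using True yz i by auto
      next
        case z: False
        then show ?thesis using False yz col by auto
      qed
    qed
  qed
qed

text \<open>Applying \<phi>_p leaves \<psi> = \<phi>_p(\<phi>_x(w)) to be compared with
  \<open>w\<close>. In \<psi> = n/d the difference n - w d has modulus at most 4 |p - x|, with |p -
  x| = rho(p,x) |1 - cnj(p) x|, while |d| \<ge> (1 - r) |1 - cnj(p) x|. The second factor 1 - r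
  comes from the denominator of rho.\<close>

lemma rho_disc_aut_left_le:
  assumes x: "x \<in> disc" and p: "p \<in> disc" and w: "cmod w \<le> r" "r < 1"
  shows "rho (disc_aut x w) (disc_aut p w) \<le> 4 * rho p x / (1 - r)^2"
proof -
  have wd: "w \<in> disc" using w by auto
  have r0: "0 \<le> r" using w(1) norm_ge_zero order_trans by blast
  define n where "n = p * (1 - cnj x * w) - (x - w)"
  define d where "d = (1 - cnj x * w) - cnj p * (x - w)"
  define D where "D = cmod (1 - cnj p * x)"
  have nz: "1 - cnj x * w \<noteq> 0" by (rule disc_aut_denom[OF x wd])
  have D0: "0 < D" using disc_aut_denom[OF p x] by (simp add: D_def)
  have px: "cmod (p - x) = rho p x * D" using D0 by (simp add: rho_def disc_aut_def norm_divide D_def)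
  define \<psi> where "\<psi> = disc_aut p (disc_aut x w)"
  have "n / (1 - cnj x * w) = p - (x - w) / (1 - cnj x * w)" "d / (1 - cnj x * w) = 1 - cnj p * ((x - w) / (1 - cnj x * w))"
    using nz by (simp_all add: n_def d_def divide_simps)
  then have "\<psi> = (n / (1 - cnj x * w)) / (d / (1 - cnj x * w))"
    unfolding \<psi>_def disc_aut_def by (simp only:)
  then have \<psi>: "\<psi> = n / d" using nz by simp
  have psd: "\<psi> \<in> disc" unfolding \<psi>_def using disc_aut_in_disc p x wd by simp
  have d_eq: "d = (1 - cnj p * x) + w * cnj (p - x)" by (simp add: d_def algebra_simps)
  have "D - cmod (w * cnj (p - x)) \<le> cmod d"
    unfolding d_eq D_def using norm_diff_ineq by blast
  moreover have "cmod (w * cnj (p - x)) \<le> r * (1 * D)"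
    unfolding norm_mult complex_mod_cnj px using w r0 D0 less_imp_le[OF rho_less_1[OF p x]] by (intro mult_mono) auto
  ultimately have dl: "(1 - r) * D \<le> cmod d" by (simp add: algebra_simps)
  have d0: "0 < cmod d" by (rule less_le_trans[OF mult_pos_pos dl]) (use D0 w in auto)
  have nd: "n - w * d = (p - x) + w * (cnj p * (x - p) - p * cnj (x - p)) - w * w * cnj (p - x)"
    by (simp add: n_def d_def algebra_simps)
  have "cmod (n - w * d) \<le> cmod (p - x) + cmod (w * (cnj p * (x - p) - p * cnj (x - p))) + cmod (w * w * cnj (p - x))"
    unfolding nd by (intro order_trans[OF norm_triangle_ineq4] add_right_mono norm_triangle_ineq)
  also have "cmod (w * (cnj p * (x - p) - p * cnj (x - p))) \<le> 1 * (1 * cmod (p - x) + 1 * cmod (p - x))"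
  proof -
    have "cmod (cnj p * (x - p) - p * cnj (x - p)) \<le> cmod (cnj p * (x - p)) + cmod (p * cnj (x - p))" by (rule norm_triangle_ineq4)
    also have "\<dots> \<le> 1 * cmod (p - x) + 1 * cmod (p - x)"
      unfolding norm_mult complex_mod_cnj norm_minus_commute[of x p] using p by (intro add_mono mult_right_mono) auto
    finally show ?thesis unfolding norm_mult[of w] using wd by (intro mult_mono) auto
  qed
  also have "cmod (w * w * cnj (p - x)) \<le> 1 * 1 * cmod (p - x)"
    unfolding norm_mult complex_mod_cnj using wd by (intro mult_mono) auto
  finally have "cmod (n - w * d) \<le> 4 * (rho p x * D)" unfolding px by (simp add: mult_ac)
  moreover have "\<psi> - w = (n - w * d) / d" unfolding \<psi> using d0 by (simp add: field_simps)
  ultimately have "cmod (\<psi> - w) \<le> 4 * (rho p x * D) / cmod d" by (simp add: norm_divide divide_right_mono)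
  also have "\<dots> \<le> 4 * (rho p x * D) / ((1 - r) * D)"
    using dl D0 w by (intro divide_left_mono) (auto intro!: mult_pos_pos d0)
  also have "\<dots> = 4 * rho p x / (1 - r)" using D0 by simp
  finally have num: "cmod (\<psi> - w) \<le> 4 * rho p x / (1 - r)" .
  have "cmod (cnj \<psi> * w) \<le> 1 * r" unfolding norm_mult complex_mod_cnj using psd w r0 by (intro mult_mono) auto
  then have den: "1 - r \<le> cmod (1 - cnj \<psi> * w)" using norm_triangle_ineq2[of 1 "cnj \<psi> * w"] by simp
  have "rho (disc_aut x w) (disc_aut p w) = rho \<psi> (disc_aut p (disc_aut p w))"
    unfolding \<psi>_def using rho_disc_aut[OF p] disc_aut_in_disc x p wd by simp
  also have "\<dots> = cmod (\<psi> - w) / cmod (1 - cnj \<psi> * w)"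
    using p wd by (simp add: disc_aut_invol rho_def disc_aut_def[of \<psi>] norm_divide)
  also have "\<dots> \<le> (4 * rho p x / (1 - r)) / (1 - r)"
    using num den w by (intro frac_le) auto
  finally show ?thesis by (simp add: power2_eq_square)
qed

text \<open>Used contrapositively: if f \<circ> \<phi>_z changes much between 0 and
  \<open>w\<close>, there is a hyperbolically steep point within rho at most |w| of
  \<open>z\<close>. The proof bounds the derivative of f \<circ> \<phi>_z by conformal
  invariance.\<close>

lemma norm_disc_aut_diff_le:
  assumes f: "f holomorphic_on disc" and z: "z \<in> disc" and w: "w \<in> disc" and e: "0 \<le> e"
    and small: "\<And>y. y \<in> disc \<Longrightarrow> rho z y \<le> cmod w \<Longrightarrow> (1 - (cmod y)^2) * cmod (deriv f y) \<le> e"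
  shows "cmod (f (disc_aut z w) - f z) \<le> e / (1 - (cmod w)^2) * cmod w"
proof -
  define g where "g = (\<lambda>x. f (disc_aut z x))"
  have g: "g holomorphic_on disc" unfolding g_def by (rule holomorphic_disc_aut_compose[OF z f])
  have w2: "0 < 1 - (cmod w)^2" using w by (simp add: abs_square_less_1)
  have "cmod (g w - g 0) \<le> e / (1 - (cmod w)^2) * cmod (w - 0)"
  proof (rule field_differentiable_bound[of "cball 0 (cmod w)"])
    fix x :: complex assume x: "x \<in> cball 0 (cmod w)"
    then have xd: "x \<in> disc" using w by auto
    show "(g has_field_derivative deriv g x) (at x within cball 0 (cmod w))"
      using holomorphic_derivI[OF g open_ball xd] by (rule has_field_derivative_at_within)
    have "(1 - (cmod w)^2) * cmod (deriv g x) \<le> (1 - (cmod x)^2) * cmod (deriv g x)"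
      using x by (intro mult_right_mono) (auto intro!: power_mono)
    also have "\<dots> \<le> e"
      unfolding g_def norm_deriv_disc_aut[OF f z xd]
      using x z xd by (intro small disc_aut_in_disc) (auto simp: rho_disc_aut_right)
    finally show "cmod (deriv g x) \<le> e / (1 - (cmod w)^2)" using w2 by (simp add: field_simps)
  qed (use w in auto)
  then show ?thesis by (simp add: g_def)
qed

lemma finite_rho_net:
  assumes t: "0 < t"
  shows "\<exists>n (\<nu> :: nat \<Rightarrow> complex). (\<forall>k<n. cmod (\<nu> k) \<le> 1/4) \<and> (\<forall>x. cmod x \<le> 1/4 \<longrightarrow> (\<exists>k<n. rho (\<nu> k) x \<le> t))"
proof -
  obtain V where V: "finite V" "V \<subseteq> cball (0::complex) (1/4)" "cball 0 (1/4) \<subseteq> (\<Union>x\<in>V. ball x (t * (3/4)))"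
    using seq_compact_imp_totally_bounded[OF compact_imp_seq_compact[OF compact_cball], of "0::complex" "1/4", rule_format, of "t * (3/4)"] t by auto
  obtain n \<nu> where \<nu>: "V = \<nu> ` {i::nat. i < n}"
    using finite_imp_nat_seg_image_inj_on[OF V(1)] by auto
  have le: "cmod (\<nu> k) \<le> 1/4" if "k < n" for k using V(2) \<nu> that by auto
  moreover have "\<exists>k<n. rho (\<nu> k) x \<le> t" if x: "cmod x \<le> 1/4" for x
  proof -
    have "x \<in> cball 0 (1/4)" using x by simp
    then have "x \<in> (\<Union>x\<in>V. ball x (t * (3/4)))" by (rule subsetD[OF V(3)])
    then obtain k where k: "k < n" "cmod (\<nu> k - x) < t * (3/4)" unfolding \<nu> by (auto simp: dist_norm)
    have "t * (3/4) \<le> t * (1 - cmod (\<nu> k))" using le[OF k(1)] t by (intro mult_left_mono) auto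
    then have "rho (\<nu> k) x \<le> t" using k le[OF k(1)] x by (intro rho_le_of_ball) auto
    then show ?thesis using k by auto
  qed
  ultimately show ?thesis by blast
qed

text \<open>The shifted points \<phi>_z(v) of one sparse class of steep points satisfy a Carleson
  condition. \<open>B\<close> is their Blaschke product, and \<open>G\<close> interpolates x
  \<mapsto> f(\<phi>_x(w)) on them. The factor 16/9 in \<open>C\<close> is the Harnack cost of a
  shift of length 1/4.\<close>

lemma colour_class_interpolation:
  assumes f: "f holomorphic_on disc" and f1: "\<And>z. z \<in> disc \<Longrightarrow> cmod (f z) \<le> 1" and w: "w \<in> disc"
    and \<epsilon>: "0 < \<epsilon>" and S: "finite S" "S \<subseteq> disc"
    and steep: "\<And>z. z \<in> S \<Longrightarrow> \<epsilon> \<le> cmod (f (disc_aut z w) - f z)"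
    and sep: "\<And>z z'. z \<in> S \<Longrightarrow> z' \<in> S \<Longrightarrow> z \<noteq> z' \<Longrightarrow> q z z' \<le> min (81/2048) ((1 - cmod w) ^ 4 / 2)"
    and v: "cmod v \<le> 1/4" and s: "0 < s" "s \<le> 1"
    and C_def: "C = 16/9 * (200 / ((\<epsilon> * (1 - (cmod w)^2))^2 * (1 - cmod w)^2))"
  shows "\<exists>B G. B holomorphic_on disc \<and> G holomorphic_on disc \<and>
    (\<forall>x\<in>disc. cmod (B x) \<le> 1 \<and> cmod (G x) \<le> exp (4 * C)) \<and>
    (\<forall>z\<in>S. \<forall>x\<in>disc. cmod (B x) \<le> rho (disc_aut z v) x) \<and>
    (\<forall>x\<in>disc. cmod (B x) < s * exp (- 2 * C) \<longrightarrow>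
       cmod (G x - f (disc_aut x w)) \<le> s * (3 * exp (4 * C) + 12 / (1 - cmod w)^2))"
proof -
  define H where "H x = f (disc_aut x w)" for x
  define r where "r = cmod w"
  have r: "0 \<le> r" "r < 1" using w by (auto simp: r_def)
  have r2: "0 < 1 - r^2" using r by (simp add: abs_square_less_1)
  define e where "e = \<epsilon> * (1 - r^2)"
  have e: "0 < e" using r2 \<epsilon> by (simp add: e_def)
  have C: "C = 16/9 * (200 / (e^2 * (1 - r)^2))" by (simp add: C_def e_def r_def)
  have vd: "v \<in> disc" using v by auto
  have Sd: "z \<in> disc" if "z \<in> S" for z using that S by auto
  have H1: "cmod (H x) \<le> 1" if "x \<in> disc" for x unfolding H_def by (intro f1 disc_aut_in_disc that w)
  have near: "\<exists>y\<in>disc. rho z y \<le> r \<and> e \<le> (1 - (cmod y)^2) * cmod (deriv f y)" if z: "z \<in> S" for z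
  proof (rule ccontr)
    assume "\<not> ?thesis"
    then have sm: "\<And>y. y \<in> disc \<Longrightarrow> rho z y \<le> cmod w \<Longrightarrow> (1 - (cmod y)^2) * cmod (deriv f y) \<le> e"
      unfolding r_def by force
    have "cmod (f (disc_aut z w) - f z) \<le> e / (1 - (cmod w)^2) * cmod w"
      by (rule norm_disc_aut_diff_le[OF f Sd[OF z] w less_imp_le[OF e] sm])
    also have "\<dots> = \<epsilon> * r" using r2 by (simp add: e_def r_def)
    also have "\<dots> < \<epsilon> * 1" using r \<epsilon> by (intro mult_strict_left_mono) auto
    finally show False using steep[OF z] by simp
  qed
  have sepS: "q z z' \<le> (1 - r) ^ 4 / 2" if "z \<in> S" "z' \<in> S" "z \<noteq> z'" for z z'
    using sep[OF that] by (simp add: r_def)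
  have sumS: "(\<Sum>z\<in>S. q a z) \<le> 200 / (e^2 * (1 - r)^2)" if "a \<in> disc" for a
    by (rule sum_q_separated_le[OF f f1 S e r that near sepS])
  define P where "P = (\<lambda>z. disc_aut z v) ` S"
  have P: "finite P" "P \<subseteq> disc" unfolding P_def using S(1) disc_aut_in_disc[OF Sd vd] by auto
  have rz: "rho (disc_aut z v) z \<le> 1/4" if "z \<in> S" for z
    unfolding rho_commute[of _ z] rho_disc_aut_right[OF Sd[OF that] vd] by (rule v)
  have qv: "q a (disc_aut z v) \<le> q a z * (16/9)" if "a \<in> disc" "z \<in> S" for a z
    using q_Harnack[OF that(1) disc_aut_in_disc[OF Sd[OF that(2)] vd] Sd[OF that(2)] rz[OF that(2)]]
    by (simp add: power2_eq_square field_simps)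
  \<comment> \<open>Shifting both points costs 16/9 twice, and (81/2048)(16/9)^2 = 1/8, the
    separation required for interpolation.\<close>
  have sepP: "q p p' \<le> 1/8" if pp: "p \<in> P" "p' \<in> P" "p \<noteq> p'" for p p'
  proof -
    obtain z z' where z: "z \<in> S" "p = disc_aut z v" "z' \<in> S" "p' = disc_aut z' v" using pp by (auto simp: P_def)
    have zz: "z \<noteq> z'" using z pp by auto
    have "q p p' \<le> q p z' * (16/9)" unfolding z(4) by (rule qv) (use pp P z in auto)
    moreover have "q z' p \<le> q z' z * (16/9)" unfolding z(2) by (rule qv) (use Sd z in auto)
    moreover have "q z' z \<le> 81/2048" using sep[OF z(3,1)] zz by simp
    ultimately show ?thesis by (simp add: q_commute[of p z'])
  qed
  have sumP: "(\<Sum>p\<in>P. q p a) \<le> C" if a: "a \<in> disc" for a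
  proof -
    have "(\<Sum>p\<in>P. q p a) \<le> (\<Sum>z\<in>S. q (disc_aut z v) a)"
      unfolding P_def using sum_image_le[OF S(1), of "\<lambda>p. q p a" "\<lambda>z. disc_aut z v"]
        less_imp_le[OF q_pos[OF disc_aut_in_disc[OF Sd vd] a]] by (simp add: o_def)
    also have "\<dots> \<le> (\<Sum>z\<in>S. q a z * (16/9))"
      by (rule sum_mono) (subst q_commute, rule qv[OF a])
    also have "\<dots> = 16/9 * (\<Sum>z\<in>S. q a z)" by (subst sum_distrib_right[symmetric]) (rule mult.commute)
    also have "\<dots> \<le> C" unfolding C by (intro mult_left_mono sumS a) auto
    finally show ?thesis .
  qed
  have HP: "cmod (H z) \<le> 1" if "z \<in> P" for z using H1 P that by auto
  have "\<exists>G. G holomorphic_on disc \<and> (\<forall>x\<in>disc. cmod (G x) \<le> exp (4 * C)) \<and> (\<forall>p\<in>P. G p = H p)"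
    by (rule Jones_interpolation[OF P sepP sumP[OF subsetD[OF P(2)]] HP])
  then obtain G where G: "G holomorphic_on disc" "\<And>x. x \<in> disc \<Longrightarrow> cmod (G x) \<le> exp (4 * C)" "\<And>p. p \<in> P \<Longrightarrow> G p = H p"
    by blast
  \<comment> \<open>By \<open>blaschke_ge\<close> a small Blaschke product puts \<open>x\<close>
    within \<open>s\<close> of some \<open>p\<close> in \<open>P\<close>, where \<open>G\<close> and
    \<open>H\<close> agree. Schwarz-Pick for \<open>G\<close>, and
    \<open>rho_disc_aut_left_le\<close> followed by Schwarz-Pick for \<open>H\<close>, carry the
    agreement from \<open>p\<close> to \<open>x\<close>.\<close>
  have fin: "cmod (G x - H x) \<le> s * (3 * exp (4 * C) + 12 / (1 - r)^2)"
    if x: "x \<in> disc" "cmod (blaschke P x) < s * exp (- 2 * C)" for x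
  proof -
    have "\<exists>p\<in>P. rho p x < s"
    proof (rule ccontr)
      assume "\<not> ?thesis"
      then have "\<And>p. p \<in> P \<Longrightarrow> s \<le> rho p x" by force
      then have "s * exp (- 2 * C) \<le> cmod (blaschke P x)"
        using s by (intro blaschke_ge[OF P x(1) sepP sumP[OF x(1)]]) auto
      then show False using x by simp
    qed
    then obtain p where p: "p \<in> P" "rho p x < s" by auto
    have pd: "p \<in> disc" using p P by auto
    have "cmod (G x - G p) \<le> 3 * exp (4 * C) * rho x p" by (rule Schwarz_Pick[OF G(1,2) x(1) pd])
    also have "\<dots> = 3 * exp (4 * C) * rho p x" by (simp add: rho_commute)
    also have "\<dots> \<le> 3 * exp (4 * C) * s" using p by (intro mult_left_mono) auto
    finally have 1: "cmod (G x - G p) \<le> 3 * exp (4 * C) * s" .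
    have "cmod (H x - H p) \<le> 3 * 1 * rho (disc_aut x w) (disc_aut p w)"
      unfolding H_def by (intro Schwarz_Pick[OF f f1] disc_aut_in_disc w pd x)
    also have "\<dots> \<le> 3 * 1 * (4 * rho p x / (1 - r)^2)"
      using rho_disc_aut_left_le[OF x(1) pd _ r(2), of w] by (simp add: r_def)
    also have "\<dots> \<le> 3 * 1 * (4 * s / (1 - r)^2)"
      using p by (intro mult_left_mono divide_right_mono) auto
    finally have 2: "cmod (H x - H p) \<le> s * (12 / (1 - r)^2)" by (simp add: mult_ac)
    have "G x - H x = (G x - G p) - (H x - H p)" using G(3)[OF p(1)] by simp
    then have "cmod (G x - H x) \<le> cmod (G x - G p) + cmod (H x - H p)" by (metis norm_triangle_ineq4)
    then show ?thesis using 1 2 by (simp add: algebra_simps)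
  qed
  show ?thesis
  proof (intro exI conjI ballI impI)
    show "blaschke P holomorphic_on disc" by (rule holomorphic_blaschke[OF P(2)])
    show "G holomorphic_on disc" by (rule G(1))
    show "cmod (blaschke P x) \<le> 1" if "x \<in> disc" for x by (rule blaschke_le(1)[OF P that])
    show "cmod (G x) \<le> exp (4 * C)" if "x \<in> disc" for x by (rule G(2)[OF that])
    show "cmod (blaschke P x) \<le> rho (disc_aut z v) x" if "z \<in> S" "x \<in> disc" for z x
      by (rule blaschke_le(2)[OF P that(2)]) (use that in \<open>simp add: P_def\<close>)
    show "cmod (G x - f (disc_aut x w)) \<le> s * (3 * exp (4 * C) + 12 / (1 - cmod w)^2)"
      if "x \<in> disc" "cmod (blaschke P x) < s * exp (- 2 * C)" for x
      using fin[OF that] by (simp add: H_def r_def)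
  qed
qed

text \<open>Packing bounds the size of separated sets, so one of greatest size exists, and no
  further point can be added to it.\<close>

lemma maximal_separated:
  assumes E: "E \<subseteq> cball 0 R" and R: "R < 1"
  shows "\<exists>T. finite T \<and> T \<subseteq> E \<and> separated T \<and> (\<forall>x\<in>E. \<exists>z\<in>T. rho z x < 1/4)"
proof -
  obtain D where D: "\<And>T. T \<subseteq> cball 0 R \<Longrightarrow> separated T \<Longrightarrow> finite T \<and> card T \<le> D"
    using rho_packing[OF R] by auto
  define N where "N n \<longleftrightarrow> (\<exists>T. T \<subseteq> E \<and> separated T \<and> card T = n)" for n
  have "N 0" unfolding N_def by (intro exI[of _ "{}"]) (simp add: separated_def)
  moreover have bd: "\<And>n. N n \<Longrightarrow> n \<le> D" using D E unfolding N_def by blast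
  ultimately have "N (Greatest N)" "\<And>n. N n \<Longrightarrow> n \<le> Greatest N"
    using GreatestI_nat[of N 0 D] Greatest_le_nat[of N _ D] by auto
  then obtain T where T: "T \<subseteq> E" "separated T" "\<And>T'. T' \<subseteq> E \<Longrightarrow> separated T' \<Longrightarrow> card T' \<le> card T"
    unfolding N_def by metis
  have fin: "finite T" using D T E by blast
  have "\<exists>z\<in>T. rho z x < 1/4" if x: "x \<in> E" for x
  proof (rule ccontr)
    assume neg: "\<not> ?thesis"
    then have far: "\<And>z. z \<in> T \<Longrightarrow> 1/4 \<le> rho z x" by force
    have "x \<notin> T" using far[of x] by auto
    moreover have "separated (insert x T)"
      using T(2) far unfolding separated_def by (auto simp: rho_commute[of x])
    ultimately show False using T(3)[of "insert x T"] T(1) x fin by auto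
  qed
  then show ?thesis using fin T by blast
qed

text \<open>\<open>L\<close>, \<open>t\<close> and \<open>K\<close> are arguments so that one choice
  can serve all \<open>R\<close>. Covering is stated with \<open>t\<close> and approximation with
  2t; the gap makes the two cases overlap when a limit at a maximal ideal is taken.\<close>

definition hoffman_level ::
    "(complex \<Rightarrow> complex) \<Rightarrow> complex \<Rightarrow> real \<Rightarrow> nat \<Rightarrow> real \<Rightarrow> real \<Rightarrow> real \<Rightarrow> (nat \<Rightarrow> complex \<Rightarrow> complex) \<Rightarrow> (nat \<Rightarrow> complex \<Rightarrow> complex) \<Rightarrow> bool" where
  "hoffman_level f w \<epsilon> L t K R B G \<longleftrightarrow>
    (\<forall>l<L. B l holomorphic_on disc \<and> G l holomorphic_on disc) \<and>
    (\<forall>l<L. \<forall>x\<in>disc. cmod (B l x) \<le> 1 \<and> cmod (G l x) \<le> K) \<and>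
    (\<forall>x\<in>cball 0 R. \<epsilon> \<le> cmod (f (disc_aut x w) - f x) \<longrightarrow> (\<exists>l<L. cmod (B l x) \<le> t)) \<and>
    (\<forall>l<L. \<forall>x\<in>disc. cmod (B l x) < 2 * t \<longrightarrow> cmod (G l x - f (disc_aut x w)) \<le> \<epsilon>)"

text \<open>The steep points are covered by small hyperbolic discs around finitely many families of
  interpolating sequences.  Where all Blaschke products \<open>B l\<close> are large, \<open>f \<circ> \<phi>\<^sub>x\<close> is nearly constant;
  where \<open>B l\<close> is small, \<open>G l\<close> interpolates.  The bounds do not depend on \<open>R\<close>.\<close>

lemma hoffman_finite_level:
  assumes f: "f holomorphic_on disc" and f1: "\<And>z. z \<in> disc \<Longrightarrow> cmod (f z) \<le> 1" and w: "w \<in> disc"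
    and \<epsilon>: "0 < \<epsilon>"
  shows "\<exists>L t K. 0 < t \<and> (\<forall>R<1. \<exists>B G. hoffman_level f w \<epsilon> L t K R B G)"
proof -
  define C where "C = 16/9 * (200 / ((\<epsilon> * (1 - (cmod w)^2))^2 * (1 - cmod w)^2))"
  define \<kappa> where "\<kappa> = min (81/2048) ((1 - cmod w) ^ 4 / 2)"
  define \<Lambda> where "\<Lambda> = 3 * exp (4 * C) + 12 / (1 - cmod w)^2"
  define s where "s = min 1 (\<epsilon> / \<Lambda>)"
  \<comment> \<open>Half of the threshold in \<open>colour_class_interpolation\<close>, so that 2t
    is exactly that threshold; \<open>s\<close> keeps the error s \<Lambda> below
    \<epsilon>.\<close>
  define t where "t = s * exp (- 2 * C) / 2"
  have \<kappa>: "0 < \<kappa>" "\<kappa> < 1" using w by (auto simp: \<kappa>_def)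
  have "0 < 3 * exp (4 * C)" "0 \<le> 12 / (1 - cmod w)^2" by auto
  then have \<Lambda>: "0 < \<Lambda>" unfolding \<Lambda>_def by linarith
  have s: "0 < s" "s \<le> 1" using \<epsilon> \<Lambda> by (auto simp: s_def)
  have s\<Lambda>: "s * \<Lambda> \<le> \<epsilon>"
  proof -
    have "s * \<Lambda> \<le> \<epsilon> / \<Lambda> * \<Lambda>" unfolding s_def using \<Lambda> by (intro mult_right_mono) auto
    then show ?thesis using \<Lambda> by simp
  qed
  have t: "0 < t" using s by (simp add: t_def)
  obtain D where D: "\<And>T. T \<subseteq> cball 0 (sqrt (1 - \<kappa>)) \<Longrightarrow> separated T \<Longrightarrow> finite T \<and> card T \<le> D"
    using rho_packing[of "sqrt (1 - \<kappa>)"] \<kappa> by auto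
  obtain n \<nu> where \<nu>: "\<And>k. k < n \<Longrightarrow> cmod (\<nu> k) \<le> 1/4" "\<And>x. cmod x \<le> 1/4 \<Longrightarrow> \<exists>k<n::nat. rho (\<nu> k) x \<le> t"
    using finite_rho_net[OF t] by blast
  \<comment> \<open>One function for every pair of a colour and a shift \<nu>; the index
    \<open>l\<close> stands for the colour \<open>l div n\<close> and the shift
    \<open>l mod n\<close>.\<close>
  define L where "L = (D + 1) * n"
  have main: "\<exists>B G. hoffman_level f w \<epsilon> L t (exp (4 * C)) R B G" if R: "R < 1" for R
  proof -
    define E where "E = {x \<in> cball 0 R. \<epsilon> \<le> cmod (f (disc_aut x w) - f x)}"
    have ER: "E \<subseteq> cball 0 R" by (auto simp: E_def)
    obtain T where T: "finite T" "T \<subseteq> E" "separated T" "\<And>x. x \<in> E \<Longrightarrow> \<exists>z\<in>T. rho z x < 1/4"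
      using maximal_separated[OF ER R] by blast
    have Td: "z \<in> disc" if "z \<in> T" for z using that T(2) R by (auto simp: E_def)
    \<comment> \<open>Neighbours are the pairs too close for interpolation. The automorphism
      \<phi>_x carries the neighbours of \<open>x\<close> onto a separated subset of a fixed smaller
      disc, so their number is bounded independently of \<open>R\<close>.\<close>
    have deg: "card {y \<in> T. y \<noteq> x \<and> \<kappa> < q x y} \<le> D" if x: "x \<in> T" for x
    proof -
      define Y where "Y = {y \<in> T. y \<noteq> x \<and> \<kappa> < q x y}"
      have Yd: "y \<in> disc" if "y \<in> Y" for y using that Td by (auto simp: Y_def)
      have inj: "inj_on (disc_aut x) Y"
        by (rule inj_on_inverseI[of _ "disc_aut x"]) (use disc_aut_invol Td[OF x] Yd in auto)
      have "disc_aut x ` Y \<subseteq> cball 0 (sqrt (1 - \<kappa>))"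
      proof
        fix y assume "y \<in> disc_aut x ` Y"
        then obtain u where u: "u \<in> Y" "y = disc_aut x u" by auto
        then have "(cmod y)^2 \<le> 1 - \<kappa>" by (simp add: Y_def q_def rho_def)
        then show "y \<in> cball 0 (sqrt (1 - \<kappa>))" by (simp add: real_le_rsqrt)
      qed
      moreover have "separated (disc_aut x ` Y)"
        unfolding separated_def
      proof (intro ballI impI)
        fix a b assume ab: "a \<in> disc_aut x ` Y" "b \<in> disc_aut x ` Y" "a \<noteq> b"
        then obtain a' b' where ab': "a' \<in> Y" "a = disc_aut x a'" "b' \<in> Y" "b = disc_aut x b'" by auto
        have "1/4 \<le> rho a' b'" using T(3) ab ab' unfolding separated_def Y_def by auto
        then show "1/4 \<le> rho a b" using ab' rho_disc_aut[OF Td[OF x] Yd Yd] by simp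
      qed
      ultimately have "card (disc_aut x ` Y) \<le> D" using D by blast
      then show ?thesis using card_image[OF inj] by (simp add: Y_def)
    qed
    have "\<exists>col :: complex \<Rightarrow> nat. (\<forall>x\<in>T. col x \<le> D) \<and> (\<forall>x\<in>T. \<forall>y\<in>T. x \<noteq> y \<and> \<kappa> < q x y \<longrightarrow> col x \<noteq> col y)"
      by (rule greedy_colouring[OF T(1)]) (use deg in \<open>auto simp: q_commute\<close>)
    then obtain col :: "complex \<Rightarrow> nat" where col: "\<forall>x\<in>T. col x \<le> D"
      "\<forall>x\<in>T. \<forall>y\<in>T. x \<noteq> y \<and> \<kappa> < q x y \<longrightarrow> col x \<noteq> col y" by (elim exE conjE)
    define S where "S i = {z \<in> T. col z = i}" for i
    define Q where "Q l B G \<longleftrightarrow> B holomorphic_on disc \<and> G holomorphic_on disc \<and>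
      (\<forall>x\<in>disc. cmod (B x) \<le> 1 \<and> cmod (G x) \<le> exp (4 * C)) \<and>
      (\<forall>z\<in>S (l div n). \<forall>x\<in>disc. cmod (B x) \<le> rho (disc_aut z (\<nu> (l mod n))) x) \<and>
      (\<forall>x\<in>disc. cmod (B x) < s * exp (- 2 * C) \<longrightarrow>
       cmod (G x - f (disc_aut x w)) \<le> s * (3 * exp (4 * C) + 12 / (1 - cmod w)^2))" for l B G
    have "\<exists>B G. Q l B G" if l: "l < L" for l
      unfolding Q_def
    proof (rule colour_class_interpolation[OF f f1 w \<epsilon>])
      show "finite (S (l div n))" "S (l div n) \<subseteq> disc" using T(1) Td by (auto simp: S_def)
      show "\<epsilon> \<le> cmod (f (disc_aut z w) - f z)" if "z \<in> S (l div n)" for z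
        using that T(2) by (auto simp: S_def E_def)
      show "q z z' \<le> min (81 / 2048) ((1 - cmod w) ^ 4 / 2)"
        if "z \<in> S (l div n)" "z' \<in> S (l div n)" "z \<noteq> z'" for z z'
      proof -
        have "z \<in> T" "z' \<in> T" "col z = col z'" using that by (auto simp: S_def)
        then have "\<not> \<kappa> < q z z'" using col(2) that(3) by blast
        then show ?thesis unfolding \<kappa>_def by (rule leI)
      qed
      have "0 < n" using l by (cases n) (auto simp: L_def)
      then show "cmod (\<nu> (l mod n)) \<le> 1/4" by (intro \<nu>) simp
      show "0 < s" "s \<le> 1" by (fact s)+
      show "C = 16/9 * (200 / ((\<epsilon> * (1 - (cmod w)^2))^2 * (1 - cmod w)^2))" by (fact C_def)
    qed
    then have "\<forall>l. \<exists>B G. l < L \<longrightarrow> Q l B G" by blast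
    then obtain B where "\<forall>l. \<exists>G. l < L \<longrightarrow> Q l (B l) G" using choice[of "\<lambda>l B. \<exists>G. l < L \<longrightarrow> Q l B G"] by blast
    then obtain G where Q: "\<forall>l. l < L \<longrightarrow> Q l (B l) (G l)" using choice[of "\<lambda>l G. l < L \<longrightarrow> Q l (B l) G"] by blast
    show ?thesis
      unfolding hoffman_level_def
    proof (rule exI[of _ B], rule exI[of _ G], intro conjI allI impI ballI)
      fix l assume "l < L"
      then have "Q l (B l) (G l)" using Q by blast
      note Ql = this[unfolded Q_def]
      show "B l holomorphic_on disc" "G l holomorphic_on disc" using Ql by simp_all
      show "cmod (B l x) \<le> 1" "cmod (G l x) \<le> exp (4 * C)" if "x \<in> disc" for x using Ql that by simp_all
      show "cmod (G l x - f (disc_aut x w)) \<le> \<epsilon>" if "x \<in> disc" "cmod (B l x) < 2 * t" for x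
      proof -
        have "cmod (B l x) < s * exp (- 2 * C)" using that(2) by (simp add: t_def)
        then have "cmod (G l x - f (disc_aut x w)) \<le> s * \<Lambda>" using Ql that(1) unfolding \<Lambda>_def by blast
        then show ?thesis using s\<Lambda> by (rule order_trans)
      qed
    next
      fix x assume x: "x \<in> cball 0 R" "\<epsilon> \<le> cmod (f (disc_aut x w) - f x)"
      then have "x \<in> E" by (simp add: E_def)
      then obtain z where z: "z \<in> T" "rho z x < 1/4" using T(4) by blast
      have xd: "x \<in> disc" using x R by auto
      define y where "y = disc_aut z x"
      have yd: "y \<in> disc" unfolding y_def by (rule disc_aut_in_disc[OF Td[OF z(1)] xd])
      have "cmod y \<le> 1/4" using z(2) by (simp add: y_def rho_def)
      then obtain k where k: "k < n" "rho (\<nu> k) y \<le> t" using \<nu>(2) by blast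
      have vd: "\<nu> k \<in> disc" using \<nu>(1)[OF k(1)] by auto
      define l where "l = col z * n + k"
      have ld: "l div n = col z" "l mod n = k" using k(1) by (simp_all add: l_def)
      have "col z * n + k < col z * n + n" using k by simp
      also have "\<dots> = (col z + 1) * n" by simp
      also have "\<dots> \<le> (D + 1) * n" using col(1) z(1) by (intro mult_right_mono) auto
      finally have l: "l < L" by (simp add: l_def L_def)
      have "z \<in> S (l div n)" using z(1) ld by (simp add: S_def)
      moreover have "Q l (B l) (G l)" using Q l by blast
      ultimately have "cmod (B l x) \<le> rho (disc_aut z (\<nu> (l mod n))) x" using xd unfolding Q_def by blast
      also have "\<dots> = rho (disc_aut z (\<nu> k)) (disc_aut z y)"
        unfolding ld y_def disc_aut_invol[OF Td[OF z(1)] xd] ..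
      also have "\<dots> = rho (\<nu> k) y" by (rule rho_disc_aut[OF Td[OF z(1)] vd yd])
      also have "\<dots> \<le> t" by (rule k(2))
      finally show "\<exists>l<L. cmod (B l x) \<le> t" using l by blast
    qed
  qed
  show ?thesis
    by (rule exI[of _ L], rule exI[of _ t], rule exI[of _ "exp (4 * C)"]) (intro conjI t allI impI main)
qed

text \<open>Let R tend to 1: the bounds are uniform, so the \<open>B\<close> and \<open>G\<close> at
  all levels form one normal family of 2L functions. The covering condition passes to the limit
  because |b_l(x)| > t for all l would persist along the sequence.\<close>

lemma hoffman_cover:
  assumes f: "f holomorphic_on disc" and f1: "\<And>z. z \<in> disc \<Longrightarrow> cmod (f z) \<le> 1" and w: "w \<in> disc"
    and \<epsilon>: "0 < \<epsilon>"
  shows "\<exists>(L::nat) t b g. 0 < t \<and> (\<forall>l<L. b l \<in> Hinf \<and> g l \<in> Hinf) \<and>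
    (\<forall>x\<in>disc. cmod (f (disc_aut x w) - f x) < \<epsilon> \<or> (\<exists>l<L. cmod (b l x) \<le> t)) \<and>
    (\<forall>l<L. \<forall>x\<in>disc. cmod (b l x) < 2 * t \<longrightarrow> cmod (g l x - f (disc_aut x w)) \<le> \<epsilon>)"
proof -
  obtain L t K where t: "0 < t" and fin: "\<forall>R<1. \<exists>B G. hoffman_level f w \<epsilon> L t K R B G"
    using hoffman_finite_level[OF f f1 w \<epsilon>] by blast
  define R where "R N = 1 - 1 / (real N + 2)" for N
  have R1: "R N < 1" for N by (simp add: R_def)
  have Rlim: "R \<longlonglongrightarrow> 1" unfolding R_def[abs_def] by real_asymp
  have "\<forall>N. \<exists>B G. hoffman_level f w \<epsilon> L t K (R N) B G" using fin R1 by blast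
  then obtain B where "\<forall>N. \<exists>G. hoffman_level f w \<epsilon> L t K (R N) (B N) G"
    using choice[of "\<lambda>N B. \<exists>G. hoffman_level f w \<epsilon> L t K (R N) B G"] by blast
  then obtain G where Q: "\<And>N. hoffman_level f w \<epsilon> L t K (R N) (B N) (G N)"
    using choice[of "\<lambda>N G. hoffman_level f w \<epsilon> L t K (R N) (B N) G"] by blast
  define F where "F N j = (if j < L then B N j else G N (j - L))" for N j
  have F: "F N j holomorphic_on disc" if "j < 2 * L" for N j
    using Q[of N] that unfolding hoffman_level_def F_def by (cases "j < L") auto
  have FK: "cmod (F N j z) \<le> max 1 K" if j: "j < 2 * L" and z: "z \<in> disc" for N j z
  proof (cases "j < L")
    case True
    then have "cmod (B N j z) \<le> 1" using Q[of N] z unfolding hoffman_level_def by blast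
    then show ?thesis using True by (simp add: F_def)
  next
    case False
    then have "j - L < L" using j by simp
    then have "cmod (G N (j - L) z) \<le> K" using Q[of N] z unfolding hoffman_level_def by blast
    then show ?thesis using False by (simp add: F_def)
  qed
  have "\<exists>h r. strict_mono (r :: nat \<Rightarrow> nat) \<and> (\<forall>j<2*L. h j holomorphic_on disc) \<and>
     (\<forall>j<2*L. \<forall>z\<in>disc. (\<lambda>N. F (r N) j z) \<longlonglongrightarrow> h j z) \<and> (\<forall>j<2*L. \<forall>z\<in>disc. cmod (h j z) \<le> max 1 K)"
    by (rule Montel_family[OF F FK])
  then obtain h and r :: "nat \<Rightarrow> nat" where r: "strict_mono r" and h: "\<forall>j<2*L. h j holomorphic_on disc"
     "\<forall>j<2*L. \<forall>z\<in>disc. (\<lambda>N. F (r N) j z) \<longlonglongrightarrow> h j z" "\<forall>j<2*L. \<forall>z\<in>disc. cmod (h j z) \<le> max 1 K"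
    by (elim exE conjE)
  define b where "b l z = (if z \<in> disc then h l z else 0)" for l z
  define g where "g l z = (if z \<in> disc then h (l + L) z else 0)" for l z
  have bH: "b l \<in> Hinf" "g l \<in> Hinf" if "l < L" for l
    unfolding b_def[abs_def] g_def[abs_def] using h(1,3) that
    by (intro HinfI[of "h l" "max 1 K"] HinfI[of "h (l + L)" "max 1 K"]; simp)+
  have blim: "(\<lambda>N. B (r N) l x) \<longlonglongrightarrow> b l x" "(\<lambda>N. G (r N) l x) \<longlonglongrightarrow> g l x" if "l < L" "x \<in> disc" for l x
  proof -
    have "(\<lambda>N. F (r N) l x) \<longlonglongrightarrow> h l x" using h(2) that by simp
    then show "(\<lambda>N. B (r N) l x) \<longlonglongrightarrow> b l x" using that by (simp add: F_def b_def)
    have "(\<lambda>N. F (r N) (l + L) x) \<longlonglongrightarrow> h (l + L) x" using h(2) that by simp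
    then show "(\<lambda>N. G (r N) l x) \<longlonglongrightarrow> g l x" using that by (simp add: F_def g_def)
  qed
  have 1: "cmod (f (disc_aut x w) - f x) < \<epsilon> \<or> (\<exists>l<L. cmod (b l x) \<le> t)" if x: "x \<in> disc" for x
  proof (rule ccontr)
    assume neg: "\<not> ?thesis"
    have "\<forall>\<^sub>F N in sequentially. t < cmod (B (r N) l x)" if "l \<in> {..<L}" for l
      using order_tendstoD(1)[OF tendsto_norm[OF blim(1)[of l x]], of t] neg that x by force
    then have "\<forall>\<^sub>F N in sequentially. \<forall>l\<in>{..<L}. t < cmod (B (r N) l x)"
      by (intro eventually_ball_finite) auto
    moreover have "\<forall>\<^sub>F N in sequentially. cmod x < R (r N)"
      using order_tendstoD(1)[OF LIMSEQ_subseq_LIMSEQ[OF Rlim r, unfolded o_def], of "cmod x"] x by simp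
    ultimately have "\<forall>\<^sub>F N in sequentially. False"
    proof eventually_elim
      case (elim N)
      have "x \<in> cball 0 (R (r N))" using elim(2) by simp
      moreover have "\<epsilon> \<le> cmod (f (disc_aut x w) - f x)" using neg by simp
      ultimately have "\<exists>l<L. cmod (B (r N) l x) \<le> t" using Q[of "r N"] unfolding hoffman_level_def by blast
      then obtain l where l: "l < L" "cmod (B (r N) l x) \<le> t" by blast
      moreover have "t < cmod (B (r N) l x)" using elim(1) l(1) by simp
      ultimately show False by simp
    qed
    then show False by simp
  qed
  have 2: "cmod (g l x - f (disc_aut x w)) \<le> \<epsilon>" if l: "l < L" and x: "x \<in> disc" and bt: "cmod (b l x) < 2 * t" for l x
  proof -
    have "\<forall>\<^sub>F N in sequentially. cmod (B (r N) l x) < 2 * t"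
      by (rule order_tendstoD(2)[OF tendsto_norm[OF blim(1)[OF l x]] bt])
    then have "\<forall>\<^sub>F N in sequentially. cmod (G (r N) l x - f (disc_aut x w)) \<le> \<epsilon>"
    proof eventually_elim
      case (elim N)
      then show ?case using Q[of "r N"] l x unfolding hoffman_level_def by blast
    qed
    then show ?thesis
      by (intro tendsto_upperbound[OF tendsto_norm[OF tendsto_diff[OF blim(2)[OF l x] tendsto_const]]]) auto
  qed
  show ?thesis using t bH 1 2 by blast
qed

section \<open>Existence of the Hoffman limits\<close>

text \<open>If |m(b_l)| < 2t for some l, then near \<open>m\<close> the function is \<epsilon>-close
  to \<open>g l\<close>, which converges. Otherwise all |b_l| exceed t near \<open>m\<close>, and it
  is \<epsilon>-close to \<open>f\<close>. In both cases it is eventually within 2\<epsilon> of a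
  constant, so its image filter is Cauchy.\<close>

lemma hoffman_limit_unit:
  assumes m: "m \<in> mult_functionals" and f: "f \<in> Hinf" and f1: "\<And>z. z \<in> disc \<Longrightarrow> cmod (f z) \<le> 1" and w: "w \<in> disc"
  shows "\<exists>c. ((\<lambda>z. f (disc_aut z w)) \<longlongrightarrow> c) (disc_to m)"
proof -
  define H where "H z = f (disc_aut z w)" for z
  have fh: "f holomorphic_on disc" using f by (simp add: Hinf_def)
  have lim: "\<exists>c. \<forall>\<^sub>F x in disc_to m. cmod (H x - c) < 2 * \<epsilon>" if \<epsilon>: "0 < \<epsilon>" for \<epsilon> :: real
  proof -
    obtain L :: nat and t b g where t: "0 < t" and H: "\<And>l. l < L \<Longrightarrow> b l \<in> Hinf" "\<And>l. l < L \<Longrightarrow> g l \<in> Hinf"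
      and c1: "\<And>x. x \<in> disc \<Longrightarrow> cmod (H x - f x) < \<epsilon> \<or> (\<exists>l<L. cmod (b l x) \<le> t)"
      and c2: "\<And>l x. l < L \<Longrightarrow> x \<in> disc \<Longrightarrow> cmod (b l x) < 2 * t \<Longrightarrow> cmod (g l x - H x) \<le> \<epsilon>"
      using hoffman_cover[OF fh f1 w \<epsilon>] unfolding H_def by blast
    show ?thesis
    proof (cases "\<exists>l<L. cmod (m (b l)) < 2 * t")
      case True
      then obtain l where l: "l < L" "cmod (m (b l)) < 2 * t" by blast
      have "\<forall>\<^sub>F x in disc_to m. cmod (b l x) < 2 * t"
        by (rule order_tendstoD(2)[OF tendsto_norm[OF tendsto_Hinf_disc_to[OF m H(1)[OF l(1)]]] l(2)])
      moreover have "\<forall>\<^sub>F x in disc_to m. dist (g l x) (m (g l)) < \<epsilon>"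
        by (rule tendstoD[OF tendsto_Hinf_disc_to[OF m H(2)[OF l(1)]] \<epsilon>])
      moreover have "\<forall>\<^sub>F x in disc_to m. x \<in> disc" by (rule eventually_disc_to_disc[OF m])
      ultimately have "\<forall>\<^sub>F x in disc_to m. cmod (H x - m (g l)) < 2 * \<epsilon>"
      proof eventually_elim
        case (elim x)
        have a: "cmod (H x - g l x) \<le> \<epsilon>" using c2[OF l(1) elim(3,1)] by (simp add: norm_minus_commute)
        have b: "cmod (g l x - m (g l)) < \<epsilon>" using elim(2) by (simp add: dist_norm)
        have "cmod (H x - m (g l)) \<le> cmod (H x - g l x) + cmod (g l x - m (g l))" by (rule norm_diff_triangle_ineq[of _ "g l x" "g l x", simplified])
        then show ?case using a b by linarith
      qed
      then show ?thesis by blast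
    next
      case False
      have "\<forall>\<^sub>F x in disc_to m. t < cmod (b l x)" if l: "l \<in> {..<L}" for l
      proof -
        have "t < cmod (m (b l))" using False l t by force
        then show ?thesis using l by (intro order_tendstoD(1)[OF tendsto_norm[OF tendsto_Hinf_disc_to[OF m H(1)]]]) auto
      qed
      then have "\<forall>\<^sub>F x in disc_to m. \<forall>l\<in>{..<L}. t < cmod (b l x)" by (intro eventually_ball_finite) auto
      moreover have "\<forall>\<^sub>F x in disc_to m. dist (f x) (m f) < \<epsilon>" by (rule tendstoD[OF tendsto_Hinf_disc_to[OF m f] \<epsilon>])
      moreover have "\<forall>\<^sub>F x in disc_to m. x \<in> disc" by (rule eventually_disc_to_disc[OF m])
      ultimately have "\<forall>\<^sub>F x in disc_to m. cmod (H x - m f) < 2 * \<epsilon>"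
      proof eventually_elim
        case (elim x)
        have a: "cmod (H x - f x) < \<epsilon>" using c1[OF elim(3)] elim(1) by force
        have b: "cmod (f x - m f) < \<epsilon>" using elim(2) by (simp add: dist_norm)
        have "cmod (H x - m f) \<le> cmod (H x - f x) + cmod (f x - m f)" by (rule norm_diff_triangle_ineq[of _ "f x" "f x", simplified])
        then show ?case using a b by linarith
      qed
      then show ?thesis by blast
    qed
  qed
  have "cauchy_filter (filtermap H (disc_to m))"
    unfolding cauchy_filter_metric_filtermap
  proof (intro allI impI)
    fix e :: real assume e: "0 < e"
    obtain c where c: "\<forall>\<^sub>F x in disc_to m. cmod (H x - c) < 2 * (e / 4)" using lim[of "e / 4"] e by auto
    show "\<exists>P. eventually P (disc_to m) \<and> (\<forall>x y. P x \<and> P y \<longrightarrow> dist (H x) (H y) < e)"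
    proof (intro exI[of _ "\<lambda>x. cmod (H x - c) < 2 * (e / 4)"] conjI c allI impI)
      fix x y assume "cmod (H x - c) < 2 * (e / 4) \<and> cmod (H y - c) < 2 * (e / 4)"
      moreover have "cmod (H x - H y) \<le> cmod (H x - c) + cmod (H y - c)"
        by (metis dist_norm dist_triangle2)
      ultimately show "dist (H x) (H y) < e" unfolding dist_norm by linarith
    qed
  qed
  moreover have "filtermap H (disc_to m) \<noteq> bot" using disc_dense[OF m] by (simp add: filtermap_bot_iff)
  ultimately have "\<exists>c\<in>UNIV. filtermap H (disc_to m) \<le> nhds c"
    using complete_UNIV[where 'a = complex] unfolding complete_uniform by auto
  then show ?thesis unfolding filterlim_def H_def by auto
qed

lemma hoffman_limit:
  assumes m: "m \<in> mult_functionals" and f: "f \<in> Hinf" and w: "w \<in> disc"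
  shows "\<exists>c. ((\<lambda>z. f (disc_aut z w)) \<longlongrightarrow> c) (disc_to m)"
proof -
  obtain C where C: "0 < C" "\<forall>z\<in>disc. cmod (f z) \<le> C" using Hinf_bound[OF f] by auto
  have 1: "cmod (of_real (1 / C) * f z) \<le> 1" if "z \<in> disc" for z
    using C that by (simp add: norm_mult norm_divide)
  obtain c where "((\<lambda>z. of_real (1 / C) * f (disc_aut z w)) \<longlongrightarrow> c) (disc_to m)"
    using hoffman_limit_unit[OF m Hinf_cmult[OF f] 1 w] by blast
  from tendsto_mult[OF tendsto_const[of "of_real C"] this] show ?thesis using C by (auto simp: mult.assoc[symmetric] of_real_mult[symmetric] simp del: of_real_mult)
qed

text \<open>The limits for the individual \<open>f\<close> form a multiplicative functional
  \<open>p\<close> because limits respect the algebra operations; restriction to \<open>Hinf\<close>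
  gives \<open>p\<close> the default value off it. Properness of \<open>disc_to m\<close> makes
  \<open>p\<close> the only candidate for the description in \<open>hoffman_map\<close>.\<close>

lemma hoffman_map:
  assumes m: "m \<in> mult_functionals" and w: "w \<in> disc"
  shows hoffman_map_mult: "hoffman_map m w \<in> mult_functionals"
    and hoffman_map_limit: "f \<in> Hinf \<Longrightarrow> ((\<lambda>z. f (disc_aut z w)) \<longlongrightarrow> hoffman_map m w f) (disc_to m)"
proof -
  note ne = disc_dense[OF m]
  obtain c where c: "\<And>f. f \<in> Hinf \<Longrightarrow> ((\<lambda>z. f (disc_aut z w)) \<longlongrightarrow> c f) (disc_to m)"
    using hoffman_limit[OF m _ w] by metis
  define p where "p = restrict c Hinf"
  have pc: "((\<lambda>z. f (disc_aut z w)) \<longlongrightarrow> p f) (disc_to m)" if "f \<in> Hinf" for f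
    using c[OF that] that by (simp add: p_def)
  have pm: "p \<in> mult_functionals"
    unfolding mult_functionals_iff
  proof (intro conjI ballI allI)
    show "p \<in> extensional Hinf" by (simp add: p_def)
    fix f assume f: "f \<in> Hinf"
    show "p (\<lambda>z. f z + g z) = p f + p g" if g: "g \<in> Hinf" for g
      using tendsto_unique[OF ne pc[OF Hinf_add[OF f g]] tendsto_add[OF pc[OF f] pc[OF g]]] .
    show "p (\<lambda>z. f z * g z) = p f * p g" if g: "g \<in> Hinf" for g
      using tendsto_unique[OF ne pc[OF Hinf_mult[OF f g]] tendsto_mult[OF pc[OF f] pc[OF g]]] .
    show "p (\<lambda>z. k * f z) = k * p f" for k
      using tendsto_unique[OF ne pc[OF Hinf_cmult[OF f]] tendsto_mult[OF tendsto_const pc[OF f]]] .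
  next
    have "((\<lambda>z. indicator disc (disc_aut z w)) \<longlongrightarrow> (1::complex)) (disc_to m)"
    proof (rule tendsto_eventually)
      show "\<forall>\<^sub>F z in disc_to m. indicator disc (disc_aut z w) = (1::complex)"
        using eventually_disc_to_disc[OF m]
        by eventually_elim (use disc_aut_in_disc[OF _ w] in \<open>simp add: indicator_def\<close>)
    qed
    from tendsto_unique[OF ne pc[OF Hinf_one] this] show "p (indicator disc) = 1" .
  qed
  have limitin_iff: "limitin M (\<lambda>z. point_eval (disc_aut z w)) p' (disc_to m) \<longleftrightarrow>
      p' \<in> mult_functionals \<and> (\<forall>f\<in>Hinf. ((\<lambda>z. f (disc_aut z w)) \<longlongrightarrow> p' f) (disc_to m))" for p'
  proof -
    have ev: "\<forall>\<^sub>F z in disc_to m. point_eval (disc_aut z w) \<in> mult_functionals"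
      using eventually_disc_to_disc[OF m] by eventually_elim (intro point_eval_mult disc_aut_in_disc w)
    have "limitin M (\<lambda>z. point_eval (disc_aut z w)) p' (disc_to m) \<longleftrightarrow>
      p' \<in> mult_functionals \<and> limitin (product_topology (\<lambda>_. euclidean) Hinf) (\<lambda>z. point_eval (disc_aut z w)) p' (disc_to m)"
      unfolding max_ideal_space_def limitin_subtopology using ev by auto
    also have "\<dots> \<longleftrightarrow> p' \<in> mult_functionals \<and> (\<forall>f\<in>Hinf. ((\<lambda>z. f (disc_aut z w)) \<longlongrightarrow> p' f) (disc_to m))"
      unfolding limitin_componentwise by (auto simp: mult_functionals_def point_eval_def)
    finally show ?thesis .
  qed
  have "hoffman_map m w = p"
    unfolding hoffman_map_def
  proof (rule the_equality)
    show "limitin M (\<lambda>z. point_eval (disc_aut z w)) p (disc_to m)" unfolding limitin_iff using pm pc by blast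
    fix p' assume "limitin M (\<lambda>z. point_eval (disc_aut z w)) p' (disc_to m)"
    then have p': "p' \<in> mult_functionals" "\<And>f. f \<in> Hinf \<Longrightarrow> ((\<lambda>z. f (disc_aut z w)) \<longlongrightarrow> p' f) (disc_to m)"
      unfolding limitin_iff by auto
    show "p' = p"
    proof
      fix f show "p' f = p f"
      proof (cases "f \<in> Hinf")
        case True
        show ?thesis by (rule tendsto_unique[OF ne p'(2)[OF True] pc[OF True]])
      next
        case False
        then show ?thesis using mult_functionals_ext p'(1) pm by metis
      qed
    qed
  qed
  then show "hoffman_map m w \<in> mult_functionals"
    "f \<in> Hinf \<Longrightarrow> ((\<lambda>z. f (disc_aut z w)) \<longlongrightarrow> hoffman_map m w f) (disc_to m)"
    using pm pc by simp_all
qed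

lemma hoffman_map_limit_continuous:
  fixes F :: "functional \<Rightarrow> 'a::topological_space"
  assumes m: "m \<in> mult_functionals" and w: "w \<in> disc" and F: "continuous_map M euclidean F"
  shows "((\<lambda>z. F (point_eval (disc_aut z w))) \<longlongrightarrow> F (hoffman_map m w)) (disc_to m)"
proof -
  have ev: "\<forall>\<^sub>F z in disc_to m. point_eval (disc_aut z w) \<in> mult_functionals"
    using eventually_disc_to_disc[OF m] by eventually_elim (intro point_eval_mult disc_aut_in_disc w)
  have lim: "limitin M (\<lambda>z. point_eval (disc_aut z w)) (hoffman_map m w) (disc_to m)"
    unfolding max_ideal_space_def limitin_subtopology limitin_componentwise
    using ev hoffman_map[OF m w] by (auto simp: mult_functionals_def point_eval_def)
  from continuous_map_limit[OF F lim] show ?thesis by (simp add: o_def)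
qed

section \<open>The Bergman space\<close>

definition L2 :: "(complex \<Rightarrow> complex) set" where
  "L2 = {u \<in> borel_measurable dA. integrable dA (\<lambda>z. (cmod (u z))^2)}"

lemma measurable_cnj [measurable]: "cnj \<in> borel_measurable borel"
  by (intro borel_measurable_continuous_onI continuous_intros)

lemma L2_measurable [measurable_dest]: "f \<in> L2 \<Longrightarrow> f \<in> borel_measurable dA"
  and L2_integrable: "f \<in> L2 \<Longrightarrow> integrable dA (\<lambda>z. (cmod (f z))^2)"
  by (auto simp: L2_def)

lemma L2_bound:
  assumes [measurable]: "f \<in> borel_measurable dA" and g: "integrable dA g" and le: "\<And>z. z \<in> disc \<Longrightarrow> (cmod (f z))^2 \<le> g z"
  shows "f \<in> L2"
proof -
  have "integrable dA (\<lambda>z. (cmod (f z))^2)"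
    by (rule Bochner_Integration.integrable_bound[OF g]) (use le in \<open>auto intro!: AE_I2 order_trans[OF le]\<close>)
  then show ?thesis using assms by (simp add: L2_def)
qed

lemma L2_bounded:
  assumes "f \<in> borel_measurable dA" "\<And>z. z \<in> disc \<Longrightarrow> cmod (f z) \<le> C"
  shows "f \<in> L2"
proof (rule L2_bound[OF assms(1)])
  show "integrable dA (\<lambda>z. C^2)" by simp
  show "(cmod (f z))^2 \<le> C^2" if "z \<in> disc" for z using assms(2)[OF that] by (intro power_mono) auto
qed

lemma L2_add:
  assumes "f \<in> L2" "g \<in> L2" shows "(\<lambda>z. f z + g z) \<in> L2"
proof (rule L2_bound)
  show "(\<lambda>z. f z + g z) \<in> borel_measurable dA" using assms[THEN L2_measurable] by measurable
  show "integrable dA (\<lambda>z. 2 * (cmod (f z))^2 + 2 * (cmod (g z))^2)" using assms[THEN L2_integrable] by simp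
  show "(cmod (f z + g z))^2 \<le> 2 * (cmod (f z))^2 + 2 * (cmod (g z))^2" for z
    by (rule order_trans[OF power_mono[OF norm_triangle_ineq norm_ge_zero] sum_squares_bound_2])
qed

lemma L2_cmult: "f \<in> L2 \<Longrightarrow> (\<lambda>z. c * f z) \<in> L2"
  by (auto simp: L2_def norm_mult power_mult_distrib)

lemma L2_diff: "f \<in> L2 \<Longrightarrow> g \<in> L2 \<Longrightarrow> (\<lambda>z. f z - g z) \<in> L2"
  using L2_add[of f "\<lambda>z. (-1) * g z"] L2_cmult[of g "-1"] by simp

lemma L2_mult_bounded:
  assumes "u \<in> borel_measurable dA" "\<And>z. z \<in> disc \<Longrightarrow> cmod (u z) \<le> C" "f \<in> L2"
  shows "(\<lambda>z. u z * f z) \<in> L2"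
proof (rule L2_bound)
  show "(\<lambda>z. u z * f z) \<in> borel_measurable dA" using assms(1) L2_measurable[OF assms(3)] by measurable
  show "integrable dA (\<lambda>z. C^2 * (cmod (f z))^2)" using L2_integrable[OF assms(3)] by simp
  show "(cmod (u z * f z))^2 \<le> C^2 * (cmod (f z))^2" if "z \<in> disc" for z
    unfolding norm_mult power_mult_distrib using assms(2)[OF that] by (intro mult_right_mono power_mono) auto
qed

lemma L2_integrable_mult:
  assumes "f \<in> L2" "g \<in> L2" shows "integrable dA (\<lambda>z. f z * cnj (g z))"
proof (rule Bochner_Integration.integrable_bound)
  show "integrable dA (\<lambda>z. (cmod (f z))^2 + (cmod (g z))^2)" using assms[THEN L2_integrable] by simp
  show "(\<lambda>z. f z * cnj (g z)) \<in> borel_measurable dA" using assms[THEN L2_measurable] by measurable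
  have "cmod (f z * cnj (g z)) \<le> (cmod (f z))^2 + (cmod (g z))^2" for z
  proof -
    have "2 * cmod (f z) * cmod (g z) \<le> (cmod (f z))^2 + (cmod (g z))^2" by (rule sum_squares_bound)
    moreover have "0 \<le> cmod (f z) * cmod (g z)" by simp
    ultimately show ?thesis unfolding norm_mult complex_mod_cnj by linarith
  qed
  then show "AE z in dA. cmod (f z * cnj (g z)) \<le> norm ((cmod (f z))^2 + (cmod (g z))^2)" by simp
qed

lemma norm2_nonneg [simp]: "0 \<le> norm2 f" by (simp add: norm2_def)

lemma norm2_square: "(norm2 f)^2 = (\<integral>z. (cmod (f z))^2 \<partial>dA)"
  by (simp add: norm2_def)

lemma ip_self: "ip f f = of_real ((norm2 f)^2)"
  unfolding norm2_square ip_def integral_complex_of_real[symmetric] complex_norm_square[unfolded of_real_power[symmetric]] by simp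

lemma ip_cong: "(\<And>z. z \<in> disc \<Longrightarrow> f z = f' z) \<Longrightarrow> (\<And>z. z \<in> disc \<Longrightarrow> g z = g' z) \<Longrightarrow> ip f g = ip f' g'"
  unfolding ip_def by (intro Bochner_Integration.integral_cong) auto

lemma norm2_cmult: "norm2 (\<lambda>z. c * f z) = cmod c * norm2 f"
  by (simp add: norm2_def norm_mult power_mult_distrib real_sqrt_mult)

lemma ip_add_left: "f \<in> L2 \<Longrightarrow> g \<in> L2 \<Longrightarrow> h \<in> L2 \<Longrightarrow> ip (\<lambda>z. f z + g z) h = ip f h + ip g h"
  using L2_integrable_mult by (simp add: ip_def distrib_right)

lemma ip_cmult_left: "ip (\<lambda>z. c * f z) h = c * ip f h"
  by (simp add: ip_def mult.assoc)

lemma ip_diff_left: "f \<in> L2 \<Longrightarrow> g \<in> L2 \<Longrightarrow> h \<in> L2 \<Longrightarrow> ip (\<lambda>z. f z - g z) h = ip f h - ip g h"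
  using L2_integrable_mult by (simp add: ip_def left_diff_distrib)

lemma ip_cnj: "ip g f = cnj (ip f g)"
  unfolding ip_def Bochner_Integration.integral_cnj[symmetric] complex_cnj_mult complex_cnj_cnj by (simp only: mult.commute)

lemma ip_diff_right: "f \<in> L2 \<Longrightarrow> g \<in> L2 \<Longrightarrow> h \<in> L2 \<Longrightarrow> ip h (\<lambda>z. f z - g z) = ip h f - ip h g"
  using L2_integrable_mult by (simp add: ip_def right_diff_distrib)

lemma ip_add_right: "f \<in> L2 \<Longrightarrow> g \<in> L2 \<Longrightarrow> h \<in> L2 \<Longrightarrow> ip h (\<lambda>z. f z + g z) = ip h f + ip h g"
  using L2_integrable_mult by (simp add: ip_def distrib_left)

lemma ip_cmult_right: "ip h (\<lambda>z. c * f z) = cnj c * ip h f"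
  by (simp add: ip_def mult.assoc mult.left_commute)

text \<open>The weighted inequality is optimal at t = B/A. Adding d > 0 to both norms covers
  vanishing norms, and d then tends to 0.\<close>

lemma Cauchy_Schwarz_ip:
  assumes f: "f \<in> L2" and g: "g \<in> L2" shows "cmod (ip f g) \<le> norm2 f * norm2 g"
proof -
  define A B where "A = norm2 f" and "B = norm2 g"
  have AB: "0 \<le> A" "0 \<le> B" by (simp_all add: A_def B_def)
  have 1: "cmod (ip f g) \<le> (t * A^2 + B^2 / t) / 2" if t: "0 < t" for t
  proof -
    have "cmod (ip f g) \<le> (\<integral>z. (t * (cmod (f z))^2 + (cmod (g z))^2 / t) / 2 \<partial>dA)"
      unfolding ip_def
    proof (rule order_trans[OF integral_norm_bound integral_mono])
      show "integrable dA (\<lambda>z. cmod (f z * cnj (g z)))" using L2_integrable_mult[OF f g] by simp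
      show "integrable dA (\<lambda>z. (t * (cmod (f z))^2 + (cmod (g z))^2 / t) / 2)"
        using L2_integrable[OF f] L2_integrable[OF g] by simp
      show "cmod (f z * cnj (g z)) \<le> (t * (cmod (f z))^2 + (cmod (g z))^2 / t) / 2" for z
      proof -
        have "2 * cmod (f z) * cmod (g z) \<le> t * (cmod (f z))^2 + (cmod (g z))^2 / t"
          by (rule mult_le_weighted_squares[OF t])
        then show ?thesis by (simp add: norm_mult)
      qed
    qed
    also have "\<dots> = (t * A^2 + B^2 / t) / 2"
      unfolding A_def B_def norm2_square using L2_integrable[OF f] L2_integrable[OF g] by simp
    finally show ?thesis .
  qed
  have 2: "cmod (ip f g) \<le> A * B + d * (A + B) / 2" if d: "0 < d" for d
  proof -
    have p: "0 < A + d" "0 < B + d" using AB d by auto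
    have "cmod (ip f g) \<le> ((B + d) / (A + d) * A^2 + B^2 / ((B + d) / (A + d))) / 2" using p by (intro 1) auto
    also have "(B + d) / (A + d) * A^2 \<le> (B + d) * A"
    proof -
      have "A * A / (A + d) \<le> A" using p AB d by (simp add: pos_divide_le_eq algebra_simps)
      then have "(B + d) * (A * A / (A + d)) \<le> (B + d) * A" using p by (intro mult_left_mono) auto
      then show ?thesis by (simp add: power2_eq_square)
    qed
    also have "B^2 / ((B + d) / (A + d)) \<le> (A + d) * B"
    proof -
      have "B * B / (B + d) \<le> B" using p AB d by (simp add: pos_divide_le_eq algebra_simps)
      then have "(A + d) * (B * B / (B + d)) \<le> (A + d) * B" using p by (intro mult_left_mono) auto
      then show ?thesis by (simp add: power2_eq_square mult.commute)
    qed
    finally show ?thesis by (simp add: field_simps)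
  qed
  have "((\<lambda>d. A * B + d * (A + B) / 2) \<longlongrightarrow> A * B + 0 * (A + B) / 2) (at_right 0)"
    by (intro tendsto_intros) auto
  then have "cmod (ip f g) \<le> A * B + 0 * (A + B) / 2"
    by (rule tendsto_lowerbound) (use 2 in \<open>auto simp: eventually_at_right_field intro!: exI[of _ 1]\<close>)
  then show ?thesis by (simp add: A_def B_def)
qed

lemma norm2_triangle:
  assumes f: "f \<in> L2" and g: "g \<in> L2" shows "norm2 (\<lambda>z. f z + g z) \<le> norm2 f + norm2 g"
proof (rule power2_le_imp_le)
  have "complex_of_real ((norm2 (\<lambda>z. f z + g z))^2) = (ip f f + ip g g) + (ip f g + ip g f)"
    unfolding ip_self[symmetric] using f g by (simp add: ip_add_left ip_add_right L2_add)
  also have "ip f g + ip g f = of_real (2 * Re (ip f g))" by (subst ip_cnj[of g f]) (simp add: complex_add_cnj)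
  finally have "(norm2 (\<lambda>z. f z + g z))^2 = (norm2 f)^2 + (norm2 g)^2 + 2 * Re (ip f g)"
    unfolding ip_self of_real_add[symmetric] of_real_eq_iff .
  moreover have "Re (ip f g) \<le> norm2 f * norm2 g"
    using complex_Re_le_cmod[of "ip f g"] Cauchy_Schwarz_ip[OF f g] by linarith
  ultimately show "(norm2 (\<lambda>z. f z + g z))^2 \<le> (norm2 f + norm2 g)^2" by (simp add: power2_sum)
qed auto

lemma norm2_mono:
  assumes g: "integrable dA (\<lambda>z. (cmod (g z))^2)" and f: "f \<in> L2"
    and le: "\<And>z. z \<in> disc \<Longrightarrow> cmod (f z) \<le> C * cmod (g z)" and C: "0 \<le> C"
  shows "norm2 f \<le> C * norm2 g"
proof (rule power2_le_imp_le)
  have "(norm2 f)^2 \<le> (\<integral>z. C^2 * (cmod (g z))^2 \<partial>dA)"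
    unfolding norm2_square
  proof (rule integral_mono)
    show "(cmod (f z))^2 \<le> C^2 * (cmod (g z))^2" if "z \<in> space dA" for z
      using power_mono[OF le, of z 2] that by (simp add: power_mult_distrib)
  qed (use f g L2_integrable in auto)
  also have "\<dots> = (C * norm2 g)^2" by (simp add: norm2_square power_mult_distrib)
  finally show "(norm2 f)^2 \<le> (C * norm2 g)^2" .
qed (use C in simp)

lemma norm2_indicator [simp]: "norm2 (indicator disc) = 1"
proof -
  have "(norm2 (indicator disc))^2 = (\<integral>z. 1 \<partial>dA)"
    unfolding norm2_square by (rule Bochner_Integration.integral_cong) auto
  then have "(norm2 (indicator disc))^2 = 1" by (simp add: measure_dA_disc)
  then show ?thesis using norm2_nonneg by (simp add: power2_eq_1_iff) (metis norm2_nonneg not_one_le_zero neg_0_le_iff_le)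
qed

lemma bergman_holo: "f \<in> bergman \<Longrightarrow> f holomorphic_on disc"
  and bergman_off: "f \<in> bergman \<Longrightarrow> z \<notin> disc \<Longrightarrow> f z = 0"
  by (simp_all add: bergman_def)

lemma bergman_L2: "f \<in> bergman \<Longrightarrow> f \<in> L2"
  unfolding bergman_def L2_def
  by (auto intro!: continuous_on_borel_measurable_dA holomorphic_on_imp_continuous_on)

lemma bergmanI: "f holomorphic_on disc \<Longrightarrow> (\<And>z. z \<notin> disc \<Longrightarrow> f z = 0) \<Longrightarrow> f \<in> L2 \<Longrightarrow> f \<in> bergman"
  by (simp add: bergman_def L2_def)

lemma bergman_add: "f \<in> bergman \<Longrightarrow> g \<in> bergman \<Longrightarrow> (\<lambda>z. f z + g z) \<in> bergman"
  by (rule bergmanI) (simp_all add: holomorphic_on_add L2_add bergman_L2 bergman_holo bergman_off del: mem_ball)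

lemma bergman_cmult: "f \<in> bergman \<Longrightarrow> (\<lambda>z. c * f z) \<in> bergman"
  by (rule bergmanI) (simp_all add: holomorphic_on_mult L2_cmult bergman_L2 bergman_holo bergman_off del: mem_ball)

lemma bergman_diff: "f \<in> bergman \<Longrightarrow> g \<in> bergman \<Longrightarrow> (\<lambda>z. f z - g z) \<in> bergman"
  using bergman_add[of f "\<lambda>z. (-1) * g z"] bergman_cmult[of g "-1"] by simp

lemma Hinf_bergman:
  assumes "h \<in> Hinf" shows "h \<in> bergman"
proof -
  obtain C where "\<forall>z\<in>disc. cmod (h z) \<le> C" using Hinf_bound[OF assms] by auto
  then show ?thesis using assms unfolding Hinf_def
    by (intro bergmanI L2_bounded[of _ C] continuous_on_borel_measurable_dA holomorphic_on_imp_continuous_on) auto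
qed

lemmas bergman_one = Hinf_bergman[OF Hinf_one]

section \<open>Unitary involutions and the reproducing property\<close>

text \<open>Up to sign this is the derivative of \<open>disc_aut z\<close>, so its squared modulus
  is the Jacobian; \<open>normalized_kernel_eq\<close> identifies it with the normalized
  kernel.\<close>

definition kk :: "complex \<Rightarrow> complex \<Rightarrow> complex" where
  "kk z w = (if w \<in> disc then of_real (1 - (cmod z)^2) / (1 - cnj z * w)^2 else 0)"

definition V :: "complex \<Rightarrow> (complex \<Rightarrow> complex) \<Rightarrow> complex \<Rightarrow> complex" where
  "V z f w = kk z w * f (disc_aut z w)"

lemma measurable_disc_aut:
  assumes "z \<in> disc" shows "disc_aut z \<in> measurable dA dA"
proof -
  have "disc_aut z \<in> borel_measurable dA"
    by (intro continuous_on_borel_measurable_dA holomorphic_on_imp_continuous_on holomorphic_disc_aut assms)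
  then have "disc_aut z \<in> measurable dA (restrict_space borel disc)"
    using disc_aut_in_disc[OF assms] by (intro measurable_restrict_space2) auto
  then show ?thesis by (subst measurable_cong_sets[OF refl sets_dA])
qed

lemma kk_holo: "z \<in> disc \<Longrightarrow> kk z holomorphic_on disc"
proof -
  assume z: "z \<in> disc"
  have "(\<lambda>w. of_real (1 - (cmod z)^2) / (1 - cnj z * w)^2) holomorphic_on disc"
    using disc_aut_denom[OF z] by (intro holomorphic_intros) auto
  then show ?thesis by (rule holomorphic_transform) (simp add: kk_def)
qed

lemma norm_kk: assumes "z \<in> disc" "w \<in> disc" shows "cmod (kk z w) = cmod (deriv (disc_aut z) w)"
  using DERIV_imp_deriv[OF has_field_derivative_disc_aut[OF assms]] assms
  by (simp add: kk_def norm_divide norm_minus_commute[of "(of_real (cmod z))^2" 1])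

lemma integral_disc_aut:
  fixes F :: "complex \<Rightarrow> 'b::{banach,second_countable_topology}"
  assumes z: "z \<in> disc" and F: "F \<in> borel_measurable dA"
  shows "(\<integral>w. (cmod (kk z w))^2 *\<^sub>R F (disc_aut z w) \<partial>dA) = integral\<^sup>L dA F" (is ?A)
    and "integrable dA (\<lambda>w. (cmod (kk z w))^2 *\<^sub>R F (disc_aut z w)) \<longleftrightarrow> integrable dA F" (is ?B)
proof -
  have kkm: "kk z \<in> borel_measurable dA"
    by (intro continuous_on_borel_measurable_dA holomorphic_on_imp_continuous_on kk_holo z)
  have km: "(\<lambda>w. (cmod (kk z w))^2) \<in> borel_measurable dA" using kkm by measurable
  define D where "D = density dA (\<lambda>w. ennreal ((cmod (kk z w))^2))"
  have "D = density dA (\<lambda>x. ennreal ((cmod (deriv (disc_aut z) x))^2))"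
    unfolding D_def
  proof (rule density_cong)
    show "(\<lambda>w. ennreal ((cmod (kk z w))^2)) \<in> borel_measurable dA" using km by measurable
    then show "(\<lambda>x. ennreal ((cmod (deriv (disc_aut z) x))^2)) \<in> borel_measurable dA"
      by (rule measurable_cong[THEN iffD1, rotated]) (simp add: norm_kk[OF z])
    show "AE x in dA. ennreal ((cmod (kk z x))^2) = ennreal ((cmod (deriv (disc_aut z) x))^2)"
      by (rule AE_I2) (simp add: norm_kk[OF z])
  qed
  then have eq: "distr D dA (disc_aut z) = dA"
    using distr_dA_biholomorphic[OF holomorphic_disc_aut[OF z] bij_betw_disc_aut[OF z] holomorphic_disc_aut[OF z] disc_aut_invol[OF z]] by simp
  have \<phi>: "disc_aut z \<in> measurable D dA" using measurable_disc_aut[OF z] by (simp add: D_def)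
  have F\<phi>: "(\<lambda>w. F (disc_aut z w)) \<in> borel_measurable dA" by (rule measurable_compose[OF measurable_disc_aut[OF z] F])
  have "integral\<^sup>L dA F = integral\<^sup>L D (\<lambda>w. F (disc_aut z w))" by (subst eq[symmetric]) (rule integral_distr[OF \<phi> F])
  also have "\<dots> = (\<integral>w. (cmod (kk z w))^2 *\<^sub>R F (disc_aut z w) \<partial>dA)" unfolding D_def by (rule integral_density[OF F\<phi> km]) simp
  finally show ?A ..
  have "integrable dA F \<longleftrightarrow> integrable D (\<lambda>w. F (disc_aut z w))" by (subst eq[symmetric]) (rule integrable_distr_eq[OF \<phi> F])
  also have "\<dots> \<longleftrightarrow> integrable dA (\<lambda>w. (cmod (kk z w))^2 *\<^sub>R F (disc_aut z w))"
    unfolding D_def by (rule integrable_density[OF F\<phi> km]) simp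
  finally show ?B ..
qed

lemma V_L2:
  assumes z: "z \<in> disc" and f: "f \<in> L2" shows "V z f \<in> L2"
proof -
  have [measurable]: "kk z \<in> borel_measurable dA"
    by (intro continuous_on_borel_measurable_dA holomorphic_on_imp_continuous_on kk_holo z)
  have [measurable]: "(\<lambda>w. f (disc_aut z w)) \<in> borel_measurable dA" by (rule measurable_compose[OF measurable_disc_aut[OF z] L2_measurable[OF f]])
  have "(\<lambda>w. (cmod (f w))^2) \<in> borel_measurable dA" using L2_measurable[OF f] by measurable
  from integral_disc_aut(2)[OF z this] L2_integrable[OF f]
  have "integrable dA (\<lambda>w. (cmod (V z f w))^2)" by (simp add: V_def norm_mult power_mult_distrib)
  moreover have "V z f \<in> borel_measurable dA" unfolding V_def[abs_def] by measurable
  ultimately show ?thesis by (simp add: L2_def)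
qed

lemma ip_V:
  assumes z: "z \<in> disc" and f: "f \<in> L2" and g: "g \<in> L2" shows "ip (V z f) (V z g) = ip f g"
proof -
  have "(\<lambda>w. f w * cnj (g w)) \<in> borel_measurable dA" using L2_measurable[OF f] L2_measurable[OF g] by measurable
  from integral_disc_aut(1)[OF z this] show ?thesis
    unfolding ip_def V_def scaleR_conv_of_real complex_norm_square[unfolded of_real_power[symmetric]] complex_cnj_mult
    by (simp add: mult_ac)
qed

lemma norm2_V: "z \<in> disc \<Longrightarrow> f \<in> L2 \<Longrightarrow> norm2 (V z f) = norm2 f"
proof -
  assume "z \<in> disc" "f \<in> L2"
  then have "complex_of_real ((norm2 (V z f))^2) = of_real ((norm2 f)^2)" unfolding ip_self[symmetric] by (simp add: ip_V)
  then have "(norm2 (V z f))^2 = (norm2 f)^2" by (simp only: of_real_eq_iff)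
  then show ?thesis by simp
qed

text \<open>The chain rule for \<phi>_z \<circ> \<phi>_z = id, as \<open>kk z\<close> is minus the
  derivative of \<phi>_z. It makes \<open>V z\<close> an involution.\<close>

lemma kk_disc_aut:
  assumes z: "z \<in> disc" and w: "w \<in> disc" shows "kk z w * kk z (disc_aut z w) = 1"
proof -
  have n: "1 - cnj z * w \<noteq> 0" "1 - cnj z * z \<noteq> 0" using disc_aut_denom z w by auto
  have *: "complex_of_real (1 - (cmod z)^2) = 1 - cnj z * z"
    using complex_norm_square[of z] by (simp add: mult.commute)
  have "1 - cnj z * disc_aut z w = (1 - cnj z * z) / (1 - cnj z * w)"
    using n by (simp add: disc_aut_def field_simps)
  then show ?thesis unfolding kk_def * using w disc_aut_in_disc[OF z w] n by (simp add: power2_eq_square)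
qed

lemma V_V: "z \<in> disc \<Longrightarrow> w \<in> disc \<Longrightarrow> V z (V z f) w = f w"
  using kk_disc_aut[of z w] disc_aut_invol[of z w] by (simp add: V_def mult.assoc[symmetric])

lemma V_bergman:
  assumes z: "z \<in> disc" and f: "f \<in> bergman" shows "V z f \<in> bergman"
proof (rule bergmanI)
  show "V z f holomorphic_on disc" unfolding V_def[abs_def]
    by (intro holomorphic_on_mult kk_holo z holomorphic_disc_aut_compose bergman_holo f)
  show "V z f w = 0" if "w \<notin> disc" for w using that by (simp add: V_def kk_def)
  show "V z f \<in> L2" by (intro V_L2 z bergman_L2 f)
qed

lemma V_V_bergman: "z \<in> disc \<Longrightarrow> f \<in> bergman \<Longrightarrow> V z (V z f) = f"
proof
  fix w assume z: "z \<in> disc" and f: "f \<in> bergman"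
  show "V z (V z f) w = f w"
    using V_V[OF z, of w f] bergman_off[OF f, of w] bergman_off[OF V_bergman[OF z V_bergman[OF z f]], of w] by (cases "w \<in> disc") auto
qed

lemma V_add: "V z (\<lambda>w. f w + g w) = (\<lambda>w. V z f w + V z g w)"
  and V_diff: "V z (\<lambda>w. f w - g w) = (\<lambda>w. V z f w - V z g w)"
  and V_cmult: "V z (\<lambda>w. c * f w) = (\<lambda>w. c * V z f w)"
  by (simp_all add: V_def fun_eq_iff algebra_simps)

lemma V_one: "z \<in> disc \<Longrightarrow> V z (indicator disc) = kk z"
proof
  fix w assume z: "z \<in> disc"
  show "V z (indicator disc) w = kk z w"
    using disc_aut_in_disc[OF z, of w] by (cases "w \<in> disc") (auto simp: V_def kk_def)
qed

lemma kk_bergman: "z \<in> disc \<Longrightarrow> kk z \<in> bergman"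
  using V_bergman[OF _ bergman_one] by (simp add: V_one)

lemma normalized_kernel_eq:
  assumes z: "z \<in> disc" shows "normalized_kernel z = kk z"
proof -
  have z1: "0 < 1 - (cmod z)^2" using z by (simp add: abs_square_less_1)
  have eq: "kk z = (\<lambda>w. of_real (1 - (cmod z)^2) * bergman_kernel z w)"
    by (auto simp: kk_def bergman_kernel_def fun_eq_iff)
  have "norm2 (kk z) = 1" using norm2_V[OF z bergman_L2[OF bergman_one]] V_one[OF z] by simp
  then have "(1 - (cmod z)^2) * norm2 (bergman_kernel z) = 1"
    unfolding eq norm2_cmult norm_of_real using z1 by simp
  then have "norm2 (bergman_kernel z) = 1 / (1 - (cmod z)^2)" using z1 by (simp add: field_simps)
  then show ?thesis unfolding eq normalized_kernel_def[abs_def] by (simp add: fun_eq_iff)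
qed

text \<open>Since \<open>V z\<close> is unitary and maps \<open>kk z\<close> to 1, the inner product
  is that of \<open>V z f\<close> with 1, hence the value of \<open>V z f\<close> at the origin by
  the mean value property.\<close>

lemma reproducing:
  assumes z: "z \<in> disc" and f: "f \<in> bergman"
  shows "ip f (kk z) = of_real (1 - (cmod z)^2) * f z"
proof -
  note Vf = V_bergman[OF z f]
  have "ip f (kk z) = ip (V z f) (V z (V z (indicator disc)))"
    unfolding V_one[OF z, symmetric] by (rule ip_V[OF z bergman_L2[OF f] V_L2[OF z bergman_L2[OF bergman_one]], symmetric])
  also have "\<dots> = ip (V z f) (indicator disc)" unfolding V_V_bergman[OF z bergman_one] ..
  also have "\<dots> = (\<integral>w. V z f w \<partial>dA)" unfolding ip_def by (rule Bochner_Integration.integral_cong) auto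
  also have "\<dots> = V z f 0"
  proof (rule mean_value_dA[OF bergman_holo[OF Vf]])
    have "integrable dA (\<lambda>w. V z f w * cnj (indicator disc w))"
      by (rule L2_integrable_mult) (intro bergman_L2 Vf bergman_one)+
    then show "integrable dA (V z f)" by (rule Bochner_Integration.integrable_cong[THEN iffD1, rotated -1]) auto
  qed
  also have "\<dots> = of_real (1 - (cmod z)^2) * f z" by (simp add: V_def kk_def)
  finally show ?thesis .
qed

lemma norm2_kk [simp]: "z \<in> disc \<Longrightarrow> norm2 (kk z) = 1"
  using norm2_V[OF _ bergman_L2[OF bergman_one]] V_one by force

lemma bergman_pointwise:
  assumes z: "z \<in> disc" and f: "f \<in> bergman"
  shows "(1 - (cmod z)^2) * cmod (f z) \<le> norm2 f"
proof -
  have "0 < 1 - (cmod z)^2" using z by (simp add: abs_square_less_1)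
  moreover have "cmod (ip f (kk z)) \<le> norm2 f * norm2 (kk z)" by (intro Cauchy_Schwarz_ip bergman_L2 f kk_bergman z)
  ultimately show ?thesis using z unfolding reproducing[OF z f] norm_mult norm_of_real by simp
qed

section \<open>The Bergman projection\<close>

lemma norm2_diff_square:
  assumes f: "f \<in> L2" and h: "h \<in> L2"
  shows "(norm2 (\<lambda>z. f z - c * h z))^2 = (norm2 f)^2 - 2 * Re (cnj c * ip f h) + (cmod c)^2 * (norm2 h)^2"
proof -
  note ch = L2_cmult[OF h, of c]
  have "complex_of_real ((norm2 (\<lambda>z. f z - c * h z))^2) = ip f f - (cnj c * ip f h + c * ip h f) + c * (cnj c * ip h h)"
    unfolding ip_self[symmetric]
    by (simp add: ip_diff_left ip_diff_right L2_diff f h ch ip_cmult_left ip_cmult_right algebra_simps)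
  also have "c * ip h f = cnj (cnj c * ip f h)" by (subst ip_cnj[of h f]) simp
  also have "cnj c * ip f h + cnj (cnj c * ip f h) = of_real (2 * Re (cnj c * ip f h))" by (rule complex_add_cnj)
  also have "c * (cnj c * ip h h) = of_real ((cmod c)^2 * (norm2 h)^2)"
    unfolding ip_self of_real_mult complex_norm_square by (simp add: mult.assoc)
  finally show ?thesis unfolding ip_self of_real_diff[symmetric] of_real_add[symmetric] of_real_eq_iff .
qed

text \<open>A minimizing sequence is bounded in norm, hence locally bounded by
  \<open>bergman_pointwise\<close>; Montel extracts a pointwise limit, and Fatou shows that it
  attains the infimum.\<close>

lemma bergman_nearest_point:
  assumes u: "u \<in> L2"
  shows "\<exists>g\<in>bergman. \<forall>h\<in>bergman. norm2 (\<lambda>z. u z - g z) \<le> norm2 (\<lambda>z. u z - h z)"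
proof -
  define N where "N g = norm2 (\<lambda>z. u z - g z)" for g
  define d where "d = Inf (N ` bergman)"
  have bb: "bdd_below (N ` bergman)" by (rule bdd_belowI[of _ 0]) (auto simp: N_def)
  have ne: "N ` bergman \<noteq> {}" using bergman_one by auto
  have d0: "0 \<le> d" unfolding d_def by (rule cInf_greatest[OF ne]) (auto simp: N_def)
  have dN: "d \<le> N h" if "h \<in> bergman" for h unfolding d_def using bb that by (intro cInf_lower) auto
  have "\<exists>g. g \<in> bergman \<and> N g < d + 1 / (real n + 1)" for n
  proof -
    have "Inf (N ` bergman) < d + 1 / (real n + 1)" unfolding d_def by simp
    from cInf_lessD[OF ne this] show ?thesis by auto
  qed
  then obtain g where g: "\<And>n. g n \<in> bergman" "\<And>n. N (g n) < d + 1 / (real n + 1)" by metis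
  define B where "B = norm2 u + (d + 1)"
  have gB: "norm2 (g n) \<le> B" for n
  proof -
    have "norm2 (g n) = norm2 (\<lambda>z. u z + (-1) * (u z - g n z))" by simp
    also have "\<dots> \<le> norm2 u + norm2 (\<lambda>z. (-1) * (u z - g n z))"
      by (intro norm2_triangle u L2_cmult L2_diff bergman_L2 g)
    also have "norm2 (\<lambda>z. (-1) * (u z - g n z)) = N (g n)" unfolding norm2_cmult by (simp add: N_def)
    also have "N (g n) \<le> d + 1" using g(2)[of n] by (rule less_imp_le[THEN order_trans]) (simp add: field_simps)
    finally show ?thesis by (simp add: B_def)
  qed
  define H where "H = {h \<in> bergman. norm2 h \<le> B}"
  have Hbd: "\<exists>C. \<forall>h\<in>H. \<forall>z\<in>K. cmod (h z) \<le> C" if K: "compact K" "K \<subseteq> disc" for K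
  proof (cases "K = {}")
    case False
    obtain x where x: "x \<in> K" "\<And>y. y \<in> K \<Longrightarrow> cmod y \<le> cmod x"
      using continuous_attains_sup[OF K(1) False, of cmod] by (auto intro: continuous_intros)
    have x1: "0 < 1 - (cmod x)^2" using x(1) K(2) by (auto simp: abs_square_less_1)
    have "cmod (h z) \<le> B / (1 - (cmod x)^2)" if h: "h \<in> H" and z: "z \<in> K" for h z
    proof -
      have "(1 - (cmod x)^2) * cmod (h z) \<le> (1 - (cmod z)^2) * cmod (h z)"
        using x(2)[OF z] by (intro mult_right_mono) (auto intro: power_mono)
      also have "\<dots> \<le> norm2 h" by (rule bergman_pointwise) (use h z K in \<open>auto simp: H_def\<close>)
      also have "\<dots> \<le> B" using h by (simp add: H_def)
      finally show ?thesis using x1 by (simp add: field_simps)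
    qed
    then show ?thesis by blast
  qed auto
  obtain g0 r where g0: "g0 holomorphic_on disc" "strict_mono (r :: nat \<Rightarrow> nat)"
      "\<And>x. x \<in> disc \<Longrightarrow> (\<lambda>n. g (r n) x) \<longlonglongrightarrow> g0 x"
  proof (rule Montel[of disc H g])
    show "\<And>h. h \<in> H \<Longrightarrow> h holomorphic_on disc" by (simp add: H_def bergman_holo)
    show "range g \<subseteq> H" using g gB by (auto simp: H_def)
  qed (use Hbd in auto)
  define g' where "g' z = (if z \<in> disc then g0 z else 0)" for z
  have g'h: "g' holomorphic_on disc" by (rule holomorphic_transform[OF g0(1)]) (simp add: g'_def)
  have g'm: "g' \<in> borel_measurable dA" by (intro continuous_on_borel_measurable_dA holomorphic_on_imp_continuous_on g'h)
  have um: "u \<in> borel_measurable dA" by (rule L2_measurable[OF u])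
  have dm: "(\<lambda>z. u z - g' z) \<in> borel_measurable dA" using um g'm by measurable
  define w where "w n z = ennreal ((cmod (u z - g (r n) z))^2)" for n z
  have wm: "w n \<in> borel_measurable dA" for n
    unfolding w_def[abs_def] using um L2_measurable[OF bergman_L2[OF g(1)[of "r n"]]] by measurable
  have "(\<integral>\<^sup>+z. ennreal ((cmod (u z - g' z))^2) \<partial>dA) = (\<integral>\<^sup>+z. liminf (\<lambda>n. w n z) \<partial>dA)"
  proof (rule nn_integral_cong)
    fix z assume "z \<in> space dA"
    then have z: "z \<in> disc" by simp
    have "(\<lambda>n. w n z) \<longlonglongrightarrow> ennreal ((cmod (u z - g0 z))^2)"
      unfolding w_def by (intro tendsto_ennrealI tendsto_intros g0(3) z)
    from lim_imp_Liminf[OF sequentially_bot this] show "ennreal ((cmod (u z - g' z))^2) = liminf (\<lambda>n. w n z)"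
      using z by (simp add: g'_def)
  qed
  also have "\<dots> \<le> liminf (\<lambda>n. \<integral>\<^sup>+z. w n z \<partial>dA)" by (rule nn_integral_liminf[OF wm])
  also have "\<dots> \<le> liminf (\<lambda>n. ennreal ((d + 1 / (real n + 1))^2))"
  proof (intro Liminf_mono always_eventually allI)
    fix n
    have "(\<integral>\<^sup>+z. w n z \<partial>dA) = ennreal ((N (g (r n)))^2)"
      unfolding w_def N_def norm2_square
      by (intro nn_integral_eq_integral L2_integrable L2_diff u bergman_L2 g) simp
    also have "\<dots> \<le> ennreal ((d + 1 / (real n + 1))^2)"
    proof (intro ennreal_leI power_mono)
      have "N (g (r n)) \<le> d + 1 / (real (r n) + 1)" using g(2) less_imp_le by blast
      also have "1 / (real (r n) + 1) \<le> 1 / (real n + 1)" using seq_suble[OF g0(2), of n] by (intro divide_left_mono) auto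
      finally show "N (g (r n)) \<le> d + 1 / (real n + 1)" by simp
    qed (simp add: N_def)
    finally show "(\<integral>\<^sup>+z. w n z \<partial>dA) \<le> ennreal ((d + 1 / (real n + 1))^2)" .
  qed
  also have "liminf (\<lambda>n. ennreal ((d + 1 / (real n + 1))^2)) = ennreal (d^2)"
  proof (rule lim_imp_Liminf[OF sequentially_bot], rule tendsto_ennrealI)
    show "(\<lambda>n. (d + 1 / (real n + 1))^2) \<longlonglongrightarrow> d^2"
      using tendsto_power[OF tendsto_add[OF tendsto_const[of d] lim_inverse_n'[THEN LIMSEQ_Suc]], of 2] by (simp add: add.commute)
  qed
  finally have le: "(\<integral>\<^sup>+z. ennreal ((cmod (u z - g' z))^2) \<partial>dA) \<le> ennreal (d^2)" .
  have int: "integrable dA (\<lambda>z. (cmod (u z - g' z))^2)"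
  proof (rule integrableI_nonneg)
    show "(\<lambda>z. (cmod (u z - g' z))^2) \<in> borel_measurable dA" using dm by measurable
    show "(\<integral>\<^sup>+z. ennreal ((cmod (u z - g' z))^2) \<partial>dA) < \<infinity>" using le by (rule le_less_trans) simp
  qed simp
  have L: "(\<lambda>z. u z - g' z) \<in> L2" using int dm by (simp add: L2_def)
  have "(\<lambda>z. u z - (u z - g' z)) \<in> L2" by (rule L2_diff[OF u L])
  then have "g' \<in> L2" by simp
  then have g'b: "g' \<in> bergman" by (intro bergmanI g'h) (simp_all add: g'_def)
  have "ennreal ((N g')^2) \<le> ennreal (d^2)"
    using le nn_integral_eq_integral[OF int] by (simp add: N_def norm2_square)
  then have "(N g')^2 \<le> d^2" by simp
  then have "N g' \<le> d" using d0 by (rule power2_le_imp_le)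
  then have "\<forall>h\<in>bergman. N g' \<le> N h" using dN order_trans by blast
  then show ?thesis using g'b unfolding N_def by blast
qed

lemma bergman_projection_exists:
  assumes u: "u \<in> L2" shows "\<exists>g\<in>bergman. \<forall>h\<in>bergman. ip (\<lambda>z. u z - g z) h = 0"
proof -
  obtain g where g: "g \<in> bergman" and min: "\<And>h. h \<in> bergman \<Longrightarrow> norm2 (\<lambda>z. u z - g z) \<le> norm2 (\<lambda>z. u z - h z)"
    using bergman_nearest_point[OF u] by blast
  define e where "e z = u z - g z" for z
  have e: "e \<in> L2" unfolding e_def[abs_def] by (intro L2_diff u bergman_L2 g)
  have "ip e h = 0" if h: "h \<in> bergman" for h
  proof (rule ccontr)
    define a where "a = ip e h"
    \<comment> \<open>For the competitor g + t a h the first-order gain is 2t |a|^2, and t ||h||^2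
      \<le> 1 keeps the quadratic loss below half of it.\<close>
    define t where "t = 1 / (1 + (norm2 h)^2)"
    assume "ip e h \<noteq> 0"
    then have a: "0 < (cmod a)^2" by (simp add: a_def)
    have p: "0 < 1 + (norm2 h)^2" by (simp add: add_pos_nonneg)
    have t: "0 < t" "t * (norm2 h)^2 \<le> 1" using p by (simp_all add: t_def field_simps)
    define c where "c = of_real t * a"
    have "norm2 e \<le> norm2 (\<lambda>z. u z - (g z + c * h z))"
      using min[OF bergman_add[OF g bergman_cmult[OF h]]] by (simp add: e_def[abs_def])
    also have "(\<lambda>z. u z - (g z + c * h z)) = (\<lambda>z. e z - c * h z)" by (simp add: e_def algebra_simps)
    finally have "(norm2 e)^2 \<le> (norm2 (\<lambda>z. e z - c * h z))^2" by (intro power_mono) auto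
    also have "\<dots> = (norm2 e)^2 - 2 * Re (cnj c * a) + (cmod c)^2 * (norm2 h)^2"
      unfolding a_def by (rule norm2_diff_square[OF e bergman_L2[OF h]])
    also have "cnj c * a = of_real (t * (cmod a)^2)"
      unfolding of_real_mult complex_norm_square by (simp add: c_def mult_ac)
    also have "(cmod c)^2 * (norm2 h)^2 = t * (cmod a)^2 * (t * (norm2 h)^2)"
      by (simp add: c_def norm_mult power2_eq_square mult_ac)
    also have "\<dots> \<le> t * (cmod a)^2 * 1" using t a by (intro mult_left_mono) auto
    finally have "t * (cmod a)^2 \<le> 0" by simp
    then show False using mult_pos_pos[OF t(1) a] by simp
  qed
  then show ?thesis using g unfolding e_def[abs_def] by blast
qed

lemma bergman_norm2_0:
  assumes f: "f \<in> bergman" and 0: "norm2 f = 0" shows "f = (\<lambda>z. 0)"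
proof
  fix z show "f z = 0"
  proof (cases "z \<in> disc")
    case True
    then have "0 < 1 - (cmod z)^2" by (simp add: abs_square_less_1)
    moreover have "(1 - (cmod z)^2) * cmod (f z) \<le> 0" using bergman_pointwise[OF True f] 0 by simp
    ultimately have "cmod (f z) \<le> 0" by (simp add: mult_le_0_iff)
    then show ?thesis by simp
  qed (simp add: bergman_off[OF f])
qed

lemma bergman_proj_eq:
  assumes u: "u \<in> L2" and g: "g \<in> bergman" and eq: "\<And>h. h \<in> bergman \<Longrightarrow> ip u h = ip g h"
  shows "bergman_proj u = g"
  unfolding bergman_proj_def
proof (rule the_equality)
  show "g \<in> bergman \<and> (\<forall>h\<in>bergman. ip (\<lambda>z. u z - g z) h = 0)"
    using g eq u bergman_L2 by (auto simp: ip_diff_left)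
  fix k assume k: "k \<in> bergman \<and> (\<forall>h\<in>bergman. ip (\<lambda>z. u z - k z) h = 0)"
  define d where "d z = k z - g z" for z
  have d: "d \<in> bergman" unfolding d_def[abs_def] using k g by (intro bergman_diff) auto
  have "ip u d = ip k d" using k d u bergman_L2 by (auto simp: ip_diff_left)
  then have "ip d d = 0" using eq[OF d] k g d bergman_L2 unfolding d_def[abs_def] by (simp add: ip_diff_left)
  then have "norm2 d = 0" by (simp add: ip_self)
  from bergman_norm2_0[OF d this] have "d z = 0" for z by simp
  then show "k = g" unfolding d_def by (simp add: fun_eq_iff)
qed

lemma
  assumes u: "u \<in> L2"
  shows bergman_proj_in: "bergman_proj u \<in> bergman"
    and ip_bergman_proj: "h \<in> bergman \<Longrightarrow> ip (bergman_proj u) h = ip u h"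
proof -
  obtain g where g: "g \<in> bergman" "\<And>h. h \<in> bergman \<Longrightarrow> ip (\<lambda>z. u z - g z) h = 0"
    using bergman_projection_exists[OF u] by blast
  have eq: "ip u h = ip g h" if "h \<in> bergman" for h
    using g(2)[OF that] by (simp add: ip_diff_left u bergman_L2 g that)
  have "bergman_proj u = g" by (rule bergman_proj_eq[OF u g(1) eq])
  then show "bergman_proj u \<in> bergman" "h \<in> bergman \<Longrightarrow> ip (bergman_proj u) h = ip u h"
    using g(1) eq by simp_all
qed

lemma norm2_bergman_proj: assumes u: "u \<in> L2" shows "norm2 (bergman_proj u) \<le> norm2 u"
proof (cases "norm2 (bergman_proj u) = 0")
  case False
  define g where "g = bergman_proj u"
  have g: "g \<in> bergman" unfolding g_def by (rule bergman_proj_in[OF u])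
  have "complex_of_real ((norm2 g)^2) = ip u g" unfolding ip_self[symmetric] using ip_bergman_proj[OF u g] by (simp add: g_def)
  then have "(norm2 g)^2 = cmod (ip u g)" using norm_of_real[of "(norm2 g)^2", where 'a = complex] by simp
  also have "\<dots> \<le> norm2 u * norm2 g" by (rule Cauchy_Schwarz_ip[OF u bergman_L2[OF g]])
  finally have "norm2 g * norm2 g \<le> norm2 u * norm2 g" by (simp add: power2_eq_square)
  moreover have "0 < norm2 g" using False norm2_nonneg[of g] unfolding g_def by linarith
  ultimately show ?thesis unfolding g_def by simp
qed simp

section \<open>Toeplitz operators\<close>

text \<open>Boundedness at every point of the disc, so that composition with \<phi>_z and pointwise
  limits need no null sets; symbols given almost everywhere are reduced to such ones by
  \<open>toeplitz_cong_AE\<close>.\<close>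

definition symbol :: "(complex \<Rightarrow> complex) \<Rightarrow> bool" where
  "symbol u \<longleftrightarrow> u \<in> borel_measurable dA \<and> (\<exists>C. \<forall>z\<in>disc. cmod (u z) \<le> C)"

lemma symbol_L2: "symbol u \<Longrightarrow> f \<in> L2 \<Longrightarrow> (\<lambda>z. u z * f z) \<in> L2"
  unfolding symbol_def using L2_mult_bounded by blast

lemma toeplitz_apply: "f \<in> bergman \<Longrightarrow> toeplitz u f = bergman_proj (\<lambda>z. u z * f z)"
  by (simp add: toeplitz_def)

lemma toeplitz_bergman: "symbol u \<Longrightarrow> f \<in> bergman \<Longrightarrow> toeplitz u f \<in> bergman"
  by (simp add: toeplitz_apply bergman_proj_in symbol_L2 bergman_L2)

lemma ip_toeplitz: "symbol u \<Longrightarrow> f \<in> bergman \<Longrightarrow> h \<in> bergman \<Longrightarrow> ip (toeplitz u f) h = ip (\<lambda>z. u z * f z) h"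
  by (simp add: toeplitz_apply ip_bergman_proj symbol_L2 bergman_L2)

lemma toeplitz_eqI:
  "symbol u \<Longrightarrow> f \<in> bergman \<Longrightarrow> g \<in> bergman \<Longrightarrow> (\<And>h. h \<in> bergman \<Longrightarrow> ip (\<lambda>z. u z * f z) h = ip g h) \<Longrightarrow> toeplitz u f = g"
  by (simp add: toeplitz_apply bergman_proj_eq symbol_L2 bergman_L2)

lemma norm2_toeplitz_le:
  assumes u: "u \<in> borel_measurable dA" "\<And>z. z \<in> disc \<Longrightarrow> cmod (u z) \<le> C" and f: "f \<in> bergman"
  shows "norm2 (toeplitz u f) \<le> C * norm2 f"
proof -
  have s: "symbol u" unfolding symbol_def using u by blast
  have "0 \<le> C" using order_trans[OF norm_ge_zero u(2)[of 0]] by simp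
  then have "norm2 (\<lambda>z. u z * f z) \<le> C * norm2 f"
    by (intro norm2_mono L2_integrable bergman_L2 f symbol_L2 s) (auto simp: norm_mult intro!: mult_right_mono u(2))
  then show ?thesis using norm2_bergman_proj[OF symbol_L2[OF s bergman_L2[OF f]]] by (simp add: toeplitz_apply f)
qed

lemma toeplitz_bounded_ops:
  assumes u: "symbol u" shows "toeplitz u \<in> bounded_ops"
proof -
  obtain C where C: "u \<in> borel_measurable dA" "\<And>z. z \<in> disc \<Longrightarrow> cmod (u z) \<le> C" using u unfolding symbol_def by blast
  have "toeplitz u \<in> bergman \<rightarrow>\<^sub>E bergman" using toeplitz_bergman[OF u] by (auto simp: toeplitz_def)
  moreover have "toeplitz u (\<lambda>z. f z + g z) = (\<lambda>z. toeplitz u f z + toeplitz u g z)" if f: "f \<in> bergman" and g: "g \<in> bergman" for f g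
  proof (rule toeplitz_eqI[OF u])
    fix h assume h: "h \<in> bergman"
    have "ip (\<lambda>z. u z * (f z + g z)) h = ip (\<lambda>z. u z * f z) h + ip (\<lambda>z. u z * g z) h"
      unfolding distrib_left by (intro ip_add_left symbol_L2 u bergman_L2 f g h)
    also have "\<dots> = ip (\<lambda>z. toeplitz u f z + toeplitz u g z) h"
      by (simp add: ip_add_left bergman_L2 toeplitz_bergman ip_toeplitz u f g h)
    finally show "ip (\<lambda>z. u z * (f z + g z)) h = ip (\<lambda>z. toeplitz u f z + toeplitz u g z) h" .
  qed (intro bergman_add toeplitz_bergman u f g)+
  moreover have "toeplitz u (\<lambda>z. c * f z) = (\<lambda>z. c * toeplitz u f z)" if f: "f \<in> bergman" for c f
  proof (rule toeplitz_eqI[OF u])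
    fix h assume h: "h \<in> bergman"
    have "(\<lambda>z. u z * (c * f z)) = (\<lambda>z. c * (u z * f z))" by (simp add: mult_ac)
    then show "ip (\<lambda>z. u z * (c * f z)) h = ip (\<lambda>z. c * toeplitz u f z) h"
      by (simp add: ip_cmult_left ip_toeplitz u f h)
  qed (intro bergman_cmult toeplitz_bergman u f)+
  moreover have "\<forall>f\<in>bergman. norm2 (toeplitz u f) \<le> C * norm2 f" using norm2_toeplitz_le[OF C] by blast
  ultimately show ?thesis unfolding bounded_ops_def by blast
qed

text \<open>The description that defines \<open>bergman_proj\<close> refers to its argument only
  through integrals.\<close>

lemma toeplitz_cong_AE:
  assumes u: "u \<in> borel_measurable dA" and v: "v \<in> borel_measurable dA" and AE: "AE z in dA. u z = v z"
  shows "toeplitz u = toeplitz v"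
proof -
  have "ip (\<lambda>z. u z * f z - g z) h = ip (\<lambda>z. v z * f z - g z) h"
    if "f \<in> bergman" "g \<in> bergman" "h \<in> bergman" for f g h
  proof -
    have [measurable]: "f \<in> borel_measurable dA" "g \<in> borel_measurable dA" "h \<in> borel_measurable dA"
      using that by (auto intro: L2_measurable bergman_L2)
    note [measurable] = u v
    show ?thesis unfolding ip_def by (rule integral_cong_AE) (use AE in \<open>measurable, auto\<close>)
  qed
  then have "bergman_proj (\<lambda>z. u z * f z) = bergman_proj (\<lambda>z. v z * f z)" if "f \<in> bergman" for f
    unfolding bergman_proj_def using that by (intro arg_cong[of _ _ The] ext) (metis (no_types, lifting))
  then show ?thesis unfolding toeplitz_def by (intro restrict_ext)
qed

lemma symbol_disc_aut: assumes z: "z \<in> disc" and u: "symbol u" shows "symbol (\<lambda>w. u (disc_aut z w))"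
  using u disc_aut_in_disc[OF z] measurable_compose[OF measurable_disc_aut[OF z]] unfolding symbol_def by blast

lemma V_toeplitz_V:
  assumes z: "z \<in> disc" and u: "symbol u" and f: "f \<in> bergman"
  shows "V z (toeplitz u (V z f)) = toeplitz (\<lambda>w. u (disc_aut z w)) f"
proof (rule toeplitz_eqI[symmetric])
  show "symbol (\<lambda>w. u (disc_aut z w))" by (rule symbol_disc_aut[OF z u])
  note Vf = V_bergman[OF z f]
  show "V z (toeplitz u (V z f)) \<in> bergman" by (intro V_bergman z toeplitz_bergman u f)
  fix h assume h: "h \<in> bergman"
  note Vh = V_bergman[OF z h]
  have uL: "(\<lambda>w. u w * V z f w) \<in> L2" by (intro symbol_L2 u bergman_L2 Vf)
  have "ip (V z (toeplitz u (V z f))) h = ip (V z (toeplitz u (V z f))) (V z (V z h))"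
    by (simp only: V_V_bergman[OF z h])
  also have "\<dots> = ip (toeplitz u (V z f)) (V z h)"
    by (intro ip_V z bergman_L2 toeplitz_bergman u Vf Vh)
  also have "\<dots> = ip (\<lambda>w. u w * V z f w) (V z h)" by (rule ip_toeplitz[OF u Vf Vh])
  also have "\<dots> = ip (V z (\<lambda>w. u w * V z f w)) (V z (V z h))"
    by (rule ip_V[OF z uL bergman_L2[OF Vh], symmetric])
  also have "\<dots> = ip (\<lambda>w. u (disc_aut z w) * f w) h"
  proof (rule ip_cong)
    fix w assume w: "w \<in> disc"
    show "V z (\<lambda>w. u w * V z f w) w = u (disc_aut z w) * f w"
      using V_V[OF z w, of f] by (simp add: V_def mult_ac)
  qed (simp only: V_V_bergman[OF z h])
  finally show "ip (\<lambda>w. u (disc_aut z w) * f w) h = ip (V z (toeplitz u (V z f))) h" ..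
qed (rule f)

lemma symbol_cnj: "symbol u \<Longrightarrow> symbol (\<lambda>z. cnj (u z))"
  unfolding symbol_def by (auto intro: measurable_compose[OF _ measurable_cnj])

lemma toeplitz_adjoint:
  assumes u: "symbol u" and f: "f \<in> bergman" and g: "g \<in> bergman"
  shows "ip (toeplitz u f) g = ip f (toeplitz (\<lambda>z. cnj (u z)) g)"
proof -
  have "ip f (toeplitz (\<lambda>z. cnj (u z)) g) = cnj (ip (\<lambda>z. cnj (u z) * g z) f)"
    by (subst ip_cnj) (simp add: ip_toeplitz symbol_cnj u f g)
  also have "\<dots> = ip (\<lambda>z. u z * f z) g" unfolding ip_cnj[symmetric] by (simp add: ip_def mult_ac)
  finally show ?thesis by (simp add: ip_toeplitz u f g)
qed

section \<open>Limits of conjugated operators\<close>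

lemma bounded_ops_bergman: "S \<in> bounded_ops \<Longrightarrow> f \<in> bergman \<Longrightarrow> S f \<in> bergman"
  and bounded_ops_add: "S \<in> bounded_ops \<Longrightarrow> f \<in> bergman \<Longrightarrow> g \<in> bergman \<Longrightarrow> S (\<lambda>z. f z + g z) = (\<lambda>z. S f z + S g z)"
  and bounded_ops_cmult: "S \<in> bounded_ops \<Longrightarrow> f \<in> bergman \<Longrightarrow> S (\<lambda>z. c * f z) = (\<lambda>z. c * S f z)"
  by (auto simp: bounded_ops_def)

lemma bounded_ops_diff:
  assumes "S \<in> bounded_ops" "f \<in> bergman" "g \<in> bergman"
  shows "S (\<lambda>z. f z - g z) = (\<lambda>z. S f z - S g z)"
  using bounded_ops_add[OF assms(1,2) bergman_cmult[OF assms(3), of "-1"]] bounded_ops_cmult[OF assms(1,3), of "-1"]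
  by (simp add: fun_eq_iff)

lemma bounded_ops_bound:
  assumes "S \<in> bounded_ops" shows "\<exists>C\<ge>0. \<forall>f\<in>bergman. norm2 (S f) \<le> C * norm2 f"
proof -
  obtain C where C: "\<forall>f\<in>bergman. norm2 (S f) \<le> C * norm2 f" using assms by (auto simp: bounded_ops_def)
  have "norm2 (S f) \<le> max C 0 * norm2 f" if "f \<in> bergman" for f
    using C that by (intro order_trans[OF _ mult_right_mono[of C "max C 0"]]) auto
  then show ?thesis by (intro exI[of _ "max C 0"]) auto
qed

lemma bounded_opsI:
  assumes "S \<in> extensional bergman" "\<And>f. f \<in> bergman \<Longrightarrow> S f \<in> bergman"
    and "\<And>f g. f \<in> bergman \<Longrightarrow> g \<in> bergman \<Longrightarrow> S (\<lambda>z. f z + g z) = (\<lambda>z. S f z + S g z)"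
    and "\<And>c f. f \<in> bergman \<Longrightarrow> S (\<lambda>z. c * f z) = (\<lambda>z. c * S f z)"
    and "\<And>f. f \<in> bergman \<Longrightarrow> norm2 (S f) \<le> C * norm2 f"
  shows "S \<in> bounded_ops"
  using assms unfolding bounded_ops_def PiE_def by blast

lemma bounded_ops_lincomb:
  assumes S: "S \<in> bounded_ops" and R: "R \<in> bounded_ops"
  shows "(\<lambda>f\<in>bergman. \<lambda>z. S f z + c * R f z) \<in> bounded_ops"
proof -
  obtain C D where C: "\<forall>f\<in>bergman. norm2 (S f) \<le> C * norm2 f" "\<forall>f\<in>bergman. norm2 (R f) \<le> D * norm2 f"
    using bounded_ops_bound[OF S] bounded_ops_bound[OF R] by auto
  show ?thesis
  proof (rule bounded_opsI[where C = "C + cmod c * D"])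
    fix f assume f: "f \<in> bergman"
    have "norm2 (\<lambda>z. S f z + c * R f z) \<le> norm2 (S f) + norm2 (\<lambda>z. c * R f z)"
      by (intro norm2_triangle bergman_L2 bergman_cmult bounded_ops_bergman[OF S] bounded_ops_bergman[OF R] f)
    also have "\<dots> \<le> C * norm2 f + cmod c * (D * norm2 f)"
      unfolding norm2_cmult using C f by (intro add_mono mult_left_mono) auto
    finally show "norm2 ((\<lambda>f\<in>bergman. \<lambda>z. S f z + c * R f z) f) \<le> (C + cmod c * D) * norm2 f"
      using f by (simp add: algebra_simps)
  qed (simp_all add: bergman_add bergman_cmult bounded_ops_bergman[OF S] bounded_ops_add[OF S] bounded_ops_cmult[OF S]
      bounded_ops_bergman[OF R] bounded_ops_add[OF R] bounded_ops_cmult[OF R] algebra_simps)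
qed

lemma bounded_ops_compose:
  assumes S: "S \<in> bounded_ops" and R: "R \<in> bounded_ops"
  shows "compose bergman S R \<in> bounded_ops"
proof -
  obtain C D where C: "0 \<le> C" "\<forall>f\<in>bergman. norm2 (S f) \<le> C * norm2 f" "\<forall>f\<in>bergman. norm2 (R f) \<le> D * norm2 f"
    using bounded_ops_bound[OF S] bounded_ops_bound[OF R] by auto
  show ?thesis
  proof (rule bounded_opsI[where C = "C * D"])
    fix f assume f: "f \<in> bergman"
    have "norm2 (S (R f)) \<le> C * norm2 (R f)" using C(2) bounded_ops_bergman[OF R f] by blast
    also have "\<dots> \<le> C * (D * norm2 f)" using C f by (intro mult_left_mono) auto
    finally show "norm2 (compose bergman S R f) \<le> C * D * norm2 f" using f by (simp add: compose_eq mult.assoc)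
  qed (simp_all add: compose_eq bergman_add bergman_cmult bounded_ops_bergman[OF S] bounded_ops_add[OF S] bounded_ops_cmult[OF S]
      bounded_ops_bergman[OF R] bounded_ops_add[OF R] bounded_ops_cmult[OF R])
qed

lemma bounded_ops_id: "(\<lambda>f\<in>bergman. f) \<in> bounded_ops"
  by (rule bounded_opsI[where C = 1]) (simp_all add: bergman_add bergman_cmult)

lemma ip_op_le:
  assumes S: "\<forall>f\<in>bergman. norm2 (S f) \<le> C * norm2 f" "S f \<in> bergman" and f: "f \<in> bergman" and g: "g \<in> bergman"
  shows "cmod (ip (S f) g) \<le> C * norm2 f * norm2 g"
proof -
  have "cmod (ip (S f) g) \<le> norm2 (S f) * norm2 g" by (intro Cauchy_Schwarz_ip bergman_L2 S g)
  also have "\<dots> \<le> C * norm2 f * norm2 g" using S(1) f by (intro mult_right_mono) auto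
  finally show ?thesis .
qed

lemma berezin_eq: "z \<in> disc \<Longrightarrow> berezin S z = ip (S (kk z)) (kk z)"
  by (simp add: berezin_def normalized_kernel_eq)

lemma berezin_V:
  assumes S: "S \<in> bounded_ops" and z: "z \<in> disc"
  shows "berezin S z = ip (V z (S (V z (indicator disc)))) (indicator disc)"
proof -
  have 1: "S (V z (indicator disc)) \<in> bergman" by (intro bounded_ops_bergman[OF S] V_bergman z bergman_one)
  have "berezin S z = ip (S (V z (indicator disc))) (V z (indicator disc))" using z by (simp add: berezin_eq V_one)
  also have "\<dots> = ip (V z (S (V z (indicator disc)))) (V z (V z (indicator disc)))"
    by (rule ip_V[symmetric]) (intro z bergman_L2 1 V_bergman bergman_one)+
  finally show ?thesis unfolding V_V_bergman[OF z bergman_one] .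
qed

text \<open>For unit vectors the squared distance is 2 - 2 Re of their inner product, which the
  reproducing property evaluates in closed form.\<close>

lemma kk_continuous:
  assumes z: "z \<in> disc" shows "((\<lambda>w. norm2 (\<lambda>x. kk w x - kk z x)) \<longlongrightarrow> 0) (at z)"
proof -
  have ev: "\<forall>\<^sub>F w in at z. w \<in> disc" using z by (intro eventually_at_in_open') auto
  have n: "1 - cnj z * z \<noteq> 0" by (rule disc_aut_denom[OF z z])
  have nz: "complex_of_real (1 - (cmod z)^2) = 1 - cnj z * z"
    using complex_norm_square[of z] by (simp add: mult.commute)
  have "((\<lambda>w. of_real (1 - (cmod z)^2) * (of_real (1 - (cmod w)^2) / (1 - cnj w * z)^2)) \<longlongrightarrow>
     of_real (1 - (cmod z)^2) * (of_real (1 - (cmod z)^2) / (1 - cnj z * z)^2)) (at z)"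
    using n by (intro tendsto_intros) auto
  also have "of_real (1 - (cmod z)^2) * (of_real (1 - (cmod z)^2) / (1 - cnj z * z)^2) = (1::complex)"
    unfolding nz using n by (simp add: power2_eq_square)
  finally have "((\<lambda>w. ip (kk w) (kk z)) \<longlongrightarrow> 1) (at z)"
  proof (rule Lim_transform_eventually)
    show "\<forall>\<^sub>F w in at z. of_real (1 - (cmod z)^2) * (of_real (1 - (cmod w)^2) / (1 - cnj w * z)^2) = ip (kk w) (kk z)"
      using ev
    proof eventually_elim
      case (elim w)
      have "kk w z = of_real (1 - (cmod w)^2) / (1 - cnj w * z)^2" unfolding kk_def if_P[OF z] ..
      then show ?case unfolding reproducing[OF z kk_bergman[OF elim]] by (simp only:)
    qed
  qed
  then have "((\<lambda>w. 2 - 2 * Re (ip (kk w) (kk z))) \<longlongrightarrow> 2 - 2 * Re 1) (at z)" by (intro tendsto_intros)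
  then have "((\<lambda>w. (norm2 (\<lambda>x. kk w x - kk z x))^2) \<longlongrightarrow> 2 - 2 * Re 1) (at z)"
  proof (rule Lim_transform_eventually)
    show "\<forall>\<^sub>F w in at z. 2 - 2 * Re (ip (kk w) (kk z)) = (norm2 (\<lambda>x. kk w x - kk z x))^2"
      using ev
    proof eventually_elim
      case (elim w)
      then show ?case using norm2_diff_square[OF bergman_L2[OF kk_bergman[OF elim]] bergman_L2[OF kk_bergman[OF z]], of 1] z by simp
    qed
  qed
  from tendsto_real_sqrt[OF this] show ?thesis by simp
qed

lemma berezin_continuous:
  assumes S: "S \<in> bounded_ops" and z: "z \<in> disc" shows "(berezin S \<longlongrightarrow> berezin S z) (nhds z)"
proof -
  obtain C where C: "\<forall>f\<in>bergman. norm2 (S f) \<le> C * norm2 f" using bounded_ops_bound[OF S] by auto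
  have ev: "\<forall>\<^sub>F w in at z. w \<in> disc" using z by (intro eventually_at_in_open') auto
  have "((\<lambda>w. berezin S w - berezin S z) \<longlongrightarrow> 0) (at z)"
  proof (rule Lim_null_comparison)
    show "((\<lambda>w. 2 * C * norm2 (\<lambda>x. kk w x - kk z x)) \<longlongrightarrow> 0) (at z)"
      by (rule tendsto_mult_right_zero) (rule kk_continuous[OF z])
    show "\<forall>\<^sub>F w in at z. cmod (berezin S w - berezin S z) \<le> 2 * C * norm2 (\<lambda>x. kk w x - kk z x)"
      using ev
    proof eventually_elim
      case (elim w)
      define d where "d x = kk w x - kk z x" for x
      note b = kk_bergman[OF elim] kk_bergman[OF z]
      have d: "d \<in> bergman" unfolding d_def[abs_def] by (intro bergman_diff b)
      note Sb = bounded_ops_bergman[OF S]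
      have "ip (S d) (kk w) = ip (S (kk w)) (kk w) - ip (S (kk z)) (kk w)"
        unfolding d_def[abs_def] bounded_ops_diff[OF S b] by (intro ip_diff_left bergman_L2 Sb b)
      moreover have "ip (S (kk z)) d = ip (S (kk z)) (kk w) - ip (S (kk z)) (kk z)"
        unfolding d_def[abs_def] by (intro ip_diff_right bergman_L2 Sb b)
      ultimately have "berezin S w - berezin S z = ip (S d) (kk w) + ip (S (kk z)) d"
        using elim z by (simp add: berezin_eq)
      then have "cmod (berezin S w - berezin S z) \<le> cmod (ip (S d) (kk w)) + cmod (ip (S (kk z)) d)"
        by (simp add: norm_triangle_ineq)
      also have "\<dots> \<le> C * norm2 d * norm2 (kk w) + C * norm2 (kk z) * norm2 d"
        by (intro add_mono ip_op_le C d b Sb)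
      finally show "cmod (berezin S w - berezin S z) \<le> 2 * C * norm2 (\<lambda>x. kk w x - kk z x)"
        using elim z by (simp add: d_def[abs_def])
    qed
  qed
  then have "(berezin S \<longlongrightarrow> berezin S z) (at z)" by (simp add: LIM_zero_iff)
  then show ?thesis by (rule tendsto_at_iff_tendsto_nhds[THEN iffD1])
qed

text \<open>Agreement with the Berezin transform at points of the disc comes from its continuity
  there: \<open>disc_to (point_eval z)\<close> is finer than the neighbourhoods of \<open>z\<close>,
  and limits along it are unique.\<close>

lemma berezin_extension:
  assumes S: "S \<in> bounded_ops" and F: "\<And>m. m \<in> mult_functionals \<Longrightarrow> (berezin S \<longlongrightarrow> F m) (disc_to m)"
  shows "continuous_extension (berezin S) F"
  unfolding continuous_extension_def
proof (intro conjI ballI)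
  show "continuous_map M euclidean F" by (rule continuous_extension_exists[OF F])
  fix z :: complex assume z: "z \<in> disc"
  have "(berezin S \<longlongrightarrow> berezin S z) (disc_to (point_eval z))"
    by (rule tendsto_mono[OF disc_to_point_eval[OF z] berezin_continuous[OF S z]])
  from tendsto_unique[OF disc_dense[OF point_eval_mult[OF z]] F[OF point_eval_mult[OF z]] this]
  show "F (point_eval z) = berezin S z" .
qed

section \<open>Strong limits along the disc\<close>

abbreviation "op_err z S T f \<equiv> norm2 (\<lambda>w. V z (S (V z f)) w - T f w)"

text \<open>Convergence of V_z S V_z in the strong operator topology; strong rather than weak, so
  that limits of bounded operators multiply.\<close>

definition op_limit :: "functional \<Rightarrow> bop \<Rightarrow> bop \<Rightarrow> bool" where
  "op_limit m S S\<^sub>0 \<longleftrightarrow> (\<forall>f\<in>bergman. S\<^sub>0 f \<in> bergman \<and>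
     ((\<lambda>z. op_err z S S\<^sub>0 f) \<longlongrightarrow> 0) (disc_to m))"

lemma op_limit_berezin:
  assumes m: "m \<in> mult_functionals" and S: "S \<in> bounded_ops" and lim: "op_limit m S S\<^sub>0"
  shows "(berezin S \<longlongrightarrow> ip (S\<^sub>0 (indicator disc)) (indicator disc)) (disc_to m)"
proof -
  let ?e = "indicator disc :: complex \<Rightarrow> complex"
  have l: "S\<^sub>0 ?e \<in> bergman" "((\<lambda>z. op_err z S S\<^sub>0 ?e) \<longlongrightarrow> 0) (disc_to m)"
    using lim bergman_one by (auto simp: op_limit_def)
  have "((\<lambda>z. berezin S z - ip (S\<^sub>0 ?e) ?e) \<longlongrightarrow> 0) (disc_to m)"
  proof (rule Lim_null_comparison[OF _ l(2)])
    show "\<forall>\<^sub>F z in disc_to m. cmod (berezin S z - ip (S\<^sub>0 ?e) ?e) \<le> op_err z S S\<^sub>0 ?e"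
      using eventually_disc_to_disc[OF m]
    proof eventually_elim
      case (elim z)
      have b: "V z (S (V z ?e)) \<in> bergman" by (intro V_bergman elim bounded_ops_bergman[OF S] bergman_one)
      have eq: "berezin S z - ip (S\<^sub>0 ?e) ?e = ip (\<lambda>w. V z (S (V z ?e)) w - S\<^sub>0 ?e w) ?e"
        unfolding berezin_V[OF S elim] by (rule ip_diff_left[symmetric]) (intro bergman_L2 b l bergman_one)+
      show ?case
        unfolding eq
        using Cauchy_Schwarz_ip[OF bergman_L2[OF bergman_diff[OF b l(1)]] bergman_L2[OF bergman_one]]
        unfolding norm2_indicator mult_1_right .
    qed
  qed
  then show ?thesis by (simp add: LIM_zero_iff)
qed

lemma op_limit_id: "m \<in> mult_functionals \<Longrightarrow> op_limit m (\<lambda>f\<in>bergman. f) (\<lambda>f\<in>bergman. f)"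
  unfolding op_limit_def
proof (intro ballI conjI tendsto_eventually)
  fix f assume m: "m \<in> mult_functionals" and f: "f \<in> bergman"
  then show "(\<lambda>f\<in>bergman. f) f \<in> bergman" by simp
  show "\<forall>\<^sub>F z in disc_to m. norm2 (\<lambda>w. V z ((\<lambda>f\<in>bergman. f) (V z f)) w - (\<lambda>f\<in>bergman. f) f w) = 0"
    using eventually_disc_to_disc[OF m]
    by eventually_elim (simp add: V_bergman V_V_bergman f, simp add: norm2_def)
qed

text \<open>V_z S R V_z is the product of V_z S V_z and V_z R V_z because V_z is an involution, and
  the first factor is bounded by a norm bound of \<open>S\<close> for every z.\<close>

lemma op_limit_compose:
  assumes m: "m \<in> mult_functionals" and S: "S \<in> bounded_ops" and R: "R \<in> bounded_ops"
    and limS: "op_limit m S S\<^sub>0" and limR: "op_limit m R R\<^sub>0"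
  shows "op_limit m (compose bergman S R) (compose bergman S\<^sub>0 R\<^sub>0)"
  unfolding op_limit_def
proof (intro ballI conjI)
  fix f assume f: "f \<in> bergman"
  have R0: "R\<^sub>0 f \<in> bergman" "((\<lambda>z. op_err z R R\<^sub>0 f) \<longlongrightarrow> 0) (disc_to m)"
    using limR f by (auto simp: op_limit_def)
  have S0: "S\<^sub>0 (R\<^sub>0 f) \<in> bergman" "((\<lambda>z. op_err z S S\<^sub>0 (R\<^sub>0 f)) \<longlongrightarrow> 0) (disc_to m)"
    using limS R0(1) by (auto simp: op_limit_def)
  show "compose bergman S\<^sub>0 R\<^sub>0 f \<in> bergman" using S0 f by (simp add: compose_eq)
  obtain C where C: "\<forall>f\<in>bergman. norm2 (S f) \<le> C * norm2 f" using bounded_ops_bound[OF S] by auto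
  show "((\<lambda>z. op_err z (compose bergman S R) (compose bergman S\<^sub>0 R\<^sub>0) f) \<longlongrightarrow> 0) (disc_to m)"
  proof (rule Lim_null_comparison)
    show "((\<lambda>z. C * op_err z R R\<^sub>0 f + op_err z S S\<^sub>0 (R\<^sub>0 f)) \<longlongrightarrow> 0) (disc_to m)"
      using tendsto_add[OF tendsto_mult_right_zero[OF R0(2), of C] S0(2)] by simp
    show "\<forall>\<^sub>F z in disc_to m. norm (op_err z (compose bergman S R) (compose bergman S\<^sub>0 R\<^sub>0) f)
        \<le> C * op_err z R R\<^sub>0 f + op_err z S S\<^sub>0 (R\<^sub>0 f)"
      using eventually_disc_to_disc[OF m]
    proof eventually_elim
      case (elim z)
      note Vb = V_bergman[OF elim]
      note Sb = bounded_ops_bergman[OF S]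
      define h where "h = V z (R (V z f))"
      have h: "h \<in> bergman" unfolding h_def by (intro Vb bounded_ops_bergman[OF R] f)
      define d where "d w = h w - R\<^sub>0 f w" for w
      have d: "d \<in> bergman" unfolding d_def[abs_def] by (intro bergman_diff h R0)
      have Vh: "V z h = R (V z f)" unfolding h_def by (intro V_V_bergman elim bounded_ops_bergman[OF R] Vb f)
      have SVd: "V z (S (V z d)) = (\<lambda>w. V z (S (V z h)) w - V z (S (V z (R\<^sub>0 f))) w)"
        unfolding d_def[abs_def] V_diff bounded_ops_diff[OF S Vb[OF h] Vb[OF R0(1)]] ..
      have "op_err z (compose bergman S R) (compose bergman S\<^sub>0 R\<^sub>0) f
         = norm2 (\<lambda>w. V z (S (V z d)) w + (V z (S (V z (R\<^sub>0 f))) w - S\<^sub>0 (R\<^sub>0 f) w))"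
        unfolding SVd Vh using f Vb[OF f] by (simp add: compose_eq)
      also have "\<dots> \<le> norm2 (V z (S (V z d))) + op_err z S S\<^sub>0 (R\<^sub>0 f)"
        by (intro norm2_triangle bergman_L2 bergman_diff Vb Sb d R0 S0)
      also have "norm2 (V z (S (V z d))) = norm2 (S (V z d))" by (intro norm2_V elim bergman_L2 Sb Vb d)
      also have "\<dots> \<le> C * norm2 (V z d)" using C Vb[OF d] by blast
      also have "norm2 (V z d) = norm2 d" by (intro norm2_V elim bergman_L2 d)
      finally show ?case by (simp add: d_def[abs_def] h_def)
    qed
  qed
qed

lemma op_limit_lincomb:
  assumes m: "m \<in> mult_functionals" and S: "S \<in> bounded_ops" and R: "R \<in> bounded_ops"
    and limS: "op_limit m S S\<^sub>0" and limR: "op_limit m R R\<^sub>0"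
  shows "op_limit m (\<lambda>f\<in>bergman. \<lambda>z. S f z + c * R f z) (\<lambda>f. \<lambda>z. S\<^sub>0 f z + c * R\<^sub>0 f z)"
  unfolding op_limit_def
proof (intro ballI conjI)
  fix f assume f: "f \<in> bergman"
  have R0: "R\<^sub>0 f \<in> bergman" "((\<lambda>z. op_err z R R\<^sub>0 f) \<longlongrightarrow> 0) (disc_to m)"
    using limR f by (auto simp: op_limit_def)
  have S0: "S\<^sub>0 f \<in> bergman" "((\<lambda>z. op_err z S S\<^sub>0 f) \<longlongrightarrow> 0) (disc_to m)"
    using limS f by (auto simp: op_limit_def)
  show "(\<lambda>z. S\<^sub>0 f z + c * R\<^sub>0 f z) \<in> bergman" by (intro bergman_add bergman_cmult R0 S0)
  show "((\<lambda>z. norm2 (\<lambda>w. V z ((\<lambda>f\<in>bergman. \<lambda>z. S f z + c * R f z) (V z f)) w - (S\<^sub>0 f w + c * R\<^sub>0 f w))) \<longlongrightarrow> 0) (disc_to m)"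
  proof (rule Lim_null_comparison)
    show "((\<lambda>z. op_err z S S\<^sub>0 f + cmod c * op_err z R R\<^sub>0 f) \<longlongrightarrow> 0) (disc_to m)"
      using tendsto_add[OF S0(2) tendsto_mult_right_zero[OF R0(2)]] by simp
    show "\<forall>\<^sub>F z in disc_to m. norm (norm2 (\<lambda>w. V z ((\<lambda>f\<in>bergman. \<lambda>z. S f z + c * R f z) (V z f)) w - (S\<^sub>0 f w + c * R\<^sub>0 f w)))
        \<le> op_err z S S\<^sub>0 f + cmod c * op_err z R R\<^sub>0 f"
      using eventually_disc_to_disc[OF m]
    proof eventually_elim
      case (elim z)
      note Vb = V_bergman[OF elim]
      have "norm2 (\<lambda>w. V z ((\<lambda>f\<in>bergman. \<lambda>z. S f z + c * R f z) (V z f)) w - (S\<^sub>0 f w + c * R\<^sub>0 f w))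
        = norm2 (\<lambda>w. (V z (S (V z f)) w - S\<^sub>0 f w) + c * (V z (R (V z f)) w - R\<^sub>0 f w))"
        using Vb[OF f] by (simp add: V_add V_cmult algebra_simps)
      also have "\<dots> \<le> op_err z S S\<^sub>0 f + norm2 (\<lambda>w. c * (V z (R (V z f)) w - R\<^sub>0 f w))"
        by (intro norm2_triangle bergman_L2 bergman_diff bergman_cmult Vb bounded_ops_bergman[OF S] bounded_ops_bergman[OF R] f R0 S0)
      finally show ?case by (simp add: norm2_cmult)
    qed
  qed
qed

section \<open>Uniform continuity in the pseudohyperbolic distance\<close>

text \<open>As rho is invariant under \<phi>_z, the compositions of such a \<open>u\<close> with all
  \<phi>_z share one modulus of continuity.\<close>

definition hyp_uc :: "(complex \<Rightarrow> complex) \<Rightarrow> bool" where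
  "hyp_uc u \<longleftrightarrow> (\<forall>\<epsilon>>0. \<exists>\<delta>>0. \<forall>z\<in>disc. \<forall>w\<in>disc. rho z w \<le> \<delta> \<longrightarrow> cmod (u z - u w) \<le> \<epsilon>)"

lemma hyp_ucD: "hyp_uc u \<Longrightarrow> 0 < \<epsilon> \<Longrightarrow> \<exists>\<delta>>0. \<forall>z\<in>disc. \<forall>w\<in>disc. rho z w \<le> \<delta> \<longrightarrow> cmod (u z - u w) \<le> \<epsilon>"
  unfolding hyp_uc_def by blast

lemma rho_le_dist:
  assumes z: "cmod z \<le> r" and r: "r < 1" and wd: "w \<in> disc" and d: "0 \<le> \<delta>" and w: "cmod (z - w) \<le> \<delta> * (1 - r)"
  shows "rho z w \<le> \<delta>"
proof (rule rho_le_of_ball)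
  have "\<delta> * (1 - r) \<le> \<delta> * (1 - cmod z)" using z d by (intro mult_left_mono) auto
  then show "cmod (z - w) \<le> \<delta> * (1 - cmod z)" using w by linarith
qed (use z r d wd in auto)

lemma hyp_uc_continuous:
  assumes u: "hyp_uc u" shows "continuous_on disc u"
  unfolding continuous_on_iff
proof (intro ballI allI impI)
  fix z and e :: real assume z: "z \<in> disc" and e: "0 < e"
  obtain \<delta> where d: "0 < \<delta>" "\<forall>z\<in>disc. \<forall>w\<in>disc. rho z w \<le> \<delta> \<longrightarrow> cmod (u z - u w) \<le> e / 2"
    using hyp_ucD[OF u, of "e / 2"] e by auto
  define d where "d = min \<delta> 1 * (1 - cmod z)"
  have "0 < d" using d z by (simp add: d_def)
  moreover have "dist (u w) (u z) < e" if w: "w \<in> disc" "dist w z < d" for w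
  proof -
    have "rho z w \<le> min \<delta> 1" by (rule rho_le_dist[of z "cmod z"]) (use w z d in \<open>auto simp: d_def dist_norm norm_minus_commute\<close>)
    then have "rho z w \<le> \<delta>" by simp
    then have "cmod (u z - u w) \<le> e / 2" using d(2) z w(1) by blast
    then show ?thesis using e by (simp add: dist_norm norm_minus_commute)
  qed
  ultimately show "\<exists>d>0. \<forall>x'\<in>disc. dist x' z < d \<longrightarrow> dist (u x') (u z) < e" by blast
qed

text \<open>An algebra closed under conjugation that contains \<open>Hinf\<close> by Schwarz-Pick;
  its uniform limits are \<open>hyp_uc\<close>, which is how Stone-Weierstrass reaches all functions
  extending to the maximal ideal space.\<close>

definition hyp_lipschitz :: "(complex \<Rightarrow> complex) \<Rightarrow> bool" where
  "hyp_lipschitz u \<longleftrightarrow> (\<exists>C\<ge>0. \<forall>z\<in>disc. cmod (u z) \<le> C \<and> (\<forall>w\<in>disc. cmod (u z - u w) \<le> C * rho z w))"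

lemma
  assumes "hyp_lipschitz u" "hyp_lipschitz v"
  shows hyp_lipschitz_add: "hyp_lipschitz (\<lambda>z. u z + v z)" and hyp_lipschitz_mult: "hyp_lipschitz (\<lambda>z. u z * v z)"
proof -
  obtain C D where C: "0 \<le> C" "\<forall>z\<in>disc. cmod (u z) \<le> C \<and> (\<forall>w\<in>disc. cmod (u z - u w) \<le> C * rho z w)"
    and D: "0 \<le> D" "\<forall>z\<in>disc. cmod (v z) \<le> D \<and> (\<forall>w\<in>disc. cmod (v z - v w) \<le> D * rho z w)"
    using assms unfolding hyp_lipschitz_def by blast
  have 1: "cmod (u z + v z) \<le> C + D" if "z \<in> disc" for z
    using C(2) D(2) that by (intro norm_triangle_mono) auto
  have 2: "cmod (u z * v z) \<le> 2 * C * D" if "z \<in> disc" for z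
  proof -
    have "cmod (u z * v z) \<le> C * D" unfolding norm_mult using C D that by (intro mult_mono) auto
    then show ?thesis using mult_nonneg_nonneg[OF C(1) D(1)] by linarith
  qed
  have 3: "cmod ((u z + v z) - (u w + v w)) \<le> (C + D) * rho z w" if "z \<in> disc" "w \<in> disc" for z w
    unfolding distrib_right using C(2) D(2) that by (intro order_trans[OF norm_diff_triangle_ineq] add_mono) blast+
  have 4: "cmod (u z * v z - u w * v w) \<le> 2 * C * D * rho z w" if "z \<in> disc" "w \<in> disc" for z w
  proof -
    have "u z * v z - u w * v w = u z * (v z - v w) + (u z - u w) * v w" by (simp add: algebra_simps)
    then have "cmod (u z * v z - u w * v w) \<le> cmod (u z) * cmod (v z - v w) + cmod (u z - u w) * cmod (v w)"
      using norm_triangle_ineq[of "u z * (v z - v w)" "(u z - u w) * v w"] by (simp add: norm_mult)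
    also have "\<dots> \<le> C * (D * rho z w) + (C * rho z w) * D" using C D that by (intro add_mono mult_mono) auto
    finally show ?thesis by (simp add: algebra_simps)
  qed
  show "hyp_lipschitz (\<lambda>z. u z + v z)" unfolding hyp_lipschitz_def
    using 1 3 C(1) D(1) by (intro exI[of _ "C + D"] conjI ballI) simp_all
  show "hyp_lipschitz (\<lambda>z. u z * v z)" unfolding hyp_lipschitz_def
    using 2 4 C(1) D(1) by (intro exI[of _ "2 * C * D"] conjI ballI) simp_all
qed

lemma hyp_lipschitz_Hinf:
  assumes h: "h \<in> Hinf" shows "hyp_lipschitz h"
proof -
  obtain C where C: "0 < C" "\<And>z. z \<in> disc \<Longrightarrow> cmod (h z) \<le> C" using Hinf_bound[OF h] by auto
  have "h holomorphic_on disc" using h by (simp add: Hinf_def)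
  from Schwarz_Pick[OF this C(2)] show ?thesis
    unfolding hyp_lipschitz_def using C by (intro exI[of _ "3 * C"]) force
qed

lemma continuous_extension_bounded:
  assumes "continuous_extension v F"
  shows "\<exists>C>0. (\<forall>m\<in>mult_functionals. cmod (F m) \<le> C) \<and> (\<forall>z\<in>disc. cmod (v z) \<le> C)"
proof -
  have c: "continuous_on mult_functionals F" and v: "\<And>z. z \<in> disc \<Longrightarrow> F (point_eval z) = v z"
    using assms by (auto simp: continuous_extension_def continuous_map_M_iff)
  have "bounded (F ` mult_functionals)"
    by (rule compact_imp_bounded[OF compact_continuous_image[OF c compact_mult_functionals]])
  then obtain C where C: "0 < C" "\<forall>m\<in>mult_functionals. cmod (F m) \<le> C" by (auto simp: bounded_pos)
  then have "\<forall>z\<in>disc. cmod (v z) \<le> C" using v point_eval_mult by metis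
  then show ?thesis using C by blast
qed

lemma continuous_extension_hyp_uc:
  assumes v: "continuous_extension v F" shows "hyp_uc v"
  unfolding hyp_uc_def
proof (intro allI impI)
  fix \<epsilon> :: real assume e: "0 < \<epsilon>"
  have F: "continuous_map M euclidean F" and vF: "\<And>z. z \<in> disc \<Longrightarrow> F (point_eval z) = v z"
    using v by (auto simp: continuous_extension_def)
  have const: "hyp_lipschitz (\<lambda>z. c)" for c unfolding hyp_lipschitz_def by (rule exI[of _ "cmod c"]) simp
  have "\<exists>u. hyp_lipschitz u \<and> (\<forall>z\<in>disc. cmod (F (point_eval z) - u z) < \<epsilon> / 3)"
  proof (rule Stone_Weierstrass_M[where P = hyp_lipschitz])
    show "hyp_lipschitz (\<lambda>z. cnj (u z))" if "hyp_lipschitz u" for u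
      using that unfolding hyp_lipschitz_def complex_cnj_diff[symmetric] complex_mod_cnj .
    show "0 < \<epsilon> / 3" using e by simp
    show "hyp_lipschitz (\<lambda>z. c * u z)" if "hyp_lipschitz u" for c u by (rule hyp_lipschitz_mult[OF const that])
  qed (fact hyp_lipschitz_add hyp_lipschitz_mult hyp_lipschitz_Hinf F)+
  then obtain u C where C: "0 \<le> C" "\<forall>z\<in>disc. \<forall>w\<in>disc. cmod (u z - u w) \<le> C * rho z w"
    and un: "\<And>z. z \<in> disc \<Longrightarrow> cmod (v z - u z) < \<epsilon> / 3"
    using vF unfolding hyp_lipschitz_def by metis
  define \<delta> where "\<delta> = \<epsilon> / (3 * (C + 1))"
  have d: "0 < \<delta>" "C * \<delta> \<le> \<epsilon> / 3" using C(1) e by (simp_all add: \<delta>_def field_simps)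
  have "cmod (v z - v w) \<le> \<epsilon>" if zw: "z \<in> disc" "w \<in> disc" "rho z w \<le> \<delta>" for z w
  proof -
    have "cmod (u z - u w) \<le> C * rho z w" using C(2) zw by blast
    also have "\<dots> \<le> C * \<delta>" by (rule mult_left_mono[OF zw(3) C(1)])
    finally have 1: "cmod (u z - u w) \<le> \<epsilon> / 3" using d(2) by linarith
    have "v z - v w = (v z - u z) + (u z - u w) - (v w - u w)" by simp
    then have "cmod (v z - v w) \<le> cmod (v z - u z) + cmod (u z - u w) + cmod (v w - u w)"
      using norm_triangle_ineq4[of "(v z - u z) + (u z - u w)" "v w - u w"] norm_triangle_ineq[of "v z - u z" "u z - u w"] by simp
    then show ?thesis using 1 un[OF zw(1)] un[OF zw(2)] by linarith
  qed
  then show "\<exists>\<delta>>0. \<forall>z\<in>disc. \<forall>w\<in>disc. rho z w \<le> \<delta> \<longrightarrow> cmod (v z - v w) \<le> \<epsilon>" using d(1) by blast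
qed

lemma continuous_extension_symbol:
  assumes v: "continuous_extension v F" shows "symbol v"
  using continuous_on_borel_measurable_dA[OF hyp_uc_continuous[OF continuous_extension_hyp_uc[OF v]]]
    continuous_extension_bounded[OF v] unfolding symbol_def by blast

lemma hoffman_tendsto:
  assumes v: "continuous_extension v F" and m: "m \<in> mult_functionals" and w: "w \<in> disc"
  shows "((\<lambda>z. v (disc_aut z w)) \<longlongrightarrow> F (hoffman_map m w)) (disc_to m)"
proof -
  have F: "continuous_map M euclidean F" and vF: "\<And>z. z \<in> disc \<Longrightarrow> F (point_eval z) = v z"
    using v by (auto simp: continuous_extension_def)
  show ?thesis
  proof (rule Lim_transform_eventually[OF hoffman_map_limit_continuous[OF m w F]])
    show "\<forall>\<^sub>F z in disc_to m. F (point_eval (disc_aut z w)) = v (disc_aut z w)"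
      using eventually_disc_to_disc[OF m] by eventually_elim (intro vF disc_aut_in_disc w)
  qed
qed

lemma hoffman_hyp_uc:
  assumes v: "continuous_extension v F" and m: "m \<in> mult_functionals"
    and d: "\<forall>z\<in>disc. \<forall>w\<in>disc. rho z w \<le> \<delta> \<longrightarrow> cmod (v z - v w) \<le> \<epsilon>"
    and ab: "a \<in> disc" "b \<in> disc" "rho a b \<le> \<delta>"
  shows "cmod (F (hoffman_map m a) - F (hoffman_map m b)) \<le> \<epsilon>"
proof (rule tendsto_upperbound)
  show "((\<lambda>z. cmod (v (disc_aut z a) - v (disc_aut z b))) \<longlongrightarrow> cmod (F (hoffman_map m a) - F (hoffman_map m b))) (disc_to m)"
    by (intro tendsto_intros hoffman_tendsto[OF v m] ab)
  show "\<forall>\<^sub>F z in disc_to m. cmod (v (disc_aut z a) - v (disc_aut z b)) \<le> \<epsilon>"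
    using eventually_disc_to_disc[OF m]
  proof eventually_elim
    case (elim z)
    have "rho (disc_aut z a) (disc_aut z b) \<le> \<delta>" using ab by (simp add: rho_disc_aut[OF elim])
    then show ?case using d disc_aut_in_disc[OF elim] ab by blast
  qed
  show "disc_to m \<noteq> bot" by (rule disc_dense[OF m])
qed

lemma hoffman_symbol:
  assumes v: "continuous_extension v F" and m: "m \<in> mult_functionals"
  shows "symbol (\<lambda>w. F (hoffman_map m w))"
proof -
  have "hyp_uc (\<lambda>w. F (hoffman_map m w))"
    unfolding hyp_uc_def
  proof (intro allI impI)
    fix \<epsilon> :: real assume "0 < \<epsilon>"
    then obtain \<delta> where d: "0 < \<delta>" "\<forall>z\<in>disc. \<forall>w\<in>disc. rho z w \<le> \<delta> \<longrightarrow> cmod (v z - v w) \<le> \<epsilon>"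
      using hyp_ucD[OF continuous_extension_hyp_uc[OF v]] by blast
    then show "\<exists>\<delta>>0. \<forall>z\<in>disc. \<forall>w\<in>disc. rho z w \<le> \<delta> \<longrightarrow> cmod (F (hoffman_map m z) - F (hoffman_map m w)) \<le> \<epsilon>"
      using hoffman_hyp_uc[OF v m d(2)] by blast
  qed
  then have "(\<lambda>w. F (hoffman_map m w)) \<in> borel_measurable dA" by (intro continuous_on_borel_measurable_dA hyp_uc_continuous)
  moreover have "\<exists>C. \<forall>w\<in>disc. cmod (F (hoffman_map m w)) \<le> C"
    using continuous_extension_bounded[OF v] hoffman_map_mult[OF m] by blast
  ultimately show ?thesis by (simp only: symbol_def)
qed

text \<open>The argument of Arzela-Ascoli: convergence on a finite net of the compact disc, together
  with the common modulus of continuity of v \<circ> \<phi>_z and of the limit.\<close>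

lemma hoffman_uniform:
  assumes v: "continuous_extension v F" and m: "m \<in> mult_functionals" and r: "r < 1" and e: "0 < \<epsilon>"
  shows "\<forall>\<^sub>F z in disc_to m. \<forall>w\<in>cball 0 r. cmod (v (disc_aut z w) - F (hoffman_map m w)) \<le> \<epsilon>"
proof -
  obtain \<delta> where d: "0 < \<delta>" "\<forall>z\<in>disc. \<forall>w\<in>disc. rho z w \<le> \<delta> \<longrightarrow> cmod (v z - v w) \<le> \<epsilon> / 3"
    using hyp_ucD[OF continuous_extension_hyp_uc[OF v], of "\<epsilon> / 3"] e by auto
  define \<eta> where "\<eta> = min \<delta> 1 * (1 - r)"
  have \<eta>: "0 < \<eta>" using d r by (simp add: \<eta>_def)
  obtain k where k: "finite k" "k \<subseteq> cball (0::complex) r" "cball (0::complex) r \<subseteq> (\<Union>x\<in>k. ball x \<eta>)"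
    using seq_compact_imp_totally_bounded[OF compact_imp_seq_compact[OF compact_cball], of "0::complex" r, rule_format, OF \<eta>] by auto
  have kd: "x \<in> disc" if "x \<in> k" for x using k(2) that r by auto
  have "\<forall>\<^sub>F z in disc_to m. \<forall>x\<in>k. dist (v (disc_aut z x)) (F (hoffman_map m x)) < \<epsilon> / 3"
    by (intro eventually_ball_finite k(1) ballI tendstoD[OF hoffman_tendsto[OF v m]] kd) (use e in auto)
  with eventually_disc_to_disc[OF m] show ?thesis
  proof eventually_elim
    case (elim z)
    show ?case
    proof
      fix w :: complex assume w: "w \<in> cball 0 r"
      then have "w \<in> (\<Union>x\<in>k. ball x \<eta>)" by (rule subsetD[OF k(3)])
      then obtain x where x: "x \<in> k" "cmod (x - w) < \<eta>" by (auto simp: dist_norm)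
      have wd: "w \<in> disc" using w r by auto
      have "cmod x \<le> r" using k(2) x(1) by auto
      then have "rho x w \<le> min \<delta> 1" by (rule rho_le_dist[OF _ r wd]) (use x d in \<open>auto simp: \<eta>_def\<close>)
      then have rx: "rho x w \<le> \<delta>" by simp
      have 1: "cmod (v (disc_aut z x) - v (disc_aut z w)) \<le> \<epsilon> / 3"
        using d(2) rx disc_aut_in_disc[OF elim(1)] kd[OF x(1)] wd by (simp add: rho_disc_aut[OF elim(1)])
      have 2: "cmod (F (hoffman_map m x) - F (hoffman_map m w)) \<le> \<epsilon> / 3"
        by (rule hoffman_hyp_uc[OF v m d(2) kd[OF x(1)] wd rx])
      have 3: "cmod (v (disc_aut z x) - F (hoffman_map m x)) < \<epsilon> / 3" using elim(2) x(1) by (simp add: dist_norm)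
      have tri: "cmod (b - d) \<le> cmod (a - b) + cmod (a - c) + cmod (c - d)" for a b c d :: complex
      proof -
        have "b - d = (a - c) + (c - d) - (a - b)" by simp
        then show ?thesis using norm_triangle_ineq4[of "(a - c) + (c - d)" "a - b"] norm_triangle_ineq[of "a - c" "c - d"] by simp
      qed
      show "cmod (v (disc_aut z w) - F (hoffman_map m w)) \<le> \<epsilon>"
        using tri[of "v (disc_aut z w)" "F (hoffman_map m w)" "v (disc_aut z x)" "F (hoffman_map m x)"] 1 2 3 by linarith
    qed
  qed
qed

lemma measurable_tail_indicator:
  assumes f: "f \<in> L2"
  shows "(\<lambda>w. indicator {w. r < cmod w} w * (cmod (f w))^2) \<in> borel_measurable dA"
proof (rule borel_measurable_times)
  show "(indicator {w. r < cmod w} :: complex \<Rightarrow> real) \<in> borel_measurable dA"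
    by (intro borel_measurable_dA_I borel_measurable_indicator) measurable
  show "(\<lambda>w. (cmod (f w))^2) \<in> borel_measurable dA" using L2_measurable[OF f] by measurable
qed

lemma L2_tail:
  assumes f: "f \<in> L2" and e: "0 < e"
  shows "\<exists>r<1. (\<integral>w. indicator {w. r < cmod w} w * (cmod (f w))^2 \<partial>dA) < e"
proof -
  define r where "r n = 1 - 1 / (real n + 1)" for n
  have "(\<lambda>n. \<integral>w. indicator {w. r n < cmod w} w * (cmod (f w))^2 \<partial>dA) \<longlonglongrightarrow> (\<integral>w. 0 \<partial>dA)"
  proof (rule integral_dominated_convergence[where w = "\<lambda>w. (cmod (f w))^2"])
    show "(\<lambda>w. indicator {w. r n < cmod w} w * (cmod (f w))^2) \<in> borel_measurable dA" for n
      by (rule measurable_tail_indicator[OF f])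
    show "AE w in dA. (\<lambda>n. indicator {w. r n < cmod w} w * (cmod (f w))^2) \<longlonglongrightarrow> 0"
    proof (rule AE_I2)
      fix w assume "w \<in> space dA"
      then have w: "cmod w < 1" by simp
      have "r \<longlonglongrightarrow> 1" unfolding r_def[abs_def] by real_asymp
      from order_tendstoD(1)[OF this w] have "\<forall>\<^sub>F n in sequentially. indicator {w. r n < cmod w} w * (cmod (f w))^2 = 0"
        by eventually_elim simp
      then show "(\<lambda>n. indicator {w. r n < cmod w} w * (cmod (f w))^2) \<longlonglongrightarrow> 0" by (rule tendsto_eventually)
    qed
    show "AE w in dA. norm (indicator {w. r n < cmod w} w * (cmod (f w))^2) \<le> (cmod (f w))^2" for n
      by (auto simp: indicator_def)
    show "integrable dA (\<lambda>w. (cmod (f w))^2)" by (rule L2_integrable[OF f])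
  qed simp
  then have "\<forall>\<^sub>F n in sequentially. (\<integral>w. indicator {w. r n < cmod w} w * (cmod (f w))^2 \<partial>dA) < e"
    by (rule order_tendstoD(2)) (use e in simp)
  then obtain n where "(\<integral>w. indicator {w. r n < cmod w} w * (cmod (f w))^2 \<partial>dA) < e"
    by (auto simp: eventually_sequentially)
  then show ?thesis by (intro exI[of _ "r n"]) (simp add: r_def)
qed

lemma toeplitz_diff_symbol:
  assumes u: "symbol u" and v: "symbol v" and f: "f \<in> bergman"
  shows "norm2 (\<lambda>z. toeplitz u f z - toeplitz v f z) \<le> norm2 (\<lambda>z. (u z - v z) * f z)"
proof -
  note uL = symbol_L2[OF u bergman_L2[OF f]] and vL = symbol_L2[OF v bergman_L2[OF f]]
  have L: "(\<lambda>z. (u z - v z) * f z) \<in> L2" unfolding left_diff_distrib by (rule L2_diff[OF uL vL])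
  have "bergman_proj (\<lambda>z. (u z - v z) * f z) = (\<lambda>z. toeplitz u f z - toeplitz v f z)"
  proof (rule bergman_proj_eq[OF L])
    show "(\<lambda>z. toeplitz u f z - toeplitz v f z) \<in> bergman" by (intro bergman_diff toeplitz_bergman u v f)
    fix h assume h: "h \<in> bergman"
    show "ip (\<lambda>z. (u z - v z) * f z) h = ip (\<lambda>z. toeplitz u f z - toeplitz v f z) h"
      unfolding left_diff_distrib
      by (simp add: ip_diff_left uL vL bergman_L2 toeplitz_bergman u v f h ip_toeplitz)
  qed
  then show ?thesis using norm2_bergman_proj[OF L] by simp
qed

text \<open>The projection does not increase norms, so it suffices to make (v \<circ> \<phi>_z - F
  \<circ> \<phi>_m) f small in L^2. Inside radius \<open>r\<close> the symbols are uniformly close;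
  outside, their difference is at most 2C and the tail of \<open>f\<close> is small.\<close>

lemma op_limit_toeplitz:
  assumes v: "continuous_extension v F" and m: "m \<in> mult_functionals"
  shows "op_limit m (toeplitz v) (toeplitz (\<lambda>w. F (hoffman_map m w)))"
  unfolding op_limit_def
proof (intro ballI conjI)
  fix f assume f: "f \<in> bergman"
  note sv = continuous_extension_symbol[OF v] and sF = hoffman_symbol[OF v m]
  show "toeplitz (\<lambda>w. F (hoffman_map m w)) f \<in> bergman" by (rule toeplitz_bergman[OF sF f])
  obtain C where C: "0 < C" "\<forall>m\<in>mult_functionals. cmod (F m) \<le> C" "\<forall>z\<in>disc. cmod (v z) \<le> C"
    using continuous_extension_bounded[OF v] by blast
  define N where "N = (norm2 f)^2"
  have N: "0 \<le> N" by (simp add: N_def)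
  show "((\<lambda>z. norm2 (\<lambda>w. V z (toeplitz v (V z f)) w - toeplitz (\<lambda>w. F (hoffman_map m w)) f w)) \<longlongrightarrow> 0) (disc_to m)"
  proof (rule tendstoI)
    fix e :: real assume e: "0 < e"
    \<comment> \<open>Inside and outside are each allotted e^2/4 of the squared norm; N + 1 avoids a
      zero denominator for f = 0.\<close>
    define \<epsilon> where "\<epsilon> = sqrt (e^2 / (4 * (N + 1)))"
    have \<epsilon>: "0 < \<epsilon>" "\<epsilon>^2 = e^2 / (4 * (N + 1))" using e N by (simp_all add: \<epsilon>_def)
    have C2: "0 < (2 * C)^2" using C by simp
    obtain r where r: "r < 1" "(\<integral>w. indicator {w. r < cmod w} w * (cmod (f w))^2 \<partial>dA) < e^2 / (4 * (2 * C)^2)"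
      using L2_tail[OF bergman_L2[OF f], of "e^2 / (4 * (2 * C)^2)"] e C2 by auto
    show "\<forall>\<^sub>F z in disc_to m. dist (norm2 (\<lambda>w. V z (toeplitz v (V z f)) w - toeplitz (\<lambda>w. F (hoffman_map m w)) f w)) 0 < e"
      using eventually_disc_to_disc[OF m] hoffman_uniform[OF v m r(1) \<epsilon>(1)]
    proof eventually_elim
      case (elim z)
      define d where "d w = (v (disc_aut z w) - F (hoffman_map m w)) * f w" for w
      define \<tau> where "\<tau> w = indicator {w. r < cmod w} w * (cmod (f w))^2" for w
      have sz: "symbol (\<lambda>w. v (disc_aut z w))" by (rule symbol_disc_aut[OF elim(1) sv])
      have dL: "d \<in> L2" unfolding d_def[abs_def] left_diff_distrib by (intro L2_diff symbol_L2 sz sF bergman_L2 f)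
      have int: "integrable dA \<tau>"
      proof (rule Bochner_Integration.integrable_bound[OF L2_integrable[OF bergman_L2[OF f]]])
        show "\<tau> \<in> borel_measurable dA" unfolding \<tau>_def[abs_def]
          by (rule measurable_tail_indicator[OF bergman_L2[OF f]])
      qed (auto simp: \<tau>_def indicator_def)
      have "(norm2 d)^2 \<le> (\<integral>w. \<epsilon>^2 * (cmod (f w))^2 + (2 * C)^2 * \<tau> w \<partial>dA)"
        unfolding norm2_square
      proof (rule integral_mono)
        show "integrable dA (\<lambda>w. (cmod (d w))^2)" by (rule L2_integrable[OF dL])
        show "integrable dA (\<lambda>w. \<epsilon>^2 * (cmod (f w))^2 + (2 * C)^2 * \<tau> w)"
          using L2_integrable[OF bergman_L2[OF f]] int by simp
        fix w assume "w \<in> space dA"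
        then have w: "w \<in> disc" by simp
        show "(cmod (d w))^2 \<le> \<epsilon>^2 * (cmod (f w))^2 + (2 * C)^2 * \<tau> w"
        proof (cases "r < cmod w")
          case False
          then have "cmod (v (disc_aut z w) - F (hoffman_map m w)) \<le> \<epsilon>" using elim(2) by simp
          then have "(cmod (d w))^2 \<le> \<epsilon>^2 * (cmod (f w))^2"
            unfolding d_def norm_mult power_mult_distrib by (intro mult_right_mono power_mono) auto
          then show ?thesis using False by (simp add: \<tau>_def)
        next
          case True
          have "cmod (v (disc_aut z w)) \<le> C" "cmod (F (hoffman_map m w)) \<le> C"
            using C(2,3) disc_aut_in_disc[OF elim(1) w] hoffman_map_mult[OF m w] by blast+
          then have "cmod (v (disc_aut z w) - F (hoffman_map m w)) \<le> 2 * C"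
            by (intro norm_triangle_le_diff) simp
          then have "(cmod (v (disc_aut z w) - F (hoffman_map m w)))^2 \<le> (2 * C)^2" by (rule power_mono) simp
          then have "(cmod (d w))^2 \<le> (2 * C)^2 * (cmod (f w))^2"
            unfolding d_def norm_mult power_mult_distrib[of "cmod (v (disc_aut z w) - F (hoffman_map m w))"]
            by (rule mult_right_mono) simp
          also have "\<dots> = (2 * C)^2 * \<tau> w" using True by (simp add: \<tau>_def)
          finally show ?thesis by (rule order_trans) simp
        qed
      qed
      also have "\<dots> = \<epsilon>^2 * N + (2 * C)^2 * (\<integral>w. \<tau> w \<partial>dA)"
        unfolding N_def norm2_square using L2_integrable[OF bergman_L2[OF f]] int by simp
      also have "\<epsilon>^2 * N \<le> e^2 / 4"
      proof -
        have "e^2 * N \<le> e^2 * (N + 1)" by (intro mult_left_mono) auto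
        then show ?thesis unfolding \<epsilon>(2) using N by (simp add: field_simps)
      qed
      also have "(2 * C)^2 * (\<integral>w. \<tau> w \<partial>dA) \<le> (2 * C)^2 * (e^2 / (4 * (2 * C)^2))"
        using r(2) C2 unfolding \<tau>_def by (intro mult_left_mono) auto
      also have "\<dots> = e^2 / 4" using C2 by (simp add: field_simps)
      finally have "(norm2 d)^2 \<le> e^2 / 4 + e^2 / 4" by simp
      also have "\<dots> < e^2" using e by simp
      finally have "norm2 d < e" using e by (intro power2_less_imp_less[of "norm2 d" e]) auto
      moreover have "norm2 (\<lambda>w. V z (toeplitz v (V z f)) w - toeplitz (\<lambda>w. F (hoffman_map m w)) f w) \<le> norm2 d"
        unfolding V_toeplitz_V[OF elim(1) sv f] d_def[abs_def] by (rule toeplitz_diff_symbol[OF sz sF f])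
      ultimately show ?case by simp
    qed
  qed
qed

section \<open>The algebra U\<close>

lemma Linf_symbol:
  assumes "symbol u" shows "u \<in> Linf"
proof -
  obtain C where C: "u \<in> borel_measurable dA" "\<forall>z\<in>disc. cmod (u z) \<le> C" using assms unfolding symbol_def by blast
  have "AE z in dA. cmod (u z) \<le> C" by (rule AE_I2) (use C(2) in simp)
  then show ?thesis unfolding Linf_def using C(1) by blast
qed

text \<open>\<open>Linf\<close> is itself a member of the family whose intersection is
  \<open>algebra_U\<close>; this gives \<open>algebra_U\<close> \<subseteq>
  \<open>Linf\<close>.\<close>

lemma Linf_cstar_subalgebra_Linf: "Linf_cstar_subalgebra Linf"
  unfolding Linf_cstar_subalgebra_def
proof (intro conjI ballI allI impI subset_refl)
  fix u assume "u \<in> Linf"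
  then obtain C where u: "u \<in> borel_measurable dA" "AE z in dA. cmod (u z) \<le> C" by (auto simp: Linf_def)
  note [measurable] = u(1)
  show "(\<lambda>z. cnj (u z)) \<in> Linf" using u by (auto simp: Linf_def intro: measurable_compose[OF _ measurable_cnj])
  have "AE z in dA. cmod (c * u z) \<le> cmod c * C" for c
    using u(2) by eventually_elim (auto simp: norm_mult intro: mult_left_mono)
  then show "(\<lambda>z. c * u z) \<in> Linf" for c by (auto simp: Linf_def)
  fix v assume "v \<in> Linf"
  then obtain D where v: "v \<in> borel_measurable dA" "AE z in dA. cmod (v z) \<le> D" by (auto simp: Linf_def)
  note [measurable] = v(1)
  have "AE z in dA. cmod (u z + v z) \<le> C + D"
    using u(2) v(2) by eventually_elim (rule norm_triangle_mono)
  then show "(\<lambda>z. u z + v z) \<in> Linf" by (auto simp: Linf_def)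
  have "AE z in dA. cmod (u z * v z) \<le> C * D"
    using u(2) v(2)
  proof eventually_elim
    case (elim z)
    then show ?case unfolding norm_mult using order_trans[OF norm_ge_zero elim(1)] by (intro mult_mono) auto
  qed
  then show "(\<lambda>z. u z * v z) \<in> Linf" by (auto simp: Linf_def)
qed auto

lemma Hinf_Linf: "Hinf \<subseteq> Linf"
proof
  fix h assume h: "h \<in> Hinf"
  have "symbol h" unfolding symbol_def using L2_measurable[OF bergman_L2[OF Hinf_bergman[OF h]]] Hinf_bound[OF h] by blast
  then show "h \<in> Linf" by (rule Linf_symbol)
qed

lemma algebra_U_Linf: "algebra_U \<subseteq> Linf"
  unfolding algebra_U_def using Linf_cstar_subalgebra_Linf Hinf_Linf by (intro Inter_lower) simp

lemma
  shows algebra_U_add: "u \<in> algebra_U \<Longrightarrow> v \<in> algebra_U \<Longrightarrow> (\<lambda>z. u z + v z) \<in> algebra_U"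
    and algebra_U_mult: "u \<in> algebra_U \<Longrightarrow> v \<in> algebra_U \<Longrightarrow> (\<lambda>z. u z * v z) \<in> algebra_U"
    and algebra_U_cmult: "u \<in> algebra_U \<Longrightarrow> (\<lambda>z. c * u z) \<in> algebra_U"
    and algebra_U_cnj: "u \<in> algebra_U \<Longrightarrow> (\<lambda>z. cnj (u z)) \<in> algebra_U"
    and algebra_U_Hinf: "h \<in> Hinf \<Longrightarrow> h \<in> algebra_U"
  unfolding algebra_U_def Linf_cstar_subalgebra_def by (blast intro!: InterI)+

lemma algebra_U_closed:
  assumes u: "u \<in> Linf" and approx: "\<And>\<epsilon>. 0 < \<epsilon> \<Longrightarrow> \<exists>v\<in>algebra_U. \<forall>z\<in>disc. cmod (u z - v z) \<le> \<epsilon>"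
  shows "u \<in> algebra_U"
  unfolding algebra_U_def
proof
  fix A assume "A \<in> {A. Linf_cstar_subalgebra A \<and> Hinf \<subseteq> A}"
  then have A: "Linf_cstar_subalgebra A" "Hinf \<subseteq> A" by auto
  have sub: "algebra_U \<subseteq> A" unfolding algebra_U_def using A by (intro Inter_lower) simp
  have "\<exists>v\<in>A. AE z in dA. cmod (u z - v z) \<le> \<epsilon>" if e: "0 < \<epsilon>" for \<epsilon> :: real
  proof -
    obtain v where v: "v \<in> algebra_U" "\<forall>z\<in>disc. cmod (u z - v z) \<le> \<epsilon>" using approx[OF e] by blast
    have "AE z in dA. cmod (u z - v z) \<le> \<epsilon>" by (rule AE_I2) (use v(2) in simp)
    then show ?thesis using v(1) sub by blast
  qed
  then show "u \<in> A" using A(1) u unfolding Linf_cstar_subalgebra_def by blast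
qed

text \<open>The inclusion of the continuous functions on the maximal ideal space in
  \<open>algebra_U\<close>: elements of \<open>algebra_U\<close> approximate them uniformly on the
  disc, and \<open>algebra_U\<close> is closed.\<close>

lemma continuous_extension_algebra_U:
  assumes v: "continuous_extension v F" shows "v \<in> algebra_U"
proof (rule algebra_U_closed)
  show "v \<in> Linf" by (rule Linf_symbol[OF continuous_extension_symbol[OF v]])
  fix \<epsilon> :: real assume e: "0 < \<epsilon>"
  have F: "continuous_map M euclidean F" and vF: "\<And>z. z \<in> disc \<Longrightarrow> F (point_eval z) = v z"
    using v by (auto simp: continuous_extension_def)
  have "\<exists>u. u \<in> algebra_U \<and> (\<forall>z\<in>disc. cmod (F (point_eval z) - u z) < \<epsilon>)"
    by (rule Stone_Weierstrass_M[where P = "\<lambda>u. u \<in> algebra_U"])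
       (simp_all add: algebra_U_add algebra_U_mult algebra_U_cmult algebra_U_cnj algebra_U_Hinf F e)
  then obtain u where u: "u \<in> algebra_U" "\<And>z. z \<in> disc \<Longrightarrow> cmod (v z - u z) < \<epsilon>" using vF by auto
  then show "\<exists>u\<in>algebra_U. \<forall>z\<in>disc. cmod (v z - u z) \<le> \<epsilon>" using less_imp_le by blast
qed

section \<open>A C*-algebra of operators with limits\<close>

definition adjoint_pair :: "bop \<Rightarrow> bop \<Rightarrow> bool" where
  "adjoint_pair S R \<longleftrightarrow> (\<forall>f\<in>bergman. \<forall>g\<in>bergman. ip (S f) g = ip f (R g))"

definition has_limits :: "bop \<Rightarrow> bool" where
  "has_limits S \<longleftrightarrow> (\<forall>m\<in>mult_functionals. \<exists>S\<^sub>0. op_limit m S S\<^sub>0)"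

text \<open>Strong limits do not commute with adjoints, so existence of the limits is required of the
  adjoint as well.\<close>

definition limit_ops :: "bop set" where
  "limit_ops = {S \<in> bounded_ops. has_limits S \<and> (\<exists>R\<in>bounded_ops. has_limits R \<and> adjoint_pair S R)}"

lemma adjoint_pair_sym: "adjoint_pair S R \<Longrightarrow> adjoint_pair R S"
  unfolding adjoint_pair_def using ip_cnj by metis

lemma limit_ops_bounded: "S \<in> limit_ops \<Longrightarrow> S \<in> bounded_ops" by (simp add: limit_ops_def)

lemma limit_ops_adjoint: "S \<in> limit_ops \<Longrightarrow> \<exists>R\<in>limit_ops. adjoint_pair S R"
  unfolding limit_ops_def using adjoint_pair_sym by blast

lemma limit_ops_lincomb:
  assumes S: "S \<in> limit_ops" and R: "R \<in> limit_ops"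
  shows "(\<lambda>f\<in>bergman. \<lambda>z. S f z + c * R f z) \<in> limit_ops"
proof -
  have lim: "has_limits (\<lambda>f\<in>bergman. \<lambda>z. S f z + c * R f z)"
    if "S \<in> bounded_ops" "R \<in> bounded_ops" "has_limits S" "has_limits R" for c S R
    using op_limit_lincomb[OF _ that(1,2)] that(3,4) unfolding has_limits_def by meson
  obtain S' R' where a: "S' \<in> bounded_ops" "has_limits S'" "adjoint_pair S S'" "R' \<in> bounded_ops" "has_limits R'" "adjoint_pair R R'"
    using S R by (auto simp: limit_ops_def)
  have b: "S \<in> bounded_ops" "R \<in> bounded_ops" "has_limits S" "has_limits R" using S R by (auto simp: limit_ops_def)
  have "adjoint_pair (\<lambda>f\<in>bergman. \<lambda>z. S f z + c * R f z) (\<lambda>f\<in>bergman. \<lambda>z. S' f z + cnj c * R' f z)"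
    using a(3,6) unfolding adjoint_pair_def
    by (simp add: ip_add_left ip_add_right ip_cmult_left ip_cmult_right bergman_L2 bergman_cmult bounded_ops_bergman[OF b(1)]
        bounded_ops_bergman[OF b(2)] bounded_ops_bergman[OF a(1)] bounded_ops_bergman[OF a(4)])
  then show ?thesis
    unfolding limit_ops_def
    using lim[OF b] lim[OF a(1,4,2,5)] bounded_ops_lincomb[OF b(1,2)] bounded_ops_lincomb[OF a(1,4)] by blast
qed

lemma limit_ops_compose:
  assumes S: "S \<in> limit_ops" and R: "R \<in> limit_ops"
  shows "compose bergman S R \<in> limit_ops"
proof -
  have lim: "has_limits (compose bergman S R)"
    if "S \<in> bounded_ops" "R \<in> bounded_ops" "has_limits S" "has_limits R" for S R
    using op_limit_compose[OF _ that(1,2)] that(3,4) unfolding has_limits_def by meson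
  obtain S' R' where a: "S' \<in> bounded_ops" "has_limits S'" "adjoint_pair S S'" "R' \<in> bounded_ops" "has_limits R'" "adjoint_pair R R'"
    using S R by (auto simp: limit_ops_def)
  have b: "S \<in> bounded_ops" "R \<in> bounded_ops" "has_limits S" "has_limits R" using S R by (auto simp: limit_ops_def)
  have "adjoint_pair (compose bergman S R) (compose bergman R' S')"
    using a(3,6) bounded_ops_bergman[OF b(2)] bounded_ops_bergman[OF a(1)] unfolding adjoint_pair_def by (simp add: compose_eq)
  then show ?thesis
    unfolding limit_ops_def using lim[OF b] lim[OF a(4,1,5,2)] bounded_ops_compose[OF b(1,2)] bounded_ops_compose[OF a(4,1)] by blast
qed

lemma berezin_limit_ops:
  assumes S: "S \<in> limit_ops" shows "berezin S \<in> algebra_U"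
proof -
  have b: "S \<in> bounded_ops" "has_limits S" using S by (auto simp: limit_ops_def)
  obtain S0 where S0: "\<And>m. m \<in> mult_functionals \<Longrightarrow> op_limit m S (S0 m)" using b(2) unfolding has_limits_def by metis
  show ?thesis
    by (rule continuous_extension_algebra_U[OF berezin_extension[OF b(1) op_limit_berezin[OF _ b(1) S0]]])
qed

lemma continuous_extension_Hinf: "h \<in> Hinf \<Longrightarrow> continuous_extension h (\<lambda>m. m h)"
  unfolding continuous_extension_def continuous_map_M_iff
  by (auto simp: point_eval_def intro: continuous_on_subset[OF continuous_on_product_coordinates])

lemma continuous_extension_cnj: "continuous_extension v F \<Longrightarrow> continuous_extension (\<lambda>z. cnj (v z)) (\<lambda>m. cnj (F m))"
  unfolding continuous_extension_def continuous_map_M_iff by (auto intro: continuous_on_cnj)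

lemma toeplitz_limit_ops:
  assumes v: "continuous_extension v F" shows "toeplitz v \<in> limit_ops"
proof -
  have lim: "toeplitz v \<in> bounded_ops" "has_limits (toeplitz v)" if "continuous_extension v F" for v F
    using toeplitz_bounded_ops[OF continuous_extension_symbol[OF that]] op_limit_toeplitz[OF that]
    unfolding has_limits_def by blast+
  have "adjoint_pair (toeplitz v) (toeplitz (\<lambda>z. cnj (v z)))"
    using toeplitz_adjoint[OF continuous_extension_symbol[OF v]] by (simp add: adjoint_pair_def)
  then show ?thesis
    unfolding limit_ops_def using lim[OF v] lim[OF continuous_extension_cnj[OF v]] by blast
qed

definition op_close :: "real \<Rightarrow> bop \<Rightarrow> bop \<Rightarrow> bool" where
  "op_close \<epsilon> S R \<longleftrightarrow> (\<forall>f\<in>bergman. norm2 (\<lambda>z. S f z - R f z) \<le> \<epsilon> * norm2 f)"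

text \<open>With the norm closure, closedness holds by construction; Berezin transforms of its
  members are reached by uniform approximation.\<close>

definition limit_ops_closure :: "bop set" where
  "limit_ops_closure = {S \<in> bounded_ops. \<forall>\<epsilon>>0. \<exists>R\<in>limit_ops. op_close \<epsilon> S R}"

lemma op_close_triangle:
  assumes SRT: "S \<in> bounded_ops" "R \<in> bounded_ops" "T \<in> bounded_ops" and SR: "op_close a S R" and RT: "op_close b R T"
  shows "op_close (a + b) S T"
  unfolding op_close_def
proof
  fix f assume f: "f \<in> bergman"
  note L = bergman_L2[OF bounded_ops_bergman[OF SRT(1) f]] bergman_L2[OF bounded_ops_bergman[OF SRT(2) f]] bergman_L2[OF bounded_ops_bergman[OF SRT(3) f]]
  have "norm2 (\<lambda>z. S f z - T f z) = norm2 (\<lambda>z. (S f z - R f z) + (R f z - T f z))" by simp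
  also have "\<dots> \<le> norm2 (\<lambda>z. S f z - R f z) + norm2 (\<lambda>z. R f z - T f z)"
    by (intro norm2_triangle L2_diff L)
  also have "\<dots> \<le> a * norm2 f + b * norm2 f" using SR RT f unfolding op_close_def by (intro add_mono) auto
  finally show "norm2 (\<lambda>z. S f z - T f z) \<le> (a + b) * norm2 f" by (simp add: distrib_right)
qed

text \<open>With d = (S' - T') g one has ||d||^2 = \<langle>(S - T) d, g\<rangle> \<le> \<epsilon>
  ||d|| ||g||: passing to adjoints preserves the distance.\<close>

lemma op_close_adjoint:
  assumes b: "S \<in> bounded_ops" "S' \<in> bounded_ops" "T \<in> bounded_ops" "T' \<in> bounded_ops"
    and adj: "adjoint_pair S S'" "adjoint_pair T T'" and ST: "op_close \<epsilon> S T"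
  shows "op_close \<epsilon> S' T'"
  unfolding op_close_def
proof
  fix g assume g: "g \<in> bergman"
  define d where "d z = S' g z - T' g z" for z
  note S'b = bounded_ops_bergman[OF b(2) g] and T'b = bounded_ops_bergman[OF b(4) g]
  have d: "d \<in> bergman" unfolding d_def[abs_def] by (intro bergman_diff S'b T'b)
  note Sd = bounded_ops_bergman[OF b(1) d] and Td = bounded_ops_bergman[OF b(3) d]
  have "ip d d = ip d (S' g) - ip d (T' g)"
    by (subst (2) d_def[abs_def]) (intro ip_diff_right bergman_L2 S'b T'b d)
  also have "\<dots> = ip (S d) g - ip (T d) g" using adj d g unfolding adjoint_pair_def by simp
  also have "\<dots> = ip (\<lambda>z. S d z - T d z) g" by (rule ip_diff_left[symmetric]) (intro bergman_L2 Sd Td g)+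
  finally have eq: "ip d d = ip (\<lambda>z. S d z - T d z) g" .
  have "cmod (ip d d) \<le> norm2 (\<lambda>z. S d z - T d z) * norm2 g"
    unfolding eq by (intro Cauchy_Schwarz_ip bergman_L2 bergman_diff Sd Td g)
  also have "\<dots> \<le> \<epsilon> * norm2 d * norm2 g" using ST d unfolding op_close_def by (intro mult_right_mono) auto
  finally have "norm2 d * norm2 d \<le> (\<epsilon> * norm2 g) * norm2 d"
    unfolding ip_self norm_of_real by (simp add: power2_eq_square mult_ac)
  moreover have "0 \<le> \<epsilon> * norm2 g" using ST g norm2_nonneg order_trans unfolding op_close_def by blast
  ultimately have "norm2 d \<le> \<epsilon> * norm2 g"
    using norm2_nonneg[of d] by (cases "norm2 d = 0") auto
  then show "norm2 (\<lambda>z. S' g z - T' g z) \<le> \<epsilon> * norm2 g" by (simp add: d_def[abs_def])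
qed

lemma op_close_mono: "op_close a S R \<Longrightarrow> a \<le> b \<Longrightarrow> op_close b S R"
  unfolding op_close_def using mult_right_mono[OF _ norm2_nonneg] order_trans by metis

lemma op_close_lincomb:
  assumes b: "S \<in> bounded_ops" "S' \<in> bounded_ops" "R \<in> bounded_ops" "R' \<in> bounded_ops"
    and close: "op_close a S S'" "op_close d R R'"
  shows "op_close (a + cmod c * d) (\<lambda>f\<in>bergman. \<lambda>z. S f z + c * R f z) (\<lambda>f\<in>bergman. \<lambda>z. S' f z + c * R' f z)"
  unfolding op_close_def
proof
  fix f assume f: "f \<in> bergman"
  have "norm2 (\<lambda>z. (S f z + c * R f z) - (S' f z + c * R' f z)) = norm2 (\<lambda>z. (S f z - S' f z) + c * (R f z - R' f z))"
    by (simp add: algebra_simps)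
  also have "\<dots> \<le> norm2 (\<lambda>z. S f z - S' f z) + norm2 (\<lambda>z. c * (R f z - R' f z))"
    by (intro norm2_triangle L2_diff L2_cmult bergman_L2 bounded_ops_bergman[OF b(1)] bounded_ops_bergman[OF b(2)]
        bounded_ops_bergman[OF b(3)] bounded_ops_bergman[OF b(4)] f)
  also have "\<dots> \<le> a * norm2 f + cmod c * (d * norm2 f)"
    unfolding norm2_cmult using close f unfolding op_close_def by (intro add_mono mult_left_mono) auto
  finally show "norm2 (\<lambda>z. (\<lambda>f\<in>bergman. \<lambda>z. S f z + c * R f z) f z - (\<lambda>f\<in>bergman. \<lambda>z. S' f z + c * R' f z) f z) \<le> (a + cmod c * d) * norm2 f"
    using f by (simp add: algebra_simps)
qed

lemma op_close_compose:
  assumes b: "S \<in> bounded_ops" "S' \<in> bounded_ops" "R \<in> bounded_ops" "R' \<in> bounded_ops"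
    and close: "op_close a S S'" "op_close c R R'" and a: "0 \<le> a"
    and C: "0 \<le> C" "\<forall>f\<in>bergman. norm2 (S f) \<le> C * norm2 f" and D: "\<forall>f\<in>bergman. norm2 (R f) \<le> D * norm2 f"
  shows "op_close (C * c + a * (D + c)) (compose bergman S R) (compose bergman S' R')"
  unfolding op_close_def
proof
  fix f assume f: "f \<in> bergman"
  note Rf = bounded_ops_bergman[OF b(3) f] and R'f = bounded_ops_bergman[OF b(4) f]
  define d where "d z = R f z - R' f z" for z
  have d: "d \<in> bergman" unfolding d_def[abs_def] by (intro bergman_diff Rf R'f)
  have dc: "norm2 d \<le> c * norm2 f" using close(2) f by (simp add: op_close_def d_def[abs_def])
  have "norm2 (R' f) = norm2 (\<lambda>z. R f z + (-1) * d z)" by (simp add: d_def)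
  also have "\<dots> \<le> norm2 (R f) + norm2 (\<lambda>z. (-1) * d z)" by (intro norm2_triangle bergman_L2 bergman_cmult Rf d)
  also have "norm2 (\<lambda>z. (-1) * d z) = norm2 d" unfolding norm2_cmult by simp
  also have "norm2 (R f) + norm2 d \<le> D * norm2 f + c * norm2 f" using D f dc by (intro add_mono) auto
  finally have R'n: "norm2 (R' f) \<le> (D + c) * norm2 f" by (simp add: distrib_right)
  have "S d = (\<lambda>z. S (R f) z - S (R' f) z)" unfolding d_def[abs_def] by (rule bounded_ops_diff[OF b(1) Rf R'f])
  then have "norm2 (\<lambda>z. S (R f) z - S' (R' f) z) = norm2 (\<lambda>z. S d z + (S (R' f) z - S' (R' f) z))" by simp
  also have "\<dots> \<le> norm2 (S d) + norm2 (\<lambda>z. S (R' f) z - S' (R' f) z)"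
    by (intro norm2_triangle L2_diff bergman_L2 bounded_ops_bergman[OF b(1)] bounded_ops_bergman[OF b(2)] d R'f)
  also have "\<dots> \<le> C * (c * norm2 f) + a * ((D + c) * norm2 f)"
  proof (rule add_mono)
    have "norm2 (S d) \<le> C * norm2 d" using C(2) d by blast
    also have "\<dots> \<le> C * (c * norm2 f)" by (rule mult_left_mono[OF dc C(1)])
    finally show "norm2 (S d) \<le> C * (c * norm2 f)" .
    have "norm2 (\<lambda>z. S (R' f) z - S' (R' f) z) \<le> a * norm2 (R' f)" using close(1) R'f by (simp add: op_close_def)
    also have "\<dots> \<le> a * ((D + c) * norm2 f)" by (rule mult_left_mono[OF R'n a])
    finally show "norm2 (\<lambda>z. S (R' f) z - S' (R' f) z) \<le> a * ((D + c) * norm2 f)" .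
  qed
  finally show "norm2 (\<lambda>z. compose bergman S R f z - compose bergman S' R' f z) \<le> (C * c + a * (D + c)) * norm2 f"
    using f by (simp add: compose_eq algebra_simps)
qed

lemma limit_ops_closureD:
  "S \<in> limit_ops_closure \<Longrightarrow> S \<in> bounded_ops"
  "S \<in> limit_ops_closure \<Longrightarrow> 0 < \<epsilon> \<Longrightarrow> \<exists>R. R \<in> limit_ops \<and> R \<in> bounded_ops \<and> op_close \<epsilon> S R"
  unfolding limit_ops_closure_def using limit_ops_bounded by blast+

lemma limit_ops_closure_lincomb:
  assumes S: "S \<in> limit_ops_closure" and R: "R \<in> limit_ops_closure"
  shows "(\<lambda>f\<in>bergman. \<lambda>z. S f z + c * R f z) \<in> limit_ops_closure"
  unfolding limit_ops_closure_def
proof (intro CollectI conjI allI impI)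
  note b = limit_ops_closureD(1)[OF S] limit_ops_closureD(1)[OF R]
  show "(\<lambda>f\<in>bergman. \<lambda>z. S f z + c * R f z) \<in> bounded_ops" by (rule bounded_ops_lincomb[OF b])
  fix \<epsilon> :: real assume e: "0 < \<epsilon>"
  define \<eta> where "\<eta> = \<epsilon> / (1 + cmod c)"
  have p: "0 < 1 + cmod c" by (simp add: add_pos_nonneg)
  then have \<eta>: "0 < \<eta>" "\<eta> + cmod c * \<eta> = \<epsilon>"
    using e distrib_right[of 1 "cmod c" \<eta>] by (simp_all add: \<eta>_def)
  obtain S' R' where S': "S' \<in> limit_ops" "S' \<in> bounded_ops" "op_close \<eta> S S'"
    and R': "R' \<in> limit_ops" "R' \<in> bounded_ops" "op_close \<eta> R R'"
    using limit_ops_closureD(2)[OF S \<eta>(1)] limit_ops_closureD(2)[OF R \<eta>(1)] by blast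
  show "\<exists>T\<in>limit_ops. op_close \<epsilon> (\<lambda>f\<in>bergman. \<lambda>z. S f z + c * R f z) T"
    using op_close_lincomb[OF b(1) S'(2) b(2) R'(2) S'(3) R'(3), of c] limit_ops_lincomb[OF S'(1) R'(1), of c]
    unfolding \<eta>(2) by blast
qed

lemma op_cstar_subalgebra_limit_ops_closure: "op_cstar_subalgebra limit_ops_closure"
  unfolding op_cstar_subalgebra_def
proof (intro conjI ballI allI impI subsetI)
  show "S \<in> bounded_ops" if "S \<in> limit_ops_closure" for S by (rule limit_ops_closureD(1)[OF that])
next
  fix S R assume S: "S \<in> limit_ops_closure" and R: "R \<in> limit_ops_closure"
  note b = limit_ops_closureD(1)[OF S] limit_ops_closureD(1)[OF R]
  show "(\<lambda>f\<in>bergman. \<lambda>z. S f z + R f z) \<in> limit_ops_closure"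
    using limit_ops_closure_lincomb[OF S R, of 1] by simp
  show "compose bergman S R \<in> limit_ops_closure"
    unfolding limit_ops_closure_def
  proof (intro CollectI conjI allI impI bounded_ops_compose b)
    fix \<epsilon> :: real assume e: "0 < \<epsilon>"
    obtain C D where C: "0 \<le> C" "\<forall>f\<in>bergman. norm2 (S f) \<le> C * norm2 f" and D: "0 \<le> D" "\<forall>f\<in>bergman. norm2 (R f) \<le> D * norm2 f"
      using bounded_ops_bound[OF b(1)] bounded_ops_bound[OF b(2)] by blast
    \<comment> \<open>The bound \<eta> \<le> 1 linearizes the error C \<eta> + \<eta> (D + \<eta>)
      to \<eta> (C + D + 1).\<close>
    define \<eta> where "\<eta> = min 1 (\<epsilon> / (C + D + 1))"
    have CD: "0 < C + D + 1" using C D by simp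
    then have \<eta>: "0 < \<eta>" "\<eta> \<le> 1" using e by (simp_all add: \<eta>_def)
    have "\<eta> * (C + D + 1) \<le> \<epsilon> / (C + D + 1) * (C + D + 1)" using CD by (intro mult_right_mono) (simp_all add: \<eta>_def)
    then have le: "\<eta> * (C + D + 1) \<le> \<epsilon>" using CD by simp
    obtain S' R' where S': "S' \<in> limit_ops" "S' \<in> bounded_ops" "op_close \<eta> S S'"
      and R': "R' \<in> limit_ops" "R' \<in> bounded_ops" "op_close \<eta> R R'"
      using limit_ops_closureD(2)[OF S \<eta>(1)] limit_ops_closureD(2)[OF R \<eta>(1)] by blast
    have "\<eta> * \<eta> \<le> \<eta> * 1" using \<eta> by (intro mult_left_mono) auto
    then have "C * \<eta> + \<eta> * (D + \<eta>) \<le> \<epsilon>" using le by (simp add: algebra_simps)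
    then have "op_close \<epsilon> (compose bergman S R) (compose bergman S' R')"
      by (rule op_close_mono[OF op_close_compose[OF b(1) S'(2) b(2) R'(2) S'(3) R'(3) less_imp_le[OF \<eta>(1)] C D(2)]])
    then show "\<exists>T\<in>limit_ops. op_close \<epsilon> (compose bergman S R) T"
      using limit_ops_compose[OF S'(1) R'(1)] by blast
  qed
next
  fix c S assume S: "S \<in> limit_ops_closure"
  show "(\<lambda>f\<in>bergman. \<lambda>z. c * S f z) \<in> limit_ops_closure"
    \<comment> \<open>Scalar multiples as linear combinations: S + (c - 1) S = c S.\<close>
    using limit_ops_closure_lincomb[OF S S, of "c - 1"] by (simp add: algebra_simps)
next
  fix S R assume S: "S \<in> limit_ops_closure" and R: "R \<in> bounded_ops"
    and adj: "\<forall>f\<in>bergman. \<forall>g\<in>bergman. ip (S f) g = ip f (R g)"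
  have a: "adjoint_pair S R" using adj by (simp add: adjoint_pair_def)
  show "R \<in> limit_ops_closure"
    unfolding limit_ops_closure_def
  proof (intro CollectI conjI allI impI R)
    fix \<epsilon> :: real assume "0 < \<epsilon>"
    then obtain T where T: "T \<in> limit_ops" "op_close \<epsilon> S T" using limit_ops_closureD(2)[OF S] by blast
    obtain T' where T': "T' \<in> limit_ops" "adjoint_pair T T'" using limit_ops_adjoint[OF T(1)] by blast
    have "op_close \<epsilon> R T'"
      by (rule op_close_adjoint[OF limit_ops_closureD(1)[OF S] R limit_ops_bounded[OF T(1)] limit_ops_bounded[OF T'(1)] a T'(2) T(2)])
    then show "\<exists>T\<in>limit_ops. op_close \<epsilon> R T" using T'(1) by blast
  qed
next
  fix S assume S: "S \<in> bounded_ops"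
    and approx: "\<forall>\<epsilon>>0. \<exists>R\<in>limit_ops_closure. \<forall>f\<in>bergman. norm2 (\<lambda>z. S f z - R f z) \<le> \<epsilon> * norm2 f"
  show "S \<in> limit_ops_closure"
    unfolding limit_ops_closure_def
  proof (intro CollectI conjI allI impI S)
    fix \<epsilon> :: real assume "0 < \<epsilon>"
    then have e: "0 < \<epsilon> / 2" by simp
    obtain R where R: "R \<in> limit_ops_closure" "op_close (\<epsilon> / 2) S R" using approx e unfolding op_close_def by blast
    obtain T where T: "T \<in> limit_ops" "op_close (\<epsilon> / 2) R T" using limit_ops_closureD(2)[OF R(1) e] by blast
    have "op_close \<epsilon> S T"
      using op_close_triangle[OF S limit_ops_closureD(1)[OF R(1)] limit_ops_bounded[OF T(1)] R(2) T(2)] by simp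
    then show "\<exists>T\<in>limit_ops. op_close \<epsilon> S T" using T(1) by blast
  qed
qed

lemma toeplitz_algebra_limit_ops_closure: "toeplitz_algebra \<subseteq> limit_ops_closure"
  unfolding toeplitz_algebra_def
proof (intro Inter_lower CollectI conjI op_cstar_subalgebra_limit_ops_closure image_subsetI)
  fix h assume "h \<in> Hinf"
  from toeplitz_limit_ops[OF continuous_extension_Hinf[OF this]]
  have T: "toeplitz h \<in> limit_ops" .
  have "op_close \<epsilon> (toeplitz h) (toeplitz h)" if "0 < \<epsilon>" for \<epsilon>
    using that by (simp add: op_close_def norm2_def)
  then show "toeplitz h \<in> limit_ops_closure" unfolding limit_ops_closure_def using T limit_ops_bounded[OF T] by blast
qed

text \<open>The vectors \<open>kk z\<close> have norm 1, so Berezin transforms differ uniformly by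
  at most the operator distance, and \<open>algebra_U\<close> is closed under uniform
  limits.\<close>

lemma berezin_limit_ops_closure:
  assumes S: "S \<in> limit_ops_closure" shows "berezin S \<in> algebra_U"
proof (rule algebra_U_closed)
  note b = limit_ops_closureD(1)[OF S]
  obtain C where C: "0 \<le> C" "\<forall>f\<in>bergman. norm2 (S f) \<le> C * norm2 f" using bounded_ops_bound[OF b] by blast
  have "continuous_on disc (berezin S)"
    unfolding continuous_on_def using berezin_continuous[OF b] by (auto intro: tendsto_mono[OF at_within_le_nhds])
  moreover have "cmod (berezin S z) \<le> C" if z: "z \<in> disc" for z
    using ip_op_le[OF C(2) bounded_ops_bergman[OF b kk_bergman[OF z]] kk_bergman[OF z] kk_bergman[OF z]] z by (simp add: berezin_eq)
  ultimately show "berezin S \<in> Linf"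
    by (intro Linf_symbol) (auto simp: symbol_def intro!: continuous_on_borel_measurable_dA exI[of _ C])
  fix \<epsilon> :: real assume "0 < \<epsilon>"
  then obtain R where R: "R \<in> limit_ops" "R \<in> bounded_ops" "op_close \<epsilon> S R" using limit_ops_closureD(2)[OF S] by blast
  have "cmod (berezin S z - berezin R z) \<le> \<epsilon>" if z: "z \<in> disc" for z
  proof -
    note k = kk_bergman[OF z]
    note Sk = bounded_ops_bergman[OF b k] and Rk = bounded_ops_bergman[OF R(2) k]
    have eq: "berezin S z - berezin R z = ip (\<lambda>w. S (kk z) w - R (kk z) w) (kk z)"
      using z by (simp add: berezin_eq ip_diff_left bergman_L2 Sk Rk k)
    have "cmod (berezin S z - berezin R z) \<le> norm2 (\<lambda>w. S (kk z) w - R (kk z) w) * norm2 (kk z)"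
      unfolding eq by (intro Cauchy_Schwarz_ip bergman_L2 bergman_diff Sk Rk k)
    then show ?thesis using R(3) k z unfolding op_close_def by force
  qed
  then show "\<exists>v\<in>algebra_U. \<forall>z\<in>disc. cmod (berezin S z - v z) \<le> \<epsilon>" using berezin_limit_ops[OF R(1)] by blast
qed

section \<open>Products of Toeplitz operators\<close>

lemma toeplitz_prod_Nil: "toeplitz_prod [] = (\<lambda>f\<in>bergman. f)"
  and toeplitz_prod_Cons: "toeplitz_prod (u # us) = compose bergman (toeplitz u) (toeplitz_prod us)"
  by (simp_all add: toeplitz_prod_def)

text \<open>Each factor is replaced by its own limit through \<open>op_limit_compose\<close>;
  boundedness of the partial product is carried along for that step.\<close>

lemma toeplitz_prod_limit:
  assumes "list_all2 continuous_extension vs Us"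
  shows "toeplitz_prod vs \<in> bounded_ops \<and>
    (\<forall>m\<in>mult_functionals. op_limit m (toeplitz_prod vs) (toeplitz_prod (map (\<lambda>U. U \<circ> hoffman_map m) Us)))"
  using assms
proof (induction rule: list_all2_induct)
  case Nil
  show ?case unfolding list.map toeplitz_prod_Nil using bounded_ops_id op_limit_id by blast
next
  case (Cons v vs U Us)
  note T = toeplitz_bounded_ops[OF continuous_extension_symbol[OF Cons(1)]]
  have b: "toeplitz_prod vs \<in> bounded_ops" using Cons.IH by blast
  have "op_limit m (toeplitz_prod (v # vs)) (toeplitz_prod (map (\<lambda>U. U \<circ> hoffman_map m) (U # Us)))"
    if m: "m \<in> mult_functionals" for m
    unfolding toeplitz_prod_Cons list.map
    using op_limit_compose[OF m T b op_limit_toeplitz[OF Cons(1) m]] Cons.IH m by (simp add: o_def)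
  then show ?case unfolding toeplitz_prod_Cons using bounded_ops_compose[OF T b] by blast
qed

text \<open>Symbols are given almost everywhere, whereas limits concern continuous functions; each
  symbol is exchanged for its continuous representative, which leaves the Toeplitz operator
  unchanged.\<close>

lemma gelfand_rep_prod:
  assumes "list_all2 gelfand_rep us Us" "set us \<subseteq> algebra_U"
  shows "\<exists>vs. toeplitz_prod us = toeplitz_prod vs \<and> list_all2 continuous_extension vs Us"
  using assms
proof (induction rule: list_all2_induct)
  case Nil
  then show ?case by auto
next
  case (Cons u us U Us)
  obtain vs where vs: "toeplitz_prod us = toeplitz_prod vs" "list_all2 continuous_extension vs Us"
    using Cons by auto
  obtain v where v: "AE z in dA. u z = v z" "continuous_extension v U" using Cons(1) by (auto simp: gelfand_rep_def)
  have "u \<in> Linf" using Cons.prems algebra_U_Linf by auto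
  then have "toeplitz u = toeplitz v"
    using continuous_extension_symbol[OF v(2)] by (intro toeplitz_cong_AE[OF _ _ v(1)]) (auto simp: Linf_def symbol_def)
  then show ?case using vs v(2) by (intro exI[of _ "v # vs"]) (simp add: toeplitz_prod_Cons)
qed

theorem theorem2p11:
  shows "(\<forall>S\<in>toeplitz_algebra. berezin S \<in> algebra_U) \<and>
    (\<forall>us Us. set us \<subseteq> algebra_U \<and> list_all2 gelfand_rep us Us \<longrightarrow>
      (\<exists>F. continuous_extension (berezin (toeplitz_prod us)) F \<and>
        (\<forall>m\<in>topspace max_ideal_space.
          F m = ip (toeplitz_prod (map (\<lambda>U. U \<circ> hoffman_map m) Us) (indicator disc)) (indicator disc))))"
proof (intro conjI ballI allI impI)
  fix S assume "S \<in> toeplitz_algebra"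
  then show "berezin S \<in> algebra_U" using toeplitz_algebra_limit_ops_closure berezin_limit_ops_closure by blast
next
  fix us Us assume "set us \<subseteq> algebra_U \<and> list_all2 gelfand_rep us Us"
  then obtain vs where vs: "toeplitz_prod us = toeplitz_prod vs" "list_all2 continuous_extension vs Us"
    using gelfand_rep_prod by blast
  define F where "F m = ip (toeplitz_prod (map (\<lambda>U. U \<circ> hoffman_map m) Us) (indicator disc)) (indicator disc)" for m
  have b: "toeplitz_prod us \<in> bounded_ops"
    and lim: "\<And>m. m \<in> mult_functionals \<Longrightarrow> op_limit m (toeplitz_prod us) (toeplitz_prod (map (\<lambda>U. U \<circ> hoffman_map m) Us))"
    using toeplitz_prod_limit[OF vs(2)] by (auto simp: vs(1))
  have "continuous_extension (berezin (toeplitz_prod us)) F"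
    unfolding F_def[abs_def] by (rule berezin_extension[OF b op_limit_berezin[OF _ b lim]])
  then show "\<exists>F. continuous_extension (berezin (toeplitz_prod us)) F \<and>
        (\<forall>m\<in>topspace max_ideal_space.
          F m = ip (toeplitz_prod (map (\<lambda>U. U \<circ> hoffman_map m) Us) (indicator disc)) (indicator disc))"
    by (intro exI[of _ F]) (simp add: F_def)
qed

end
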